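(* Let $\bar{\mathcal{W}}^F$ be the path collection obtained from a double Brownian web $\bar{\mathcal{W}}^D=(\bar{\mathcal{W}},\bar{\mathcal{W}}^b)$ with skeleton $\{\tilde W_1,\tilde W_1^b,\tilde W_2,\tilde W_2^b,\ldots\}$ as the closure in $(\Pi^F,d^F)$ of $\{\tilde W_1^F,\tilde W_2^F,\ldots\}$, where $\tilde W^F_j$ equals $\tilde W_j^b$ before $t_j$ and $\tilde W_j$ after $t_j$. Then, almost surely, $\bar{\mathcal{W}}^F$ consists exactly of the two "trivial" paths that are identically $+\infty$ or identically $-\infty$ for all $t$, plus the following collection of paths constructed from $\bar{\mathcal{W}}^D$. For each $(x^*,t^* )\in\mathbb{R}^2$, of type $(m_{\rm in},m_{\rm out})$, let $W_1,\ldots,W_{m_{\rm out}}$ be the forward paths (in $\bar{\mathcal{W}}$) from $(x^*,t^* )$ and let $W_1^b,\ldots,W^b_{m_{\rm in}+1}$ be the backward paths (in $\bar{\mathcal{W}}^b$) from $(x^*,t^* )$. Take every path of the form $$W_{ij}^F(t)=\begin{cases}W_i(t), & t\ge t^*,\\ W_j^b(t), & t\le t^*,\end{cases}$$ except that, when $(m_{\rm in},m_{\rm out})=(1,2)$, the unique choice of $(i,j)$ for which $W_{ij}^F$ would cross the forward path of $\bar{\mathcal{W}}$ passing through $(x^*,t^* )$ is not taken.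
   Context: Doubly infinite paths. Put $\Phi(x,t)=\tanh(x)/(1+|t|)$ and $\Psi(t)=\tanh(t)$ for $(x,t)\in[-\infty,\infty]^2$ (so $\Phi(x,\pm\infty)=0$). $\Pi^F$ is the set of functions $f:[-\infty,\infty]\to[-\infty,\infty]$ such that $t\mapsto\Phi(f(t),t)$ is continuous (functions differing only at $t=\pm\infty$ are identified), with metric $d^F(f_1,f_2)=\sup_{-\infty\le t\le\infty}|\Phi(f_1(t),t)-\Phi(f_2(t),t)|$. Semipaths. $\Pi$ is the set of pairs $(f,t_0)$, $t_0\in[-\infty,\infty]$, with $f:[t_0,\infty]\to[-\infty,\infty]$ such that $\Phi(f(t),t)$ is continuous, with metric $d((f_1,t_1),(f_2,t_2))=\sup_t|\Phi(\hat f_1(t),t)-\Phi(\hat f_2(t),t)|\vee|\Psi(t_1)-\Psi(t_2)|$, where $\hat f_i$ extends $f_i$ by the constant $f_i(t_i)$ to times before $t_i$. $\Pi^b$ is the analogous space of backward semipaths $(g^b,t_0)$, $g^b$ defined on $[-\infty,t_0]$. Two paths cross if on their common time domain there are times $s,t$ at which their difference is strictly positive and strictly negative, respectively. Double Brownian web. Coalescing Brownian motions (unit diffusion constant) are Brownian motions started at given space-time points, evolving independently until two of them meet, after which those two coincide forever; backward coalescing Brownian motions are the analogous objects run backward in time. For a deterministic countable dense $\mathcal{D}=\{(x_1,t_1),(x_2,t_2),\ldots\}\subset\mathbb{R}^2$, the double Brownian web skeleton $\{\tilde W_1,\tilde W_1^b,\tilde W_2,\tilde W_2^b,\ldots\}$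 is the family of coalescing/reflecting forward/backward Brownian motions starting at the points of $\mathcal{D}$: $\tilde W_j$ (resp. $\tilde W_j^b$) is a forward (resp. backward) path from $(x_j,t_j)$, the forward paths are coalescing Brownian motions, the backward paths are backward coalescing Brownian motions, and almost surely no forward path crosses a backward path; these properties determine the joint law. The double Brownian web is $\bar{\mathcal{W}}^D=(\bar{\mathcal{W}},\bar{\mathcal{W}}^b)$, where $\bar{\mathcal{W}}$ is the closure of $\{\tilde W_j\}$ in $\Pi$ and $\bar{\mathcal{W}}^b$ is the closure of $\{\tilde W^b_j\}$ in $\Pi^b$. Types. For $(x^*,t^* )\in\mathbb{R}^2$, $m_{\rm in}$ is the number of forward paths of $\bar{\mathcal{W}}$ starting before $t^*$, not coalescing with each other up to right before $t^*$, and passing through $(x^*,t^* )$; $m_{\rm out}$ is the number of forward paths of $\bar{\mathcal{W}}$ starting at $(x^*,t^* )$. The type of $(x^*,t^* )$ is $(m_{\rm in},m_{\rm out})$. It is known that almost surely, for every point, the number of backward paths of $\bar{\mathcal{W}}^b$ starting at $(x^*,t^* )$ is $m_{\rm in}+1$. *)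

theory Defs
  imports "HOL-Probability.Probability"
begin

section \<open>Path spaces\<close>

definition ereal_tanh :: "ereal \<Rightarrow> real" where
  "ereal_tanh x = (case x of ereal r \<Rightarrow> tanh r | PInfty \<Rightarrow> 1 | MInfty \<Rightarrow> -1)"

definition Phi :: "ereal \<Rightarrow> ereal \<Rightarrow> real" where
  "Phi x t = (case t of ereal s \<Rightarrow> ereal_tanh x / (1 + \<bar>s\<bar>) | PInfty \<Rightarrow> 0 | MInfty \<Rightarrow> 0)"

definition Psi :: "ereal \<Rightarrow> real" where
  "Psi t = ereal_tanh t"

definition Phi_dist :: "(ereal \<Rightarrow> ereal) \<Rightarrow> (ereal \<Rightarrow> ereal) \<Rightarrow> real" where
  "Phi_dist f g = (SUP t. \<bar>Phi (f t) t - Phi (g t) t\<bar>)"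

text \<open>
  Functions that differ only at the times \<open>\<plusminus>\<infinity>\<close> are identified. Every class of identified
  functions is represented by its unique member with value \<open>0\<close> at both infinite times.
\<close>

definition canonical :: "(ereal \<Rightarrow> ereal) \<Rightarrow> ereal \<Rightarrow> ereal" where
  "canonical f t = (if \<bar>t\<bar> = \<infinity> then 0 else f t)"

definition PiF :: "(ereal \<Rightarrow> ereal) set" where
  "PiF = {f. continuous_on UNIV (\<lambda>t. Phi (f t) t) \<and> f \<infinity> = 0 \<and> f (-\<infinity>) = 0}"

text \<open>
  A semipath is a pair of a function and a starting time; the function is extensional on its time
  domain. The value at an infinite time is invisible to the metric and is again normalised to \<open>0\<close>,
  except for the degenerate domain \<open>{\<infinity>}\<close> (\<open>{-\<infinity>}\<close> for backward semipaths): there it is visible,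
  because the constant extension carries it to finite times.
\<close>

type_synonym semipath = "(ereal \<Rightarrow> ereal) \<times> ereal"

definition Pi_fwd :: "semipath set" where
  "Pi_fwd = {(f, t0). f \<in> extensional {t0..} \<and> continuous_on {t0..} (\<lambda>t. Phi (f t) t) \<and>
     (t0 \<noteq> \<infinity> \<longrightarrow> (\<forall>t\<in>{t0..}. \<bar>t\<bar> = \<infinity> \<longrightarrow> f t = 0))}"

definition Pi_bwd :: "semipath set" where
  "Pi_bwd = {(g, t0). g \<in> extensional {..t0} \<and> continuous_on {..t0} (\<lambda>t. Phi (g t) t) \<and>
     (t0 \<noteq> -\<infinity> \<longrightarrow> (\<forall>t\<in>{..t0}. \<bar>t\<bar> = \<infinity> \<longrightarrow> g t = 0))}"

definition hat_fwd :: "semipath \<Rightarrow> ereal \<Rightarrow> ereal" where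
  "hat_fwd p t = fst p (max (snd p) t)"

definition hat_bwd :: "semipath \<Rightarrow> ereal \<Rightarrow> ereal" where
  "hat_bwd p t = fst p (min (snd p) t)"

definition dist_fwd :: "semipath \<Rightarrow> semipath \<Rightarrow> real" where
  "dist_fwd p q = max (Phi_dist (hat_fwd p) (hat_fwd q)) \<bar>Psi (snd p) - Psi (snd q)\<bar>"

definition dist_bwd :: "semipath \<Rightarrow> semipath \<Rightarrow> real" where
  "dist_bwd p q = max (Phi_dist (hat_bwd p) (hat_bwd q)) \<bar>Psi (snd p) - Psi (snd q)\<bar>"

abbreviation "PiF_topology \<equiv> Metric_space.mtopology PiF Phi_dist"
abbreviation "Pi_fwd_topology \<equiv> Metric_space.mtopology Pi_fwd dist_fwd"
abbreviation "Pi_bwd_topology \<equiv> Metric_space.mtopology Pi_bwd dist_bwd"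


subsection \<open>These are metric spaces\<close>

lemma ereal_tanh_inject: "ereal_tanh x = ereal_tanh y \<longleftrightarrow> x = y"
proof -
  have lt: "tanh (r::real) < 1" "-1 < tanh (r::real)" for r
    using tanh_real_lt_1 tanh_real_gt_neg1 by auto
  have "tanh (r::real) \<noteq> 1" "tanh r \<noteq> -1" for r
    using lt[of r] by auto
  then show ?thesis
    by (cases x; cases y) (auto simp: ereal_tanh_def, (metis)+)
qed

lemma abs_ereal_tanh_le: "\<bar>ereal_tanh x\<bar> \<le> 1"
  using tanh_real_lt_1 tanh_real_gt_neg1
  by (cases x) (auto simp: ereal_tanh_def abs_le_iff less_imp_le minus_le_iff)

lemma abs_Phi_le: "\<bar>Phi x t\<bar> \<le> 1"
proof (cases t)
  case (real s)
  have "\<bar>ereal_tanh x\<bar> / (1 + \<bar>s\<bar>) \<le> 1"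
    using abs_ereal_tanh_le[of x] by (subst divide_le_eq) auto
  then show ?thesis using real by (simp add: Phi_def)
qed (auto simp: Phi_def)

lemma Phi_inject: "\<bar>t\<bar> \<noteq> \<infinity> \<Longrightarrow> Phi x t = Phi y t \<longleftrightarrow> x = y"
  by (cases t) (auto simp: Phi_def ereal_tanh_inject divide_eq_eq add_nonneg_eq_0_iff
      dest: abs_ge_zero[THEN add_nonneg_pos])

lemma Phi_dist_upper: "\<bar>Phi (f t) t - Phi (g t) t\<bar> \<le> Phi_dist f g"
  unfolding Phi_dist_def
proof (rule cSUP_upper)
  have "\<bar>Phi (f t) t - Phi (g t) t\<bar> \<le> 2" for t
    using abs_Phi_le[of "f t" t] abs_Phi_le[of "g t" t] by linarith
  then show "bdd_above (range (\<lambda>t. \<bar>Phi (f t) t - Phi (g t) t\<bar>))"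
    by (intro bdd_aboveI[of _ 2]) auto
qed simp

lemma Phi_dist_nonneg: "0 \<le> Phi_dist f g"
  using Phi_dist_upper[of f 0 g] by linarith

lemma Phi_dist_commute: "Phi_dist f g = Phi_dist g f"
  by (simp add: Phi_dist_def abs_minus_commute)

lemma Phi_dist_triangle: "Phi_dist f h \<le> Phi_dist f g + Phi_dist g h"
proof -
  have "\<bar>Phi (f t) t - Phi (h t) t\<bar> \<le> Phi_dist f g + Phi_dist g h" for t
    using Phi_dist_upper[of f t g] Phi_dist_upper[of g t h] by linarith
  then show ?thesis
    unfolding Phi_dist_def[of f h] by (intro cSUP_least) auto
qed

lemma Phi_dist_refl: "Phi_dist f f = 0"
  by (simp add: Phi_dist_def)

lemma Phi_dist_0_D:
  assumes "Phi_dist f g = 0" "\<bar>t\<bar> \<noteq> \<infinity>" shows "f t = g t"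
  using Phi_dist_upper[of f t g] Phi_inject[of t "f t" "g t"] assms by auto

lemma Metric_space_PiF: "Metric_space PiF Phi_dist"
proof
  fix f g assume fg: "f \<in> PiF" "g \<in> PiF"
  show "Phi_dist f g = 0 \<longleftrightarrow> f = g"
  proof
    assume d: "Phi_dist f g = 0"
    have "f t = g t" for t
      using Phi_dist_0_D[OF d, of t] fg by (cases t) (auto simp: PiF_def)
    then show "f = g" by auto
  qed (simp add: Phi_dist_refl)
qed (auto simp: Phi_dist_nonneg Phi_dist_triangle Phi_dist_commute)

lemma Metric_space_Pi_fwd: "Metric_space Pi_fwd dist_fwd"
proof
  fix p q assume pq: "p \<in> Pi_fwd" "q \<in> Pi_fwd"
  show "dist_fwd p q = 0 \<longleftrightarrow> p = q"
  proof
    assume "dist_fwd p q = 0"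
    then have d: "Phi_dist (hat_fwd p) (hat_fwd q) = 0" and "\<bar>Psi (snd p) - Psi (snd q)\<bar> = 0"
      using Phi_dist_nonneg[of "hat_fwd p" "hat_fwd q"] by (auto simp: dist_fwd_def max_def split: if_splits)
    then obtain f g s where eq: "p = (f, s)" "q = (g, s)"
      by (cases p; cases q) (auto simp: Psi_def ereal_tanh_inject)
    have "f t = g t" for t
    proof (cases "s \<le> t")
      case False
      then show ?thesis using pq eq by (auto simp: Pi_fwd_def extensional_def)
    next
      case True
      show ?thesis
      proof (cases "\<bar>t\<bar> = \<infinity>")
        case False
        then show ?thesis
          using Phi_dist_0_D[OF d False] True by (simp add: hat_fwd_def eq)
      next
        case inf: True
        show ?thesis
        proof (cases "s = \<infinity>")
          case False
          then show ?thesis using inf pq eq True by (auto simp: Pi_fwd_def)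
        next
          case s: True
          then have "t = \<infinity>" using True by simp
          moreover have "f \<infinity> = g \<infinity>"
            using Phi_dist_0_D[OF d, of 0] by (simp add: hat_fwd_def eq s)
          ultimately show ?thesis by simp
        qed
      qed
    qed
    then show "p = q" using eq by auto
  qed (simp add: dist_fwd_def Phi_dist_refl)
next
  fix p q r :: semipath
  show "dist_fwd p r \<le> dist_fwd p q + dist_fwd q r"
    using Phi_dist_triangle[of "hat_fwd p" "hat_fwd r" "hat_fwd q"]
    unfolding dist_fwd_def by linarith
qed (auto simp: dist_fwd_def Phi_dist_nonneg Phi_dist_commute abs_minus_commute le_max_iff_disj)

lemma Metric_space_Pi_bwd: "Metric_space Pi_bwd dist_bwd"
proof
  fix p q assume pq: "p \<in> Pi_bwd" "q \<in> Pi_bwd"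
  show "dist_bwd p q = 0 \<longleftrightarrow> p = q"
  proof
    assume "dist_bwd p q = 0"
    then have d: "Phi_dist (hat_bwd p) (hat_bwd q) = 0" and "\<bar>Psi (snd p) - Psi (snd q)\<bar> = 0"
      using Phi_dist_nonneg[of "hat_bwd p" "hat_bwd q"] by (auto simp: dist_bwd_def max_def split: if_splits)
    then obtain f g s where eq: "p = (f, s)" "q = (g, s)"
      by (cases p; cases q) (auto simp: Psi_def ereal_tanh_inject)
    have "f t = g t" for t
    proof (cases "t \<le> s")
      case False
      then show ?thesis using pq eq by (auto simp: Pi_bwd_def extensional_def)
    next
      case True
      show ?thesis
      proof (cases "\<bar>t\<bar> = \<infinity>")
        case False
        then show ?thesis
          using Phi_dist_0_D[OF d False] True by (simp add: hat_bwd_def eq min_absorb2)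
      next
        case inf: True
        show ?thesis
        proof (cases "s = -\<infinity>")
          case False
          then show ?thesis using inf pq eq True by (auto simp: Pi_bwd_def)
        next
          case s: True
          then have "t = -\<infinity>" using True by simp
          moreover have "f (-\<infinity>) = g (-\<infinity>)"
            using Phi_dist_0_D[OF d, of 0] by (simp add: hat_bwd_def eq s)
          ultimately show ?thesis by simp
        qed
      qed
    qed
    then show "p = q" using eq by auto
  qed (simp add: dist_bwd_def Phi_dist_refl)
next
  fix p q r :: semipath
  show "dist_bwd p r \<le> dist_bwd p q + dist_bwd q r"
    using Phi_dist_triangle[of "hat_bwd p" "hat_bwd r" "hat_bwd q"]
    unfolding dist_bwd_def by linarith
qed (auto simp: dist_bwd_def Phi_dist_nonneg Phi_dist_commute abs_minus_commute le_max_iff_disj)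


section \<open>Coalescing Brownian motions\<close>

definition brownian_motion ::
    "'w measure \<Rightarrow> real \<times> real \<Rightarrow> (real \<Rightarrow> 'w \<Rightarrow> real) \<Rightarrow> bool" where
  "brownian_motion N = (\<lambda>(x0, t0) B.
     (\<forall>t\<ge>t0. B t \<in> borel_measurable N) \<and>
     (AE \<omega> in N. B t0 \<omega> = x0) \<and>
     (AE \<omega> in N. continuous_on {t0..} (\<lambda>t. B t \<omega>)) \<and>
     (\<forall>s t. t0 \<le> s \<and> s < t \<longrightarrow>
        distributed N lborel (\<lambda>\<omega>. B t \<omega> - B s \<omega>) (normal_density 0 (sqrt (t - s)))) \<and>
     (\<forall>\<tau> :: nat \<Rightarrow> real. mono \<tau> \<and> t0 \<le> \<tau> 0 \<longrightarrow>
        prob_space.indep_vars N (\<lambda>_. borel) (\<lambda>k \<omega>. B (\<tau> (Suc k)) \<omega> - B (\<tau> k) \<omega>) UNIV))"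

definition independent_BMs ::
    "'w measure \<Rightarrow> (nat \<Rightarrow> real \<times> real) \<Rightarrow> (nat \<Rightarrow> real \<Rightarrow> 'w \<Rightarrow> real) \<Rightarrow> bool" where
  "independent_BMs N z B \<longleftrightarrow>
     (\<forall>j. brownian_motion N (z j) (B j)) \<and>
     prob_space.indep_vars N (\<lambda>j. Pi\<^sub>M {snd (z j)..} (\<lambda>_. borel))
       (\<lambda>j \<omega>. \<lambda>t\<in>{snd (z j)..}. B j t \<omega>) UNIV"

text \<open>
  The paths \<open>v\<close> coalesce and are driven by the paths \<open>b\<close>: two paths that meet coincide from then
  on, and \<open>v j\<close> follows its own driving path \<open>b j\<close> until it first meets some \<open>v i\<close> with
  \<open>i < j\<close>. Between paths that have met, the smaller index thus keeps its driving path. For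
  continuous \<open>b\<close> and \<open>v\<close> this determines \<open>v\<close> from \<open>b\<close>, since it gives \<open>v j = b j\<close> up to and
  including the first meeting time.
\<close>

definition coalesces_along ::
    "(nat \<Rightarrow> real \<times> real) \<Rightarrow> (nat \<Rightarrow> real \<Rightarrow> real) \<Rightarrow> (nat \<Rightarrow> real \<Rightarrow> real) \<Rightarrow> bool" where
  "coalesces_along z b v \<longleftrightarrow>
     (\<forall>i j s t. snd (z i) \<le> s \<and> snd (z j) \<le> s \<and> s \<le> t \<and> v i s = v j s \<longrightarrow> v i t = v j t) \<and>
     (\<forall>j t. snd (z j) \<le> t \<and>
        (\<forall>i<j. \<forall>s. snd (z i) \<le> s \<and> snd (z j) \<le> s \<and> s < t \<longrightarrow> v i s \<noteq> v j s) \<longrightarrow>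
        v j t = b j t)"

text \<open>The law of a family of paths, restricted to the pairs of an index and a time in its domain.\<close>

definition family_law ::
    "'w measure \<Rightarrow> (nat \<Rightarrow> real \<times> real) \<Rightarrow> (nat \<Rightarrow> real \<Rightarrow> 'w \<Rightarrow> real) \<Rightarrow> (nat \<times> real \<Rightarrow> real) measure"
  where
  "family_law M z V =
     (let I = {(j, t). snd (z j) \<le> t}
      in distr M (Pi\<^sub>M I (\<lambda>_. borel)) (\<lambda>\<omega>. \<lambda>(j, t)\<in>I. V j t \<omega>))"

definition continuous_path_family ::
    "'w measure \<Rightarrow> (nat \<Rightarrow> real \<times> real) \<Rightarrow> (nat \<Rightarrow> real \<Rightarrow> 'w \<Rightarrow> real) \<Rightarrow> bool" where
  "continuous_path_family M z V \<longleftrightarrow>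
     (\<forall>j. (\<forall>t\<ge>snd (z j). V j t \<in> borel_measurable M) \<and>
          (AE \<omega> in M. continuous_on {snd (z j)..} (\<lambda>t. V j t \<omega>)))"

text \<open>
  Being a family of coalescing Brownian motions is a property of the law, so the driving
  Brownian motions need not live on the given probability space. They are taken on a space
  with underlying type \<open>nat \<Rightarrow> real \<Rightarrow> real\<close>, which is no restriction: the law of the driving
  family itself lives on that type.
\<close>

definition coalescing_BMs ::
    "'w measure \<Rightarrow> (nat \<Rightarrow> real \<times> real) \<Rightarrow> (nat \<Rightarrow> real \<Rightarrow> 'w \<Rightarrow> real) \<Rightarrow> bool" where
  "coalescing_BMs M z W \<longleftrightarrow>
     continuous_path_family M z W \<and>
     (\<exists>(N :: (nat \<Rightarrow> real \<Rightarrow> real) measure) B V.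
        prob_space N \<and> independent_BMs N z B \<and> continuous_path_family N z V \<and>
        (AE \<omega> in N. coalesces_along z (\<lambda>j t. B j t \<omega>) (\<lambda>j t. V j t \<omega>)) \<and>
        family_law M z W = family_law N z V)"

definition backward_coalescing_BMs ::
    "'w measure \<Rightarrow> (nat \<Rightarrow> real \<times> real) \<Rightarrow> (nat \<Rightarrow> real \<Rightarrow> 'w \<Rightarrow> real) \<Rightarrow> bool" where
  "backward_coalescing_BMs M z Wb \<longleftrightarrow>
     coalescing_BMs M (\<lambda>j. (fst (z j), - snd (z j))) (\<lambda>j t. Wb j (- t))"


section \<open>The double Brownian web\<close>

definition crosses :: "'a set \<Rightarrow> ('a \<Rightarrow> 'b::linorder) \<Rightarrow> ('a \<Rightarrow> 'b) \<Rightarrow> bool" where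
  "crosses D f g \<longleftrightarrow> (\<exists>s\<in>D. \<exists>t\<in>D. f s > g s \<and> f t < g t)"

definition double_web_skeleton ::
    "'w measure \<Rightarrow> (nat \<Rightarrow> real \<times> real) \<Rightarrow>
     (nat \<Rightarrow> real \<Rightarrow> 'w \<Rightarrow> real) \<Rightarrow> (nat \<Rightarrow> real \<Rightarrow> 'w \<Rightarrow> real) \<Rightarrow> bool" where
  "double_web_skeleton M z W Wb \<longleftrightarrow>
     coalescing_BMs M z W \<and> backward_coalescing_BMs M z Wb \<and>
     (AE \<omega> in M. \<forall>i j. \<not> crosses {snd (z i)..snd (z j)} (\<lambda>t. W i t \<omega>) (\<lambda>t. Wb j t \<omega>))"

definition fwd_semipath :: "real \<Rightarrow> (real \<Rightarrow> real) \<Rightarrow> semipath" where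
  "fwd_semipath t0 w =
     (\<lambda>t\<in>{ereal t0..}. canonical (\<lambda>t. ereal (w (real_of_ereal t))) t, ereal t0)"

definition bwd_semipath :: "real \<Rightarrow> (real \<Rightarrow> real) \<Rightarrow> semipath" where
  "bwd_semipath t0 w =
     (\<lambda>t\<in>{..ereal t0}. canonical (\<lambda>t. ereal (w (real_of_ereal t))) t, ereal t0)"

text \<open>The path that equals \<open>g\<close> before time \<open>s\<close> and \<open>f\<close> after time \<open>s\<close>.\<close>

definition glue :: "ereal \<Rightarrow> (ereal \<Rightarrow> ereal) \<Rightarrow> (ereal \<Rightarrow> ereal) \<Rightarrow> ereal \<Rightarrow> ereal" where
  "glue s f g = canonical (\<lambda>t. if s \<le> t then f t else g t)"

definition fwd_web ::
    "(nat \<Rightarrow> real \<times> real) \<Rightarrow> (nat \<Rightarrow> real \<Rightarrow> 'w \<Rightarrow> real) \<Rightarrow> 'w \<Rightarrow> semipath set" where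
  "fwd_web z W \<omega> =
     Pi_fwd_topology closure_of range (\<lambda>j. fwd_semipath (snd (z j)) (\<lambda>t. W j t \<omega>))"

definition bwd_web ::
    "(nat \<Rightarrow> real \<times> real) \<Rightarrow> (nat \<Rightarrow> real \<Rightarrow> 'w \<Rightarrow> real) \<Rightarrow> 'w \<Rightarrow> semipath set" where
  "bwd_web z Wb \<omega> =
     Pi_bwd_topology closure_of range (\<lambda>j. bwd_semipath (snd (z j)) (\<lambda>t. Wb j t \<omega>))"

definition full_web ::
    "(nat \<Rightarrow> real \<times> real) \<Rightarrow> (nat \<Rightarrow> real \<Rightarrow> 'w \<Rightarrow> real) \<Rightarrow> (nat \<Rightarrow> real \<Rightarrow> 'w \<Rightarrow> real) \<Rightarrow> 'w \<Rightarrow>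
     (ereal \<Rightarrow> ereal) set" where
  "full_web z W Wb \<omega> =
     PiF_topology closure_of
       range (\<lambda>j. glue (ereal (snd (z j)))
                    (fst (fwd_semipath (snd (z j)) (\<lambda>t. W j t \<omega>)))
                    (fst (bwd_semipath (snd (z j)) (\<lambda>t. Wb j t \<omega>))))"


subsection \<open>Types of points\<close>

definition paths_from :: "semipath set \<Rightarrow> real \<Rightarrow> real \<Rightarrow> (ereal \<Rightarrow> ereal) set" where
  "paths_from P x t = {f. (f, ereal t) \<in> P \<and> f (ereal t) = ereal x}"

definition paths_into :: "semipath set \<Rightarrow> real \<Rightarrow> real \<Rightarrow> semipath set" where
  "paths_into F x t = {p \<in> F. snd p < ereal t \<and> fst p (ereal t) = ereal x}"

text \<open>Two incoming paths are equivalent if they have coalesced strictly before time \<open>t\<close>.\<close>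

definition coalesced_before :: "semipath set \<Rightarrow> real \<Rightarrow> real \<Rightarrow> semipath rel" where
  "coalesced_before F x t =
     {(p, q). p \<in> paths_into F x t \<and> q \<in> paths_into F x t \<and>
        (\<exists>s<ereal t. snd p \<le> s \<and> snd q \<le> s \<and> (\<forall>u\<in>{s..ereal t}. fst p u = fst q u))}"

lemma equiv_coalesced_before: "equiv (paths_into F x t) (coalesced_before F x t)"
proof (rule equivI)
  show "coalesced_before F x t \<subseteq> paths_into F x t \<times> paths_into F x t"
    by (auto simp: coalesced_before_def)
  show "refl_on (paths_into F x t) (coalesced_before F x t)"
    by (auto simp: refl_on_def coalesced_before_def paths_into_def)
  show "sym (coalesced_before F x t)"
    by (auto simp: sym_def coalesced_before_def)
  show "trans (coalesced_before F x t)"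
  proof (rule transI)
    fix p q r
    assume "(p, q) \<in> coalesced_before F x t" "(q, r) \<in> coalesced_before F x t"
    then obtain s s' where s: "s < ereal t" "snd p \<le> s" "snd q \<le> s" "\<forall>u\<in>{s..ereal t}. fst p u = fst q u"
      and s': "s' < ereal t" "snd q \<le> s'" "snd r \<le> s'" "\<forall>u\<in>{s'..ereal t}. fst q u = fst r u"
      and pr: "p \<in> paths_into F x t" "r \<in> paths_into F x t"
      by (auto simp: coalesced_before_def)
    then have "max s s' < ereal t \<and> snd p \<le> max s s' \<and> snd r \<le> max s s' \<and>
        (\<forall>u\<in>{max s s'..ereal t}. fst p u = fst r u)"
      by (auto simp: le_max_iff_disj)
    with pr show "(p, r) \<in> coalesced_before F x t"
      unfolding coalesced_before_def by blast
  qed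
qed

definition ecard :: "'a set \<Rightarrow> enat" where
  "ecard A = (if finite A then enat (card A) else \<infinity>)"

definition m_in :: "semipath set \<Rightarrow> real \<Rightarrow> real \<Rightarrow> enat" where
  "m_in F x t = ecard (paths_into F x t // coalesced_before F x t)"

definition m_out :: "semipath set \<Rightarrow> real \<Rightarrow> real \<Rightarrow> enat" where
  "m_out F x t = ecard (paths_from F x t)"

definition point_type :: "semipath set \<Rightarrow> real \<Rightarrow> real \<Rightarrow> enat \<times> enat" where
  "point_type F x t = (m_in F x t, m_out F x t)"

definition crosses_incoming :: "semipath set \<Rightarrow> real \<Rightarrow> real \<Rightarrow> (ereal \<Rightarrow> ereal) \<Rightarrow> bool" where
  "crosses_incoming F x t h \<longleftrightarrow> (\<exists>p\<in>paths_into F x t. crosses {snd p..} h (fst p))"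

end

theory Submission
  imports Defs "HOL-Library.Diagonal_Subsequence"
begin

text \<open>
  Let \<open>h j\<close> be the path that follows the forward path \<open>W j\<close> after its starting time and the backward
  path \<open>Wb j\<close> before it. Since forward and backward paths do not cross, any two of the \<open>h j\<close> are
  ordered, so a web path that stays close to a given point for a while is a barrier for all others;
  as such barriers exist near every point, the family \<open>h\<close> is compact for locally uniform convergence.
  The elements of the three webs are then the right halves, the left halves and the whole of the
  limits of paths \<open>h j\<close> with convergent starting points.

  Two limits from \<open>(x, t)\<close> that differ after \<open>t\<close> enclose a skeleton path started after \<open>t\<close>, and its
  backward part runs into \<open>(x, t)\<close>; likewise two limits that differ before \<open>t\<close> force a forward path
  through \<open>(x, t)\<close>. If at most one of these happens, any two halves fit together. If both happen, the
  type is \<open>(1, 2)\<close>, the right half is determined by its side of the backward path and the left half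
  by its side of the forward path; three of the four combinations are limits, the fourth one crosses
  the forward path.

  The probabilistic input is that forward and backward paths do not touch at rational times, that two
  forward paths never join exactly on a backward path (and vice versa), and that the paths are locally
  finite after any positive time.
  All of it rests on the bound \<open>a / sqrt t\<close>, up to a constant, for the probability that two
  coalescing paths at distance \<open>a\<close> have not met after time \<open>t\<close>. This bound needs only second and
  fourth moments, which are computed for discrete stochastic integrals against the driving motions.
\<close>

section \<open>Moments and independence\<close>

text \<open>The hypotheses fix the law of the forward family and that of the backward family
  separately; the only link between the two is that they do not cross. Joint statements are
  therefore reduced to forward paths alone: a backward path that passes between two forward paths
  keeps these two from meeting before its own starting time. The noncoalescence bound holds on every
  event of the forward past, so it yields a conditional bound for the position of a backward path,
  and disjoint past events can be summed without loss. A second obstacle is that the driving motions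
  live on an unrelated space \<open>N\<close>; estimates are proved there and transferred through
  the law of the whole family. Along a coalescing path the index of the driver can only decrease, so
  path \<open>j\<close> changes its driver at most \<open>j\<close> times, and sums of driver
  increments over a grid converge to the increment of the path; a theory of stochastic integration
  is avoided. The pathwise part starts from a list of properties that survives time reversal and
  reflection of space, so each one-sided statement is proved once.\<close>

lemma Int_stable_vimages: "Int_stable {X -` A \<inter> \<Omega> |A. A \<in> sets N}"
proof (rule Int_stableI)
  fix a b assume "a \<in> {X -` A \<inter> \<Omega> |A. A \<in> sets N}" "b \<in> {X -` A \<inter> \<Omega> |A. A \<in> sets N}"
  then obtain A B where "A \<in> sets N" "B \<in> sets N" "a = X -` A \<inter> \<Omega>" "b = X -` B \<inter> \<Omega>" by auto
  then have "a \<inter> b = X -` (A \<inter> B) \<inter> \<Omega> \<and> A \<inter> B \<in> sets N" by auto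
  then show "a \<inter> b \<in> {X -` A \<inter> \<Omega> |A. A \<in> sets N}" by blast
qed

lemma normal_moments:
  fixes \<xi> :: "'a \<Rightarrow> real"
  assumes \<xi>: "distributed M lborel \<xi> (normal_density 0 \<sigma>)" and \<sigma>: "0 < \<sigma>"
  shows "integrable M (\<lambda>\<omega>. \<xi> \<omega> ^ k)" and "(\<integral>\<omega>. \<xi> \<omega> \<partial>M) = 0" and "(\<integral>\<omega>. \<xi> \<omega> ^ 2 \<partial>M) = \<sigma>\<^sup>2"
    and "(\<integral>\<omega>. \<xi> \<omega> ^ 3 \<partial>M) = 0" and "(\<integral>\<omega>. \<xi> \<omega> ^ 4 \<partial>M) = 3 * \<sigma> ^ 4"
proof -
  have int: "(\<integral>\<omega>. \<xi> \<omega> ^ n \<partial>M) = (\<integral>x. normal_density 0 \<sigma> x * x ^ n \<partial>lborel)" for n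
    by (rule distributed_integral[OF \<xi>, symmetric]) auto
  show "integrable M (\<lambda>\<omega>. \<xi> \<omega> ^ k)"
    using distributed_integrable[OF \<xi>, of "\<lambda>x. x ^ k"] integrable_normal_moment[OF \<sigma>, of 0 k] by simp
  show "(\<integral>\<omega>. \<xi> \<omega> \<partial>M) = 0"
    using int[of 1] integral_normal_moment_odd[OF \<sigma>, of 0 0] by simp
  show "(\<integral>\<omega>. \<xi> \<omega> ^ 2 \<partial>M) = \<sigma>\<^sup>2"
    using int[of 2] integral_normal_moment_even[OF \<sigma>, of 0 1] by simp
  show "(\<integral>\<omega>. \<xi> \<omega> ^ 3 \<partial>M) = 0"
    using int[of 3] integral_normal_moment_odd[OF \<sigma>, of 0 1] by simp
  show "(\<integral>\<omega>. \<xi> \<omega> ^ 4 \<partial>M) = 3 * \<sigma> ^ 4"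
    using int[of 4] integral_normal_moment_even[OF \<sigma>, of 0 2]
    by (simp add: fact_numeral field_simps power2_eq_square power4_eq_xxxx)
qed

lemma (in prob_space) expectation_mult_indep:
  fixes X \<xi> :: "'a \<Rightarrow> real"
  assumes F: "subalgebra M F" and ind: "indep_set (sets F) {\<xi> -` S \<inter> space M | S. S \<in> sets borel}"
    and X: "X \<in> borel_measurable F" "integrable M X"
    and \<xi>: "\<xi> \<in> borel_measurable M" "integrable M (\<lambda>\<omega>. \<xi> \<omega> ^ k)"
  shows "expectation (\<lambda>\<omega>. X \<omega> * \<xi> \<omega> ^ k) = expectation X * expectation (\<lambda>\<omega>. \<xi> \<omega> ^ k)"
proof (rule indep_var_lebesgue_integral)
  have XM: "random_variable borel X"
    using F X(1) by (rule measurable_from_subalg)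
  have spF: "space F = space M" and sF: "sets F \<subseteq> sets M" using F by (auto simp: subalgebra_def)
  have X': "{X -` A \<inter> space M |A. A \<in> sets borel} \<subseteq> sets F"
    using X(1) spF by (auto simp: measurable_def)
  have "indep_var borel X borel \<xi>"
    unfolding indep_var_eq
  proof (intro conjI XM \<xi> indep_set_sigma_sets)
    show "indep_set {X -` A \<inter> space M |A. A \<in> sets borel} {\<xi> -` A \<inter> space M |A. A \<in> sets borel}"
    proof (rule indep_setI)
      fix a b assume "a \<in> {X -` A \<inter> space M |A. A \<in> sets borel}" "b \<in> {\<xi> -` A \<inter> space M |A. A \<in> sets borel}"
      with X' show "prob (a \<inter> b) = prob a * prob b" by (intro indep_setD[OF ind]) auto
    qed (use X' sF \<xi>(1) in auto)
  qed (rule Int_stable_vimages)+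
  then have "indep_var borel (id \<circ> X) borel ((\<lambda>x. x ^ k) \<circ> \<xi>)"
    by (rule indep_var_compose) auto
  then show "indep_var borel X borel (\<lambda>\<omega>. \<xi> \<omega> ^ k)" by (simp add: comp_def)
qed fact+

text \<open>\<open>X\<close> is a discrete stochastic integral. In step \<open>q\<close> the past
  events \<open>A q \<rho>\<close> select which Gaussian increment is added, at most one because
  they are disjoint, and none outside their union. The index \<open>\<rho>\<close> will be a driving
  motion, or a pair of distinct ones; adding nothing then corresponds to paths that have already
  coalesced.\<close>

locale gaussian_sum = prob_space M for M :: "'a measure" +
  fixes F :: "nat \<Rightarrow> 'a measure" and R :: "nat \<Rightarrow> 'r set" and A :: "nat \<Rightarrow> 'r \<Rightarrow> 'a set"
    and \<xi> :: "nat \<Rightarrow> 'r \<Rightarrow> 'a \<Rightarrow> real" and \<sigma> \<delta> :: real and X :: "nat \<Rightarrow> 'a \<Rightarrow> real"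
  assumes finite_R: "finite (R q)"
    and F: "subalgebra M (F q)" and F_mono: "sets (F q) \<subseteq> sets (F (Suc q))"
    and A: "\<rho> \<in> R q \<Longrightarrow> A q \<rho> \<in> sets (F q)" and disj: "disjoint_family_on (A q) (R q)"
    and \<xi>_meas: "\<rho> \<in> R q \<Longrightarrow> \<xi> q \<rho> \<in> borel_measurable (F (Suc q))"
    and \<xi>_ind: "\<rho> \<in> R q \<Longrightarrow> indep_set (sets (F q)) {\<xi> q \<rho> -` S \<inter> space M | S. S \<in> sets borel}"
    and \<xi>_dist: "\<rho> \<in> R q \<Longrightarrow> distributed M lborel (\<xi> q \<rho>) (normal_density 0 \<sigma>)"
    and \<sigma>_pos: "0 < \<sigma>"
    and X0: "X 0 \<in> borel_measurable (F 0)" "\<And>\<omega>. \<omega> \<in> space M \<Longrightarrow> \<bar>X 0 \<omega>\<bar> \<le> \<delta>"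
    and X_Suc: "\<omega> \<in> space M \<Longrightarrow> X (Suc q) \<omega> = X q \<omega> + (\<Sum>\<rho>\<in>R q. indicator (A q \<rho>) \<omega> * \<xi> q \<rho> \<omega>)"
begin

lemma space_F: "space (F q) = space M" and sets_F: "sets (F q) \<subseteq> sets M"
  using F by (auto simp: subalgebra_def)

lemma F_sub: "subalgebra (F (Suc q)) (F q)"
  using F_mono by (simp add: subalgebra_def space_F)

lemma X_meas_F: "X q \<in> borel_measurable (F q)"
proof (induction q)
  case (Suc q)
  have *: "X q \<in> borel_measurable (F (Suc q))" "\<rho> \<in> R q \<Longrightarrow> A q \<rho> \<in> sets (F (Suc q))" for \<rho>
    using measurable_from_subalg[OF F_sub Suc] A F_mono by auto
  have "(\<lambda>\<omega>. X q \<omega> + (\<Sum>\<rho>\<in>R q. indicator (A q \<rho>) \<omega> * \<xi> q \<rho> \<omega>)) \<in> borel_measurable (F (Suc q))"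
    using * \<xi>_meas by (intro borel_measurable_add borel_measurable_sum borel_measurable_times borel_measurable_indicator) auto
  then show ?case
    by (subst measurable_cong[OF X_Suc]) (auto simp: space_F)
qed (rule X0)

lemma X_meas: "X q \<in> borel_measurable M"
  by (rule measurable_from_subalg[OF F X_meas_F])

lemma \<xi>_measM: "\<rho> \<in> R q \<Longrightarrow> \<xi> q \<rho> \<in> borel_measurable M"
  by (rule measurable_from_subalg[OF F \<xi>_meas])

lemma A_M: "\<rho> \<in> R q \<Longrightarrow> A q \<rho> \<in> sets M" using A sets_F by auto

lemma pow4_add: "(a + b :: real) ^ 4 \<le> 8 * (a ^ 4 + b ^ 4)"
proof -
  have "(a + b)\<^sup>2 \<le> 2 * (a\<^sup>2 + b\<^sup>2)"
    using zero_le_power2[of "a - b"] by (simp add: power2_eq_square algebra_simps)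
  then have "((a + b)\<^sup>2)\<^sup>2 \<le> (2 * (a\<^sup>2 + b\<^sup>2))\<^sup>2" by (intro power_mono) auto
  also have "\<dots> \<le> 8 * (a ^ 4 + b ^ 4)"
    using zero_le_power2[of "a\<^sup>2 - b\<^sup>2"] by (simp add: power2_eq_square power4_eq_xxxx algebra_simps)
  finally show ?thesis by (simp add: power4_eq_xxxx power2_eq_square algebra_simps)
qed

text \<open>At most one summand of the step is nonzero, so a nonlinear \<open>f\<close> of the new
  value also splits into one term per \<open>\<rho>\<close>. This is used for squares and fourth
  powers.\<close>

lemma expand_le: "\<omega> \<in> space M \<Longrightarrow> f (X (Suc q) \<omega>) =
    f (X q \<omega>) + (\<Sum>\<rho>\<in>R q. indicator (A q \<rho>) \<omega> * (f (X q \<omega> + \<xi> q \<rho> \<omega>) - f (X q \<omega>)))" for f :: "real \<Rightarrow> real"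
proof (cases "\<exists>\<rho>\<in>R q. \<omega> \<in> A q \<rho>")
  assume \<omega>: "\<omega> \<in> space M"
  case True
  then obtain \<rho> where \<rho>: "\<rho> \<in> R q" "\<omega> \<in> A q \<rho>" by auto
  then have "\<rho>' \<in> R q - {\<rho>} \<Longrightarrow> \<omega> \<notin> A q \<rho>'" for \<rho>'
    using disj[of q] by (auto simp: disjoint_family_on_def)
  then have "(\<Sum>\<rho>\<in>R q. indicator (A q \<rho>) \<omega> * g \<rho>) = g \<rho>" for g :: "'r \<Rightarrow> real"
    using \<rho> finite_R by (subst sum.remove[of _ \<rho>]) (auto simp: sum.neutral)
  then show ?thesis using X_Suc[OF \<omega>] by simp
next
  assume \<omega>: "\<omega> \<in> space M"
  case False
  then show ?thesis using X_Suc[OF \<omega>] by (simp add: sum.neutral)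
qed

text \<open>With the maximum of \<open>1\<close>, \<open>\<bar>x\<bar>\<close>,
  \<open>\<bar>y\<bar>\<close> as a common bound, every monomial of total degree at most four is
  dominated by the pure fourth powers. All mixed terms of the expansions below are covered.\<close>

lemma integrable_bounded_pow:
  assumes "integrable M (\<lambda>\<omega>. f \<omega> ^ 4)" "integrable M (\<lambda>\<omega>. g \<omega> ^ 4)"
    and [measurable]: "f \<in> borel_measurable M" "g \<in> borel_measurable M" "B \<in> sets M"
    and "k + l \<le> 4"
  shows "integrable M (\<lambda>\<omega>. indicator B \<omega> * f \<omega> ^ k * g \<omega> ^ l :: real)"
proof (rule Bochner_Integration.integrable_bound)
  show "integrable M (\<lambda>\<omega>. 1 + f \<omega> ^ 4 + g \<omega> ^ 4)" using assms by auto
  have *: "\<bar>x\<bar> ^ k * \<bar>y\<bar> ^ l \<le> 1 + x ^ 4 + y ^ 4" for x y :: real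
  proof -
    let ?m = "max 1 (max \<bar>x\<bar> \<bar>y\<bar>)"
    have "\<bar>x\<bar> ^ k * \<bar>y\<bar> ^ l \<le> ?m ^ k * ?m ^ l"
      by (intro mult_mono power_mono) auto
    also have "\<dots> \<le> ?m ^ 4" using \<open>k + l \<le> 4\<close> by (simp add: power_add[symmetric] power_increasing)
    also have "\<dots> \<le> 1 + x ^ 4 + y ^ 4" by (auto simp: max_def power_even_abs)
    finally show ?thesis .
  qed
  show "AE \<omega> in M. norm (indicator B \<omega> * f \<omega> ^ k * g \<omega> ^ l) \<le> norm (1 + f \<omega> ^ 4 + g \<omega> ^ 4)"
    using * by (auto simp: abs_mult power_abs indicator_def abs_of_nonneg intro!: AE_I2)
qed measurable

lemma integrable_X4: "integrable M (\<lambda>\<omega>. X q \<omega> ^ 4)"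
proof (induction q)
  case 0
  show ?case
  proof (rule integrable_const_bound)
    show "AE \<omega> in M. norm (X 0 \<omega> ^ 4) \<le> \<bar>\<delta>\<bar> ^ 4"
    proof (intro AE_I2)
      fix \<omega> assume "\<omega> \<in> space M"
      then have "\<bar>X 0 \<omega>\<bar> \<le> \<bar>\<delta>\<bar>" using X0(2)[of \<omega>] by simp
      then have "\<bar>X 0 \<omega>\<bar> ^ 4 \<le> \<bar>\<delta>\<bar> ^ 4" by (intro power_mono) auto
      then show "norm (X 0 \<omega> ^ 4) \<le> \<bar>\<delta>\<bar> ^ 4" by (simp add: power_abs)
    qed
  qed (use X_meas in auto)
next
  case (Suc q)
  have "integrable M (\<lambda>\<omega>. X q \<omega> ^ 4 + (\<Sum>\<rho>\<in>R q. indicator (A q \<rho>) \<omega> * ((X q \<omega> + \<xi> q \<rho> \<omega>) ^ 4 - X q \<omega> ^ 4)))"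
  proof (intro Bochner_Integration.integrable_add Suc Bochner_Integration.integrable_sum)
    fix \<rho> assume \<rho>: "\<rho> \<in> R q"
    note [measurable] = X_meas \<xi>_measM[OF \<rho>] A_M[OF \<rho>]
    show "integrable M (\<lambda>\<omega>. indicator (A q \<rho>) \<omega> * ((X q \<omega> + \<xi> q \<rho> \<omega>) ^ 4 - X q \<omega> ^ 4))"
    proof (rule Bochner_Integration.integrable_bound)
      show "integrable M (\<lambda>\<omega>. 9 * X q \<omega> ^ 4 + 8 * \<xi> q \<rho> \<omega> ^ 4)"
        using Suc normal_moments(1)[OF \<xi>_dist[OF \<rho>] \<sigma>_pos, of 4] by auto
      show "AE \<omega> in M. norm (indicator (A q \<rho>) \<omega> * ((X q \<omega> + \<xi> q \<rho> \<omega>) ^ 4 - X q \<omega> ^ 4))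
          \<le> norm (9 * X q \<omega> ^ 4 + 8 * \<xi> q \<rho> \<omega> ^ 4)"
      proof (intro AE_I2)
        fix \<omega>
        have aux: "u \<le> 8 * (v + w) \<Longrightarrow> 0 \<le> u \<Longrightarrow> 0 \<le> v \<Longrightarrow> 0 \<le> w \<Longrightarrow> \<bar>u - v\<bar> \<le> \<bar>9 * v + 8 * w\<bar>" for u v w :: real
          by (simp add: abs_le_iff)
        have "0 \<le> (X q \<omega> + \<xi> q \<rho> \<omega>) ^ 4" "0 \<le> X q \<omega> ^ 4" "0 \<le> \<xi> q \<rho> \<omega> ^ 4" by simp_all
        with pow4_add[of "X q \<omega>" "\<xi> q \<rho> \<omega>"]
        have "\<bar>(X q \<omega> + \<xi> q \<rho> \<omega>) ^ 4 - X q \<omega> ^ 4\<bar> \<le> \<bar>9 * X q \<omega> ^ 4 + 8 * \<xi> q \<rho> \<omega> ^ 4\<bar>"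
          by (intro aux)
        then show "norm (indicator (A q \<rho>) \<omega> * ((X q \<omega> + \<xi> q \<rho> \<omega>) ^ 4 - X q \<omega> ^ 4))
          \<le> norm (9 * X q \<omega> ^ 4 + 8 * \<xi> q \<rho> \<omega> ^ 4)"
          by (simp add: indicator_def)
      qed
    qed measurable
  qed
  then show ?case
    by (subst Bochner_Integration.integrable_cong[OF refl expand_le[where f = "\<lambda>x. x ^ 4"]]) auto
qed

text \<open>The event and the power of \<open>X q\<close> belong to the past, while the increment is
  independent of it, so the expectation factorises.\<close>

lemma moment_step:
  assumes \<rho>: "\<rho> \<in> R q" and k: "k + l \<le> 4"
  shows "expectation (\<lambda>\<omega>. indicator (A q \<rho>) \<omega> * X q \<omega> ^ k * \<xi> q \<rho> \<omega> ^ l) =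
    expectation (\<lambda>\<omega>. indicator (A q \<rho>) \<omega> * X q \<omega> ^ k) * expectation (\<lambda>\<omega>. \<xi> q \<rho> \<omega> ^ l)"
proof (rule expectation_mult_indep[OF F \<xi>_ind[OF \<rho>]])
  show "(\<lambda>\<omega>. indicator (A q \<rho>) \<omega> * X q \<omega> ^ k) \<in> borel_measurable (F q)"
    using A[OF \<rho>] X_meas_F by measurable
  show "integrable M (\<lambda>\<omega>. indicator (A q \<rho>) \<omega> * X q \<omega> ^ k)"
    using integrable_bounded_pow[of "X q" "X q" "A q \<rho>" k 0] k integrable_X4 X_meas A_M[OF \<rho>] by simp
qed (use \<xi>_measM[OF \<rho>] normal_moments(1)[OF \<xi>_dist[OF \<rho>] \<sigma>_pos] in auto)

lemma integrable_pow:
  assumes \<rho>: "\<rho> \<in> R q" and k: "k + l \<le> 4"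
  shows "integrable M (\<lambda>\<omega>. indicator (A q \<rho>) \<omega> * X q \<omega> ^ k * \<xi> q \<rho> \<omega> ^ l)"
  by (rule integrable_bounded_pow[OF integrable_X4 normal_moments(1)[OF \<xi>_dist[OF \<rho>] \<sigma>_pos]
      X_meas \<xi>_measM[OF \<rho>] A_M[OF \<rho>] k])

lemma integrable_X_pow: "k \<le> 4 \<Longrightarrow> integrable M (\<lambda>\<omega>. X q \<omega> ^ k)"
  using integrable_bounded_pow[of "X q" "X q" "space M" k 0] integrable_X4 X_meas
  by (simp cong: Bochner_Integration.integrable_cong)

lemma expectation_X: "expectation (X q) = expectation (X 0)"
proof (induction q)
  case (Suc q)
  have "expectation (X (Suc q)) = expectation (\<lambda>\<omega>. X q \<omega> + (\<Sum>\<rho>\<in>R q. indicator (A q \<rho>) \<omega> * X q \<omega> ^ 0 * \<xi> q \<rho> \<omega> ^ 1))"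
    by (intro Bochner_Integration.integral_cong refl) (simp add: X_Suc)
  also have "\<dots> = expectation (X q) + (\<Sum>\<rho>\<in>R q. expectation (\<lambda>\<omega>. indicator (A q \<rho>) \<omega> * X q \<omega> ^ 0 * \<xi> q \<rho> \<omega> ^ 1))"
    using integrable_X_pow[of 1 q] integrable_pow[of _ q 0 1] by (simp add: Bochner_Integration.integral_sum)
  also have "(\<Sum>\<rho>\<in>R q. expectation (\<lambda>\<omega>. indicator (A q \<rho>) \<omega> * X q \<omega> ^ 0 * \<xi> q \<rho> \<omega> ^ 1)) = 0"
    by (intro sum.neutral ballI, subst moment_step) (auto simp: normal_moments(2)[OF \<xi>_dist \<sigma>_pos])
  finally show ?case using Suc by simp
qed simp

text \<open>The cross term vanishes because increments are centred. What remains is the variance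
  times the probability that some increment was selected; this probability later becomes that of not
  having coalesced.\<close>

lemma expectation_X2_Suc:
  "expectation (\<lambda>\<omega>. X (Suc q) \<omega> ^ 2) = expectation (\<lambda>\<omega>. X q \<omega> ^ 2) + \<sigma>\<^sup>2 * prob (\<Union>\<rho>\<in>R q. A q \<rho>)"
proof -
  define J where "J k l \<rho> \<omega> = indicator (A q \<rho>) \<omega> * X q \<omega> ^ k * \<xi> q \<rho> \<omega> ^ l" for k l \<rho> \<omega>
  have J: "k + l \<le> 4 \<Longrightarrow> \<rho> \<in> R q \<Longrightarrow> integrable M (J k l \<rho>)" for k l \<rho>
    using integrable_pow unfolding J_def by blast
  have "expectation (\<lambda>\<omega>. X (Suc q) \<omega> ^ 2) =
      expectation (\<lambda>\<omega>. X q \<omega> ^ 2 + (\<Sum>\<rho>\<in>R q. 2 * J 1 1 \<rho> \<omega> + J 0 2 \<rho> \<omega>))"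
    by (intro Bochner_Integration.integral_cong refl)
      (subst expand_le[where f = "\<lambda>x. x ^ 2"], auto simp: J_def power2_eq_square algebra_simps intro!: sum.cong)
  also have "\<dots> = expectation (\<lambda>\<omega>. X q \<omega> ^ 2) + (\<Sum>\<rho>\<in>R q. 2 * expectation (J 1 1 \<rho>) + expectation (J 0 2 \<rho>))"
    using J by (simp add: integrable_X_pow Bochner_Integration.integral_sum)
  also have "(\<Sum>\<rho>\<in>R q. 2 * expectation (J 1 1 \<rho>) + expectation (J 0 2 \<rho>)) = (\<Sum>\<rho>\<in>R q. \<sigma>\<^sup>2 * prob (A q \<rho>))"
  proof (rule sum.cong[OF refl])
    fix \<rho> assume \<rho>: "\<rho> \<in> R q"
    note nm = normal_moments[OF \<xi>_dist[OF \<rho>] \<sigma>_pos]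
    show "2 * expectation (J 1 1 \<rho>) + expectation (J 0 2 \<rho>) = \<sigma>\<^sup>2 * prob (A q \<rho>)"
      using moment_step[OF \<rho>, of 1 1] moment_step[OF \<rho>, of 0 2] nm A_M[OF \<rho>] by (simp add: J_def[abs_def])
  qed
  also have "\<dots> = \<sigma>\<^sup>2 * prob (\<Union>\<rho>\<in>R q. A q \<rho>)"
    using finite_R A_M disj by (subst finite_measure_finite_Union) (auto simp: sum_distrib_left)
  finally show ?thesis .
qed

text \<open>Odd moments vanish. The factor \<open>6\<close> is the binomial coefficient of the
  middle term, \<open>3 * \<sigma> ^ 4\<close> is the Gaussian fourth moment, and the inequality
  comes from dropping the indicator of the selecting events.\<close>

lemma expectation_X4_Suc:
  "expectation (\<lambda>\<omega>. X (Suc q) \<omega> ^ 4) \<le>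
    expectation (\<lambda>\<omega>. X q \<omega> ^ 4) + 6 * \<sigma>\<^sup>2 * expectation (\<lambda>\<omega>. X q \<omega> ^ 2) + 3 * \<sigma> ^ 4"
proof -
  define J where "J k l \<rho> \<omega> = indicator (A q \<rho>) \<omega> * X q \<omega> ^ k * \<xi> q \<rho> \<omega> ^ l" for k l \<rho> \<omega>
  have J: "k + l \<le> 4 \<Longrightarrow> \<rho> \<in> R q \<Longrightarrow> integrable M (J k l \<rho>)" for k l \<rho>
    using integrable_pow unfolding J_def by blast
  have ex: "(x + y) ^ 4 - x ^ 4 = 4 * x^3 * y + 6 * x\<^sup>2 * y\<^sup>2 + 4 * x * y ^ 3 + y ^ 4" for x y :: real
    by (simp add: power2_eq_square power3_eq_cube power4_eq_xxxx algebra_simps)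
  have "expectation (\<lambda>\<omega>. X (Suc q) \<omega> ^ 4) = expectation (\<lambda>\<omega>. X q \<omega> ^ 4 +
      (\<Sum>\<rho>\<in>R q. 4 * J 3 1 \<rho> \<omega> + 6 * J 2 2 \<rho> \<omega> + 4 * J 1 3 \<rho> \<omega> + J 0 4 \<rho> \<omega>))"
    by (intro Bochner_Integration.integral_cong refl)
      (auto simp: expand_le[where f = "\<lambda>x. x ^ 4"] ex J_def algebra_simps intro!: sum.cong)
  also have "\<dots> = expectation (\<lambda>\<omega>. X q \<omega> ^ 4) + (\<Sum>\<rho>\<in>R q. 4 * expectation (J 3 1 \<rho>) +
      6 * expectation (J 2 2 \<rho>) + 4 * expectation (J 1 3 \<rho>) + expectation (J 0 4 \<rho>))"
    using J by (simp add: integrable_X_pow Bochner_Integration.integral_sum)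
  also have "(\<Sum>\<rho>\<in>R q. 4 * expectation (J 3 1 \<rho>) +
      6 * expectation (J 2 2 \<rho>) + 4 * expectation (J 1 3 \<rho>) + expectation (J 0 4 \<rho>)) =
      (\<Sum>\<rho>\<in>R q. 6 * \<sigma>\<^sup>2 * expectation (\<lambda>\<omega>. indicator (A q \<rho>) \<omega> * X q \<omega> ^ 2) + 3 * \<sigma> ^ 4 * expectation (indicator (A q \<rho>)))"
  proof (rule sum.cong[OF refl])
    fix \<rho> assume \<rho>: "\<rho> \<in> R q"
    note nm = normal_moments[OF \<xi>_dist[OF \<rho>] \<sigma>_pos]
    show "4 * expectation (J 3 1 \<rho>) + 6 * expectation (J 2 2 \<rho>) + 4 * expectation (J 1 3 \<rho>) + expectation (J 0 4 \<rho>)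
      = 6 * \<sigma>\<^sup>2 * expectation (\<lambda>\<omega>. indicator (A q \<rho>) \<omega> * X q \<omega> ^ 2) + 3 * \<sigma> ^ 4 * expectation (indicator (A q \<rho>))"
      using moment_step[OF \<rho>, of 3 1] moment_step[OF \<rho>, of 2 2] moment_step[OF \<rho>, of 1 3] moment_step[OF \<rho>, of 0 4]
        nm by (simp add: J_def[abs_def])
  qed
  also have "\<dots> = 6 * \<sigma>\<^sup>2 * expectation (\<lambda>\<omega>. indicator (\<Union>\<rho>\<in>R q. A q \<rho>) \<omega> * X q \<omega> ^ 2) + 3 * \<sigma> ^ 4 * expectation (indicator (\<Union>\<rho>\<in>R q. A q \<rho>))"
  proof -
    have ind: "(indicator (\<Union>\<rho>\<in>R q. A q \<rho>) \<omega> :: real) = (\<Sum>\<rho>\<in>R q. indicator (A q \<rho>) \<omega>)" for \<omega>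
      using indicator_UN_disjoint[OF finite_R disj, of q \<omega>] by simp
    have i1: "\<rho> \<in> R q \<Longrightarrow> integrable M (\<lambda>\<omega>. indicator (A q \<rho>) \<omega> * X q \<omega> ^ 2)" for \<rho>
      using integrable_pow[of \<rho> q 2 0] by simp
    have i2: "\<rho> \<in> R q \<Longrightarrow> integrable M (indicator (A q \<rho>) :: _ \<Rightarrow> real)" for \<rho>
      using integrable_pow[of \<rho> q 0 0] by simp
    show ?thesis
      unfolding ind sum_distrib_right
      by (simp add: Bochner_Integration.integral_sum i1 i2 sum.distrib sum_distrib_left)
  qed
  also have "\<dots> \<le> 6 * \<sigma>\<^sup>2 * expectation (\<lambda>\<omega>. X q \<omega> ^ 2) + 3 * \<sigma> ^ 4 * 1"
  proof (intro add_mono mult_left_mono)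
    have U: "(\<Union>\<rho>\<in>R q. A q \<rho>) \<in> sets M" using finite_R A_M by auto
    show "expectation (\<lambda>\<omega>. indicator (\<Union>\<rho>\<in>R q. A q \<rho>) \<omega> * X q \<omega> ^ 2) \<le> expectation (\<lambda>\<omega>. X q \<omega> ^ 2)"
      using integrable_bounded_pow[OF integrable_X4 integrable_X4 X_meas X_meas U, of 2 0]
      by (intro integral_mono) (auto simp: integrable_X_pow indicator_def)
    show "expectation (indicator (\<Union>\<rho>\<in>R q. A q \<rho>)) \<le> (1 :: real)"
      by simp
  qed auto
  finally show ?thesis by simp
qed

lemma expectation_X2:
  "expectation (\<lambda>\<omega>. X n \<omega> ^ 2) = expectation (\<lambda>\<omega>. X 0 \<omega> ^ 2) + \<sigma>\<^sup>2 * (\<Sum>q<n. prob (\<Union>\<rho>\<in>R q. A q \<rho>))"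
  by (induction n) (simp_all add: expectation_X2_Suc algebra_simps)

text \<open>The second moments increase with the step, so in the recursion each is replaced by the
  last one. Keeping the last second moment in the bound is what allows it to be absorbed
  later.\<close>

lemma expectation_X4:
  "expectation (\<lambda>\<omega>. X n \<omega> ^ 4) \<le>
    expectation (\<lambda>\<omega>. X 0 \<omega> ^ 4) + 6 * n * \<sigma>\<^sup>2 * expectation (\<lambda>\<omega>. X n \<omega> ^ 2) + 3 * n * \<sigma> ^ 4"
proof -
  have mono: "expectation (\<lambda>\<omega>. X q \<omega> ^ 2) \<le> expectation (\<lambda>\<omega>. X n \<omega> ^ 2)" if "q \<le> n" for q
    using that by (simp add: expectation_X2[of q] expectation_X2[of n] mult_left_mono sum_mono2)
  have "expectation (\<lambda>\<omega>. X q \<omega> ^ 4) \<le>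
    expectation (\<lambda>\<omega>. X 0 \<omega> ^ 4) + 6 * q * \<sigma>\<^sup>2 * expectation (\<lambda>\<omega>. X n \<omega> ^ 2) + 3 * q * \<sigma> ^ 4" if "q \<le> n" for q
    using that
  proof (induction q)
    case (Suc q)
    have "6 * \<sigma>\<^sup>2 * expectation (\<lambda>\<omega>. X q \<omega> ^ 2) \<le> 6 * \<sigma>\<^sup>2 * expectation (\<lambda>\<omega>. X n \<omega> ^ 2)"
      using mono[of q] Suc by (intro mult_left_mono) auto
    then show ?case using Suc expectation_X4_Suc[of q] by (simp add: algebra_simps)
  qed simp
  then show ?thesis by blast
qed

end

section \<open>Independence of the past from later increments\<close>

lemma Int_stable_finite_Ints:
  assumes int: "\<And>j. Int_stable (E j)" and sp: "\<And>j. \<Omega> \<in> E j" and sub: "\<And>j. E j \<subseteq> Pow \<Omega>"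
  shows "Int_stable {\<Inter>j\<le>n::nat. A j | A n. \<forall>j. A j \<in> E j}"
proof (rule Int_stableI)
  fix a b assume "a \<in> {\<Inter>j\<le>n::nat. A j | A n. \<forall>j. A j \<in> E j}" "b \<in> {\<Inter>j\<le>n::nat. A j | A n. \<forall>j. A j \<in> E j}"
  then obtain A n A' n' where A: "a = (\<Inter>j\<le>n::nat. A j)" "\<And>j. A j \<in> E j"
    and A': "b = (\<Inter>j\<le>n'::nat. A' j)" "\<And>j. A' j \<in> E j" by auto
  define C where "C j = (if j \<le> n then A j else \<Omega>) \<inter> (if j \<le> n' then A' j else \<Omega>)" for j
  have "C j \<in> E j" for j
    using A A' sp int[of j] by (auto simp: C_def Int_stable_def)
  moreover have "a \<subseteq> \<Omega>" "b \<subseteq> \<Omega>" using A A' sub by fastforce+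
  then have "a \<inter> b = (\<Inter>j\<le>max n n'. C j)"
    unfolding A(1) A'(1) C_def by (auto simp: le_max_iff_disj split: if_splits)
  ultimately show "a \<inter> b \<in> {\<Inter>j\<le>n::nat. A j | A n. \<forall>j. A j \<in> E j}" by blast
qed

lemma (in prob_space) indep_set_mono:
  "indep_set A B \<Longrightarrow> A' \<subseteq> A \<Longrightarrow> B' \<subseteq> B \<Longrightarrow> indep_set A' B'"
  unfolding indep_sets2_eq by blast

text \<open>On a finite intersection the probability factorises twice: over the index
  \<open>j\<close> by independence of the \<open>P j\<close>, and within each \<open>j\<close> by
  independence of \<open>H j\<close> and \<open>D j\<close>. Regrouping the factors separates the
  \<open>H\<close> part from the \<open>D\<close> part. Below, \<open>H j\<close> is the past of
  driver \<open>j\<close> and \<open>D j\<close> its next increment.\<close>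

lemma (in prob_space) indep_set_sigma_Union:
  fixes P H D :: "nat \<Rightarrow> 'a set set"
  assumes ind: "indep_sets P UNIV" and P: "\<And>j. Int_stable (P j)" and HD: "\<And>j. H j \<subseteq> P j" "\<And>j. D j \<subseteq> P j"
    and HD_ind: "\<And>j. indep_set (H j) (D j)"
    and stable: "\<And>j. Int_stable (H j)" "\<And>j. Int_stable (D j)"
    and sp: "\<And>j. space M \<in> H j" "\<And>j. space M \<in> D j"
  shows "indep_set (sigma_sets (space M) (\<Union>j. H j)) (sigma_sets (space M) (\<Union>j. D j))"
proof -
  let ?f = "\<lambda>E :: nat \<Rightarrow> 'a set set. {\<Inter>j\<le>n. A j | A n. \<forall>j. A j \<in> E j}"
  have ev: "P j \<subseteq> events" for j using ind by (auto simp: indep_sets_def)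
  have sub: "H j \<subseteq> Pow (space M)" "D j \<subseteq> Pow (space M)" for j
    using ev[of j] HD[of j] sets.space_closed by blast+
  have gen: "sigma_sets (space M) (\<Union>j. E j) \<subseteq> sigma_sets (space M) (?f E)"
    if "\<And>j. space M \<in> E j" "\<And>j. E j \<subseteq> Pow (space M)" for E
  proof (rule sigma_sets_mono', safe)
    fix a j assume a: "a \<in> E j"
    have "a \<subseteq> space M" using a that(2)[of j] by auto
    then have "a = (\<Inter>i\<le>j. if i = j then a else space M)" by (auto split: if_splits)
    moreover have "\<forall>i. (if i = j then a else space M) \<in> E i" using a that(1) by auto
    ultimately show "\<exists>A n. a = (\<Inter>j\<le>n. A j) \<and> (\<forall>j. A j \<in> E j)"
      by (intro exI[of _ "\<lambda>i. if i = j then a else space M"] exI[of _ j]) simp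
  qed
  have "indep_set (?f H) (?f D)"
  proof (rule indep_setI)
    fix a b assume "a \<in> ?f H" "b \<in> ?f D"
    then obtain A n A' n' where A: "a = (\<Inter>j\<le>n. A j)" "\<And>j. A j \<in> H j"
      and A': "b = (\<Inter>j\<le>n'. A' j)" "\<And>j. A' j \<in> D j" by auto
    define m where "m = max n n'"
    define B where "B j = (if j \<le> n then A j else space M)" for j
    define B' where "B' j = (if j \<le> n' then A' j else space M)" for j
    have B: "B j \<in> H j" "B' j \<in> D j" for j using A A' sp by (auto simp: B_def B'_def)
    have "a \<subseteq> space M" "b \<subseteq> space M" using A A' sub by fastforce+
    then have a: "a = (\<Inter>j\<le>m. B j)" and b: "b = (\<Inter>j\<le>m. B' j)"
      unfolding A(1) A'(1) B_def B'_def m_def by (auto simp: le_max_iff_disj split: if_splits)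
    have BP: "B j \<in> P j" "B' j \<in> P j" "B j \<inter> B' j \<in> P j" for j
      using B[of j] HD[of j] P[of j] unfolding Int_stable_def by blast+
    have prod: "prob (\<Inter>j\<le>m. C j) = (\<Prod>j\<le>m. prob (C j))" if "\<And>j. C j \<in> P j" for C
      using indep_setsD[OF ind, of "{..m}" C] that by auto
    have "a \<inter> b = (\<Inter>j\<le>m. B j \<inter> B' j)" unfolding a b by auto
    then have "prob (a \<inter> b) = (\<Prod>j\<le>m. prob (B j \<inter> B' j))" using prod[OF BP(3)] by simp
    also have "\<dots> = (\<Prod>j\<le>m. prob (B j) * prob (B' j))"
      using indep_setD[OF HD_ind B] by simp
    also have "\<dots> = prob a * prob b"
      unfolding a b using prod[of B] prod[of B'] BP by (simp add: prod.distrib)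
    finally show "prob (a \<inter> b) = prob a * prob b" .
  next
    have *: "(\<Inter>j\<le>n. A j) \<in> events" if "\<forall>j. A j \<in> E j" "\<And>j. E j \<subseteq> P j" for E A and n :: nat
    proof (rule sets.finite_INT)
      show "A j \<in> events" for j using that(1) that(2)[of j] ev[of j] by blast
    qed auto
    show "?f H \<subseteq> events" using *[OF _ HD(1)] by auto
    show "?f D \<subseteq> events" using *[OF _ HD(2)] by auto
  qed
  then have "indep_set (sigma_sets (space M) (?f H)) (sigma_sets (space M) (?f D))"
    by (intro indep_set_sigma_sets Int_stable_finite_Ints[of _ "space M"] stable sp sub)
  then show ?thesis
    by (rule indep_set_mono) (rule gen[OF sp(1) sub(1)], rule gen[OF sp(2) sub(2)])
qed

text \<open>The values of \<open>b\<close> at finitely many times up to \<open>p\<close> are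
  \<open>x0\<close> plus sums of increments over a grid from \<open>t0\<close> to \<open>p\<close>;
  the increment from \<open>p\<close> to \<open>p'\<close> is one more member of the same
  independent sequence.\<close>

lemma (in prob_space) indep_set_past_increment:
  fixes b :: "real \<Rightarrow> 'a \<Rightarrow> real"
  assumes b: "\<And>s. t0 \<le> s \<Longrightarrow> b s \<in> borel_measurable M"
    and b0: "\<And>\<omega>. \<omega> \<in> space M \<Longrightarrow> b t0 \<omega> = x0"
    and inc: "\<And>\<tau> :: nat \<Rightarrow> real. mono \<tau> \<Longrightarrow> t0 \<le> \<tau> 0 \<Longrightarrow>
        indep_vars (\<lambda>_. borel) (\<lambda>k \<omega>. b (\<tau> (Suc k)) \<omega> - b (\<tau> k) \<omega>) UNIV"
    and p: "t0 \<le> p" "p \<le> p'"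
  shows "indep_set (sigma_sets (space M) {b s -` S \<inter> space M | s S. t0 \<le> s \<and> s \<le> p \<and> S \<in> sets borel})
     {(\<lambda>\<omega>. b p' \<omega> - b p \<omega>) -` S \<inter> space M | S. S \<in> sets borel}"
    (is "indep_set (sigma_sets _ ?H) ?D")
proof -
  define G where "G F = sigma_sets (space M) {b s -` S \<inter> space M | s S. s \<in> F \<and> S \<in> sets borel}" for F
  have D_ev: "?D \<subseteq> events" using b p by (auto intro!: measurable_sets borel_measurable_diff)
  have G_ev: "G F \<subseteq> events" if "F \<subseteq> {t0..p}" for F
    unfolding G_def using b that by (intro sets.sigma_sets_subset) (auto intro: measurable_sets)
  have fin: "indep_set (G F) ?D" if F: "finite F" "F \<subseteq> {t0..p}" for F
  proof -
    define xs where "xs = sorted_list_of_set (insert t0 (insert p F))"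
    have xs: "set xs = insert t0 (insert p F)" "sorted xs" "distinct xs"
      unfolding xs_def using F(1) by (simp_all only: set_sorted_list_of_set finite_insert
          sorted_sorted_list_of_set distinct_sorted_list_of_set)
    define m where "m = length xs - 1"
    have len: "length xs = Suc m" using xs(1) by (cases xs) (auto simp: m_def)
    \<comment> \<open>Index \<open>m\<close> is the last grid point \<open>p\<close>, and all later
      points equal \<open>p'\<close>, so increment number \<open>m\<close> is exactly the one from
      \<open>p\<close> to \<open>p'\<close>.\<close>
    define \<tau> where "\<tau> k = (if k \<le> m then xs ! k else p')" for k
    have le_p': "x \<in> set xs \<Longrightarrow> x \<le> p'" for x using xs(1) F p by auto
    have mono: "mono \<tau>"
      unfolding mono_def \<tau>_def using xs(2) len le_p' by (auto simp: sorted_iff_nth_mono)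
    have hd: "\<tau> 0 = t0"
    proof -
      have "xs ! 0 \<in> set xs" using len by (intro nth_mem) simp
      then have "t0 \<le> xs ! 0" using xs(1) F p by auto
      moreover obtain i where "i < length xs" "xs ! i = t0" using xs(1) by (metis in_set_conv_nth insertI1)
      then have "xs ! 0 \<le> t0" using sorted_nth_mono[OF xs(2), of 0 i] by auto
      ultimately show ?thesis by (simp add: \<tau>_def)
    qed
    have lst: "\<tau> m = p"
    proof -
      have "xs ! m \<in> set xs" using len by (intro nth_mem) simp
      then have "xs ! m \<le> p" using xs(1) F p by auto
      moreover obtain i where "i < length xs" "xs ! i = p" using xs(1) by (metis in_set_conv_nth insertI1 insertI2)
      then have "p \<le> xs ! m" using sorted_nth_mono[OF xs(2), of i m] len by auto
      ultimately show ?thesis by (simp add: \<tau>_def)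
    qed
    define X where "X = (\<lambda>k \<omega>. b (\<tau> (Suc k)) \<omega> - b (\<tau> k) \<omega>)"
    have iv: "indep_vars (\<lambda>_. borel) X UNIV" unfolding X_def using inc[OF mono] hd by simp
    let ?Y = "\<lambda>\<omega>. restrict (\<lambda>i. X i \<omega>) {..<m}" and ?Z = "\<lambda>\<omega>. restrict (\<lambda>i. X i \<omega>) {m}"
    have "indep_var (PiM {..<m} (\<lambda>_. borel)) ?Y (PiM {m} (\<lambda>_. borel)) ?Z"
      by (rule indep_var_restrict[OF iv]) auto
    then have ind: "indep_set (sigma_sets (space M) {?Y -` A \<inter> space M |A. A \<in> sets (PiM {..<m} (\<lambda>_. borel))})
        (sigma_sets (space M) {?Z -` A \<inter> space M |A. A \<in> sets (PiM {m} (\<lambda>_. borel))})"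
      unfolding indep_var_eq by blast
    have 1: "G F \<subseteq> sigma_sets (space M) {?Y -` A \<inter> space M |A. A \<in> sets (PiM {..<m} (\<lambda>_. borel))}"
      unfolding G_def
    proof (rule sigma_sets_mono', safe)
      fix s and S :: "real set" assume s: "s \<in> F" and S: "S \<in> sets borel"
      obtain i where i: "i < length xs" "xs ! i = s" using xs(1) s by (metis in_set_conv_nth insertI2)
      then have \<tau>i: "\<tau> i = s" "i \<le> m" using len by (auto simp: \<tau>_def)
      define g where "g = (\<lambda>y :: nat \<Rightarrow> real. x0 + (\<Sum>k<i. y k))"
      have "b s \<omega> = g (?Y \<omega>)" if "\<omega> \<in> space M" for \<omega>
      proof -
        have "g (?Y \<omega>) = x0 + (\<Sum>k<i. X k \<omega>)" using \<tau>i by (auto simp: g_def)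
        also have "\<dots> = x0 + (b (\<tau> i) \<omega> - b (\<tau> 0) \<omega>)"
          unfolding X_def by (subst sum_lessThan_telescope) simp
        also have "x0 + (b (\<tau> i) \<omega> - b (\<tau> 0) \<omega>) = b s \<omega>" using hd \<tau>i b0[OF that] by simp
        finally show ?thesis by (rule sym)
      qed
      then have "b s -` S \<inter> space M = ?Y -` (g -` S \<inter> space (PiM {..<m} (\<lambda>_. borel))) \<inter> space M"
        by (auto simp: space_PiM)
      moreover have "g \<in> borel_measurable (PiM {..<m} (\<lambda>_. borel))"
        unfolding g_def using \<tau>i by (intro borel_measurable_add borel_measurable_sum measurable_component_singleton) auto
      ultimately show "\<exists>A. b s -` S \<inter> space M = ?Y -` A \<inter> space M \<and> A \<in> sets (PiM {..<m} (\<lambda>_. borel))"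
        using S by (blast intro: measurable_sets)
    qed
    have 2: "?D \<subseteq> sigma_sets (space M) {?Z -` A \<inter> space M |A. A \<in> sets (PiM {m} (\<lambda>_. borel))}"
    proof safe
      fix S :: "real set" assume S: "S \<in> sets borel"
      have "(\<lambda>\<omega>. b p' \<omega> - b p \<omega>) -` S \<inter> space M = ?Z -` ((\<lambda>y. y m) -` S \<inter> space (PiM {m} (\<lambda>_. borel))) \<inter> space M"
        using lst by (auto simp: X_def \<tau>_def space_PiM)
      moreover have "(\<lambda>y. y m) -` S \<inter> space (PiM {m} (\<lambda>_. borel)) \<in> sets (PiM {m} (\<lambda>_. borel))"
        using S by (intro measurable_sets[OF measurable_component_singleton]) auto
      ultimately show "(\<lambda>\<omega>. b p' \<omega> - b p \<omega>) -` S \<inter> space M \<in>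
          sigma_sets (space M) {?Z -` A \<inter> space M |A. A \<in> sets (PiM {m} (\<lambda>_. borel))}" by blast
    qed
    show ?thesis using ind 1 2 by (rule indep_set_mono)
  qed
  \<comment> \<open>Events at a single time are not closed under intersection; the union over finite
    sets of times is, and it generates the same past.\<close>
  define U where "U = (\<Union>F\<in>{F. finite F \<and> F \<subseteq> {t0..p}}. G F)"
  have G_mono: "F \<subseteq> F' \<Longrightarrow> G F \<subseteq> G F'" for F F'
    unfolding G_def by (intro sigma_sets_mono') auto
  have "Int_stable U"
  proof (rule Int_stableI)
    fix a c assume "a \<in> U" "c \<in> U"
    then obtain F F' where F: "finite F" "F \<subseteq> {t0..p}" "finite F'" "F' \<subseteq> {t0..p}" "a \<in> G F" "c \<in> G F'" by (auto simp: U_def)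
    then have "a \<in> G (F \<union> F')" "c \<in> G (F \<union> F')" using G_mono by blast+
    then have "a \<inter> c \<in> G (F \<union> F')"
    proof -
      interpret sigma_algebra "space M" "G (F \<union> F')"
        unfolding G_def by (rule sigma_algebra_sigma_sets) auto
      show "a \<in> G (F \<union> F') \<Longrightarrow> c \<in> G (F \<union> F') \<Longrightarrow> ?thesis" by (rule Int)
    qed
    then show "a \<inter> c \<in> U" using F unfolding U_def by blast
  qed
  moreover have "indep_set U ?D"
  proof (rule indep_setI)
    show "U \<subseteq> events" unfolding U_def using G_ev by blast
    fix a d assume "a \<in> U" "d \<in> ?D"
    then obtain F where "finite F" "F \<subseteq> {t0..p}" "a \<in> G F" by (auto simp: U_def)
    then show "prob (a \<inter> d) = prob a * prob d" using indep_setD[OF fin _ \<open>d \<in> ?D\<close>] by blast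
  qed (rule D_ev)
  moreover have "Int_stable ?D"
  proof (rule Int_stableI)
    fix a c assume "a \<in> ?D" "c \<in> ?D"
    then obtain A C where "a = (\<lambda>\<omega>. b p' \<omega> - b p \<omega>) -` A \<inter> space M" "c = (\<lambda>\<omega>. b p' \<omega> - b p \<omega>) -` C \<inter> space M"
      "A \<in> sets borel" "C \<in> sets borel" by blast
    then have "a \<inter> c = (\<lambda>\<omega>. b p' \<omega> - b p \<omega>) -` (A \<inter> C) \<inter> space M \<and> A \<inter> C \<in> sets borel" by auto
    then show "a \<inter> c \<in> ?D" by blast
  qed
  ultimately have ind: "indep_set (sigma_sets (space M) U) (sigma_sets (space M) ?D)"
    by (intro indep_set_sigma_sets)
  have sub: "sigma_sets (space M) ?H \<subseteq> sigma_sets (space M) U"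
  proof (rule sigma_sets_mono', safe)
    fix s and S :: "real set" assume "t0 \<le> s" "s \<le> p" "S \<in> sets borel"
    then have "b s -` S \<inter> space M \<in> G {s}"
      unfolding G_def by (intro sigma_sets.Basic CollectI exI[of _ s] exI[of _ S]) simp
    then show "b s -` S \<inter> space M \<in> U"
      unfolding U_def using \<open>t0 \<le> s\<close> \<open>s \<le> p\<close> by (intro UN_I[of "{s}"]) simp_all
  qed
  show ?thesis by (rule indep_set_mono[OF ind sub]) (rule sigma_sets_superset_generator)
qed

section \<open>Coalescing paths and their driving motions\<close>

definition dom_upto :: "(nat \<Rightarrow> real \<times> real) \<Rightarrow> real \<Rightarrow> (nat \<times> real) set" where
  "dom_upto z u = {(j, t). snd (z j) \<le> t \<and> t \<le> u}"

definition hist :: "(nat \<Rightarrow> real \<times> real) \<Rightarrow> real \<Rightarrow> (nat \<Rightarrow> real \<Rightarrow> 'w \<Rightarrow> real) \<Rightarrow> 'w \<Rightarrow> nat \<times> real \<Rightarrow> real" where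
  "hist z u V \<omega> = (\<lambda>(j, t)\<in>dom_upto z u. V j t \<omega>)"

text \<open>The history map takes values in a product space that depends only on \<open>z\<close>
  and \<open>u\<close>. An event of the past is thus given by a set of histories, and that set can
  be carried to another probability space.\<close>

definition past :: "'w measure \<Rightarrow> (nat \<Rightarrow> real \<times> real) \<Rightarrow> (nat \<Rightarrow> real \<Rightarrow> 'w \<Rightarrow> real) \<Rightarrow> real \<Rightarrow> 'w measure" where
  "past N z V u = vimage_algebra (space N) (hist z u V) (Pi\<^sub>M (dom_upto z u) (\<lambda>_. borel))"

lemma space_past [simp]: "space (past N z V u) = space N"
  by (simp add: past_def)

lemma hist_PiM: "hist z u V \<in> space N \<rightarrow> space (Pi\<^sub>M (dom_upto z u) (\<lambda>_. borel))"
  by (auto simp: hist_def space_PiM)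

lemma measurable_past: "snd (z j) \<le> t \<Longrightarrow> t \<le> u \<Longrightarrow> V j t \<in> borel_measurable (past N z V u)"
proof -
  assume jt: "snd (z j) \<le> t" "t \<le> u"
  then have mem: "(j, t) \<in> dom_upto z u" by (simp add: dom_upto_def)
  have "(\<lambda>\<omega>. hist z u V \<omega> (j, t)) \<in> borel_measurable (past N z V u)"
    unfolding past_def
    by (rule measurable_compose[OF measurable_vimage_algebra1[OF hist_PiM] measurable_component_singleton[OF mem]])
  then show ?thesis using mem by (simp add: hist_def)
qed

lemma past_least:
  assumes "space K = space N" "\<And>j t. snd (z j) \<le> t \<Longrightarrow> t \<le> u \<Longrightarrow> V j t \<in> borel_measurable K"
  shows "sets (past N z V u) \<subseteq> sets K"
  unfolding past_def
proof (rule sets_image_in_sets[OF assms(1)])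
  show "hist z u V \<in> K \<rightarrow>\<^sub>M Pi\<^sub>M (dom_upto z u) (\<lambda>_. borel)"
    unfolding hist_def[abs_def] case_prod_beta
    by (rule measurable_restrict) (use assms(2) in \<open>auto simp: dom_upto_def\<close>)
qed

lemma past_mono: "u \<le> u' \<Longrightarrow> sets (past N z V u) \<subseteq> sets (past N z V u')"
  by (rule past_least) (auto intro: measurable_past)

lemma past_subalgebra:
  "(\<And>j t. snd (z j) \<le> t \<Longrightarrow> V j t \<in> borel_measurable N) \<Longrightarrow> subalgebra N (past N z V u)"
  unfolding subalgebra_def by (auto dest!: past_least[THEN subsetD, rotated -1])

lemma (in prob_space) indep_var_pair:
  assumes "indep_vars (\<lambda>_. L) X {k, l}" "k \<noteq> l"
  shows "indep_var L (X k) L (X l)"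
proof -
  let ?G = "\<lambda>i. sigma_sets (space M) {X i -` A \<inter> space M |A. A \<in> sets L}"
  have ind: "indep_sets ?G {k, l}" and rv: "random_variable L (X k)" "random_variable L (X l)"
    using assms(1) by (auto simp: indep_vars_def)
  have "indep_set (?G k) (?G l)"
  proof (rule indep_setI)
    fix a b assume "a \<in> ?G k" "b \<in> ?G l"
    then show "prob (a \<inter> b) = prob a * prob b"
      using indep_setsD[OF ind, of "{k, l}" "\<lambda>i. if i = k then a else b"] \<open>k \<noteq> l\<close> by (auto simp: Int_commute)
  qed (use ind in \<open>auto simp: indep_sets_def\<close>)
  then show ?thesis using rv by (simp add: indep_var_eq)
qed

text \<open>All path properties hold at every point of \<open>space N\<close>, not merely almost
  surely. This makes the path \<open>V\<close> a measurable function of the drivers without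
  completing the sigma-algebras; \<open>coalescing_BMs_driven\<close> shows that it is no
  loss.\<close>

locale driven = prob_space N for N :: "'w measure" +
  fixes z :: "nat \<Rightarrow> real \<times> real" and B V :: "nat \<Rightarrow> real \<Rightarrow> 'w \<Rightarrow> real"
  assumes indep: "independent_BMs N z B"
    and B_start: "\<omega> \<in> space N \<Longrightarrow> B j (snd (z j)) \<omega> = fst (z j)"
    and B_cont: "\<omega> \<in> space N \<Longrightarrow> continuous_on {snd (z j)..} (\<lambda>t. B j t \<omega>)"
    and V_cont: "\<omega> \<in> space N \<Longrightarrow> continuous_on {snd (z j)..} (\<lambda>t. V j t \<omega>)"
    and coal: "\<omega> \<in> space N \<Longrightarrow> coalesces_along z (\<lambda>j t. B j t \<omega>) (\<lambda>j t. V j t \<omega>)"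
begin

abbreviation "T j \<equiv> snd (z j)"

lemma B_meas: "T j \<le> t \<Longrightarrow> B j t \<in> borel_measurable N"
  using indep by (auto simp: independent_BMs_def brownian_motion_def split_beta)

lemma B_incr: "T j \<le> s \<Longrightarrow> s < t \<Longrightarrow>
    distributed N lborel (\<lambda>\<omega>. B j t \<omega> - B j s \<omega>) (normal_density 0 (sqrt (t - s)))"
  using indep by (auto simp: independent_BMs_def brownian_motion_def split_beta)

abbreviation "H \<equiv> past N z B"

lemma H_sub: "subalgebra N (H u)"
  by (rule past_subalgebra[OF B_meas])

lemma sets_H: "sets (H u) \<subseteq> sets N"
  using H_sub by (simp add: subalgebra_def)

lemma indep_past_increments:
  assumes p: "p < p'"
  shows "indep_set (sets (H p)) (sigma_sets (space N)
    (\<Union>j\<in>{j. T j \<le> p}. {(\<lambda>\<omega>. B j p' \<omega> - B j p \<omega>) -` S \<inter> space N | S. S \<in> sets borel}))"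
proof -
  define P where "P j = sigma_sets (space N) {(\<lambda>\<omega>. \<lambda>t\<in>{T j..}. B j t \<omega>) -` A \<inter> space N | A. A \<in> sets (Pi\<^sub>M {T j..} (\<lambda>_. borel))}" for j
  define HH where "HH j = sigma_sets (space N) {B j s -` S \<inter> space N | s S. T j \<le> s \<and> s \<le> p \<and> S \<in> sets borel}" for j
  \<comment> \<open>A driver that has not started by time \<open>p\<close> has no increment to
    contribute, hence the trivial system.\<close>
  define D where "D j = (if T j \<le> p then {(\<lambda>\<omega>. B j p' \<omega> - B j p \<omega>) -` S \<inter> space N | S. S \<in> sets borel} else {{}, space N})" for j
  have pathm: "(\<lambda>\<omega>. \<lambda>t\<in>{T j..}. B j t \<omega>) \<in> N \<rightarrow>\<^sub>M Pi\<^sub>M {T j..} (\<lambda>_. borel)" for j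
    using B_meas by (intro measurable_restrict) auto
  have P_ind: "indep_sets P UNIV"
    using indep unfolding independent_BMs_def indep_vars_def P_def by blast
  have P_alg: "sigma_algebra (space N) (P j)" for j
    unfolding P_def by (rule sigma_algebra_sigma_sets) auto
  have comp: "f -` S \<inter> space N \<in> P j" if "\<And>\<omega>. \<omega> \<in> space N \<Longrightarrow> f \<omega> = g (\<lambda>t\<in>{T j..}. B j t \<omega>)"
      "g \<in> borel_measurable (Pi\<^sub>M {T j..} (\<lambda>_. borel))" "S \<in> sets borel" for f :: "'w \<Rightarrow> real" and g j S
  proof -
    have "f -` S \<inter> space N = (\<lambda>\<omega>. \<lambda>t\<in>{T j..}. B j t \<omega>) -` (g -` S \<inter> space (Pi\<^sub>M {T j..} (\<lambda>_. borel))) \<inter> space N"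
      using that(1) by (auto simp: space_PiM)
    then show ?thesis unfolding P_def using that(2,3)
      by (intro sigma_sets.Basic CollectI exI[of _ "g -` S \<inter> space (Pi\<^sub>M {T j..} (\<lambda>_. borel))"] conjI measurable_sets) simp_all
  qed
  have HH_P: "HH j \<subseteq> P j" for j
  proof -
    interpret sigma_algebra "space N" "P j" by (rule P_alg)
    show ?thesis unfolding HH_def
    proof (rule sigma_sets_subset, safe)
      fix s and S :: "real set" assume s: "T j \<le> s" "s \<le> p" and S: "S \<in> sets borel"
      show "B j s -` S \<inter> space N \<in> P j"
        by (rule comp[of _ "\<lambda>y. y s"]) (use s S in auto)
    qed
  qed
  have D_P: "D j \<subseteq> P j" for j
  proof -
    interpret sigma_algebra "space N" "P j" by (rule P_alg)
    show ?thesis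
    proof (cases "T j \<le> p")
      case True
      show ?thesis unfolding D_def if_P[OF True]
      proof safe
        fix S :: "real set" assume S: "S \<in> sets borel"
        have "T j \<le> p'" using True p by simp
        show "(\<lambda>\<omega>. B j p' \<omega> - B j p \<omega>) -` S \<inter> space N \<in> P j"
          by (rule comp[of _ "\<lambda>y. y p' - y p"])
            (use True \<open>T j \<le> p'\<close> S in \<open>auto intro!: borel_measurable_diff measurable_component_singleton\<close>)
      qed
    qed (simp add: D_def)
  qed
  have HD: "indep_set (HH j) (D j)" for j
  proof (cases "T j \<le> p")
    case True
    show ?thesis unfolding HH_def D_def if_P[OF True]
    proof (rule indep_set_past_increment[where ?x0.0 = "fst (z j)"])
      show "indep_vars (\<lambda>_. borel) (\<lambda>k \<omega>. B j (\<tau> (Suc k)) \<omega> - B j (\<tau> k) \<omega>) UNIV"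
        if "mono \<tau>" "T j \<le> \<tau> 0" for \<tau> :: "nat \<Rightarrow> real"
        using indep that by (auto simp: independent_BMs_def brownian_motion_def split_beta)
    qed (use True p B_meas B_start in auto)
  next
    case False
    have "HH j \<subseteq> sets N" using HH_P[of j] P_ind by (auto simp: indep_sets_def)
    then show ?thesis using False
      by (intro indep_setI) (auto simp: D_def prob_space Int_absorb2[OF sets.sets_into_space])
  qed
  have "indep_set (sigma_sets (space N) (\<Union>j. HH j)) (sigma_sets (space N) (\<Union>j. D j))"
  proof (rule indep_set_sigma_Union[OF P_ind _ HH_P D_P HD])
    fix j
    interpret P: sigma_algebra "space N" "P j" by (rule P_alg)
    interpret HH: sigma_algebra "space N" "HH j" unfolding HH_def by (rule sigma_algebra_sigma_sets) auto
    show "Int_stable (P j)" "Int_stable (HH j)" by (auto simp: Int_stable_def)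
    show "space N \<in> HH j" by simp
    show "Int_stable (D j)" unfolding D_def by (auto simp: Int_stable_vimages intro: Int_stableI)
    show "space N \<in> D j" by (auto simp: D_def intro!: exI[of _ UNIV])
  qed
  then show ?thesis
  proof (rule indep_set_mono)
    let ?K = "sigma (space N) (\<Union>j. HH j)"
    have sub: "(\<Union>j. HH j) \<subseteq> Pow (space N)"
      unfolding HH_def using sigma_sets_into_sp[of "{B j s -` S \<inter> space N | s S. T j \<le> s \<and> s \<le> p \<and> S \<in> sets borel}" "space N" for j] by blast
    have "sets (H p) \<subseteq> sets ?K"
    proof (rule past_least)
      fix j t assume "T j \<le> t" "t \<le> p"
      then have "B j t -` S \<inter> space N \<in> HH j" if "S \<in> sets borel" for S
        unfolding HH_def using that by (intro sigma_sets.Basic CollectI exI[of _ t] exI[of _ S]) simp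
      then show "B j t \<in> borel_measurable ?K"
        by (intro measurableI) (auto simp: space_measure_of[OF sub] sets_measure_of[OF sub] intro: sigma_sets.Basic)
    qed (simp add: space_measure_of[OF sub])
    then show "sets (H p) \<subseteq> sigma_sets (space N) (\<Union>j. HH j)" by (simp add: sets_measure_of[OF sub])
    show "sigma_sets (space N) (\<Union>j\<in>{j. T j \<le> p}. {(\<lambda>\<omega>. B j p' \<omega> - B j p \<omega>) -` S \<inter> space N | S. S \<in> sets borel})
        \<subseteq> sigma_sets (space N) (\<Union>j. D j)"
      by (rule sigma_sets_mono') (auto simp: D_def intro!: exI)
  qed
qed

lemma indep_increment:
  assumes "T k \<le> p" "p < p'"
  shows "indep_set (sets (H p)) {(\<lambda>\<omega>. B k p' \<omega> - B k p \<omega>) -` S \<inter> space N | S. S \<in> sets borel}"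
  using indep_past_increments[OF assms(2)]
  by (rule indep_set_mono) (use assms in \<open>auto intro!: sigma_sets.Basic\<close>)

lemma indep_increment_diff:
  assumes "T k \<le> p" "T l \<le> p" "p < p'"
  shows "indep_set (sets (H p))
    {(\<lambda>\<omega>. (B k p' \<omega> - B k p \<omega>) - (B l p' \<omega> - B l p \<omega>)) -` S \<inter> space N | S. S \<in> sets borel}"
  using indep_past_increments[OF assms(3)]
proof (rule indep_set_mono)
  let ?G = "\<Union>j\<in>{j. T j \<le> p}. {(\<lambda>\<omega>. B j p' \<omega> - B j p \<omega>) -` S \<inter> space N | S. S \<in> sets borel}"
  let ?K = "sigma (space N) ?G"
  have sub: "?G \<subseteq> Pow (space N)" by auto
  have *: "(\<lambda>\<omega>. B j p' \<omega> - B j p \<omega>) \<in> borel_measurable ?K" if "T j \<le> p" for j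
    using that
    by (intro measurableI) (auto simp: space_measure_of[OF sub] sets_measure_of[OF sub] intro!: sigma_sets.Basic)
  have "(\<lambda>\<omega>. (B k p' \<omega> - B k p \<omega>) - (B l p' \<omega> - B l p \<omega>)) \<in> borel_measurable ?K"
    using *[OF assms(1)] *[OF assms(2)] by (rule borel_measurable_diff)
  from measurable_sets[OF this]
  show "{(\<lambda>\<omega>. (B k p' \<omega> - B k p \<omega>) - (B l p' \<omega> - B l p \<omega>)) -` S \<inter> space N | S. S \<in> sets borel} \<subseteq> sigma_sets (space N) ?G"
    by (auto simp: space_measure_of[OF sub] sets_measure_of[OF sub])
qed simp

lemma distributed_increment_diff:
  assumes kl: "k \<noteq> l" and p: "T k \<le> p" "T l \<le> p" "p < p'"
  shows "distributed N lborel (\<lambda>\<omega>. (B k p' \<omega> - B k p \<omega>) - (B l p' \<omega> - B l p \<omega>))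
    (normal_density 0 (sqrt (2 * (p' - p))))"
proof -
  have "indep_vars (\<lambda>j. Pi\<^sub>M {T j..} (\<lambda>_. borel)) (\<lambda>j \<omega>. \<lambda>t\<in>{T j..}. B j t \<omega>) {k, l}"
    using indep unfolding independent_BMs_def by (auto intro: indep_vars_subset)
  then have "indep_vars (\<lambda>_. borel) (\<lambda>j \<omega>. (\<lambda>y. y p' - y p) (\<lambda>t\<in>{T j..}. B j t \<omega>)) {k, l}"
    by (rule indep_vars_compose2) (use p in \<open>auto intro!: borel_measurable_diff measurable_component_singleton\<close>)
  then have "indep_vars (\<lambda>_. borel) (\<lambda>j \<omega>. B j p' \<omega> - B j p \<omega>) {k, l}"
    by (rule indep_vars_cong[THEN iffD1, rotated -1]) (use p in auto)
  from indep_var_pair[OF this kl]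
  have "indep_var borel (\<lambda>\<omega>. B k p' \<omega> - B k p \<omega>) borel (\<lambda>\<omega>. B l p' \<omega> - B l p \<omega>)" .
  from diff_indep_normal[OF this _ _ B_incr[OF p(1,3)] B_incr[OF p(2,3)]]
  show ?thesis using p by (simp add: real_sqrt_pow2)
qed

end

text \<open>By compactness a zero exists as soon as the values come arbitrarily close to zero, and
  by continuity rational times suffice for that. This turns an uncountable condition into a
  measurable one. The point \<open>a\<close> is inserted because the interval may consist of one
  irrational point.\<close>

lemma compact_zero_iff:
  fixes f :: "real \<Rightarrow> real"
  assumes f: "continuous_on {a..} f" and ac: "a \<le> c"
  shows "(\<exists>s\<in>{a..c}. f s = 0) \<longleftrightarrow> (\<forall>n::nat. \<exists>s\<in>insert a (\<rat> \<inter> {a..c}). \<bar>f s\<bar> < 1 / Suc n)"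
proof
  assume "\<exists>s\<in>{a..c}. f s = 0"
  then obtain s where s: "s \<in> {a..c}" "f s = 0" by auto
  show "\<forall>n::nat. \<exists>s\<in>insert a (\<rat> \<inter> {a..c}). \<bar>f s\<bar> < 1 / Suc n"
  proof
    fix n :: nat
    show "\<exists>s\<in>insert a (\<rat> \<inter> {a..c}). \<bar>f s\<bar> < 1 / Suc n"
    proof (cases "a = c")
      case False
      have "\<exists>d>0. \<forall>x\<in>{a..}. dist x s < d \<longrightarrow> dist (f x) (f s) < 1 / Suc n"
        using f[unfolded continuous_on_iff, rule_format, of s "1 / Suc n"] s by (simp del: of_nat_Suc)
      then obtain d where d: "d > 0" "\<And>x. x \<ge> a \<Longrightarrow> \<bar>x - s\<bar> < d \<Longrightarrow> \<bar>f x\<bar> < 1 / Suc n"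
        using s(2) by (auto simp: dist_real_def)
      have "max a (s - d) < min c (s + d)" using d s False ac by auto
      then obtain r where r: "r \<in> \<rat>" "max a (s - d) < r" "r < min c (s + d)" using Rats_dense_in_real by blast
      then have "\<bar>f r\<bar> < 1 / Suc n" by (intro d) auto
      then show ?thesis using r by auto
    qed (use s in auto)
  qed
next
  assume *: "\<forall>n::nat. \<exists>s\<in>insert a (\<rat> \<inter> {a..c}). \<bar>f s\<bar> < 1 / Suc n"
  have cont: "continuous_on {a..c} (\<lambda>s. \<bar>f s\<bar>)"
    by (intro continuous_intros continuous_on_subset[OF f]) auto
  obtain s where s: "s \<in> {a..c}" "\<And>x. x \<in> {a..c} \<Longrightarrow> \<bar>f s\<bar> \<le> \<bar>f x\<bar>"
    using continuous_attains_inf[OF compact_Icc _ cont] ac by auto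
  have "\<bar>f s\<bar> \<le> inverse (Suc n)" for n
  proof -
    obtain x where x: "x \<in> insert a (\<rat> \<inter> {a..c})" "\<bar>f x\<bar> < 1 / Suc n" using * by blast
    then have "x \<in> {a..c}" using ac by auto
    from s(2)[OF this] x(2) show ?thesis by (simp add: inverse_eq_divide)
  qed
  then have "\<bar>f s\<bar> \<le> 0"
    by (intro LIMSEQ_le_const[OF LIMSEQ_inverse_real_of_nat]) blast
  then show "\<exists>s\<in>{a..c}. f s = 0" using s by auto
qed

text \<open>The zeros of finitely many continuous functions up to time \<open>s\<close> form a
  nonempty compact set, whose minimum is the first zero.\<close>

lemma finite_first_zero:
  fixes f :: "nat \<Rightarrow> real \<Rightarrow> real"
  assumes f: "\<And>k. k < j \<Longrightarrow> continuous_on {a k..} (f k)" and ex: "k < j" "a k \<le> s" "f k s = 0"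
  obtains k' s' where "k' < j" "a k' \<le> s'" "s' \<le> s" "f k' s' = 0"
    "\<And>i r. i < j \<Longrightarrow> a i \<le> r \<Longrightarrow> r < s' \<Longrightarrow> f i r \<noteq> 0"
proof -
  define S where "S = (\<Union>i<j. {r \<in> {a i..s}. f i r = 0})"
  have "compact S" unfolding S_def
  proof (intro compact_UN finite_lessThan)
    fix i assume "i \<in> {..<j}"
    then have "continuous_on {a i..s} (f i)" by (intro continuous_on_subset[OF f]) auto
    then have "closed {r \<in> {a i..s}. f i r = 0}"
      using continuous_closed_preimage_constant[of "{a i..s}" "f i" 0] by simp
    moreover have "{r \<in> {a i..s}. f i r = 0} = {r \<in> {a i..s}. f i r = 0} \<inter> {a i..s}" by auto
    ultimately show "compact {r \<in> {a i..s}. f i r = 0}"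
      using closed_Int_compact[OF _ compact_Icc] by metis
  qed
  moreover have "S \<noteq> {}" using ex by (auto simp: S_def)
  ultimately obtain s' where s': "s' \<in> S" "\<And>r. r \<in> S \<Longrightarrow> s' \<le> r"
    using continuous_attains_inf[of S "\<lambda>x. x"] by (auto intro: continuous_on_id)
  then obtain k' where k': "k' < j" "a k' \<le> s'" "s' \<le> s" "f k' s' = 0" by (auto simp: S_def)
  have "f i r \<noteq> 0" if "i < j" "a i \<le> r" "r < s'" for i r
    using s'(2)[of r] that k'(3) by (auto simp: S_def)
  with k' show thesis by (rule that)
qed

section \<open>Measurability of the coalescing paths with respect to their drivers\<close>

context driven begin

lemma coalesce: "\<omega> \<in> space N \<Longrightarrow> T i \<le> s \<Longrightarrow> T j \<le> s \<Longrightarrow> s \<le> t \<Longrightarrow> V i s \<omega> = V j s \<omega> \<Longrightarrow> V i t \<omega> = V j t \<omega>"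
  using coal[of \<omega>] unfolding coalesces_along_def by blast

lemma follow: "\<omega> \<in> space N \<Longrightarrow> T j \<le> t \<Longrightarrow>
    (\<And>i s. i < j \<Longrightarrow> T i \<le> s \<Longrightarrow> T j \<le> s \<Longrightarrow> s < t \<Longrightarrow> V i s \<omega> \<noteq> V j s \<omega>) \<Longrightarrow> V j t \<omega> = B j t \<omega>"
  using coal[of \<omega>] unfolding coalesces_along_def by blast

lemma cont_V: "\<omega> \<in> space N \<Longrightarrow> T j \<le> a \<Longrightarrow> continuous_on {a..} (\<lambda>t. V j t \<omega>)"
  by (rule continuous_on_subset[OF V_cont]) auto

lemma cont_B: "\<omega> \<in> space N \<Longrightarrow> T j \<le> a \<Longrightarrow> continuous_on {a..} (\<lambda>t. B j t \<omega>)"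
  by (rule continuous_on_subset[OF B_cont]) auto

text \<open>In contrast to \<open>follow\<close>, the assumption concerns the driver
  \<open>B j\<close> and not the unknown path \<open>V j\<close>. Up to and including the first
  meeting of \<open>V j\<close> with a lower path it still equals its driver, so the driver would
  have met that path too.\<close>

lemma follow_until:
  assumes \<omega>: "\<omega> \<in> space N" and u: "T j \<le> u"
    and no: "\<And>k s. k < j \<Longrightarrow> T k \<le> s \<Longrightarrow> T j \<le> s \<Longrightarrow> s < u \<Longrightarrow> V k s \<omega> \<noteq> B j s \<omega>"
  shows "V j u \<omega> = B j u \<omega>"
proof (rule follow[OF \<omega> u])
  fix i s assume s: "i < j" "T i \<le> s" "T j \<le> s" "s < u"
  show "V i s \<omega> \<noteq> V j s \<omega>"
  proof
    assume eq: "V i s \<omega> = V j s \<omega>"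
    have "continuous_on {max (T k) (T j)..} (\<lambda>r. V k r \<omega> - V j r \<omega>)" for k
      using cont_V[OF \<omega>] by (intro continuous_intros) auto
    then obtain k r where k: "k < j" "max (T k) (T j) \<le> r" "r \<le> s" "V k r \<omega> - V j r \<omega> = 0"
      "\<And>i r'. i < j \<Longrightarrow> max (T i) (T j) \<le> r' \<Longrightarrow> r' < r \<Longrightarrow> V i r' \<omega> - V j r' \<omega> \<noteq> 0"
      using finite_first_zero[where a = "\<lambda>k. max (T k) (T j)" and f = "\<lambda>k r. V k r \<omega> - V j r \<omega>" and j = j and k = i and s = s] s eq
      by (metis (no_types, lifting) diff_self max.bounded_iff)
    have "V j r \<omega> = B j r \<omega>"
      using k by (intro follow[OF \<omega>]) force+
    then show False using no[of k r] k s by auto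
  qed
qed

definition meets :: "nat \<Rightarrow> nat \<Rightarrow> real \<Rightarrow> 'w \<Rightarrow> bool" where
  "meets i j c \<omega> \<longleftrightarrow> (\<exists>s\<in>{max (T i) (T j)..c}. V i s \<omega> = B j s \<omega>)"

lemma B_meas_H: "T j \<le> t \<Longrightarrow> t \<le> u \<Longrightarrow> B j t \<in> borel_measurable (H u)"
  by (rule measurable_past)

lemma H_mono: "u \<le> u' \<Longrightarrow> sets (H u) \<subseteq> sets (H u')"
  by (rule past_mono)

lemma sets_meets:
  assumes V: "\<And>s. T i \<le> s \<Longrightarrow> s \<le> c \<Longrightarrow> V i s \<in> borel_measurable (H c)"
  shows "{\<omega> \<in> space N. meets i j c \<omega>} \<in> sets (H c)"
proof (cases "max (T i) (T j) \<le> c")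
  case True
  let ?a = "max (T i) (T j)"
  have "{\<omega> \<in> space N. meets i j c \<omega>} =
      (\<Inter>n::nat. \<Union>s\<in>insert ?a (\<rat> \<inter> {?a..c}). {\<omega> \<in> space (H c). \<bar>V i s \<omega> - B j s \<omega>\<bar> < 1 / Suc n})"
  proof -
    have "meets i j c \<omega> \<longleftrightarrow> (\<forall>n::nat. \<exists>s\<in>insert ?a (\<rat> \<inter> {?a..c}). \<bar>V i s \<omega> - B j s \<omega>\<bar> < 1 / Suc n)"
      if "\<omega> \<in> space N" for \<omega>
    proof -
      have "continuous_on {?a..} (\<lambda>s. V i s \<omega> - B j s \<omega>)"
        using cont_V[OF that] cont_B[OF that] by (intro continuous_intros) auto
      from compact_zero_iff[OF this True] show ?thesis unfolding meets_def by (simp only: right_minus_eq)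
    qed
    note iff = this
    show ?thesis
    proof (intro set_eqI)
      fix \<omega>
      show "\<omega> \<in> {\<omega> \<in> space N. meets i j c \<omega>} \<longleftrightarrow> \<omega> \<in> (\<Inter>n::nat. \<Union>s\<in>insert ?a (\<rat> \<inter> {?a..c}).
          {\<omega> \<in> space (H c). \<bar>V i s \<omega> - B j s \<omega>\<bar> < 1 / Suc n})"
        by (cases "\<omega> \<in> space N") (simp_all add: iff del: of_nat_Suc)
    qed
  qed
  also have "\<dots> \<in> sets (H c)"
  proof -
    have "(\<Union>s\<in>insert ?a (\<rat> \<inter> {?a..c}). {\<omega> \<in> space (H c). \<bar>V i s \<omega> - B j s \<omega>\<bar> < 1 / Suc n}) \<in> sets (H c)" for n
    proof (rule sets.countable_UN'')
      show "countable (insert ?a (\<rat> \<inter> {?a..c}))" by (auto intro: countable_Int1 countable_rat)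
      fix s assume "s \<in> insert ?a (\<rat> \<inter> {?a..c})"
      then have [measurable]: "V i s \<in> borel_measurable (H c)" "B j s \<in> borel_measurable (H c)"
        using V B_meas_H True by auto
      show "{\<omega> \<in> space (H c). \<bar>V i s \<omega> - B j s \<omega>\<bar> < 1 / Suc n} \<in> sets (H c)" by measurable
    qed
    then show ?thesis by (intro sets.countable_INT) auto
  qed
  finally show ?thesis .
next
  case False
  then have "{\<omega> \<in> space N. meets i j c \<omega>} = {}" by (auto simp: meets_def)
  then show ?thesis by (simp only: sets.empty_sets)
qed

lemma sets_meets_less: "(\<And>s. T i \<le> s \<Longrightarrow> V i s \<in> borel_measurable (H s)) \<Longrightarrow> c \<le> t \<Longrightarrow>
    {\<omega> \<in> space N. meets i j c \<omega>} \<in> sets (H t)"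
proof -
  assume V: "\<And>s. T i \<le> s \<Longrightarrow> V i s \<in> borel_measurable (H s)" and c: "c \<le> t"
  have "V i s \<in> borel_measurable (H c)" if "T i \<le> s" "s \<le> c" for s
    using V[OF that(1)] by (rule measurable_from_subalg[rotated]) (simp add: subalgebra_def H_mono that)
  from sets_meets[OF this, of j] show ?thesis using H_mono[OF c] by auto
qed

text \<open>The path that \<open>j\<close> joins first is detected by comparing the hitting times of \<open>B j\<close> at rational levels.\<close>

definition joins_first :: "nat \<Rightarrow> nat \<Rightarrow> real \<Rightarrow> 'w \<Rightarrow> bool" where
  "joins_first i j t \<omega> \<longleftrightarrow> (\<exists>c\<in>\<rat> \<inter> {..<t}. meets i j c \<omega>) \<and> (\<forall>k<j. \<forall>c\<in>\<rat> \<inter> {..<t}. meets k j c \<omega> \<longrightarrow> meets i j c \<omega>)"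

lemma first_meeting:
  assumes \<omega>: "\<omega> \<in> space N" and ex: "k < j" "T k \<le> s" "T j \<le> s" "V k s \<omega> = B j s \<omega>"
  obtains k' s' where "k' < j" "T k' \<le> s'" "T j \<le> s'" "s' \<le> s" "V k' s' \<omega> = B j s' \<omega>"
    "\<And>i r. i < j \<Longrightarrow> T i \<le> r \<Longrightarrow> T j \<le> r \<Longrightarrow> r < s' \<Longrightarrow> V i r \<omega> \<noteq> B j r \<omega>"
proof -
  have "continuous_on {max (T k) (T j)..} (\<lambda>r. V k r \<omega> - B j r \<omega>)" for k
    using cont_V[OF \<omega>] cont_B[OF \<omega>] by (intro continuous_intros) auto
  then obtain k' s' where "k' < j" "max (T k') (T j) \<le> s'" "s' \<le> s" "V k' s' \<omega> - B j s' \<omega> = 0"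
      "\<And>i r. i < j \<Longrightarrow> max (T i) (T j) \<le> r \<Longrightarrow> r < s' \<Longrightarrow> V i r \<omega> - B j r \<omega> \<noteq> 0"
    using finite_first_zero[where a = "\<lambda>k. max (T k) (T j)" and f = "\<lambda>k r. V k r \<omega> - B j r \<omega>" and j = j and k = k and s = s] ex
    by (metis (no_types, lifting) diff_self max.bounded_iff)
  then show thesis by (intro that[of k' s']) auto
qed

text \<open>The path \<open>i\<close> attains the first meeting time \<open>r\<close> of the driver
  \<open>B j\<close> with the lower paths. At \<open>r\<close> path \<open>j\<close> still equals
  its driver, hence equals path \<open>i\<close>, and coalescence takes over.\<close>

lemma V_eq_joined:
  assumes \<omega>: "\<omega> \<in> space N" and j: "T j \<le> t" and i: "i < j" "joins_first i j t \<omega>"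
  shows "T i \<le> t \<and> V j t \<omega> = V i t \<omega>"
proof -
  obtain c where c: "c \<in> \<rat>" "c < t" "meets i j c \<omega>" using i by (auto simp: joins_first_def)
  then obtain s where s: "T i \<le> s" "T j \<le> s" "s \<le> c" "V i s \<omega> = B j s \<omega>" by (auto simp: meets_def)
  obtain k r where k: "k < j" "T k \<le> r" "T j \<le> r" "r \<le> s" "V k r \<omega> = B j r \<omega>"
    and first: "\<And>i r'. i < j \<Longrightarrow> T i \<le> r' \<Longrightarrow> T j \<le> r' \<Longrightarrow> r' < r \<Longrightarrow> V i r' \<omega> \<noteq> B j r' \<omega>"
    by (rule first_meeting[OF \<omega> i(1) s(1,2,4)]) blast
  \<comment> \<open>Path \<open>k\<close> meets the driver at \<open>r\<close>, hence before every
    rational level above \<open>r\<close>; \<open>joins_first\<close> forces the same for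
    \<open>i\<close>. So \<open>i\<close> meets the driver arbitrarily soon after \<open>r\<close>,
    and its own first meeting time is \<open>r\<close>.\<close>
  have "\<exists>s'\<in>{max (T i) (T j)..<r + e}. V i s' \<omega> = B j s' \<omega>" if "e > 0" for e
  proof -
    have "r < min (r + e) t" using that k s c by auto
    then obtain q where q: "q \<in> \<rat>" "r < q" "q < min (r + e) t" using Rats_dense_in_real by blast
    have "meets k j q \<omega>" using k q by (auto simp: meets_def)
    then have "meets i j q \<omega>" using i k q by (auto simp: joins_first_def)
    then show ?thesis using q by (auto simp: meets_def)
  qed
  have "T i \<le> r \<and> V i r \<omega> = B j r \<omega>"
  proof -
    have "\<exists>s'\<in>{max (T i) (T j)..s}. V i s' \<omega> = B j s' \<omega>" using s by auto
    obtain r' where r': "T i \<le> r'" "T j \<le> r'" "V i r' \<omega> = B j r' \<omega>"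
      and first': "\<And>x. T i \<le> x \<Longrightarrow> T j \<le> x \<Longrightarrow> x < r' \<Longrightarrow> V i x \<omega> \<noteq> B j x \<omega>"
    proof -
      have "continuous_on {max (T i) (T j)..} (\<lambda>r. V i r \<omega> - B j r \<omega>)"
        using cont_V[OF \<omega>] cont_B[OF \<omega>] by (intro continuous_intros) auto
      then show thesis
        using finite_first_zero[where a = "\<lambda>_. max (T i) (T j)" and f = "\<lambda>_ r. V i r \<omega> - B j r \<omega>" and j = 1 and k = 0 and s = s] s that
        by (metis (no_types, lifting) diff_self less_one max.bounded_iff right_minus_eq)
    qed
    have "r \<le> r'" using first[of i r'] i r' by force
    moreover have "r' \<le> r"
    proof (rule ccontr)
      assume "\<not> r' \<le> r"
      with \<open>\<And>e. e > 0 \<Longrightarrow> _ e\<close>[of "r' - r"] first' show False by auto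
    qed
    ultimately show ?thesis using r' by simp
  qed
  moreover have "V j r \<omega> = B j r \<omega>"
    using first k by (intro follow_until[OF \<omega>]) auto
  ultimately show ?thesis
    using coalesce[OF \<omega>, of i r j t] k s c by auto
qed

lemma V_eq_B:
  assumes \<omega>: "\<omega> \<in> space N" and j: "T j \<le> t" and no: "\<And>i. i < j \<Longrightarrow> \<not> joins_first i j t \<omega>"
  shows "V j t \<omega> = B j t \<omega>"
proof (rule follow_until[OF \<omega> j])
  fix k s assume s: "k < j" "T k \<le> s" "T j \<le> s" "s < t"
  show "V k s \<omega> \<noteq> B j s \<omega>"
  proof
    assume eq: "V k s \<omega> = B j s \<omega>"
    obtain i r where i: "i < j" "T i \<le> r" "T j \<le> r" "r \<le> s" "V i r \<omega> = B j r \<omega>"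
      and first: "\<And>i r'. i < j \<Longrightarrow> T i \<le> r' \<Longrightarrow> T j \<le> r' \<Longrightarrow> r' < r \<Longrightarrow> V i r' \<omega> \<noteq> B j r' \<omega>"
      by (rule first_meeting[OF \<omega> s(1,2,3) eq]) blast
    obtain q where q: "q \<in> \<rat>" "r < q" "q < t" using Rats_dense_in_real[of r t] i s by auto
    have "meets i j q \<omega>" using i q by (auto simp: meets_def)
    moreover have "meets i j c \<omega>" if k: "k < j" and m: "meets k j c \<omega>" for k c
    proof -
      obtain s' where s': "T k \<le> s'" "T j \<le> s'" "s' \<le> c" "V k s' \<omega> = B j s' \<omega>"
        using m by (auto simp: meets_def)
      then have "r \<le> s'" using first[OF k, of s'] by force
      then show ?thesis using i s' unfolding meets_def by (intro bexI[of _ r]) auto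
    qed
    ultimately have "joins_first i j t \<omega>" using q unfolding joins_first_def by blast
    then show False using no i by blast
  qed
qed

text \<open>Induction on the index: on each of the finitely many events \<open>J i\<close> the value
  is that of a lower path, and off all of them it is that of the driver.\<close>

lemma V_meas_H_self: "T j \<le> t \<Longrightarrow> V j t \<in> borel_measurable (H t)"
proof (induction j arbitrary: t rule: less_induct)
  case (less j)
  define J where "J i = {\<omega> \<in> space N. joins_first i j t \<omega>}" for i
  have J: "J i \<in> sets (H t)" if "i < j" for i
  proof -
    have m: "{\<omega> \<in> space N. meets k j c \<omega>} \<in> sets (H t)" if "k < j" "c \<in> \<rat> \<inter> {..<t}" for k c
      using that less.IH by (intro sets_meets_less) auto
    have "J i = (\<Union>c\<in>\<rat> \<inter> {..<t}. {\<omega> \<in> space N. meets i j c \<omega>}) -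
        (\<Union>k\<in>{..<j}. \<Union>c\<in>\<rat> \<inter> {..<t}. {\<omega> \<in> space N. meets k j c \<omega>} - {\<omega> \<in> space N. meets i j c \<omega>})"
      by (auto simp: J_def joins_first_def)
    also have "\<dots> \<in> sets (H t)"
      by (intro sets.Diff sets.countable_UN'' sets.finite_UN m)
        (auto intro: countable_Int1 countable_rat m \<open>i < j\<close>)
    finally show ?thesis .
  qed
  show ?case
  proof (rule measurableI)
    fix S :: "real set" assume S: "S \<in> sets borel"
    have "V j t -` S \<inter> space (H t) = ((B j t -` S \<inter> space (H t)) - (\<Union>i<j. J i)) \<union>
        (\<Union>i\<in>{i. i < j \<and> T i \<le> t}. J i \<inter> (V i t -` S \<inter> space (H t)))" (is "?L = ?R")
    proof (intro set_eqI)
      fix \<omega>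
      show "\<omega> \<in> ?L \<longleftrightarrow> \<omega> \<in> ?R"
      proof (cases "\<omega> \<in> space N")
        case \<omega>: True
        show ?thesis
        proof (cases "\<exists>i<j. joins_first i j t \<omega>")
          case True
          have "i < j \<Longrightarrow> joins_first i j t \<omega> \<Longrightarrow> T i \<le> t \<and> V i t \<omega> = V j t \<omega>" for i
            using V_eq_joined[OF \<omega> less.prems] by simp
          then show ?thesis using \<omega> True by (auto simp: J_def)
        next
          case False
          then show ?thesis using \<omega> V_eq_B[OF \<omega> less.prems] by (auto simp: J_def)
        qed
      qed (auto simp: J_def)
    qed
    also have "\<dots> \<in> sets (H t)"
      using J S less.IH B_meas_H[OF less.prems order_refl]
      by (intro sets.Un sets.Diff sets.finite_UN sets.Int measurable_sets[of _ "H t" borel]) auto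
    finally show "V j t -` S \<inter> space (H t) \<in> sets (H t)" .
  qed simp
qed

lemma V_meas_H: "T j \<le> t \<Longrightarrow> t \<le> u \<Longrightarrow> V j t \<in> borel_measurable (H u)"
  using V_meas_H_self by (rule measurable_from_subalg[rotated]) (simp_all add: subalgebra_def H_mono)

lemma V_meas: "T j \<le> t \<Longrightarrow> V j t \<in> borel_measurable N"
  using V_meas_H_self by (rule measurable_from_subalg[OF H_sub])

text \<open>Estimates hold for events of the driving past, but only events of the path past can be
  expressed through the law of the family; this inclusion connects the two.\<close>

lemma past_V_subset: "sets (past N z V u) \<subseteq> sets (H u)"
  by (rule past_least) (auto intro: V_meas_H)

end

section \<open>Moment bounds and coalescence\<close>

lemma integrable_Fatou:
  fixes X :: "nat \<Rightarrow> 'a \<Rightarrow> real"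
  assumes X: "\<And>n. integrable M (X n)" "\<And>n \<omega>. \<omega> \<in> space M \<Longrightarrow> 0 \<le> X n \<omega>"
    and lim: "\<And>\<omega>. \<omega> \<in> space M \<Longrightarrow> (\<lambda>n. X n \<omega>) \<longlonglongrightarrow> Y \<omega>"
    and bound: "eventually (\<lambda>n. (\<integral>\<omega>. X n \<omega> \<partial>M) \<le> c n) sequentially" "c \<longlonglongrightarrow> C"
  shows "integrable M Y" "(\<integral>\<omega>. Y \<omega> \<partial>M) \<le> C"
proof -
  have Y: "Y \<in> borel_measurable M"
    using X(1) lim by (intro borel_measurable_LIMSEQ_real[of M X Y]) auto
  have Y0: "\<omega> \<in> space M \<Longrightarrow> 0 \<le> Y \<omega>" for \<omega>
    using LIMSEQ_le_const[OF lim] X(2) by blast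
  have "(\<integral>\<^sup>+\<omega>. ennreal (Y \<omega>) \<partial>M) = (\<integral>\<^sup>+\<omega>. liminf (\<lambda>n. ennreal (X n \<omega>)) \<partial>M)"
  proof (rule nn_integral_cong)
    fix \<omega> assume "\<omega> \<in> space M"
    from tendsto_ennrealI[OF lim[OF this]] show "ennreal (Y \<omega>) = liminf (\<lambda>n. ennreal (X n \<omega>))"
      by (rule lim_imp_Liminf[OF trivial_limit_sequentially, symmetric])
  qed
  also have "\<dots> \<le> liminf (\<lambda>n. \<integral>\<^sup>+\<omega>. ennreal (X n \<omega>) \<partial>M)"
    using X(1) by (intro nn_integral_liminf) auto
  also have "\<dots> = liminf (\<lambda>n. ennreal (\<integral>\<omega>. X n \<omega> \<partial>M))"
    using X by (simp add: nn_integral_eq_integral)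
  also have "\<dots> \<le> liminf (\<lambda>n. ennreal (c n))"
    by (rule Liminf_mono) (use bound(1) in eventually_elim, rule ennreal_leI)
  also have "\<dots> = ennreal C"
    by (rule lim_imp_Liminf[OF trivial_limit_sequentially tendsto_ennrealI[OF bound(2)]])
  finally have le: "(\<integral>\<^sup>+\<omega>. ennreal (Y \<omega>) \<partial>M) \<le> ennreal C" .
  show int: "integrable M Y"
    using le_less_trans[OF le ennreal_less_top, folded infinity_ennreal_def] by (intro integrableI_nonneg Y AE_I2 Y0)
  have "0 \<le> C"
  proof (rule LIMSEQ_le_const[OF bound(2)])
    obtain n0 where "\<And>n. n \<ge> n0 \<Longrightarrow> (\<integral>\<omega>. X n \<omega> \<partial>M) \<le> c n" using bound(1) by (auto simp: eventually_sequentially)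
    moreover have "0 \<le> (\<integral>\<omega>. X n \<omega> \<partial>M)" for n using X(2) by (intro integral_nonneg_AE AE_I2)
    ultimately show "\<exists>n0. \<forall>n\<ge>n0. 0 \<le> c n" by (intro exI[of _ n0]) (auto intro: order_trans)
  qed
  then show "(\<integral>\<omega>. Y \<omega> \<partial>M) \<le> C"
    using le nn_integral_eq_integral[OF int] Y0 by (simp add: ennreal_le_iff)
qed

section \<open>Leaders, and increments of coalescing paths as limits of discrete integrals\<close>

context driven begin

text \<open>The lowest index at a given position has not joined any other lower path, so it still
  follows its own driver. This index therefore tells which driving motion carries path
  \<open>j\<close> at time \<open>t\<close>.\<close>

definition leader :: "nat \<Rightarrow> real \<Rightarrow> 'w \<Rightarrow> nat" where
  "leader j t \<omega> = (LEAST i. T i \<le> t \<and> V i t \<omega> = V j t \<omega>)"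

lemma leader:
  assumes "T j \<le> t"
  shows leader_T: "T (leader j t \<omega>) \<le> t" and V_leader: "V (leader j t \<omega>) t \<omega> = V j t \<omega>"
    and leader_le: "leader j t \<omega> \<le> j"
    and leader_least: "T i \<le> t \<Longrightarrow> V i t \<omega> = V j t \<omega> \<Longrightarrow> leader j t \<omega> \<le> i"
proof -
  let ?P = "\<lambda>i. T i \<le> t \<and> V i t \<omega> = V j t \<omega>"
  have "?P j" using assms by simp
  from LeastI[of ?P, OF this] Least_le[of ?P, OF this]
  show "T (leader j t \<omega>) \<le> t" "V (leader j t \<omega>) t \<omega> = V j t \<omega>" "leader j t \<omega> \<le> j"
    by (auto simp: leader_def)
  show "T i \<le> t \<Longrightarrow> V i t \<omega> = V j t \<omega> \<Longrightarrow> leader j t \<omega> \<le> i"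
    unfolding leader_def by (rule Least_le) simp
qed

text \<open>An earlier meeting of the leader with a lower path would persist until \<open>t\<close>
  by coalescence and contradict minimality, so \<open>follow\<close> applies to the leader.\<close>

lemma V_eq_B_leader:
  assumes \<omega>: "\<omega> \<in> space N" and j: "T j \<le> t"
  shows "V j t \<omega> = B (leader j t \<omega>) t \<omega>"
proof -
  have "V (leader j t \<omega>) t \<omega> = B (leader j t \<omega>) t \<omega>"
  proof (rule follow[OF \<omega> leader_T[OF j]])
    fix i s assume i: "i < leader j t \<omega>" "T i \<le> s" "T (leader j t \<omega>) \<le> s" "s < t"
    show "V i s \<omega> \<noteq> V (leader j t \<omega>) s \<omega>"
    proof
      assume "V i s \<omega> = V (leader j t \<omega>) s \<omega>"
      then have "V i t \<omega> = V j t \<omega>" using coalesce[OF \<omega> i(2,3), of t] i V_leader[OF j] by simp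
      then show False using leader_least[OF j, of i \<omega>] i by simp
    qed
  qed
  then show ?thesis using V_leader[OF j] by simp
qed

lemma leader_antimono:
  assumes \<omega>: "\<omega> \<in> space N" and "T j \<le> s" "s \<le> t"
  shows "leader j t \<omega> \<le> leader j s \<omega>"
proof (rule leader_least)
  show "T (leader j s \<omega>) \<le> t" using leader_T[of j s \<omega>] assms by simp
  show "V (leader j s \<omega>) t \<omega> = V j t \<omega>"
    using coalesce[OF \<omega> leader_T[of j s] _ \<open>s \<le> t\<close> V_leader[of j s]] assms by simp
qed (use assms in simp)

lemma sets_V_eq:
  assumes "T i \<le> t" "T j \<le> t" shows "{\<omega> \<in> space N. V i t \<omega> = V j t \<omega>} \<in> sets (H t)"
proof -
  note [measurable] = V_meas_H[OF assms(1) order_refl] V_meas_H[OF assms(2) order_refl]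
  have "{\<omega> \<in> space (H t). V i t \<omega> = V j t \<omega>} \<in> sets (H t)" by measurable
  then show ?thesis by simp
qed

lemma sets_leader:
  assumes j: "T j \<le> t" shows "{\<omega> \<in> space N. leader j t \<omega> = i} \<in> sets (H t)"
proof (cases "T i \<le> t")
  case True
  have "{\<omega> \<in> space N. leader j t \<omega> = i} = {\<omega> \<in> space N. V i t \<omega> = V j t \<omega>} -
      (\<Union>k\<in>{k. k < i \<and> T k \<le> t}. {\<omega> \<in> space N. V k t \<omega> = V j t \<omega>})"
  proof (intro set_eqI iffI)
    fix \<omega> assume "\<omega> \<in> {\<omega> \<in> space N. leader j t \<omega> = i}"
    then show "\<omega> \<in> {\<omega> \<in> space N. V i t \<omega> = V j t \<omega>} - (\<Union>k\<in>{k. k < i \<and> T k \<le> t}. {\<omega> \<in> space N. V k t \<omega> = V j t \<omega>})"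
      using V_leader[OF j, of \<omega>] leader_least[OF j, of _ \<omega>] by fastforce
  next
    fix \<omega> assume \<omega>: "\<omega> \<in> {\<omega> \<in> space N. V i t \<omega> = V j t \<omega>} - (\<Union>k\<in>{k. k < i \<and> T k \<le> t}. {\<omega> \<in> space N. V k t \<omega> = V j t \<omega>})"
    have "leader j t \<omega> \<le> i" using \<omega> leader_least[OF j True] by auto
    moreover have "\<not> leader j t \<omega> < i" using \<omega> V_leader[OF j, of \<omega>] leader_T[OF j, of \<omega>] by auto
    ultimately show "\<omega> \<in> {\<omega> \<in> space N. leader j t \<omega> = i}" using \<omega> by auto
  qed
  also have "\<dots> \<in> sets (H t)"
    using True j by (intro sets.Diff sets.finite_UN sets_V_eq) auto
  finally show ?thesis .
next
  case False
  then have "{\<omega> \<in> space N. leader j t \<omega> = i} = {}" using leader_T[OF j] by auto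
  then show ?thesis by (simp only: sets.empty_sets)
qed

definition grid :: "real \<Rightarrow> real \<Rightarrow> nat \<Rightarrow> nat \<Rightarrow> real" where
  "grid u s n q = u + (s - u) * real q / real n"

text \<open>The driver is read off at the left end of each grid step, so every increment is
  independent of the event that selects it.\<close>

definition ito :: "nat \<Rightarrow> real \<Rightarrow> real \<Rightarrow> nat \<Rightarrow> 'w \<Rightarrow> real" where
  "ito j u s n \<omega> = (\<Sum>q<n. B (leader j (grid u s n q) \<omega>) (grid u s n (Suc q)) \<omega>
     - B (leader j (grid u s n q) \<omega>) (grid u s n q) \<omega>)"

lemma grid_Suc: "n > 0 \<Longrightarrow> grid u s n (Suc q) = grid u s n q + (s - u) / n"
  by (simp add: grid_def field_simps)

lemma grid_0: "grid u s n 0 = u" and grid_n: "n > 0 \<Longrightarrow> grid u s n n = s"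
  by (auto simp: grid_def)

lemma grid_ge: "u \<le> s \<Longrightarrow> u \<le> grid u s n q"
  by (simp add: grid_def)

lemma grid_le: "u \<le> s \<Longrightarrow> q \<le> n \<Longrightarrow> grid u s n q \<le> s"
proof -
  assume "u \<le> s" "q \<le> n"
  then have "(s - u) * (real q / real n) \<le> (s - u) * 1"
    by (intro mult_left_mono) (auto simp: divide_le_eq_1)
  then show ?thesis by (simp add: grid_def)
qed

lemma modulus:
  assumes \<omega>: "\<omega> \<in> space N" and e: "0 < e"
  shows "eventually (\<lambda>d. \<forall>x y. T j \<le> x \<longrightarrow> u \<le> x \<longrightarrow> x \<le> s \<longrightarrow> T j \<le> y \<longrightarrow> u \<le> y \<longrightarrow> y \<le> s \<longrightarrow> \<bar>y - x\<bar> \<le> d \<longrightarrow> \<bar>B j y \<omega> - B j x \<omega>\<bar> \<le> e) (at_right 0)" (is ?B)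
    and "eventually (\<lambda>d. \<forall>x y. T j \<le> x \<longrightarrow> u \<le> x \<longrightarrow> x \<le> s \<longrightarrow> T j \<le> y \<longrightarrow> u \<le> y \<longrightarrow> y \<le> s \<longrightarrow> \<bar>y - x\<bar> \<le> d \<longrightarrow> \<bar>V j y \<omega> - V j x \<omega>\<bar> \<le> e) (at_right 0)" (is ?V)
proof -
  have *: "eventually (\<lambda>d. \<forall>x y. T j \<le> x \<longrightarrow> u \<le> x \<longrightarrow> x \<le> s \<longrightarrow> T j \<le> y \<longrightarrow> u \<le> y \<longrightarrow> y \<le> s \<longrightarrow> \<bar>y - x\<bar> \<le> d \<longrightarrow> \<bar>f y - f x\<bar> \<le> e) (at_right 0)"
    if f: "continuous_on {max (T j) u..} f" for f :: "real \<Rightarrow> real"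
  proof -
    have "continuous_on {max (T j) u..s} f" by (rule continuous_on_subset[OF f]) auto
    from compact_uniformly_continuous[OF this compact_Icc]
    obtain d where d: "d > 0" "\<And>x y. x \<in> {max (T j) u..s} \<Longrightarrow> y \<in> {max (T j) u..s} \<Longrightarrow> dist y x < d \<Longrightarrow> dist (f y) (f x) < e"
      unfolding uniformly_continuous_on_def using e by metis
    show ?thesis
    proof (rule eventually_at_rightI[of 0 d])
      fix d' assume "d' \<in> {0<..<d}"
      then show "\<forall>x y. T j \<le> x \<longrightarrow> u \<le> x \<longrightarrow> x \<le> s \<longrightarrow> T j \<le> y \<longrightarrow> u \<le> y \<longrightarrow> y \<le> s \<longrightarrow> \<bar>y - x\<bar> \<le> d' \<longrightarrow> \<bar>f y - f x\<bar> \<le> e"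
        using d(2) by (auto simp: dist_real_def intro!: less_imp_le)
    qed (rule d(1))
  qed
  show ?B ?V using *[OF cont_B[OF \<omega>]] *[OF cont_V[OF \<omega>]] by auto
qed

text \<open>A grid step without change of leader contributes no error. In the other steps the error
  is at most two oscillations, and since the leader index decreases from at most \<open>j\<close>,
  there are at most \<open>j\<close> such steps whatever the mesh.\<close>

lemma ito_limit:
  assumes \<omega>: "\<omega> \<in> space N" and j: "T j \<le> u" and us: "u < s"
  shows "(\<lambda>n. ito j u s n \<omega>) \<longlonglongrightarrow> V j s \<omega> - V j u \<omega>"
proof (rule tendstoI)
  fix e :: real assume e: "0 < e"
  define e' where "e' = e / (2 * real j + 1)"
  have e': "0 < e'" "2 * e' * real j < e" using e by (auto simp: e'_def field_simps)
  have "eventually (\<lambda>d. 0 < d \<and>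
     (\<forall>i\<in>{..j}. \<forall>x y. T i \<le> x \<longrightarrow> u \<le> x \<longrightarrow> x \<le> s \<longrightarrow> T i \<le> y \<longrightarrow> u \<le> y \<longrightarrow> y \<le> s \<longrightarrow> \<bar>y - x\<bar> \<le> d \<longrightarrow> \<bar>B i y \<omega> - B i x \<omega>\<bar> \<le> e') \<and>
     (\<forall>x y. T j \<le> x \<longrightarrow> u \<le> x \<longrightarrow> x \<le> s \<longrightarrow> T j \<le> y \<longrightarrow> u \<le> y \<longrightarrow> y \<le> s \<longrightarrow> \<bar>y - x\<bar> \<le> d \<longrightarrow> \<bar>V j y \<omega> - V j x \<omega>\<bar> \<le> e')) (at_right 0)"
    by (intro eventually_conj eventually_ball_finite finite_atMost ballI modulus[OF \<omega> e'(1)] eventually_at_right_less)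
  then obtain d where d: "0 < d"
    "\<And>i x y. i \<le> j \<Longrightarrow> T i \<le> x \<Longrightarrow> u \<le> x \<Longrightarrow> x \<le> s \<Longrightarrow> T i \<le> y \<Longrightarrow> u \<le> y \<Longrightarrow> y \<le> s \<Longrightarrow> \<bar>y - x\<bar> \<le> d \<Longrightarrow> \<bar>B i y \<omega> - B i x \<omega>\<bar> \<le> e'"
    "\<And>x y. u \<le> x \<Longrightarrow> x \<le> s \<Longrightarrow> u \<le> y \<Longrightarrow> y \<le> s \<Longrightarrow> \<bar>y - x\<bar> \<le> d \<Longrightarrow> \<bar>V j y \<omega> - V j x \<omega>\<bar> \<le> e'"
    using eventually_happens'[OF trivial_limit_at_right_real] j by (smt (verit) atMost_iff)
  have "(\<lambda>n. (s - u) / real n) \<longlonglongrightarrow> 0" by (rule lim_const_over_n)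
  then have "eventually (\<lambda>n. (s - u) / real n < d) sequentially" using d(1) by (rule order_tendstoD)
  moreover have "eventually (\<lambda>n::nat. 0 < n) sequentially" by (rule eventually_gt_at_top)
  ultimately show "eventually (\<lambda>n. dist (ito j u s n \<omega>) (V j s \<omega> - V j u \<omega>) < e) sequentially"
  proof eventually_elim
    case (elim n)
    define p where "p = grid u s n"
    define l where "l q = leader j (p q) \<omega>" for q
    define h where "h = (s - u) / n"
    have p: "p (Suc q) = p q + h" "u \<le> p q" "q \<le> n \<Longrightarrow> p q \<le> s" "p 0 = u" "p n = s" for q
      using elim us by (simp_all add: p_def h_def grid_Suc grid_ge grid_le grid_0 grid_n)
    have V: "V j (p q) \<omega> = B (l q) (p q) \<omega>" for q
      unfolding l_def using j p(2)[of q] by (intro V_eq_B_leader \<omega>) simp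
    have tel: "V j s \<omega> - V j u \<omega> = (\<Sum>q<n. V j (p (Suc q)) \<omega> - V j (p q) \<omega>)"
      using p by (subst sum_lessThan_telescope) simp
    have "\<bar>ito j u s n \<omega> - (V j s \<omega> - V j u \<omega>)\<bar> \<le>
        (\<Sum>q<n. \<bar>(B (l q) (p (Suc q)) \<omega> - B (l q) (p q) \<omega>) - (V j (p (Suc q)) \<omega> - V j (p q) \<omega>)\<bar>)"
      unfolding tel ito_def p_def[symmetric] l_def[symmetric] sum_subtractf[symmetric] by (rule sum_abs)
    \<comment> \<open>Weighting the error of a step by the drop of the leader index counts the
      changes through a telescoping sum.\<close>
    also have "\<dots> \<le> (\<Sum>q<n. 2 * e' * (real (l q) - real (l (Suc q))))"
    proof (rule sum_mono)
      fix q assume "q \<in> {..<n}"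
      then have q: "q < n" by simp
      have step: "0 \<le> h" "h \<le> d" using us elim by (auto simp: h_def)
      have Tq: "T j \<le> p q" using j p(2)[of q] by simp
      have mono: "l (Suc q) \<le> l q"
        unfolding l_def using p(1)[of q] step by (intro leader_antimono \<omega> Tq) simp
      show "\<bar>(B (l q) (p (Suc q)) \<omega> - B (l q) (p q) \<omega>) - (V j (p (Suc q)) \<omega> - V j (p q) \<omega>)\<bar>
          \<le> 2 * e' * (real (l q) - real (l (Suc q)))"
      proof (cases "l (Suc q) = l q")
        case True
        then show ?thesis using V[of q] V[of "Suc q"] by simp
      next
        case False
        have "T (l q) \<le> p q" "l q \<le> j" unfolding l_def using leader[OF Tq] by auto
        then have "\<bar>B (l q) (p (Suc q)) \<omega> - B (l q) (p q) \<omega>\<bar> \<le> e'"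
          using p(1-3)[of q] p(2,3)[of "Suc q"] q step by (intro d(2)) auto
        moreover have "\<bar>V j (p (Suc q)) \<omega> - V j (p q) \<omega>\<bar> \<le> e'"
          using p(1-3)[of q] p(2,3)[of "Suc q"] q step by (intro d(3)) auto
        moreover have "2 * e' * 1 \<le> 2 * e' * (real (l q) - real (l (Suc q)))"
          using False mono e' by (intro mult_left_mono) auto
        ultimately show ?thesis by linarith
      qed
    qed
    also have "\<dots> = 2 * e' * (real (l 0) - real (l n))"
      unfolding sum_distrib_left[symmetric] by (subst sum_lessThan_telescope') simp
    also have "\<dots> \<le> 2 * e' * real j"
      using leader_le[OF j, of \<omega>] e' p(4) by (intro mult_left_mono) (auto simp: l_def)
    also have "\<dots> < e" by (rule e')
    finally show ?case by (simp add: dist_real_def)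
  qed
qed

end

lemma sqrt_power4: "0 \<le> x \<Longrightarrow> sqrt x ^ 4 = x\<^sup>2"
  using real_sqrt_pow2[of x] power_mult[of "sqrt x" 2 2] by simp

section \<open>Moments of single paths and of pairs, and the bound for late coalescence\<close>

context driven begin

text \<open>The second moment is at most \<open>s - u\<close>, so the recursion gives
  \<open>6 * (s - u)\<^sup>2\<close> for the middle terms; the pure fourth moments add at most
  \<open>3 * (s - u)\<^sup>2\<close>, whence the constant \<open>9\<close>, uniformly in the
  mesh.\<close>

lemma ito_fourth_moment:
  assumes j: "T j \<le> u" and us: "u < s" and n: "0 < n"
  shows "integrable N (\<lambda>\<omega>. ito j u s n \<omega> ^ 4)" "expectation (\<lambda>\<omega>. ito j u s n \<omega> ^ 4) \<le> 9 * (s - u)\<^sup>2"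
proof -
  define p where "p = grid u s n"
  define h where "h = (s - u) / n"
  have h: "0 < h" "n * h = s - u" using us n by (simp_all add: h_def)
  have p: "p (Suc q) = p q + h" "p q < p (Suc q)" "u \<le> p q" "T j \<le> p q" for q
    using n us h j grid_ge[of u s n q] by (simp_all add: p_def h_def grid_Suc)
  define Y where "Y q \<omega> = (\<Sum>r<q. B (leader j (p r) \<omega>) (p (Suc r)) \<omega> - B (leader j (p r) \<omega>) (p r) \<omega>)" for q \<omega>
  interpret G: gaussian_sum N "\<lambda>q. H (p q)" "\<lambda>q. {i. i \<le> j \<and> T i \<le> p q}" "\<lambda>q \<rho>. {\<omega> \<in> space N. leader j (p q) \<omega> = \<rho>}"
    "\<lambda>q \<rho> \<omega>. B \<rho> (p (Suc q)) \<omega> - B \<rho> (p q) \<omega>" "sqrt h" 0 Y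
  proof
    fix q
    show "finite {i. i \<le> j \<and> T i \<le> p q}" by simp
    show "subalgebra N (H (p q))" by (rule H_sub)
    show "sets (H (p q)) \<subseteq> sets (H (p (Suc q)))" using p(2)[of q] by (intro H_mono) simp
    show "disjoint_family_on (\<lambda>\<rho>. {\<omega> \<in> space N. leader j (p q) \<omega> = \<rho>}) {i. i \<le> j \<and> T i \<le> p q}"
      by (auto simp: disjoint_family_on_def)
    show "0 < sqrt h" using h by simp
    show "Y 0 \<in> borel_measurable (H (p 0))" by (simp add: Y_def[abs_def])
    show "\<bar>Y 0 \<omega>\<bar> \<le> 0" for \<omega> by (simp add: Y_def)
    fix \<rho> assume \<rho>: "\<rho> \<in> {i. i \<le> j \<and> T i \<le> p q}"
    then have T: "T \<rho> \<le> p q" by simp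
    show "{\<omega> \<in> space N. leader j (p q) \<omega> = \<rho>} \<in> sets (H (p q))" by (rule sets_leader[OF p(4)])
    show "(\<lambda>\<omega>. B \<rho> (p (Suc q)) \<omega> - B \<rho> (p q) \<omega>) \<in> borel_measurable (H (p (Suc q)))"
      using T p(2)[of q] by (intro borel_measurable_diff B_meas_H) auto
    show "indep_set (sets (H (p q))) {(\<lambda>\<omega>. B \<rho> (p (Suc q)) \<omega> - B \<rho> (p q) \<omega>) -` S \<inter> space N |S. S \<in> sets borel}"
      by (rule indep_increment[OF T p(2)])
    show "distributed N lborel (\<lambda>\<omega>. B \<rho> (p (Suc q)) \<omega> - B \<rho> (p q) \<omega>) (normal_density 0 (sqrt h))"
      using B_incr[OF T p(2)] by (simp add: p(1))
  next
    fix \<omega> q assume "\<omega> \<in> space N"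
    then have "(\<Sum>\<rho>\<in>{i. i \<le> j \<and> T i \<le> p q}. indicator {\<omega> \<in> space N. leader j (p q) \<omega> = \<rho>} \<omega> * (B \<rho> (p (Suc q)) \<omega> - B \<rho> (p q) \<omega>))
      = (\<Sum>\<rho>\<in>{i. i \<le> j \<and> T i \<le> p q}. if leader j (p q) \<omega> = \<rho> then B \<rho> (p (Suc q)) \<omega> - B \<rho> (p q) \<omega> else 0)"
      by (intro sum.cong) auto
    also have "\<dots> = B (leader j (p q) \<omega>) (p (Suc q)) \<omega> - B (leader j (p q) \<omega>) (p q) \<omega>"
      using leader_le[OF p(4), of q \<omega>] leader_T[OF p(4), of q \<omega>] by (subst sum.delta') auto
    finally show "Y (Suc q) \<omega> = Y q \<omega> + (\<Sum>\<rho>\<in>{i. i \<le> j \<and> T i \<le> p q}.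
        indicator {\<omega> \<in> space N. leader j (p q) \<omega> = \<rho>} \<omega> * (B \<rho> (p (Suc q)) \<omega> - B \<rho> (p q) \<omega>))"
      by (simp add: Y_def)
  qed
  have Yn: "Y n = ito j u s n" by (simp add: Y_def ito_def p_def fun_eq_iff)
  show "integrable N (\<lambda>\<omega>. ito j u s n \<omega> ^ 4)" using G.integrable_X4[of n] by (simp add: Yn)
  have Y0: "Y 0 = (\<lambda>_. 0)" by (simp add: Y_def fun_eq_iff)
  have m2: "expectation (\<lambda>\<omega>. Y n \<omega> ^ 2) \<le> s - u"
  proof -
    have "expectation (\<lambda>\<omega>. Y n \<omega> ^ 2) \<le> h * (\<Sum>q<n. 1)"
    proof -
      have "expectation (\<lambda>\<omega>. Y n \<omega> ^ 2) = h * (\<Sum>q<n. prob (\<Union>\<rho>\<in>{i. i \<le> j \<and> T i \<le> p q}. {\<omega> \<in> space N. leader j (p q) \<omega> = \<rho>}))"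
        using G.expectation_X2[of n] h by (simp add: Y0)
      also have "\<dots> \<le> h * (\<Sum>q<n. 1)" using h by (intro mult_left_mono sum_mono prob_le_1) auto
      finally show ?thesis .
    qed
    then show ?thesis using h by (simp add: mult.commute)
  qed
  have "expectation (\<lambda>\<omega>. Y n \<omega> ^ 4) \<le> 6 * n * h * expectation (\<lambda>\<omega>. Y n \<omega> ^ 2) + 3 * n * h\<^sup>2"
    using G.expectation_X4[of n] h by (simp add: Y0 sqrt_power4)
  also have "\<dots> \<le> 6 * (s - u) * (s - u) + 3 * (s - u) * (s - u)"
  proof (intro add_mono)
    have "6 * n * h * expectation (\<lambda>\<omega>. Y n \<omega> ^ 2) = 6 * (s - u) * expectation (\<lambda>\<omega>. Y n \<omega> ^ 2)" using h by (simp add: mult.assoc)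
    also have "\<dots> \<le> 6 * (s - u) * (s - u)" using m2 us by (intro mult_left_mono) auto
    finally show "6 * n * h * expectation (\<lambda>\<omega>. Y n \<omega> ^ 2) \<le> 6 * (s - u) * (s - u)" .
    have "1 * h \<le> n * h" using h n by (intro mult_right_mono) auto
    then have "h \<le> s - u" using h by simp
    then have "3 * (s - u) * h \<le> 3 * (s - u) * (s - u)" using h us by (intro mult_left_mono) auto
    moreover have "3 * n * h\<^sup>2 = 3 * (s - u) * h" using h(2) by (simp add: power2_eq_square mult.assoc[symmetric])
    ultimately show "3 * n * h\<^sup>2 \<le> 3 * (s - u) * (s - u)" by simp
  qed
  finally show "expectation (\<lambda>\<omega>. ito j u s n \<omega> ^ 4) \<le> 9 * (s - u)\<^sup>2"
    unfolding Yn by (simp add: power2_eq_square algebra_simps)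
qed

lemma fourth_moment:
  assumes j: "T j \<le> u" and us: "u < s"
  shows "integrable N (\<lambda>\<omega>. (V j s \<omega> - V j u \<omega>) ^ 4)" "expectation (\<lambda>\<omega>. (V j s \<omega> - V j u \<omega>) ^ 4) \<le> 9 * (s - u)\<^sup>2"
proof -
  have lim: "(\<lambda>n. ito j u s (Suc n) \<omega> ^ 4) \<longlonglongrightarrow> (V j s \<omega> - V j u \<omega>) ^ 4" if "\<omega> \<in> space N" for \<omega>
    using LIMSEQ_Suc[OF ito_limit[OF that j us]] by (rule tendsto_power)
  note * = integrable_Fatou[OF ito_fourth_moment(1)[OF j us zero_less_Suc] _ lim, of "\<lambda>_. 9 * (s - u)\<^sup>2" "9 * (s - u)\<^sup>2"]
  show "integrable N (\<lambda>\<omega>. (V j s \<omega> - V j u \<omega>) ^ 4)"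
    by (rule *(1)) (auto intro!: always_eventually ito_fourth_moment(2)[OF j us zero_less_Suc])
  show "expectation (\<lambda>\<omega>. (V j s \<omega> - V j u \<omega>) ^ 4) \<le> 9 * (s - u)\<^sup>2"
    by (rule *(2)) (auto intro!: always_eventually ito_fourth_moment(2)[OF j us zero_less_Suc])
qed

text \<open>The selected increments are differences of two distinct drivers, of variance
  \<open>2 * h\<close>, and nothing is added once the leaders agree. If the paths have not met by
  time \<open>s\<close>, every one of the \<open>n\<close> steps is active; this gives the lower
  bound for the second moment. The terms \<open>12 * (s - u)\<close> and
  \<open>12 * (s - u)\<^sup>2 / n\<close> are \<open>6 * n * \<sigma>\<^sup>2\<close> and
  \<open>3 * n * \<sigma> ^ 4\<close> for this variance.\<close>

lemma ito_pair_moments: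
  assumes ij: "T i \<le> u" "T j \<le> u" and us: "u < s" and n: "0 < n"
    and E: "E \<in> sets (H u)" "\<And>\<omega>. \<omega> \<in> E \<Longrightarrow> 0 \<le> V i u \<omega> - V j u \<omega> \<and> V i u \<omega> - V j u \<omega> \<le> \<delta>" and \<delta>: "0 \<le> \<delta>"
  defines "X \<equiv> (\<lambda>\<omega>. indicator E \<omega> * (V i u \<omega> - V j u \<omega> + ito i u s n \<omega> - ito j u s n \<omega>))"
  shows "X \<in> borel_measurable N" "k \<le> 4 \<Longrightarrow> integrable N (\<lambda>\<omega>. X \<omega> ^ k)" "expectation X \<le> \<delta> * prob E"
    "2 * (s - u) * prob (E \<inter> {\<omega> \<in> space N. V i s \<omega> \<noteq> V j s \<omega>}) \<le> expectation (\<lambda>\<omega>. X \<omega> ^ 2)"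
    "expectation (\<lambda>\<omega>. X \<omega> ^ 2) \<le> \<delta>\<^sup>2 + 2 * (s - u)"
    "expectation (\<lambda>\<omega>. X \<omega> ^ 4) \<le> \<delta> ^ 4 * prob E + 12 * (s - u) * expectation (\<lambda>\<omega>. X \<omega> ^ 2) + 12 * (s - u)\<^sup>2 / n"
proof -
  define p where "p = grid u s n"
  define h where "h = (s - u) / n"
  have h: "0 < h" "n * h = s - u" using us n by (simp_all add: h_def)
  have p: "p (Suc q) = p q + h" "p q < p (Suc q)" "u \<le> p q" "T i \<le> p q" "T j \<le> p q" for q
    using n us h ij grid_ge[of u s n q] by (simp_all add: p_def h_def grid_Suc)
  have p_le: "q \<le> n \<Longrightarrow> p q \<le> s" and p0: "p 0 = u" for q using us by (simp_all add: p_def grid_le grid_0)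
  define D where "D k q \<omega> = B k (p (Suc q)) \<omega> - B k (p q) \<omega>" for k q \<omega>
  define Y where "Y q \<omega> = indicator E \<omega> * (V i u \<omega> - V j u \<omega> + (\<Sum>r<q. D (leader i (p r) \<omega>) r \<omega> - D (leader j (p r) \<omega>) r \<omega>))" for q \<omega>
  define R where "R q = {(k, l). k \<le> i \<and> l \<le> j \<and> k \<noteq> l \<and> T k \<le> p q \<and> T l \<le> p q}" for q
  define A where "A q \<rho> = E \<inter> {\<omega> \<in> space N. leader i (p q) \<omega> = fst \<rho>} \<inter> {\<omega> \<in> space N. leader j (p q) \<omega> = snd \<rho>}" for q \<rho>
  define \<xi> where "\<xi> q \<rho> \<omega> = D (fst \<rho>) q \<omega> - D (snd \<rho>) q \<omega>" for q \<rho> \<omega>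
  have EN: "E \<in> sets N" using E(1) sets_H by auto
  interpret G: gaussian_sum N "\<lambda>q. H (p q)" R A \<xi> "sqrt (2 * h)" \<delta> Y
  proof
    fix q
    show "finite (R q)" by (rule finite_subset[of _ "{..i} \<times> {..j}"]) (auto simp: R_def)
    show "subalgebra N (H (p q))" by (rule H_sub)
    show "sets (H (p q)) \<subseteq> sets (H (p (Suc q)))" using p(2)[of q] by (intro H_mono) simp
    show "disjoint_family_on (A q) (R q)" by (auto simp: disjoint_family_on_def A_def R_def)
    show "0 < sqrt (2 * h)" using h by simp
    note [measurable] = E(1) V_meas_H[OF ij(1) order_refl] V_meas_H[OF ij(2) order_refl]
    show "Y 0 \<in> borel_measurable (H (p 0))" unfolding p0 Y_def[abs_def] by simp
    show "\<bar>Y 0 \<omega>\<bar> \<le> \<delta>" for \<omega> using E(2)[of \<omega>] \<delta> by (auto simp: Y_def indicator_def)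
    fix \<rho> assume \<rho>: "\<rho> \<in> R q"
    then have T: "T (fst \<rho>) \<le> p q" "T (snd \<rho>) \<le> p q" "fst \<rho> \<noteq> snd \<rho>" by (auto simp: R_def)
    show "A q \<rho> \<in> sets (H (p q))" unfolding A_def
      using H_mono[OF p(3), of q] E(1) by (intro sets.Int sets_leader p) auto
    show "\<xi> q \<rho> \<in> borel_measurable (H (p (Suc q)))"
      unfolding \<xi>_def[abs_def] D_def using T p(2)[of q] by (intro borel_measurable_diff B_meas_H) auto
    show "indep_set (sets (H (p q))) {\<xi> q \<rho> -` S \<inter> space N |S. S \<in> sets borel}"
      unfolding \<xi>_def[abs_def] D_def by (rule indep_increment_diff[OF T(1,2) p(2)])
    show "distributed N lborel (\<xi> q \<rho>) (normal_density 0 (sqrt (2 * h)))"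
      using distributed_increment_diff[OF T(3,1,2) p(2)] unfolding \<xi>_def[abs_def] D_def by (simp add: p(1))
  next
    fix \<omega> q assume \<omega>: "\<omega> \<in> space N"
    let ?l = "(leader i (p q) \<omega>, leader j (p q) \<omega>)"
    have "(\<Sum>\<rho>\<in>R q. indicator (A q \<rho>) \<omega> * \<xi> q \<rho> \<omega>) = (\<Sum>\<rho>\<in>R q. if ?l = \<rho> then indicator E \<omega> * \<xi> q \<rho> \<omega> else 0)"
      using \<omega> by (intro sum.cong) (auto simp: A_def indicator_def)
    also have "\<dots> = (if ?l \<in> R q then indicator E \<omega> * \<xi> q ?l \<omega> else 0)"
      by (rule sum.delta') (rule finite_subset[of _ "{..i} \<times> {..j}"], auto simp: R_def)
    also have "\<dots> = indicator E \<omega> * \<xi> q ?l \<omega>"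
      using leader_le[OF p(4), of q \<omega>] leader_T[OF p(4), of q \<omega>] leader_le[OF p(5), of q \<omega>] leader_T[OF p(5), of q \<omega>]
      by (auto simp: R_def \<xi>_def)
    finally show "Y (Suc q) \<omega> = Y q \<omega> + (\<Sum>\<rho>\<in>R q. indicator (A q \<rho>) \<omega> * \<xi> q \<rho> \<omega>)"
      by (simp add: Y_def \<xi>_def algebra_simps)
  qed
  have Yn: "Y n = X" by (simp add: X_def Y_def ito_def p_def D_def fun_eq_iff sum_subtractf)
  show "X \<in> borel_measurable N" using G.X_meas[of n] by (simp add: Yn)
  show "k \<le> 4 \<Longrightarrow> integrable N (\<lambda>\<omega>. X \<omega> ^ k)" using G.integrable_X_pow[of k n] by (simp add: Yn)
  have Y0: "0 \<le> Y 0 \<omega>" "Y 0 \<omega> \<le> \<delta> * indicator E \<omega>" for \<omega> using E(2)[of \<omega>] by (auto simp: Y_def indicator_def)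
  have Y0_pow: "expectation (\<lambda>\<omega>. Y 0 \<omega> ^ k) \<le> \<delta> ^ k * prob E" if "0 < k" "k \<le> 4" for k
  proof -
    have "expectation (\<lambda>\<omega>. Y 0 \<omega> ^ k) \<le> expectation (\<lambda>\<omega>. \<delta> ^ k * indicator E \<omega>)"
    proof (rule integral_mono)
      fix \<omega>
      have "Y 0 \<omega> ^ k \<le> (\<delta> * indicator E \<omega>) ^ k" using Y0 by (intro power_mono) auto
      then show "Y 0 \<omega> ^ k \<le> \<delta> ^ k * indicator E \<omega>" using that by (cases "\<omega> \<in> E") (auto simp: zero_power)
    next
      have "integrable N (indicat_real E)"
        by (rule integrable_real_indicator[OF EN]) (simp add: emeasure_eq_measure)
      then show "integrable N (\<lambda>\<omega>. \<delta> ^ k * indicator E \<omega>)" by simp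
    qed (use that G.integrable_X_pow in auto)
    then show ?thesis using EN by simp
  qed
  show "expectation X \<le> \<delta> * prob E" using G.expectation_X[of n] Y0_pow[of 1] by (simp add: Yn)
  have U: "E \<inter> {\<omega> \<in> space N. V i s \<omega> \<noteq> V j s \<omega>} \<subseteq> (\<Union>\<rho>\<in>R q. A q \<rho>)" if "q < n" for q
  proof safe
    fix \<omega> assume \<omega>: "\<omega> \<in> E" "\<omega> \<in> space N" "V i s \<omega> \<noteq> V j s \<omega>"
    have ne: "leader i (p q) \<omega> \<noteq> leader j (p q) \<omega>"
    proof
      assume "leader i (p q) \<omega> = leader j (p q) \<omega>"
      then have "V i (p q) \<omega> = V j (p q) \<omega>" using V_leader[OF p(4), of q \<omega>] V_leader[OF p(5), of q \<omega>] by simp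
      then show False using coalesce[OF \<omega>(2) p(4,5) p_le[of q]] that \<omega> by simp
    qed
    then have "(leader i (p q) \<omega>, leader j (p q) \<omega>) \<in> R q"
      using leader_le[OF p(4), of q \<omega>] leader_T[OF p(4), of q \<omega>] leader_le[OF p(5), of q \<omega>] leader_T[OF p(5), of q \<omega>]
      by (auto simp: R_def)
    then show "\<omega> \<in> (\<Union>\<rho>\<in>R q. A q \<rho>)" using \<omega> by (intro UN_I[of "(leader i (p q) \<omega>, leader j (p q) \<omega>)"]) (auto simp: A_def)
  qed
  have U_sets: "(\<Union>\<rho>\<in>R q. A q \<rho>) \<in> sets N" for q using G.A_M G.finite_R by auto
  have X2: "expectation (\<lambda>\<omega>. X \<omega> ^ 2) = expectation (\<lambda>\<omega>. Y 0 \<omega> ^ 2) + 2 * h * (\<Sum>q<n. prob (\<Union>\<rho>\<in>R q. A q \<rho>))"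
    using G.expectation_X2[of n] h by (simp add: Yn)
  have "(\<Sum>q<n. prob (E \<inter> {\<omega> \<in> space N. V i s \<omega> \<noteq> V j s \<omega>})) \<le> (\<Sum>q<n. prob (\<Union>\<rho>\<in>R q. A q \<rho>))"
    using U U_sets by (intro sum_mono finite_measure_mono) auto
  then have "2 * h * (n * prob (E \<inter> {\<omega> \<in> space N. V i s \<omega> \<noteq> V j s \<omega>})) \<le> 2 * h * (\<Sum>q<n. prob (\<Union>\<rho>\<in>R q. A q \<rho>))"
    using h by (intro mult_left_mono) auto
  moreover have "2 * h * (n * prob (E \<inter> {\<omega> \<in> space N. V i s \<omega> \<noteq> V j s \<omega>})) = 2 * (s - u) * prob (E \<inter> {\<omega> \<in> space N. V i s \<omega> \<noteq> V j s \<omega>})"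
  proof -
    have "2 * h * (n * prob (E \<inter> {\<omega> \<in> space N. V i s \<omega> \<noteq> V j s \<omega>})) = 2 * (n * h) * prob (E \<inter> {\<omega> \<in> space N. V i s \<omega> \<noteq> V j s \<omega>})"
      by simp
    then show ?thesis unfolding h(2) .
  qed
  moreover have "0 \<le> expectation (\<lambda>\<omega>. Y 0 \<omega> ^ 2)" by (intro integral_nonneg_AE) auto
  ultimately show "2 * (s - u) * prob (E \<inter> {\<omega> \<in> space N. V i s \<omega> \<noteq> V j s \<omega>}) \<le> expectation (\<lambda>\<omega>. X \<omega> ^ 2)"
    unfolding X2 by linarith
  have "2 * h * (\<Sum>q<n. prob (\<Union>\<rho>\<in>R q. A q \<rho>)) \<le> 2 * h * (\<Sum>q<n. 1)"
    using h by (intro mult_left_mono sum_mono prob_le_1) auto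
  also have "\<dots> = 2 * (s - u)" by (simp add: h(2)[symmetric])
  finally have "2 * h * (\<Sum>q<n. prob (\<Union>\<rho>\<in>R q. A q \<rho>)) \<le> 2 * (s - u)" .
  moreover have "expectation (\<lambda>\<omega>. Y 0 \<omega> ^ 2) \<le> \<delta>\<^sup>2 * 1"
    using Y0_pow[of 2] by (intro order_trans[OF Y0_pow mult_left_mono]) auto
  ultimately show "expectation (\<lambda>\<omega>. X \<omega> ^ 2) \<le> \<delta>\<^sup>2 + 2 * (s - u)" unfolding X2 by simp
  have "6 * n * (sqrt (2 * h))\<^sup>2 = 12 * (s - u)" using h by (simp flip: h(2))
  moreover have "3 * n * sqrt (2 * h) ^ 4 = 12 * (s - u)\<^sup>2 / n"
    using h n by (simp add: sqrt_power4 power2_eq_square flip: h(2))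
  ultimately show "expectation (\<lambda>\<omega>. X \<omega> ^ 4) \<le> \<delta> ^ 4 * prob E + 12 * (s - u) * expectation (\<lambda>\<omega>. X \<omega> ^ 2) + 12 * (s - u)\<^sup>2 / n"
    using G.expectation_X4[of n] Y0_pow[of 4] unfolding Yn by simp
qed

text \<open>A change of order would force a meeting by the intermediate value theorem, and after a
  meeting the paths coincide.\<close>

lemma V_order:
  assumes \<omega>: "\<omega> \<in> space N" and ij: "T i \<le> u" "T j \<le> u" and us: "u \<le> s" and le: "V j u \<omega> \<le> V i u \<omega>"
  shows "V j s \<omega> \<le> V i s \<omega>"
proof (rule ccontr)
  assume gt: "\<not> ?thesis"
  have "continuous_on {u..s} (\<lambda>t. V j t \<omega> - V i t \<omega>)"
    by (rule continuous_on_subset[of "{u..}"]) (auto intro!: continuous_intros cont_V[OF \<omega>] ij)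
  then obtain t where "u \<le> t" "t \<le> s" "V j t \<omega> - V i t \<omega> = 0"
    using IVT'[of "\<lambda>t. V j t \<omega> - V i t \<omega>" u 0 s] le gt us by auto
  then show False using coalesce[OF \<omega>, of j t i s] ij gt by simp
qed

text \<open>The bound comes from \<open>x\<^sup>2 \<le> a \<bar>x\<bar> + x ^ 4 / a\<^sup>2\<close> with \<open>a\<^sup>2 = 24 (s - u)\<close>: the fourth moment
  is then absorbed into half of the second one.\<close>

lemma noncoalescence_ordered:
  assumes ij: "T i \<le> u" "T j \<le> u" and us: "u < s"
    and E: "E \<in> sets (H u)" "\<And>\<omega>. \<omega> \<in> E \<Longrightarrow> 0 \<le> V i u \<omega> - V j u \<omega> \<and> V i u \<omega> - V j u \<omega> \<le> \<delta>" and \<delta>: "0 \<le> \<delta>"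
  shows "2 * (s - u) * prob (E \<inter> {\<omega> \<in> space N. V i s \<omega> \<noteq> V j s \<omega>}) \<le>
    2 * sqrt (24 * (s - u)) * (\<delta> * prob E) + \<delta> ^ 4 * prob E / (12 * (s - u))" (is "?L \<le> ?K")
proof (rule field_le_epsilon)
  fix e :: real assume e: "0 < e"
  define S where "S = s - u"
  have S: "0 < S" using us by (simp add: S_def)
  define a where "a = sqrt (24 * S)"
  have a: "0 < a" "a\<^sup>2 = 24 * S" using S by (simp_all add: a_def)
  define \<epsilon> where "\<epsilon> = e / (4 * a + 1 / (12 * S))"
  have \<epsilon>: "0 < \<epsilon>" "\<epsilon> * (4 * a + 1 / (12 * S)) = e"
    using e a S by (simp_all add: \<epsilon>_def add_pos_pos order_less_imp_not_eq2)
  define X where "X n \<omega> = indicator E \<omega> * (V i u \<omega> - V j u \<omega> + ito i u s (Suc n) \<omega> - ito j u s (Suc n) \<omega>)" for n \<omega>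
  note X = ito_pair_moments[OF ij us zero_less_Suc E \<delta>, folded X_def, folded S_def]
  define b where "b = \<delta>\<^sup>2 + 2 * S"
  \<comment> \<open>Truncation level for the negative part of \<open>X n\<close>: what is cut off is
    at most \<open>X n \<omega> ^ 2 / c\<close>, and since the second moment is at most
    \<open>b\<close> this costs no more than \<open>\<epsilon> / 2\<close>.\<close>
  define c where "c = 2 * b / \<epsilon>"
  have B_pos: "0 < b" using S by (simp add: b_def add_nonneg_pos)
  have c: "0 < c" unfolding c_def using B_pos \<epsilon> by simp
  have Xlim: "(\<lambda>n. X n \<omega>) \<longlonglongrightarrow> indicator E \<omega> * (V i s \<omega> - V j s \<omega>)" if "\<omega> \<in> space N" for \<omega>
  proof -
    have "(\<lambda>n. X n \<omega>) \<longlonglongrightarrow> indicator E \<omega> * (V i u \<omega> - V j u \<omega> + (V i s \<omega> - V i u \<omega>) - (V j s \<omega> - V j u \<omega>))"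
      unfolding X_def by (intro tendsto_intros LIMSEQ_Suc[OF ito_limit[OF that _ us]] ij)
    then show ?thesis by simp
  qed
  \<comment> \<open>The limit of \<open>X n\<close> is nonnegative because ordered paths stay
    ordered, but \<open>X n\<close> itself may be negative. Its truncated negative part disappears
    in the limit, so the bound on the mean of \<open>X n\<close> becomes one on the mean of its
    absolute value.\<close>
  have "(\<lambda>n. expectation (\<lambda>\<omega>. min (max 0 (- X n \<omega>)) c)) \<longlonglongrightarrow> expectation (\<lambda>_. 0)"
  proof (rule integral_dominated_convergence[where w = "\<lambda>_. c"])
    show "AE \<omega> in N. (\<lambda>n. min (max 0 (- X n \<omega>)) c) \<longlonglongrightarrow> 0"
    proof (rule AE_I2)
      fix \<omega> assume \<omega>: "\<omega> \<in> space N"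
      have "0 \<le> indicator E \<omega> * (V i s \<omega> - V j s \<omega>)"
        using E(2)[of \<omega>] V_order[OF \<omega> ij, of s] us by (auto simp: indicator_def)
      then have "min (max 0 (- (indicator E \<omega> * (V i s \<omega> - V j s \<omega>)))) c = 0" using c by simp
      moreover have "(\<lambda>n. min (max 0 (- X n \<omega>)) c) \<longlonglongrightarrow> min (max 0 (- (indicator E \<omega> * (V i s \<omega> - V j s \<omega>)))) c"
        by (intro tendsto_intros tendsto_min tendsto_max Xlim[OF \<omega>])
      ultimately show "(\<lambda>n. min (max 0 (- X n \<omega>)) c) \<longlonglongrightarrow> 0" by simp
    qed
  qed (use X(1) c in auto)
  then have "eventually (\<lambda>n. expectation (\<lambda>\<omega>. min (max 0 (- X n \<omega>)) c) < \<epsilon> / 2) sequentially"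
    using \<epsilon>(1) by (intro order_tendstoD) auto
  moreover have "(\<lambda>n. 12 * S\<^sup>2 / real (Suc n)) \<longlonglongrightarrow> 0" by (rule LIMSEQ_Suc[OF lim_const_over_n])
  then have "eventually (\<lambda>n. 12 * S\<^sup>2 / real (Suc n) < \<epsilon>) sequentially"
    using \<epsilon>(1) by (rule order_tendstoD)
  ultimately have "eventually (\<lambda>n. expectation (\<lambda>\<omega>. min (max 0 (- X n \<omega>)) c) < \<epsilon> / 2 \<and> 12 * S\<^sup>2 / real (Suc n) < \<epsilon>) sequentially"
    by (rule eventually_conj)
  then obtain n where n: "expectation (\<lambda>\<omega>. min (max 0 (- X n \<omega>)) c) < \<epsilon> / 2" "12 * S\<^sup>2 / real (Suc n) < \<epsilon>"
    using eventually_happens by fastforce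
  define m where "m = expectation (\<lambda>\<omega>. X n \<omega> ^ 2)"
  note [measurable] = X(1)[of n]
  have int[simp]: "integrable N (X n)" "integrable N (\<lambda>\<omega>. X n \<omega> ^ 2)" "integrable N (\<lambda>\<omega>. X n \<omega> ^ 4)"
    "integrable N (\<lambda>\<omega>. max 0 (- X n \<omega>))" "integrable N (\<lambda>\<omega>. min (max 0 (- X n \<omega>)) c)"
    using X(2)[of 1 n] X(2)[of 2 n] X(2)[of 4 n] by (auto intro!: integrable_max integrable_min)
  have "expectation (\<lambda>\<omega>. max 0 (- X n \<omega>)) \<le> expectation (\<lambda>\<omega>. min (max 0 (- X n \<omega>)) c + X n \<omega> ^ 2 / c)"
  proof (rule integral_mono)
    fix \<omega>
    show "max 0 (- X n \<omega>) \<le> min (max 0 (- X n \<omega>)) c + X n \<omega> ^ 2 / c"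
    proof (cases "- X n \<omega> \<le> c")
      case False
      then have "- X n \<omega> * c \<le> - X n \<omega> * - X n \<omega>" using c by (intro mult_left_mono) auto
      then have "- X n \<omega> \<le> X n \<omega> ^ 2 / c" using c by (simp add: power2_eq_square field_simps)
      then show ?thesis using False c by auto
    qed (use c in auto)
  qed auto
  also have "\<dots> = expectation (\<lambda>\<omega>. min (max 0 (- X n \<omega>)) c) + m / c" by (simp add: m_def)
  also have "m / c \<le> \<epsilon> / 2"
  proof -
    have "m / c \<le> b / c" using X(5)[of n] c by (intro divide_right_mono) (auto simp: m_def b_def)
    also have "\<dots> = \<epsilon> / 2" using B_pos \<epsilon>(1) by (simp add: c_def)
    finally show ?thesis .
  qed
  finally have neg: "expectation (\<lambda>\<omega>. max 0 (- X n \<omega>)) \<le> \<epsilon>" using n by simp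
  have aux: "m \<le> A + B + m / 2 \<Longrightarrow> m \<le> 2 * (A + B)" for A B :: real by simp
  have "m \<le> expectation (\<lambda>\<omega>. a * (X n \<omega> + 2 * max 0 (- X n \<omega>)) + X n \<omega> ^ 4 / a\<^sup>2)"
    unfolding m_def
  proof (rule integral_mono)
    fix \<omega>
    define x where "x = \<bar>X n \<omega>\<bar>"
    have x: "X n \<omega> + 2 * max 0 (- X n \<omega>) = x" "X n \<omega> ^ 2 = x ^ 2" "X n \<omega> ^ 4 = x ^ 4" "0 \<le> x"
      by (auto simp: x_def power_even_abs)
    have "x\<^sup>2 \<le> a * x + x ^ 4 / a\<^sup>2"
    proof (cases "x \<le> a")
      case True
      then have "x * x \<le> a * x" using x by (intro mult_right_mono) auto
      then show ?thesis by (simp add: power2_eq_square add_increasing2)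
    next
      case False
      then have "x\<^sup>2 * a\<^sup>2 \<le> x\<^sup>2 * x\<^sup>2" using a by (intro mult_left_mono power_mono) auto
      moreover have "x\<^sup>2 * x\<^sup>2 = x ^ 4" by (simp flip: power_add)
      ultimately have "x\<^sup>2 \<le> x ^ 4 / a\<^sup>2" using a(1) by (subst pos_le_divide_eq) auto
      then show ?thesis using a x by (simp add: add_increasing)
    qed
    then show "X n \<omega> ^ 2 \<le> a * (X n \<omega> + 2 * max 0 (- X n \<omega>)) + X n \<omega> ^ 4 / a\<^sup>2" using x by simp
  qed auto
  also have "\<dots> = a * (expectation (X n) + 2 * expectation (\<lambda>\<omega>. max 0 (- X n \<omega>))) + expectation (\<lambda>\<omega>. X n \<omega> ^ 4) / a\<^sup>2"
    by simp
  also have "\<dots> \<le> a * (\<delta> * prob E + 2 * \<epsilon>) + (\<delta> ^ 4 * prob E + 12 * S * m + \<epsilon>) / a\<^sup>2"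
    using X(3,6)[of n] neg n(2) a S by (intro add_mono mult_left_mono divide_right_mono) (auto simp: m_def)
  also have "\<dots> = a * (\<delta> * prob E + 2 * \<epsilon>) + (\<delta> ^ 4 * prob E + \<epsilon>) / (24 * S) + m / 2"
    using S unfolding a(2) by (simp add: field_simps)
  finally have "m \<le> 2 * (a * (\<delta> * prob E + 2 * \<epsilon>) + (\<delta> ^ 4 * prob E + \<epsilon>) / (24 * S))" by (rule aux)
  also have "\<dots> = 2 * a * (\<delta> * prob E) + \<delta> ^ 4 * prob E / (12 * S) + \<epsilon> * (4 * a + 1 / (12 * S))"
    using S by (simp add: field_simps)
  finally show "?L \<le> ?K + e"
    using X(4)[of n] \<epsilon>(2) unfolding a_def S_def m_def by simp
qed

text \<open>For \<open>\<delta>\<close> above \<open>sqrt (s - u)\<close> the right side exceeds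
  \<open>prob E\<close>. Otherwise \<open>\<delta> ^ 4\<close> is at most \<open>\<delta>\<close>
  times the cube of that root, and the two terms of the previous bound add up to less than
  \<open>10\<close>, since \<open>2 * sqrt 24\<close> is at most \<open>9.8\<close> and the other
  coefficient is \<open>1 / 12\<close>; division by \<open>2\<close> gives \<open>5\<close>.\<close>

lemma noncoalescence_bound_ordered:
  assumes ij: "T i \<le> u" "T j \<le> u" and us: "u < s"
    and E: "E \<in> sets (H u)" "\<And>\<omega>. \<omega> \<in> E \<Longrightarrow> 0 \<le> V i u \<omega> - V j u \<omega> \<and> V i u \<omega> - V j u \<omega> \<le> \<delta>" and \<delta>: "0 \<le> \<delta>"
  shows "prob (E \<inter> {\<omega> \<in> space N. V i s \<omega> \<noteq> V j s \<omega>}) \<le> 5 * \<delta> / sqrt (s - u) * prob E"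
proof -
  define r where "r = sqrt (s - u)"
  have r: "0 < r" "s - u = r\<^sup>2" using us by (simp_all add: r_def)
  have EN: "E \<in> sets N" using E(1) sets_H by auto
  show ?thesis
  proof (cases "\<delta> \<le> r")
    case True
    have "\<delta> ^ 4 \<le> \<delta> * r ^ 3"
      using mult_left_mono[OF power_mono[OF True \<delta>, of 3] \<delta>] by (simp add: power_Suc[symmetric] numeral_eq_Suc)
    then have "\<delta> ^ 4 * prob E / (12 * r\<^sup>2) \<le> \<delta> * r ^ 3 * prob E / (12 * r\<^sup>2)"
      by (intro divide_right_mono mult_right_mono) auto
    also have "\<dots> = \<delta> * r * prob E / 12" using r by (simp add: power2_eq_square power3_eq_cube)
    finally have 1: "\<delta> ^ 4 * prob E / (12 * r\<^sup>2) \<le> \<delta> * r * prob E / 12" .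
    have "sqrt 24 \<le> 49 / 10" by (rule real_le_lsqrt) (auto simp: power2_eq_square)
    then have "sqrt (24 * r\<^sup>2) \<le> 49 / 10 * r" using r by (simp add: real_sqrt_mult)
    then have 2: "2 * sqrt (24 * r\<^sup>2) * (\<delta> * prob E) \<le> 2 * (49 / 10 * r) * (\<delta> * prob E)"
      using \<delta> by (intro mult_right_mono mult_left_mono) auto
    have "2 * r\<^sup>2 * prob (E \<inter> {\<omega> \<in> space N. V i s \<omega> \<noteq> V j s \<omega>}) \<le> 2 * (49 / 10 * r) * (\<delta> * prob E) + \<delta> * r * prob E / 12"
      using noncoalescence_ordered[OF ij us E \<delta>] 1 2 unfolding r(2) by linarith
    also have "\<dots> \<le> 10 * r * (\<delta> * prob E)" using r \<delta> by (simp add: field_simps)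
    finally have "prob (E \<inter> {\<omega> \<in> space N. V i s \<omega> \<noteq> V j s \<omega>}) * r * r \<le> 5 * \<delta> * prob E * r"
      by (simp add: power2_eq_square mult_ac)
    then have "prob (E \<inter> {\<omega> \<in> space N. V i s \<omega> \<noteq> V j s \<omega>}) * r \<le> 5 * \<delta> * prob E" using r by simp
    then show ?thesis using r unfolding r_def[symmetric] by (simp add: pos_le_divide_eq)
  next
    case False
    have "prob (E \<inter> {\<omega> \<in> space N. V i s \<omega> \<noteq> V j s \<omega>}) \<le> prob E"
      using EN by (intro finite_measure_mono) auto
    also have "\<dots> = 1 * prob E" by simp
    also have "1 * prob E \<le> 5 * \<delta> / r * prob E"
      using False r by (intro mult_right_mono) (auto simp: pos_le_divide_eq)
    finally show ?thesis by (simp add: r_def)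
  qed
qed

text \<open>The order of the two paths at time \<open>u\<close> is decided by the past, so
  \<open>E\<close> splits into two past events on which it is fixed.\<close>

lemma noncoalescence_bound:
  assumes ij: "T i \<le> u" "T j \<le> u" and us: "u < s"
    and E: "E \<in> sets (H u)" "\<And>\<omega>. \<omega> \<in> E \<Longrightarrow> \<bar>V i u \<omega> - V j u \<omega>\<bar> \<le> \<delta>" and \<delta>: "0 \<le> \<delta>"
  shows "prob (E \<inter> {\<omega> \<in> space N. V i s \<omega> \<noteq> V j s \<omega>}) \<le> 5 * \<delta> / sqrt (s - u) * prob E"
proof -
  note [measurable] = V_meas_H[OF ij(1) order_refl] V_meas_H[OF ij(2) order_refl] E(1)
  have [measurable]: "V i s \<in> borel_measurable N" "V j s \<in> borel_measurable N" using ij us by (auto intro!: V_meas)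
  have le: "{\<omega> \<in> space (H u). V j u \<omega> \<le> V i u \<omega>} \<in> sets (H u)" by measurable
  define E1 where "E1 = E \<inter> {\<omega> \<in> space N. V j u \<omega> \<le> V i u \<omega>}"
  define E2 where "E2 = E - {\<omega> \<in> space N. V j u \<omega> \<le> V i u \<omega>}"
  have E12: "E1 \<in> sets (H u)" "E2 \<in> sets (H u)" using le E(1) by (auto simp: E1_def E2_def)
  then have E12N: "E1 \<in> sets N" "E2 \<in> sets N" using sets_H by auto
  have sub: "E \<subseteq> space N" using sets.sets_into_space[OF E(1)] by simp
  let ?D = "{\<omega> \<in> space N. V i s \<omega> \<noteq> V j s \<omega>}"
  have D: "?D \<in> sets N" by measurable
  have E_le: "V i u \<omega> - V j u \<omega> \<le> \<delta>" "V j u \<omega> - V i u \<omega> \<le> \<delta>" if "\<omega> \<in> E" for \<omega>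
    using E(2)[OF that] by linarith+
  have e1: "prob (E1 \<inter> ?D) \<le> 5 * \<delta> / sqrt (s - u) * prob E1"
    using E_le by (intro noncoalescence_bound_ordered[OF ij us E12(1) _ \<delta>]) (auto simp: E1_def)
  have "prob (E2 \<inter> {\<omega> \<in> space N. V j s \<omega> \<noteq> V i s \<omega>}) \<le> 5 * \<delta> / sqrt (s - u) * prob E2"
    using E_le sub by (intro noncoalescence_bound_ordered[OF ij(2,1) us E12(2) _ \<delta>]) (auto simp: E2_def)
  then have e2: "prob (E2 \<inter> ?D) \<le> 5 * \<delta> / sqrt (s - u) * prob E2" by (simp add: eq_commute)
  have "prob (E \<inter> ?D) = prob (E1 \<inter> ?D \<union> E2 \<inter> ?D)"
    by (rule arg_cong[where f = prob]) (auto simp: E1_def E2_def)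
  also have "\<dots> = prob (E1 \<inter> ?D) + prob (E2 \<inter> ?D)"
    using E12N D by (intro finite_measure_Union) (auto simp: E1_def E2_def)
  also have "\<dots> \<le> 5 * \<delta> / sqrt (s - u) * (prob E1 + prob E2)" using e1 e2 by (simp add: distrib_left)
  also have "prob E1 + prob E2 = prob E"
    using E12N by (subst finite_measure_Union[symmetric]) (auto simp: E1_def E2_def intro!: arg_cong[where f = prob])
  finally show ?thesis .
qed

text \<open>Each driver started before \<open>t\<close> has a density at time \<open>t\<close>,
  there are countably many drivers, and \<open>V j t\<close> is the value of one of them.\<close>

lemma prob_V_eq_const:
  assumes t: "T j < t" shows "AE \<omega> in N. V j t \<omega> \<noteq> x"
proof -
  have B_ne: "AE \<omega> in N. B i t \<omega> \<noteq> x" if i: "T i < t" for i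
  proof -
    let ?Y = "\<lambda>\<omega>. B i t \<omega> - B i (T i) \<omega>"
    have d: "distributed N lborel ?Y (normal_density 0 (sqrt (t - T i)))" by (rule B_incr) (use i in auto)
    have "AE y in lborel. y \<noteq> x - fst (z i)" by (rule AE_lborel_singleton)
    then have "AE y in density lborel (\<lambda>y. ennreal (normal_density 0 (sqrt (t - T i)) y)). y \<noteq> x - fst (z i)"
      by (subst AE_density) auto
    then have "AE y in distr N lborel ?Y. y \<noteq> x - fst (z i)"
      unfolding distributed_distr_eq_density[OF d] .
    then have "AE \<omega> in N. ?Y \<omega> \<noteq> x - fst (z i)"
      using d by (subst (asm) AE_distr_iff) (auto simp: distributed_def)
    then show ?thesis
      by (rule AE_mp) (auto intro!: AE_I2 simp: B_start)
  qed
  then have "AE \<omega> in N. \<forall>i. T i < t \<longrightarrow> B i t \<omega> \<noteq> x" by (auto simp: AE_all_countable)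
  then show ?thesis
  proof (rule AE_mp, intro AE_I2 impI)
    fix \<omega> assume \<omega>: "\<omega> \<in> space N" and ne: "\<forall>i. T i < t \<longrightarrow> B i t \<omega> \<noteq> x"
    \<comment> \<open>The leader at time \<open>t\<close> itself could start exactly at
      \<open>t\<close>, where its driver is deterministic. Leaders at earlier times take finitely
      many values, so one of them recurs as \<open>s n\<close> tends to \<open>t\<close>, and by
      continuity its driver carries the path at \<open>t\<close>.\<close>
    define s where "s n = t - (t - T j) / real (Suc n)" for n
    have s: "T j \<le> s n" "s n < t" for n
    proof -
      have "(t - T j) / real (Suc n) \<le> (t - T j) / 1" using t by (intro divide_left_mono) auto
      then show "T j \<le> s n" by (simp add: s_def)
      show "s n < t" using t by (simp add: s_def)
    qed
    have slim: "s \<longlonglongrightarrow> t"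
      unfolding s_def by (rule tendsto_eq_intros LIMSEQ_Suc[OF lim_const_over_n] refl)+ simp
    have "finite (range (\<lambda>n. leader j (s n) \<omega>))"
      by (rule finite_subset[of _ "{..j}"]) (use leader_le[OF s(1)] in auto)
    from inf_img_fin_dom[OF this infinite_UNIV_nat] obtain i where "infinite ((\<lambda>n. leader j (s n) \<omega>) -` {i})"
      by auto
    from infinite_enumerate[OF this] obtain r :: "nat \<Rightarrow> nat" where r0: "strict_mono r" "\<forall>n. r n \<in> (\<lambda>n. leader j (s n) \<omega>) -` {i}"
      by blast
    then have r: "strict_mono r" "leader j (s (r n)) \<omega> = i" for n by auto
    have sr: "(s \<circ> r) \<longlonglongrightarrow> t" by (rule LIMSEQ_subseq_LIMSEQ[OF slim r(1)])
    have i: "T i \<le> s (r n)" for n using leader_T[OF s(1), of "r n" \<omega>] r(2) by simp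
    have iT: "T i < t" using i[of 0] s(2)[of "r 0"] by simp
    have "(\<lambda>n. V j (s (r n)) \<omega>) \<longlonglongrightarrow> V j t \<omega>"
      using continuous_on_tendsto_compose[OF V_cont[OF \<omega>, of j] sr] s t by (auto simp: comp_def)
    moreover have "(\<lambda>n. B i (s (r n)) \<omega>) \<longlonglongrightarrow> B i t \<omega>"
      using continuous_on_tendsto_compose[OF B_cont[OF \<omega>, of i] sr] i iT by (auto simp: comp_def)
    moreover have "V j (s (r n)) \<omega> = B i (s (r n)) \<omega>" for n
      using V_eq_B_leader[OF \<omega> s(1), of "r n"] r(2) by simp
    ultimately have "V j t \<omega> = B i t \<omega>" by (simp add: LIMSEQ_unique)
    then show "V j t \<omega> \<noteq> x" using ne iT by simp
  qed
qed

end

section \<open>Transfer to the given probability space\<close>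

lemma (in prob_space) indep_vars_cong_AE:
  assumes X: "indep_vars M' X I" and I: "I \<noteq> {}" and Y: "\<And>i. i \<in> I \<Longrightarrow> random_variable (M' i) (Y i)"
    and eq: "AE \<omega> in M. \<forall>i\<in>I. X i \<omega> = Y i \<omega>"
  shows "indep_vars M' Y I"
proof -
  have Xm: "\<And>i. i \<in> I \<Longrightarrow> random_variable (M' i) (X i)" using X by (simp add: indep_vars_def)
  have "distr M (Pi\<^sub>M I M') (\<lambda>x. \<lambda>i\<in>I. Y i x) = distr M (Pi\<^sub>M I M') (\<lambda>x. \<lambda>i\<in>I. X i x)"
  proof (intro distr_cong_AE measurable_restrict Xm Y refl)
    show "AE \<omega> in M. (\<lambda>i\<in>I. Y i \<omega>) = (\<lambda>i\<in>I. X i \<omega>)"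
      using eq by eventually_elim (auto intro: restrict_ext)
  qed
  also have "\<dots> = Pi\<^sub>M I (\<lambda>i. distr M (M' i) (X i))"
    using X indep_vars_iff_distr_eq_PiM'[OF I Xm] by simp
  also have "\<dots> = Pi\<^sub>M I (\<lambda>i. distr M (M' i) (Y i))"
  proof (intro PiM_cong distr_cong_AE Xm Y refl)
    fix i assume "i \<in> I"
    then show "AE \<omega> in M. X i \<omega> = Y i \<omega>" using eq by (auto elim: eventually_mono)
  qed
  finally show ?thesis using indep_vars_iff_distr_eq_PiM'[OF I Y] by simp
qed

lemma distributed_cong_AE:
  assumes "distributed M L X f" "Y \<in> M \<rightarrow>\<^sub>M L" "AE \<omega> in M. X \<omega> = Y \<omega>"
  shows "distributed M L Y f"
proof -
  have "distr M L X = distr M L Y"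
    using assms by (intro distr_cong_AE refl) (auto simp: distributed_def)
  then show ?thesis using assms by (simp add: distributed_def)
qed

definition path_dom :: "(nat \<Rightarrow> real \<times> real) \<Rightarrow> (nat \<times> real) set" where
  "path_dom z = {(j, t). snd (z j) \<le> t}"

definition full :: "(nat \<Rightarrow> real \<times> real) \<Rightarrow> (nat \<Rightarrow> real \<Rightarrow> 'w \<Rightarrow> real) \<Rightarrow> 'w \<Rightarrow> nat \<times> real \<Rightarrow> real" where
  "full z V \<omega> = (\<lambda>(j, t)\<in>path_dom z. V j t \<omega>)"

lemma family_law_full: "family_law M z V = distr M (Pi\<^sub>M (path_dom z) (\<lambda>_. borel)) (full z V)"
  by (simp add: family_law_def Let_def full_def[abs_def] path_dom_def)

lemma full_apply: "snd (z j) \<le> t \<Longrightarrow> full z V \<omega> (j, t) = V j t \<omega>"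
  by (simp add: full_def path_dom_def)

lemma full_measurable:
  assumes "\<And>j t. snd (z j) \<le> t \<Longrightarrow> V j t \<in> borel_measurable N"
  shows "full z V \<in> N \<rightarrow>\<^sub>M Pi\<^sub>M (path_dom z) (\<lambda>_. borel)"
  unfolding full_def[abs_def] case_prod_beta
  by (rule measurable_restrict) (use assms in \<open>auto simp: path_dom_def\<close>)

lemma restrict_full: "restrict (full z V \<omega>) (dom_upto z u) = hist z u V \<omega>"
  by (auto simp: full_def hist_def path_dom_def dom_upto_def fun_eq_iff restrict_def)

text \<open>Off a set \<open>G\<close> of full probability all drivers and paths are replaced by
  constants at their starting positions. Constant families trivially coalesce along themselves, and
  the replacement changes neither the law nor the Brownian properties, which are stable under almost
  sure equality.\<close>

lemma coalescing_BMs_driven: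
  assumes W: "coalescing_BMs M z W"
  obtains N :: "(nat \<Rightarrow> real \<Rightarrow> real) measure" and B V
  where "driven N z B V" "family_law M z W = family_law N z V"
proof -
  obtain N :: "(nat \<Rightarrow> real \<Rightarrow> real) measure" and B V
    where N: "prob_space N" and BM: "independent_BMs N z B" and V: "continuous_path_family N z V"
      and co: "AE \<omega> in N. coalesces_along z (\<lambda>j t. B j t \<omega>) (\<lambda>j t. V j t \<omega>)"
      and law: "family_law M z W = family_law N z V"
    using W by (auto simp: coalescing_BMs_def)
  interpret prob_space N by (rule N)
  let ?T = "\<lambda>j. snd (z j)"
  have bm: "brownian_motion N (z j) (B j)" for j using BM by (simp add: independent_BMs_def)
  have B_meas: "?T j \<le> t \<Longrightarrow> B j t \<in> borel_measurable N" for j t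
    using bm[of j] by (auto simp: brownian_motion_def split_beta)
  have V_meas: "?T j \<le> t \<Longrightarrow> V j t \<in> borel_measurable N" for j t
    using V by (auto simp: continuous_path_family_def)
  let ?P = "\<lambda>\<omega>. (\<forall>j. B j (?T j) \<omega> = fst (z j) \<and> continuous_on {?T j..} (\<lambda>t. B j t \<omega>) \<and> continuous_on {?T j..} (\<lambda>t. V j t \<omega>))
      \<and> coalesces_along z (\<lambda>j t. B j t \<omega>) (\<lambda>j t. V j t \<omega>)"
  have AE_P: "AE \<omega> in N. ?P \<omega>"
    using bm V co by (auto simp: AE_all_countable brownian_motion_def split_beta continuous_path_family_def)
  obtain K where K: "{\<omega> \<in> space N. \<not> ?P \<omega>} \<subseteq> K" "emeasure N K = 0" "K \<in> sets N"
    using AE_P by (rule AE_E)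
  define G where "G = space N - K"
  have G: "G \<in> sets N" "\<omega> \<in> G \<Longrightarrow> ?P \<omega>" for \<omega> using K by (auto simp: G_def)
  have G_AE: "AE \<omega> in N. \<omega> \<in> G"
    using K by (intro AE_I'[of K]) (auto simp: G_def null_sets_def)
  define B' where "B' j t \<omega> = (if \<omega> \<in> G then B j t \<omega> else fst (z j))" for j t \<omega>
  define V' where "V' j t \<omega> = (if \<omega> \<in> G then V j t \<omega> else fst (z j))" for j t \<omega>
  have G': "Measurable.pred N (\<lambda>\<omega>. \<omega> \<in> G)" using G(1) by measurable
  have B'_meas: "?T j \<le> t \<Longrightarrow> B' j t \<in> borel_measurable N" for j t
    unfolding B'_def[abs_def] using B_meas G' by (intro measurable_If) auto
  have V'_meas: "?T j \<le> t \<Longrightarrow> V' j t \<in> borel_measurable N" for j t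
    unfolding V'_def[abs_def] using V_meas G' by (intro measurable_If) auto
  have B'_cont: "continuous_on {?T j..} (\<lambda>t. B' j t \<omega>)" for j \<omega>
    using G(2)[of \<omega>] by (cases "\<omega> \<in> G") (auto simp: B'_def)
  have V'_cont: "continuous_on {?T j..} (\<lambda>t. V' j t \<omega>)" for j \<omega>
    using G(2)[of \<omega>] by (cases "\<omega> \<in> G") (auto simp: V'_def)
  have "brownian_motion N (z j) (B' j)" for j
    unfolding brownian_motion_def split_beta
  proof (intro conjI allI impI)
    show "B' j t \<in> borel_measurable N" if "?T j \<le> t" for t by (rule B'_meas[OF that])
    show "AE \<omega> in N. B' j (?T j) \<omega> = fst (z j)" using G(2) by (intro AE_I2) (auto simp: B'_def)
    show "AE \<omega> in N. continuous_on {?T j..} (\<lambda>t. B' j t \<omega>)" using B'_cont by simp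
    fix s t assume st: "?T j \<le> s \<and> s < t"
    show "distributed N lborel (\<lambda>\<omega>. B' j t \<omega> - B' j s \<omega>) (\<lambda>x. ennreal (normal_density 0 (sqrt (t - s)) x))"
    proof (rule distributed_cong_AE)
      show "distributed N lborel (\<lambda>\<omega>. B j t \<omega> - B j s \<omega>) (\<lambda>x. ennreal (normal_density 0 (sqrt (t - s)) x))"
        using bm[of j] st by (auto simp: brownian_motion_def split_beta)
      show "AE \<omega> in N. B j t \<omega> - B j s \<omega> = B' j t \<omega> - B' j s \<omega>"
        using G_AE by (rule AE_mp) (auto intro!: AE_I2 simp: B'_def)
    qed (use st B'_meas[of j] in \<open>auto intro!: borel_measurable_diff\<close>)
  next
    fix \<tau> :: "nat \<Rightarrow> real" assume \<tau>: "mono \<tau> \<and> ?T j \<le> \<tau> 0"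
    then have \<tau>': "?T j \<le> \<tau> k" for k using monoD[of \<tau> 0 k] by auto
    show "indep_vars (\<lambda>_. borel) (\<lambda>k \<omega>. B' j (\<tau> (Suc k)) \<omega> - B' j (\<tau> k) \<omega>) UNIV"
    proof (rule indep_vars_cong_AE)
      show "indep_vars (\<lambda>_. borel) (\<lambda>k \<omega>. B j (\<tau> (Suc k)) \<omega> - B j (\<tau> k) \<omega>) UNIV"
        using bm[of j] \<tau> by (auto simp: brownian_motion_def split_beta)
      show "AE \<omega> in N. \<forall>i\<in>UNIV. B j (\<tau> (Suc i)) \<omega> - B j (\<tau> i) \<omega> = B' j (\<tau> (Suc i)) \<omega> - B' j (\<tau> i) \<omega>"
        using G_AE by (rule AE_mp) (auto intro!: AE_I2 simp: B'_def)
    qed (use \<tau>' B'_meas[of j] in \<open>auto intro!: borel_measurable_diff\<close>)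
  qed
  moreover have "indep_vars (\<lambda>j. Pi\<^sub>M {?T j..} (\<lambda>_. borel)) (\<lambda>j \<omega>. \<lambda>t\<in>{?T j..}. B' j t \<omega>) UNIV"
  proof (rule indep_vars_cong_AE)
    show "indep_vars (\<lambda>j. Pi\<^sub>M {?T j..} (\<lambda>_. borel)) (\<lambda>j \<omega>. \<lambda>t\<in>{?T j..}. B j t \<omega>) UNIV"
      using BM by (simp add: independent_BMs_def)
    show "AE \<omega> in N. \<forall>j\<in>UNIV. (\<lambda>t\<in>{?T j..}. B j t \<omega>) = (\<lambda>t\<in>{?T j..}. B' j t \<omega>)"
      using G_AE by (rule AE_mp) (auto intro!: AE_I2 simp: B'_def)
    show "(\<lambda>\<omega>. \<lambda>t\<in>{?T j..}. B' j t \<omega>) \<in> N \<rightarrow>\<^sub>M Pi\<^sub>M {?T j..} (\<lambda>_. borel)" for j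
      using B'_meas by (intro measurable_restrict) auto
  qed simp
  ultimately have "independent_BMs N z B'" by (simp add: independent_BMs_def)
  moreover have "coalesces_along z (\<lambda>j t. B' j t \<omega>) (\<lambda>j t. V' j t \<omega>)" for \<omega>
  proof (cases "\<omega> \<in> G")
    case True
    then have "coalesces_along z (\<lambda>j t. B j t \<omega>) (\<lambda>j t. V j t \<omega>)" using G(2) by blast
    then show ?thesis using True by (simp add: B'_def V'_def)
  next
    case False
    then show ?thesis by (simp add: B'_def V'_def coalesces_along_def)
  qed
  moreover have "B' j (?T j) \<omega> = fst (z j)" for j \<omega>
    using G(2)[of \<omega>] by (simp add: B'_def)
  ultimately have "driven N z B' V'"
    using B'_cont V'_cont by unfold_locales auto
  moreover have "family_law N z V = family_law N z V'"
    unfolding family_law_full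
  proof (intro distr_cong_AE full_measurable V_meas V'_meas refl)
    show "AE \<omega> in N. full z V \<omega> = full z V' \<omega>"
      using G_AE by eventually_elim (simp add: full_def V'_def)
  qed
  ultimately show thesis using law that by simp
qed

locale coalescing = prob_space M for M :: "'w measure" +
  fixes z :: "nat \<Rightarrow> real \<times> real" and W :: "nat \<Rightarrow> real \<Rightarrow> 'w \<Rightarrow> real"
  assumes W: "coalescing_BMs M z W"
begin

abbreviation "T j \<equiv> snd (z j)"

lemma W_meas: "T j \<le> t \<Longrightarrow> W j t \<in> borel_measurable M"
  using W by (auto simp: coalescing_BMs_def continuous_path_family_def)

lemma W_cont: "AE \<omega> in M. \<forall>j. continuous_on {T j..} (\<lambda>t. W j t \<omega>)"
  using W by (auto simp: coalescing_BMs_def continuous_path_family_def AE_all_countable)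

text \<open>Only the law is common to \<open>M\<close> and \<open>N\<close>. A statement can be
  moved once it is a measurable predicate of the whole family, which is why statements about all
  times are first reduced to countably many times.\<close>

lemma driven_law:
  assumes "driven N z B V" "family_law M z W = family_law N z V"
    and P: "Measurable.pred (Pi\<^sub>M (path_dom z) (\<lambda>_. borel)) P"
  shows "measure M {\<omega> \<in> space M. P (full z W \<omega>)} = measure N {\<omega> \<in> space N. P (full z V \<omega>)}"
    and "(AE \<omega> in M. P (full z W \<omega>)) \<longleftrightarrow> (AE \<omega> in N. P (full z V \<omega>))"
proof -
  interpret D: driven N z B V by (rule assms(1))
  let ?S = "{y \<in> space (Pi\<^sub>M (path_dom z) (\<lambda>_. borel)). P y}"
  have S: "?S \<in> sets (Pi\<^sub>M (path_dom z) (\<lambda>_. borel))" using P by (simp add: pred_def)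
  have mW: "full z W \<in> M \<rightarrow>\<^sub>M Pi\<^sub>M (path_dom z) (\<lambda>_. borel)" by (rule full_measurable[OF W_meas])
  have mV: "full z V \<in> N \<rightarrow>\<^sub>M Pi\<^sub>M (path_dom z) (\<lambda>_. borel)" by (rule full_measurable[OF D.V_meas])
  have "measure M {\<omega> \<in> space M. P (full z W \<omega>)} = measure (family_law M z W) ?S"
    unfolding family_law_full using measurable_space[OF mW]
    by (subst measure_distr[OF mW S]) (auto intro!: arg_cong[where f = "measure M"])
  also have "\<dots> = measure N {\<omega> \<in> space N. P (full z V \<omega>)}"
    unfolding assms(2) unfolding family_law_full using measurable_space[OF mV]
    by (subst measure_distr[OF mV S]) (auto intro!: arg_cong[where f = "measure N"])
  finally show "measure M {\<omega> \<in> space M. P (full z W \<omega>)} = measure N {\<omega> \<in> space N. P (full z V \<omega>)}" .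
  have "(AE \<omega> in M. P (full z W \<omega>)) \<longleftrightarrow> (AE y in family_law M z W. P y)"
    unfolding family_law_full using AE_distr_iff[OF mW S] by simp
  also have "\<dots> \<longleftrightarrow> (AE \<omega> in N. P (full z V \<omega>))"
    unfolding assms(2) unfolding family_law_full using AE_distr_iff[OF mV S] by simp
  finally show "(AE \<omega> in M. P (full z W \<omega>)) \<longleftrightarrow> (AE \<omega> in N. P (full z V \<omega>))" .
qed

lemma W_start: "AE \<omega> in M. \<forall>j. W j (T j) \<omega> = fst (z j)"
  unfolding AE_all_countable
proof
  fix j
  obtain N :: "(nat \<Rightarrow> real \<Rightarrow> real) measure" and B V where D: "driven N z B V" and law: "family_law M z W = family_law N z V"
    using W by (rule coalescing_BMs_driven)
  interpret D: driven N z B V by (rule D)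
  have P: "Measurable.pred (Pi\<^sub>M (path_dom z) (\<lambda>_. borel)) (\<lambda>y. y (j, T j) = fst (z j))"
    by (rule pred_eq_const1[OF measurable_component_singleton]) (auto simp: path_dom_def)
  have "V j (T j) \<omega> = fst (z j)" if "\<omega> \<in> space N" for \<omega>
    using D.follow[OF that, of j "T j"] D.B_start[OF that] by auto
  then have "AE \<omega> in N. full z V \<omega> (j, T j) = fst (z j)" by (intro AE_I2) (simp add: full_apply)
  then show "AE \<omega> in M. W j (T j) \<omega> = fst (z j)"
    using driven_law(2)[OF D law P] by (simp add: full_apply)
qed

lemma W_ne_const: "T j < t \<Longrightarrow> AE \<omega> in M. W j t \<omega> \<noteq> x"
proof -
  assume t: "T j < t"
  obtain N :: "(nat \<Rightarrow> real \<Rightarrow> real) measure" and B V where D: "driven N z B V" and law: "family_law M z W = family_law N z V"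
    using W by (rule coalescing_BMs_driven)
  interpret D: driven N z B V by (rule D)
  have "Measurable.pred (Pi\<^sub>M (path_dom z) (\<lambda>_. borel)) (\<lambda>y. y (j, t) = x)"
    by (rule pred_eq_const1[OF measurable_component_singleton]) (use t in \<open>auto simp: path_dom_def\<close>)
  then have P: "Measurable.pred (Pi\<^sub>M (path_dom z) (\<lambda>_. borel)) (\<lambda>y. y (j, t) \<noteq> x)"
    by measurable
  show ?thesis
    using driven_law(2)[OF D law P] D.prob_V_eq_const[OF t, of x] t by (simp add: full_apply)
qed

text \<open>Markov's inequality for fourth powers. The quadratic decay in the length of the interval
  is what makes dyadic chaining summable and lets unions of linearly many tubes remain
  improbable.\<close>

lemma W_fourth_moment:
  assumes u: "T j \<le> u" "u \<le> s" and e: "0 < e"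
  shows "prob {\<omega> \<in> space M. e < \<bar>W j s \<omega> - W j u \<omega>\<bar>} \<le> 9 * (s - u)\<^sup>2 / e ^ 4"
proof (cases "u = s")
  case False
  with u have us: "u < s" by simp
  obtain N :: "(nat \<Rightarrow> real \<Rightarrow> real) measure" and B V where D: "driven N z B V" and law: "family_law M z W = family_law N z V"
    using W by (rule coalescing_BMs_driven)
  interpret D: driven N z B V by (rule D)
  have [measurable]: "(\<lambda>y. y (j, s)) \<in> borel_measurable (Pi\<^sub>M (path_dom z) (\<lambda>_. borel))" "(\<lambda>y. y (j, u)) \<in> borel_measurable (Pi\<^sub>M (path_dom z) (\<lambda>_. borel))"
    by (rule measurable_component_singleton; use u in \<open>simp add: path_dom_def\<close>)+
  have P: "Measurable.pred (Pi\<^sub>M (path_dom z) (\<lambda>_. borel)) (\<lambda>y. e < \<bar>y (j, s) - y (j, u)\<bar>)" by measurable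
  have [measurable]: "V j s \<in> borel_measurable N" "V j u \<in> borel_measurable N" using u by (auto intro!: D.V_meas)
  have "prob {\<omega> \<in> space M. e < \<bar>W j s \<omega> - W j u \<omega>\<bar>} = D.prob {\<omega> \<in> space N. e < \<bar>V j s \<omega> - V j u \<omega>\<bar>}"
    using driven_law(1)[OF D law P] u by (simp add: full_apply)
  also have "\<dots> \<le> D.prob {\<omega> \<in> space N. e ^ 4 \<le> (V j s \<omega> - V j u \<omega>) ^ 4}"
  proof (rule D.finite_measure_mono)
    have "e ^ 4 \<le> x ^ 4" if "e < \<bar>x\<bar>" for x :: real
      using power_mono[of e "\<bar>x\<bar>" 4] that e by (simp add: power_even_abs)
    then show "{\<omega> \<in> space N. e < \<bar>V j s \<omega> - V j u \<omega>\<bar>} \<subseteq> {\<omega> \<in> space N. e ^ 4 \<le> (V j s \<omega> - V j u \<omega>) ^ 4}" by auto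
  qed measurable
  also have "\<dots> \<le> D.expectation (\<lambda>\<omega>. (V j s \<omega> - V j u \<omega>) ^ 4) / e ^ 4"
    by (rule integral_Markov_inequality_measure[OF D.fourth_moment(1)[OF u(1) us], of "{}"]) (use e in auto)
  also have "\<dots> \<le> 9 * (s - u)\<^sup>2 / e ^ 4"
    using D.fourth_moment(2)[OF u(1) us] e by (intro divide_right_mono) auto
  finally show ?thesis .
qed (use e in simp)

lemma W_noncoalescence:
  assumes ij: "T i \<le> u" "T j \<le> u" and us: "u < s"
    and E: "E \<in> sets (past M z W u)" "\<And>\<omega>. \<omega> \<in> E \<Longrightarrow> \<bar>W i u \<omega> - W j u \<omega>\<bar> \<le> \<delta>" and \<delta>: "0 \<le> \<delta>"
  shows "prob (E \<inter> {\<omega> \<in> space M. W i s \<omega> \<noteq> W j s \<omega>}) \<le> 5 * \<delta> / sqrt (s - u) * prob E"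
proof -
  obtain N :: "(nat \<Rightarrow> real \<Rightarrow> real) measure" and B V where D: "driven N z B V" and law: "family_law M z W = family_law N z V"
    using W by (rule coalescing_BMs_driven)
  interpret D: driven N z B V by (rule D)
  obtain S where S: "S \<in> sets (Pi\<^sub>M (dom_upto z u) (\<lambda>_. borel))" "E = hist z u W -` S \<inter> space M"
    using E(1) by (auto simp: past_def sets_vimage_algebra2[OF hist_PiM])
  have [measurable]: "(\<lambda>y. y (i, u)) \<in> borel_measurable (Pi\<^sub>M (path_dom z) (\<lambda>_. borel))" "(\<lambda>y. y (j, u)) \<in> borel_measurable (Pi\<^sub>M (path_dom z) (\<lambda>_. borel))"
    "(\<lambda>y. y (i, s)) \<in> borel_measurable (Pi\<^sub>M (path_dom z) (\<lambda>_. borel))" "(\<lambda>y. y (j, s)) \<in> borel_measurable (Pi\<^sub>M (path_dom z) (\<lambda>_. borel))"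
    by (rule measurable_component_singleton; use ij us in \<open>simp add: path_dom_def\<close>)+
  have r: "(\<lambda>y. restrict y (dom_upto z u)) \<in> Pi\<^sub>M (path_dom z) (\<lambda>_. borel) \<rightarrow>\<^sub>M Pi\<^sub>M (dom_upto z u) (\<lambda>_. borel)"
    by (rule measurable_restrict_subset) (auto simp: dom_upto_def path_dom_def)
  have Q[measurable]: "Measurable.pred (Pi\<^sub>M (path_dom z) (\<lambda>_. borel)) (\<lambda>y. restrict y (dom_upto z u) \<in> S)"
    using measurable_sets[OF r S(1)] by (simp add: pred_def vimage_def Int_def conj_commute)
  have d: "(i, u) \<in> path_dom z" "(j, u) \<in> path_dom z" "(i, s) \<in> path_dom z" "(j, s) \<in> path_dom z"
    using ij us by (auto simp: path_dom_def)
  have a: "Measurable.pred (Pi\<^sub>M (path_dom z) (\<lambda>_. borel)) (\<lambda>y. \<bar>y (i, u) - y (j, u)\<bar> \<le> \<delta>)"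
    using d by measurable
  have b: "Measurable.pred (Pi\<^sub>M (path_dom z) (\<lambda>_. borel)) (\<lambda>y. y (i, s) = (y (j, s) :: real))"
  proof -
    have "Measurable.pred (Pi\<^sub>M (path_dom z) (\<lambda>_. borel)) (\<lambda>y. \<bar>y (i, s) - y (j, s)\<bar> \<le> (0 :: real))"
      using d by measurable
    then show ?thesis by simp
  qed
  have P1: "Measurable.pred (Pi\<^sub>M (path_dom z) (\<lambda>_. borel)) (\<lambda>y. restrict y (dom_upto z u) \<in> S \<and> \<bar>y (i, u) - y (j, u)\<bar> \<le> \<delta> \<and> y (i, s) \<noteq> y (j, s))"
    by (intro pred_intros_logic Q a b)
  have P2: "Measurable.pred (Pi\<^sub>M (path_dom z) (\<lambda>_. borel)) (\<lambda>y. restrict y (dom_upto z u) \<in> S \<and> \<bar>y (i, u) - y (j, u)\<bar> \<le> \<delta>)"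
    by (intro pred_intros_logic Q a)
  \<comment> \<open>The distance bound at time \<open>u\<close> is known only for points of
    \<open>E\<close> on the space \<open>M\<close>; including it in the transferred event supplies
    it on \<open>N\<close> without changing the probability.\<close>
  define E' where "E' = {\<omega> \<in> space N. hist z u V \<omega> \<in> S \<and> \<bar>V i u \<omega> - V j u \<omega>\<bar> \<le> \<delta>}"
  have E': "E' \<in> sets (D.H u)"
  proof -
    note [measurable] = D.V_meas_H[OF ij(1) order_refl] D.V_meas_H[OF ij(2) order_refl]
    have "hist z u V -` S \<inter> space N \<in> sets (past N z V u)"
      using S(1) by (auto simp: past_def sets_vimage_algebra2[OF hist_PiM])
    then have "hist z u V -` S \<inter> space N \<in> sets (D.H u)" using D.past_V_subset by auto
    moreover have "{\<omega> \<in> space (D.H u). \<bar>V i u \<omega> - V j u \<omega>\<bar> \<le> \<delta>} \<in> sets (D.H u)" by measurable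
    ultimately have "(hist z u V -` S \<inter> space N) \<inter> {\<omega> \<in> space (D.H u). \<bar>V i u \<omega> - V j u \<omega>\<bar> \<le> \<delta>} \<in> sets (D.H u)" by (rule sets.Int)
    also have "(hist z u V -` S \<inter> space N) \<inter> {\<omega> \<in> space (D.H u). \<bar>V i u \<omega> - V j u \<omega>\<bar> \<le> \<delta>} = E'" by (auto simp: E'_def)
    finally show ?thesis .
  qed
  have ap: "full z W \<omega> (k, t) = W k t \<omega>" "full z V \<omega>' (k, t) = V k t \<omega>'" if "T k \<le> t" for \<omega> \<omega>' k t
    using that by (simp_all add: full_apply)
  have "E \<inter> {\<omega> \<in> space M. W i s \<omega> \<noteq> W j s \<omega>} =
      {\<omega> \<in> space M. restrict (full z W \<omega>) (dom_upto z u) \<in> S \<and> \<bar>full z W \<omega> (i, u) - full z W \<omega> (j, u)\<bar> \<le> \<delta> \<and> full z W \<omega> (i, s) \<noteq> full z W \<omega> (j, s)}"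
    using E(2) S(2) ij us by (auto simp: restrict_full ap)
  then have "prob (E \<inter> {\<omega> \<in> space M. W i s \<omega> \<noteq> W j s \<omega>}) =
      D.prob {\<omega> \<in> space N. restrict (full z V \<omega>) (dom_upto z u) \<in> S \<and> \<bar>full z V \<omega> (i, u) - full z V \<omega> (j, u)\<bar> \<le> \<delta> \<and> full z V \<omega> (i, s) \<noteq> full z V \<omega> (j, s)}"
    using driven_law(1)[OF D law P1] by simp
  also have "\<dots> = D.prob (E' \<inter> {\<omega> \<in> space N. V i s \<omega> \<noteq> V j s \<omega>})"
    using ij us by (intro arg_cong[where f = D.prob]) (auto simp: E'_def restrict_full ap)
  also have "\<dots> \<le> 5 * \<delta> / sqrt (s - u) * D.prob E'"
    by (rule D.noncoalescence_bound[OF ij us E' _ \<delta>]) (simp add: E'_def)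
  also have "D.prob E' = prob {\<omega> \<in> space M. restrict (full z W \<omega>) (dom_upto z u) \<in> S \<and> \<bar>full z W \<omega> (i, u) - full z W \<omega> (j, u)\<bar> \<le> \<delta>}"
    unfolding driven_law(1)[OF D law P2] using ij by (simp add: E'_def restrict_full ap)
  also have "\<dots> = prob E"
    using E(2) S(2) ij by (intro arg_cong[where f = prob]) (auto simp: restrict_full ap)
  finally show ?thesis .
qed

end

section \<open>Almost sure regularity of coalescing families\<close>

lemma (in prob_space) AE_ex_notin:
  assumes A: "\<And>n::nat. A n \<in> events" "\<And>n. prob (A n) \<le> c n" and c: "c \<longlonglongrightarrow> 0"
  shows "AE \<omega> in M. \<exists>n. \<omega> \<notin> A n"
proof -
  have "prob (\<Inter>n. A n) \<le> c n" for n
    using A by (intro order_trans[OF finite_measure_mono A(2)]) auto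
  then have "prob (\<Inter>n. A n) \<le> 0" by (intro LIMSEQ_le_const[OF c]) auto
  then have "prob (\<Inter>n. A n) = 0" using measure_nonneg[of M] by (simp add: order_antisym)
  then have "(\<Inter>n. A n) \<in> null_sets M"
    using A by (intro null_setsI) (auto simp: emeasure_eq_measure)
  from AE_not_in[OF this] show ?thesis by (auto elim: eventually_mono)
qed

text \<open>Allows a double limit: the bound \<open>c\<close> is uniform in the fine mesh
  \<open>n\<close>, which is sent to infinity first, and only afterwards another parameter makes
  \<open>c\<close> small.\<close>

lemma (in prob_space) prob_eventually_le:
  assumes X: "\<And>n::nat. X n \<in> events" "\<And>n. prob (X n) \<le> c"
  shows "(\<Union>N. \<Inter>n\<in>{N..}. X n) \<in> events" "prob (\<Union>N. \<Inter>n\<in>{N..}. X n) \<le> c"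
proof -
  have ev: "(\<Inter>n\<in>{N..}. X n) \<in> events" for N using X by (intro sets.countable_INT') auto
  then show "(\<Union>N. \<Inter>n\<in>{N..}. X n) \<in> events" by auto
  have lim: "(\<lambda>N. prob (\<Inter>n\<in>{N..}. X n)) \<longlonglongrightarrow> prob (\<Union>N. \<Inter>n\<in>{N..}. X n)"
    using ev by (intro finite_Lim_measure_incseq) (auto simp: incseq_def)
  have "prob (\<Inter>n\<in>{N..}. X n) \<le> c" for N
    using X by (intro order_trans[OF finite_measure_mono X(2)[of N]]) auto
  then show "prob (\<Union>N. \<Inter>n\<in>{N..}. X n) \<le> c" by (intro LIMSEQ_le_const2[OF lim]) auto
qed

text \<open>Each dyadic point reaches \<open>a\<close> by passing to coarser levels, with at most
  one increment per level; continuity extends the bound to all times.\<close>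

lemma dyadic_increments_bound:
  fixes f :: "real \<Rightarrow> real"
  assumes f: "continuous_on {a..a + l} f" and l: "0 \<le> l"
    and inc: "\<And>n k. k < 2 ^ n \<Longrightarrow> \<bar>f (a + real (Suc k) * (l / 2 ^ n)) - f (a + real k * (l / 2 ^ n))\<bar> \<le> c n"
    and c: "\<And>n::nat. (\<Sum>m\<le>n. c m) \<le> e" and t: "t \<in> {a..a + l}"
  shows "\<bar>f t - f a\<bar> \<le> e"
proof -
  have grid: "\<bar>f (a + real k * (l / 2 ^ n)) - f a\<bar> \<le> (\<Sum>m\<le>n. c m)" if "k \<le> 2 ^ n" for n k
    using that
  proof (induction n arbitrary: k)
    case 0
    have "0 \<le> c 0" using inc[of 0 0] by (simp add: abs_le_iff)
    then show ?case using 0 inc[of 0 0] by (cases k) auto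
  next
    case (Suc n)
    \<comment> \<open>An even point of level \<open>Suc n\<close> already lies on level
      \<open>n\<close>; an odd one is a single increment to the right of such a point, indexed by
      \<open>k'\<close>.\<close>
    define k' where "k' = k div 2"
    have k': "k' \<le> 2 ^ n" using Suc.prems by (simp add: k'_def)
    have half: "real (2 * k') * (l / 2 ^ Suc n) = real k' * (l / 2 ^ n)" by simp
    have c0: "0 \<le> c (Suc n)" using inc[of 0 "Suc n"] abs_ge_zero order_trans by (metis zero_less_numeral zero_less_power)
    show ?case
    proof (cases "even k")
      case True
      then have "k = 2 * k'" by (simp add: k'_def)
      then show ?thesis using Suc.IH[OF k'] c0 half by simp
    next
      case False
      then have k: "k = Suc (2 * k')" by (simp add: k'_def)
      then have "2 * k' < 2 ^ Suc n" using Suc.prems by simp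
      from inc[OF this] have "\<bar>f (a + real k * (l / 2 ^ Suc n)) - f (a + real k' * (l / 2 ^ n))\<bar> \<le> c (Suc n)"
        unfolding half k[symmetric] .
      then show ?thesis using Suc.IH[OF k'] by (simp only: sum.atMost_Suc)
    qed
  qed
  define k where "k n = nat \<lfloor>(t - a) / l * 2 ^ n\<rfloor>" for n
  show ?thesis
  proof (cases "l = 0")
    case True
    then have "t = a" using t by auto
    moreover have "0 \<le> c 0" using inc[of 0 0] True by simp
    ultimately show ?thesis using c[of 0] by simp
  next
    case False
    with l have l: "0 < l" by simp
    define s where "s n = a + real (k n) * (l / 2 ^ n)" for n
    have x: "0 \<le> (t - a) / l * 2 ^ n" "(t - a) / l \<le> 1" for n using t l by auto
    have kx: "real (k n) \<le> (t - a) / l * 2 ^ n" "(t - a) / l * 2 ^ n < real (k n) + 1" for n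
      unfolding k_def using x(1)[of n] by linarith+
    have k_le: "k n \<le> 2 ^ n" for n
    proof -
      have "(t - a) / l * 2 ^ n \<le> 1 * 2 ^ n" using x(2) by (intro mult_right_mono) auto
      then have "real (k n) \<le> 2 ^ n" using kx(1)[of n] by linarith
      then have "real (k n) \<le> real (2 ^ n)" by simp
      then show ?thesis by (simp only: of_nat_le_iff)
    qed
    have s: "s n \<le> t" "t - l / 2 ^ n \<le> s n" for n
    proof -
      have b: "0 < l / 2 ^ n" "(t - a) / l * 2 ^ n * (l / 2 ^ n) = t - a" using l by simp_all
      have "real (k n) * (l / 2 ^ n) \<le> (t - a) / l * 2 ^ n * (l / 2 ^ n)"
        using kx(1)[of n] b(1) by (intro mult_right_mono) auto
      then show "s n \<le> t" unfolding s_def b(2) by simp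
      have "(t - a) / l * 2 ^ n * (l / 2 ^ n) \<le> (real (k n) + 1) * (l / 2 ^ n)"
        using kx(2)[of n] b(1) by (intro mult_right_mono) auto
      then show "t - l / 2 ^ n \<le> s n" unfolding s_def b(2) distrib_right by linarith
    qed
    have "(\<lambda>n. t - l / 2 ^ n) \<longlonglongrightarrow> t - 0"
      by (intro tendsto_diff tendsto_const LIMSEQ_divide_realpow_zero) auto
    then have slim: "s \<longlonglongrightarrow> t"
      by (intro tendsto_sandwich[OF _ _ _ tendsto_const, of "\<lambda>n. t - l / 2 ^ n" s sequentially t]) (use s in auto)
    have "s n \<in> {a..a + l}" for n using s(1)[of n] t l by (auto simp: s_def)
    then have "(\<lambda>n. f (s n)) \<longlonglongrightarrow> f t"
      using continuous_on_tendsto_compose[OF f slim t] by simp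
    then have lim: "(\<lambda>n. \<bar>f (s n) - f a\<bar>) \<longlonglongrightarrow> \<bar>f t - f a\<bar>" by (intro tendsto_intros)
    have "\<bar>f (s n) - f a\<bar> \<le> e" for n
      unfolding s_def using grid[OF k_le, of n] c[of n] by linarith
    then show ?thesis by (intro LIMSEQ_le_const2[OF lim]) auto
  qed
qed

lemma pred_Bex_countable:
  assumes "countable D" "\<And>s. s \<in> D \<Longrightarrow> Measurable.pred K (P s)"
  shows "Measurable.pred K (\<lambda>x. \<exists>s\<in>D. P s x)"
proof -
  have "(\<Union>s\<in>D. {x \<in> space K. P s x}) \<in> sets K"
    using assms by (intro sets.countable_UN'') (auto simp: pred_def)
  also have "(\<Union>s\<in>D. {x \<in> space K. P s x}) = {x \<in> space K. \<exists>s\<in>D. P s x}" by auto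
  finally show ?thesis by (simp add: pred_def)
qed

context coalescing begin

text \<open>Coalescence quantifies over all real times and is not a measurable predicate. The
  transferred statement \<open>P\<close> says that a zero of the difference up to a rational time
  \<open>u\<close>, detected on a countable set by \<open>compact_zero_iff\<close>, forces equality
  at \<open>u\<close>; continuity of the given paths restores all real times.\<close>

lemma W_coalesce:
  "AE \<omega> in M. \<forall>i j s t. T i \<le> s \<longrightarrow> T j \<le> s \<longrightarrow> s \<le> t \<longrightarrow> W i s \<omega> = W j s \<omega> \<longrightarrow> W i t \<omega> = W j t \<omega>"
proof -
  define a where "a i j = max (T i) (T j)" for i j
  define D where "D i j u = insert (a i j) (\<rat> \<inter> {a i j..u})" for i j u
  define P where "P i j u y \<longleftrightarrow> (\<forall>n::nat. \<exists>s\<in>D i j u. \<bar>y (i, s) - y (j, s)\<bar> < 1 / Suc n) \<longrightarrow> \<bar>y (i, u) - y (j, u)\<bar> \<le> (0::real)"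
    for i j u and y :: "nat \<times> real \<Rightarrow> real"
  obtain N :: "(nat \<Rightarrow> real \<Rightarrow> real) measure" and B V where Dr: "driven N z B V" and law: "family_law M z W = family_law N z V"
    using W by (rule coalescing_BMs_driven)
  interpret D: driven N z B V by (rule Dr)
  have "AE \<omega> in M. P i j u (full z W \<omega>)" if u: "u \<in> \<rat>" "a i j \<le> u" for i j u
  proof -
    have c: "T i \<le> s" "T j \<le> s" if "s \<in> D i j u" for s using that by (auto simp: D_def a_def)
    have m: "(\<lambda>y. y (i, s)) \<in> borel_measurable (Pi\<^sub>M (path_dom z) (\<lambda>_. borel))"
      "(\<lambda>y. y (j, s)) \<in> borel_measurable (Pi\<^sub>M (path_dom z) (\<lambda>_. borel))" if "a i j \<le> s" for s
      by (rule measurable_component_singleton; use that in \<open>simp add: path_dom_def a_def\<close>)+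
    have 1: "Measurable.pred (Pi\<^sub>M (path_dom z) (\<lambda>_. borel)) (\<lambda>y. \<bar>y (i, s) - y (j, s)\<bar> < 1 / Suc n)"
      if "s \<in> D i j u" for s and n :: nat
    proof -
      have "a i j \<le> s" using that by (auto simp: D_def)
      note [measurable] = m[OF this]
      show ?thesis by measurable
    qed
    have 2: "Measurable.pred (Pi\<^sub>M (path_dom z) (\<lambda>_. borel)) (\<lambda>y. \<bar>y (i, u) - y (j, u)\<bar> \<le> (0::real))"
    proof -
      note [measurable] = m[OF u(2)]
      show ?thesis by measurable
    qed
    have "countable (D i j u)" by (auto simp: D_def intro: countable_Int1 countable_rat)
    then have Pm: "Measurable.pred (Pi\<^sub>M (path_dom z) (\<lambda>_. borel)) (P i j u)"
      unfolding P_def[abs_def] by (intro pred_intros_logic pred_intros_countable pred_Bex_countable 1 2)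
    have "P i j u (full z V \<omega>)" if \<omega>: "\<omega> \<in> space N" for \<omega>
      unfolding P_def
    proof
      assume "\<forall>n::nat. \<exists>s\<in>D i j u. \<bar>full z V \<omega> (i, s) - full z V \<omega> (j, s)\<bar> < 1 / Suc n"
      then have "\<forall>n::nat. \<exists>s\<in>D i j u. \<bar>V i s \<omega> - V j s \<omega>\<bar> < 1 / Suc n"
        using c by (simp add: full_apply del: of_nat_Suc)
      moreover have "continuous_on {a i j..} (\<lambda>s. V i s \<omega> - V j s \<omega>)"
        by (intro continuous_intros D.cont_V[OF \<omega>]) (auto simp: a_def)
      ultimately have "\<exists>s\<in>{a i j..u}. V i s \<omega> - V j s \<omega> = 0"
        using compact_zero_iff[OF _ u(2), of "\<lambda>s. V i s \<omega> - V j s \<omega>"] by (simp add: D_def)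
      then have "V i u \<omega> = V j u \<omega>" using D.coalesce[OF \<omega>, of i _ j u] by (auto simp: a_def)
      then show "\<bar>full z V \<omega> (i, u) - full z V \<omega> (j, u)\<bar> \<le> 0" using u by (simp add: full_apply a_def)
    qed
    then show ?thesis using driven_law(2)[OF Dr law Pm] by (auto intro!: AE_I2)
  qed
  then have "AE \<omega> in M. \<forall>i j. \<forall>u\<in>\<rat>. a i j \<le> u \<longrightarrow> P i j u (full z W \<omega>)"
    by (auto simp: AE_all_countable AE_ball_countable countable_rat intro: AE_impI)
  then show ?thesis using W_cont
  proof eventually_elim
    case (elim \<omega>)
    show ?case
    proof (intro allI impI)
      fix i j s t assume st: "T i \<le> s" "T j \<le> s" "s \<le> t" and eq: "W i s \<omega> = W j s \<omega>"
      have cont: "continuous_on {a i j..} (\<lambda>s. W i s \<omega> - W j s \<omega>)"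
        using elim(2) by (intro continuous_intros) (auto simp: a_def intro: continuous_on_subset)
      have rat: "W i u \<omega> = W j u \<omega>" if u: "u \<in> \<rat>" "s < u" for u
      proof -
        have au: "a i j \<le> u" using st u by (simp add: a_def)
        have "\<exists>s\<in>{a i j..u}. W i s \<omega> - W j s \<omega> = 0"
          using st u eq by (intro bexI[of _ s]) (auto simp: a_def)
        then have "\<forall>n::nat. \<exists>s\<in>D i j u. \<bar>W i s \<omega> - W j s \<omega>\<bar> < 1 / Suc n"
          using compact_zero_iff[OF cont au] by (simp add: D_def)
        moreover have "T i \<le> s" "T j \<le> s" if "s \<in> D i j u" for s using that by (auto simp: D_def a_def)
        ultimately have "\<forall>n::nat. \<exists>s\<in>D i j u. \<bar>full z W \<omega> (i, s) - full z W \<omega> (j, s)\<bar> < 1 / Suc n"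
          by (simp add: full_apply del: of_nat_Suc)
        then have "\<bar>full z W \<omega> (i, u) - full z W \<omega> (j, u)\<bar> \<le> 0"
          using elim(1) u au unfolding P_def by blast
        then show ?thesis using au by (simp add: full_apply a_def)
      qed
      show "W i t \<omega> = W j t \<omega>"
      proof (rule ccontr)
        assume ne: "W i t \<omega> \<noteq> W j t \<omega>"
        then have "s < t" using st eq by (cases "s = t") auto
        have "t \<in> {a i j..}" using st by (simp add: a_def)
        from cont[unfolded continuous_on_iff, rule_format, OF this, of "\<bar>W i t \<omega> - W j t \<omega>\<bar>"] ne
        obtain d where d: "d > 0" "\<And>x. a i j \<le> x \<Longrightarrow> \<bar>x - t\<bar> < d \<Longrightarrow> \<bar>(W i x \<omega> - W j x \<omega>) - (W i t \<omega> - W j t \<omega>)\<bar> < \<bar>W i t \<omega> - W j t \<omega>\<bar>"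
          by (auto simp: dist_real_def)
        obtain q where q: "q \<in> \<rat>" "max s (t - d) < q" "q < t"
          using Rats_dense_in_real[of "max s (t - d)" t] \<open>s < t\<close> d(1) by auto
        have "a i j \<le> q" "\<bar>q - t\<bar> < d" using q st by (auto simp: a_def)
        from d(2)[OF this] show False using rat[OF q(1)] q by auto
      qed
    qed
  qed
qed

text \<open>Dyadic chaining with weights \<open>(9/10) ^ n\<close>, which beat the growth \<open>2 ^ n\<close> of the number of
  increments because \<open>2 * (9/10) ^ 4 > 1\<close>.\<close>

lemma W_tube:
  assumes a: "T j \<le> a" and l: "0 < l" and e: "0 < e"
  obtains A where "A \<in> events" "prob A \<le> 450000 * l\<^sup>2 / e ^ 4"
    "\<And>\<omega>. \<omega> \<in> space M \<Longrightarrow> continuous_on {T j..} (\<lambda>t. W j t \<omega>) \<Longrightarrow> \<omega> \<notin> A \<Longrightarrow> \<forall>t\<in>{a..a + l}. \<bar>W j t \<omega> - W j a \<omega>\<bar> \<le> e"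
proof -
  \<comment> \<open>The factor \<open>e / 10\<close> makes the weights sum to \<open>e\<close>,
    since the geometric series with ratio \<open>9 / 10\<close> has sum \<open>10\<close>.\<close>
  define c where "c n = e / 10 * (9 / 10) ^ n" for n :: nat
  define p where "p n k = a + real k * (l / 2 ^ n)" for n k :: nat
  define A where "A n k = {\<omega> \<in> space M. c n < \<bar>W j (p n (Suc k)) \<omega> - W j (p n k) \<omega>\<bar>}" for n k
  define C where "C n = (\<Union>k<2 ^ n. A n k)" for n
  have p: "T j \<le> p n k" "p n k \<le> p n (Suc k)" "p n (Suc k) - p n k = l / 2 ^ n" for n k
  proof -
    have "0 \<le> real k * (l / 2 ^ n)" using l by simp
    then show "T j \<le> p n k" using a unfolding p_def by linarith
    show "p n (Suc k) - p n k = l / 2 ^ n" by (simp add: p_def field_simps)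
    moreover have "0 \<le> l / 2 ^ n" using l by simp
    ultimately show "p n k \<le> p n (Suc k)" by linarith
  qed
  have A_ev: "A n k \<in> events" for n k
  proof -
    note [measurable] = W_meas[OF p(1)]
    show ?thesis unfolding A_def by measurable
  qed
  have C_ev: "C n \<in> events" for n unfolding C_def using A_ev by auto
  \<comment> \<open>The ratio between consecutive levels: \<open>2 ^ n\<close> increments, each with
    squared length divided by \<open>4 ^ n\<close> and threshold power \<open>c n ^ 4\<close>. The
    prefactor \<open>90000\<close> is \<open>9 * 10 ^ 4\<close>, and the sum of the geometric
    series, bounded by \<open>5\<close>, turns it into \<open>450000\<close>.\<close>
  define r :: real where "r = 1 / (2 * (9 / 10) ^ 4)"
  have r: "0 < r" "r < 1" "1 / (1 - r) \<le> 5" by (simp_all add: r_def power4_eq_xxxx)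
  have C_prob: "prob (C n) \<le> 90000 * l\<^sup>2 / e ^ 4 * r ^ n" for n
  proof -
    have "prob (C n) \<le> (\<Sum>k<2 ^ n. prob (A n k))"
      unfolding C_def using A_ev by (intro finite_measure_subadditive_finite) auto
    also have "\<dots> \<le> (\<Sum>k<(2::nat) ^ n. 9 * (l / 2 ^ n)\<^sup>2 / c n ^ 4)"
    proof (rule sum_mono)
      fix k
      have "0 < c n" using e by (simp add: c_def)
      from W_fourth_moment[OF p(1,2) this, of n k] show "prob (A n k) \<le> 9 * (l / 2 ^ n)\<^sup>2 / c n ^ 4"
        by (simp only: A_def p(3))
    qed
    also have "\<dots> = 90000 * l\<^sup>2 / e ^ 4 * r ^ n"
    proof -
      define A B where "A = ((9 / 10 :: real) ^ 4) ^ n" and "B = (2 :: real) ^ n"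
      have AB: "0 < A" "0 < B" by (simp_all add: A_def B_def)
      have "((9 / 10 :: real) ^ n) ^ 4 = A"
        unfolding A_def by (simp only: mult.commute flip: power_mult)
      then have "c n ^ 4 = (e / 10) ^ 4 * A" by (simp only: c_def power_mult_distrib)
      then have 1: "c n ^ 4 = e ^ 4 / 10000 * A" by (simp add: power_divide)
      have 2: "r ^ n = 1 / (B * A)"
        by (simp only: r_def A_def B_def power_one_over power_mult_distrib)
      have 3: "(\<Sum>k<(2::nat) ^ n. 9 * (l / 2 ^ n)\<^sup>2 / c n ^ 4) = B * (9 * (l / B)\<^sup>2 / c n ^ 4)"
        by (simp add: B_def)
      show ?thesis unfolding 3 unfolding 2 1 using AB e by (simp add: field_simps power2_eq_square)
    qed
    finally show ?thesis .
  qed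
  have summ: "summable (\<lambda>n. 90000 * l\<^sup>2 / e ^ 4 * r ^ n)"
    using r by (intro summable_mult summable_geometric) auto
  have sC: "summable (\<lambda>n. prob (C n))"
    by (rule summable_comparison_test'[OF summ, of 0]) (use C_prob in simp)
  have "prob (\<Union>n. C n) \<le> (\<Sum>n. prob (C n))"
    using C_ev by (intro finite_measure_subadditive_countably sC) auto
  also have "\<dots> \<le> (\<Sum>n. 90000 * l\<^sup>2 / e ^ 4 * r ^ n)"
    by (intro suminf_le C_prob summ sC)
  also have "\<dots> = 90000 * l\<^sup>2 / e ^ 4 * (1 / (1 - r))"
    using r by (subst suminf_mult) (auto simp: suminf_geometric intro!: summable_geometric)
  also have "\<dots> \<le> 90000 * l\<^sup>2 / e ^ 4 * 5" using r e by (intro mult_left_mono) auto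
  finally have "prob (\<Union>n. C n) \<le> 450000 * l\<^sup>2 / e ^ 4" by simp
  moreover have "\<forall>t\<in>{a..a + l}. \<bar>W j t \<omega> - W j a \<omega>\<bar> \<le> e"
    if \<omega>: "\<omega> \<in> space M" "continuous_on {T j..} (\<lambda>t. W j t \<omega>)" "\<omega> \<notin> (\<Union>n. C n)" for \<omega>
  proof
    fix t assume t: "t \<in> {a..a + l}"
    show "\<bar>W j t \<omega> - W j a \<omega>\<bar> \<le> e"
    proof (rule dyadic_increments_bound[OF _ _ _ _ t, where c = c])
      show "continuous_on {a..a + l} (\<lambda>t. W j t \<omega>)" by (rule continuous_on_subset[OF \<omega>(2)]) (use a in auto)
      show "\<bar>W j (a + real (Suc k) * (l / 2 ^ n)) \<omega> - W j (a + real k * (l / 2 ^ n)) \<omega>\<bar> \<le> c n" if "k < 2 ^ n" for n k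
        using \<omega> that by (auto simp: C_def A_def p_def not_less)
      show "(\<Sum>m\<le>n. c m) \<le> e" for n
      proof -
        have "(\<Sum>m\<le>n. c m) = e / 10 * (\<Sum>m<Suc n. (9 / 10) ^ m)" by (simp add: c_def sum_distrib_left lessThan_Suc_atMost)
        also have "(\<Sum>m<Suc n. (9 / 10 :: real) ^ m) = 10 * (1 - (9 / 10) ^ Suc n)"
          by (subst sum_gp_strict) (simp add: field_simps)
        also have "e / 10 * \<dots> \<le> e / 10 * 10" using e by (intro mult_left_mono) auto
        finally show ?thesis by simp
      qed
    qed (use l in simp)
  qed
  ultimately show thesis using C_ev by (intro that[of "\<Union>n. C n"]) auto
qed

text \<open>On the event that the initial distance is at most \<open>m\<close>, the noncoalescence
  bound is evaluated after time \<open>(n + 1)\<^sup>2\<close>; the square root then gives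
  \<open>5 * m / (n + 1)\<close>, which tends to zero.\<close>

lemma W_meet: "AE \<omega> in M. \<forall>i j. \<exists>s\<ge>max (T i) (T j). W i s \<omega> = W j s \<omega>"
  unfolding AE_all_countable
proof (intro allI)
  fix i j
  define a where "a = max (T i) (T j)"
  have "AE \<omega> in M. \<forall>m::nat. \<exists>n::nat. \<omega> \<notin> {\<omega> \<in> space M. \<bar>W i a \<omega> - W j a \<omega>\<bar> \<le> real m} \<inter> {\<omega> \<in> space M. W i (a + (real (Suc n))\<^sup>2) \<omega> \<noteq> W j (a + (real (Suc n))\<^sup>2) \<omega>}"
    unfolding AE_all_countable
  proof
    fix m :: nat
    note [measurable] = W_meas[of i a] W_meas[of j a]
    show "AE \<omega> in M. \<exists>n::nat. \<omega> \<notin> {\<omega> \<in> space M. \<bar>W i a \<omega> - W j a \<omega>\<bar> \<le> real m} \<inter> {\<omega> \<in> space M. W i (a + (real (Suc n))\<^sup>2) \<omega> \<noteq> W j (a + (real (Suc n))\<^sup>2) \<omega>}"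
    proof (rule AE_ex_notin)
      fix n :: nat
      have Ta: "T i \<le> a" "T j \<le> a" by (auto simp: a_def)
      have past: "W i a \<in> borel_measurable (past M z W a)" "W j a \<in> borel_measurable (past M z W a)"
        by (auto intro: measurable_past Ta)
      have E: "{\<omega> \<in> space M. \<bar>W i a \<omega> - W j a \<omega>\<bar> \<le> real m} \<in> sets (past M z W a)"
      proof -
        note [measurable] = past
        have "{\<omega> \<in> space (past M z W a). \<bar>W i a \<omega> - W j a \<omega>\<bar> \<le> real m} \<in> sets (past M z W a)" by measurable
        then show ?thesis by simp
      qed
      have sM: "sets (past M z W a) \<subseteq> events" using past_subalgebra[OF W_meas] by (auto simp: subalgebra_def)
      have [measurable]: "W i (a + (real (Suc n))\<^sup>2) \<in> borel_measurable M" "W j (a + (real (Suc n))\<^sup>2) \<in> borel_measurable M"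
        using Ta by (auto intro!: W_meas add_increasing2)
      have D: "{\<omega> \<in> space M. W i (a + (real (Suc n))\<^sup>2) \<omega> \<noteq> W j (a + (real (Suc n))\<^sup>2) \<omega>} \<in> events" by measurable
      show "{\<omega> \<in> space M. \<bar>W i a \<omega> - W j a \<omega>\<bar> \<le> real m} \<inter> {\<omega> \<in> space M. W i (a + (real (Suc n))\<^sup>2) \<omega> \<noteq> W j (a + (real (Suc n))\<^sup>2) \<omega>} \<in> events"
        using E sM D by (intro sets.Int) auto
      have "prob ({\<omega> \<in> space M. \<bar>W i a \<omega> - W j a \<omega>\<bar> \<le> real m} \<inter> {\<omega> \<in> space M. W i (a + (real (Suc n))\<^sup>2) \<omega> \<noteq> W j (a + (real (Suc n))\<^sup>2) \<omega>})
        \<le> 5 * real m / sqrt (a + (real (Suc n))\<^sup>2 - a) * prob {\<omega> \<in> space M. \<bar>W i a \<omega> - W j a \<omega>\<bar> \<le> real m}"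
        by (rule W_noncoalescence[OF Ta _ E]) auto
      also have "\<dots> \<le> 5 * real m / sqrt (a + (real (Suc n))\<^sup>2 - a) * 1"
        by (intro mult_left_mono prob_le_1) auto
      finally show "prob ({\<omega> \<in> space M. \<bar>W i a \<omega> - W j a \<omega>\<bar> \<le> real m} \<inter> {\<omega> \<in> space M. W i (a + (real (Suc n))\<^sup>2) \<omega> \<noteq> W j (a + (real (Suc n))\<^sup>2) \<omega>})
        \<le> 5 * real m / real (Suc n)" by simp
    next
      show "(\<lambda>n. 5 * real m / real (Suc n)) \<longlonglongrightarrow> 0" by (rule LIMSEQ_Suc[OF lim_const_over_n])
    qed
  qed
  then show "AE \<omega> in M. \<exists>s\<ge>max (T i) (T j). W i s \<omega> = W j s \<omega>"
  proof (rule AE_mp, intro AE_I2 impI)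
    fix \<omega> assume \<omega>: "\<omega> \<in> space M" and *: "\<forall>m::nat. \<exists>n::nat. \<omega> \<notin> {\<omega> \<in> space M. \<bar>W i a \<omega> - W j a \<omega>\<bar> \<le> real m} \<inter> {\<omega> \<in> space M. W i (a + (real (Suc n))\<^sup>2) \<omega> \<noteq> W j (a + (real (Suc n))\<^sup>2) \<omega>}"
    obtain m :: nat where m: "\<bar>W i a \<omega> - W j a \<omega>\<bar> \<le> real m" using real_arch_simple by blast
    obtain n :: nat where "W i (a + (real (Suc n))\<^sup>2) \<omega> = W j (a + (real (Suc n))\<^sup>2) \<omega>"
      using *[rule_format, of m] m \<omega> by blast
    then show "\<exists>s\<ge>max (T i) (T j). W i s \<omega> = W j s \<omega>"
      by (intro exI[of _ "a + (real (Suc n))\<^sup>2"]) (auto simp: a_def[symmetric])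
  qed
qed

end

lemma dense_point:
  fixes z :: "nat \<Rightarrow> real \<times> real"
  assumes "closure (range z) = UNIV" "a < b" "0 < e"
  obtains k where "a < snd (z k)" "snd (z k) < b" "\<bar>fst (z k) - x\<bar> < e"
proof -
  let ?U = "{x - e<..<x + e} \<times> {a<..<b}"
  have "open ?U" by (intro open_Times) auto
  moreover have "(x, (a + b) / 2) \<in> ?U" using assms by auto
  ultimately have "?U \<inter> range z \<noteq> {}"
    using open_Int_closure_eq_empty[of ?U "range z"] assms(1) by auto
  then obtain p where p: "p \<in> ?U" "p \<in> range z" by blast
  from p(2) obtain k where "p = z k" by (elim rangeE)
  with p(1) have "z k \<in> ?U" by simp
  then show thesis by (intro that[of k]) (auto simp: mem_Times_iff abs_less_iff)
qed

text \<open>One skeleton path is chosen for every cell of a grid with time mesh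
  \<open>1 / Suc n\<close> and space mesh \<open>1 / m\<close>. A tube fails with probability of
  order \<open>1 / n\<^sup>2\<close> while the number of cells grows only like \<open>n\<close>, so
  for some \<open>n\<close> no tube fails. The tolerance is three times \<open>1 / m\<close>:
  oscillation of the path, distance of its start from the grid point, and distance of the grid point
  from \<open>y\<close>.\<close>

lemma (in coalescing) W_tubes:
  assumes dense: "closure (range z) = UNIV"
  shows "AE \<omega> in M. \<forall>m::nat. \<exists>d>0. \<forall>(t::real) (y::real). \<bar>t\<bar> \<le> Suc m \<longrightarrow> \<bar>y\<bar> \<le> Suc m \<longrightarrow>
    (\<exists>k. T k \<le> t - d \<and> (\<forall>s\<in>{t - d..t + d}. \<bar>W k s \<omega> - y\<bar> \<le> 3 / Suc m))"
  unfolding AE_all_countable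
proof
  fix m' :: nat
  define m where "m = Suc m'"
  have m: "0 < m" by (simp add: m_def)
  \<comment> \<open>The path starts between grid times \<open>q - 2\<close> and \<open>q - 1\<close>
    and is controlled until \<open>q + 2\<close>. If \<open>t\<close> lies in cell \<open>q\<close>,
    this window contains one mesh width on either side of \<open>t\<close> and has length at most
    four meshes.\<close>
  define G where "G n q l k A \<longleftrightarrow> A \<in> events \<and> prob A \<le> 450000 * (4 / Suc n)\<^sup>2 / (1 / m) ^ 4 \<and> T k < real_of_int (q - 1) / Suc n \<and> \<bar>fst (z k) - real_of_int l / m\<bar> < 1 / m \<and>
      (\<forall>\<omega>\<in>space M. continuous_on {T k..} (\<lambda>t. W k t \<omega>) \<longrightarrow> \<omega> \<notin> A \<longrightarrow> (\<forall>t\<in>{T k..real_of_int (q + 2) / Suc n}. \<bar>W k t \<omega> - W k (T k) \<omega>\<bar> \<le> 1 / m))"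
    for n :: nat and q l :: int and k A
  have "\<exists>k A. G n q l k A" for n :: nat and q l :: int
  proof -
    have "real_of_int (q - 2) / Suc n < real_of_int (q - 1) / Suc n" by (intro divide_strict_right_mono) auto
    then obtain k where k: "real_of_int (q - 2) / Suc n < T k" "T k < real_of_int (q - 1) / Suc n" "\<bar>fst (z k) - real_of_int l / m\<bar> < 1 / m"
      using dense_point[OF dense, of "real_of_int (q - 2) / Suc n" "real_of_int (q - 1) / Suc n" "1 / m" "l / m"] m by auto
    define len where "len = real_of_int (q + 2) / Suc n - T k"
    have "real_of_int (q - 1) / Suc n < real_of_int (q + 2) / Suc n" by (intro divide_strict_right_mono) auto
    then have len: "0 < len" using k(2) by (simp add: len_def)
    have "real_of_int (q + 2) / Suc n - real_of_int (q - 2) / Suc n = 4 / Suc n" by (simp add: diff_divide_distrib[symmetric])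
    then have len': "len \<le> 4 / Suc n" using k(1) by (simp add: len_def)
    obtain A where A: "A \<in> events" "prob A \<le> 450000 * len\<^sup>2 / (1 / m) ^ 4"
      "\<And>\<omega>. \<omega> \<in> space M \<Longrightarrow> continuous_on {T k..} (\<lambda>t. W k t \<omega>) \<Longrightarrow> \<omega> \<notin> A \<Longrightarrow> \<forall>t\<in>{T k..T k + len}. \<bar>W k t \<omega> - W k (T k) \<omega>\<bar> \<le> 1 / m"
      using W_tube[OF order_refl len, of "1 / m" k] m by auto
    have "450000 * len\<^sup>2 / (1 / m) ^ 4 \<le> 450000 * (4 / Suc n)\<^sup>2 / (1 / m) ^ 4"
      using len len' by (intro divide_right_mono mult_left_mono power_mono) auto
    moreover have "T k + len = real_of_int (q + 2) / Suc n" by (simp add: len_def)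
    ultimately show ?thesis using A k unfolding G_def by (intro exI[of _ k] exI[of _ A]) auto
  qed
  then have "\<forall>x. \<exists>p. G (fst x) (fst (snd x)) (snd (snd x)) (fst p) (snd p)" by auto
  from choice[OF this] obtain f where f: "\<And>x. G (fst x) (fst (snd x)) (snd (snd x)) (fst (f x)) (snd (f x))" by blast
  define \<kappa> where "\<kappa> n q l = fst (f (n, q, l))" for n q l
  define A where "A n q l = snd (f (n, q, l))" for n q l
  have G: "G n q l (\<kappa> n q l) (A n q l)" for n q l using f[of "(n, q, l)"] by (simp add: \<kappa>_def A_def)
  have A: "\<And>n q l. A n q l \<in> events" "\<And>n q l. prob (A n q l) \<le> 450000 * (4 / Suc n)\<^sup>2 / (1 / m) ^ 4"
    and \<kappa>: "\<And>n q l. T (\<kappa> n q l) < real_of_int (q - 1) / Suc n" "\<And>n q l. \<bar>fst (z (\<kappa> n q l)) - real_of_int l / m\<bar> < 1 / m"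
    and tube: "\<And>n q l \<omega>. \<omega> \<in> space M \<Longrightarrow> continuous_on {T (\<kappa> n q l)..} (\<lambda>t. W (\<kappa> n q l) t \<omega>) \<Longrightarrow> \<omega> \<notin> A n q l \<Longrightarrow>
        \<forall>t\<in>{T (\<kappa> n q l)..real_of_int (q + 2) / Suc n}. \<bar>W (\<kappa> n q l) t \<omega> - W (\<kappa> n q l) (T (\<kappa> n q l)) \<omega>\<bar> \<le> 1 / m"
    for q l :: int
    by (use G in \<open>simp_all add: G_def\<close>)
  define Q where "Q n = {- int m * int (Suc n)..int m * int (Suc n)}" for n
  define L where "L = {- int m * int m..int m * int m}"
  define Bad where "Bad n = (\<Union>q\<in>Q n. \<Union>l\<in>L. A n q l)" for n
  define C where "C = card L * (450000 * 16 / (1 / real m) ^ 4)"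
  have "AE \<omega> in M. \<exists>n. \<omega> \<notin> Bad n"
  proof (rule AE_ex_notin)
    fix n
    show "Bad n \<in> events" using A(1) by (auto simp: Bad_def Q_def L_def)
    have "prob (Bad n) \<le> (\<Sum>q\<in>Q n. prob (\<Union>l\<in>L. A n q l))"
      unfolding Bad_def using A(1) by (intro finite_measure_subadditive_finite) (auto simp: Q_def L_def)
    also have "\<dots> \<le> (\<Sum>q\<in>Q n. \<Sum>l\<in>L. prob (A n q l))"
      using A(1) by (intro sum_mono finite_measure_subadditive_finite) (auto simp: L_def)
    also have "\<dots> \<le> (\<Sum>q\<in>Q n. \<Sum>l\<in>L. 450000 * (4 / Suc n)\<^sup>2 / (1 / m) ^ 4)"
      by (intro sum_mono A(2))
    also have "\<dots> = real (card (Q n)) * (C / (real (Suc n))\<^sup>2)"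
      by (simp add: C_def power_divide)
    also have "real (card (Q n)) = 2 * m * Suc n + 1" by (simp add: Q_def algebra_simps)
    also have "(2 * m * Suc n + 1) * (C / (real (Suc n))\<^sup>2) \<le> (3 * m * Suc n) * (C / (real (Suc n))\<^sup>2)"
    proof (rule mult_right_mono)
      have "1 \<le> m * Suc n" using m by simp
      then have "2 * m * Suc n + 1 \<le> 3 * m * Suc n" by linarith
      then show "real (2 * m * Suc n + 1) \<le> real (3 * m * Suc n)" by (simp only: of_nat_le_iff)
    qed (simp add: C_def)
    also have "\<dots> = 3 * m * C / Suc n"
      by (simp add: power2_eq_square del: of_nat_Suc mult_Suc_right)
    finally show "prob (Bad n) \<le> 3 * m * C / Suc n" .
    show "(\<lambda>n. 3 * m * C / Suc n) \<longlonglongrightarrow> 0" by (rule LIMSEQ_Suc[OF lim_const_over_n])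
  qed
  then show "AE \<omega> in M. \<exists>d>0. \<forall>(t::real) (y::real). \<bar>t\<bar> \<le> Suc m' \<longrightarrow> \<bar>y\<bar> \<le> Suc m' \<longrightarrow>
    (\<exists>k. T k \<le> t - d \<and> (\<forall>s\<in>{t - d..t + d}. \<bar>W k s \<omega> - y\<bar> \<le> 3 / Suc m'))"
    using W_cont W_start AE_space
  proof eventually_elim
    case (elim \<omega>)
    then obtain n where n: "\<omega> \<notin> Bad n" by auto
    let ?d = "1 / real (Suc n)"
    have "\<exists>k. T k \<le> t - ?d \<and> (\<forall>s\<in>{t - ?d..t + ?d}. \<bar>W k s \<omega> - y\<bar> \<le> 3 / m)"
      if t: "\<bar>t\<bar> \<le> m" and y: "\<bar>y\<bar> \<le> m" for t y :: real
    proof -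
      define q where "q = \<lfloor>t * Suc n\<rfloor>"
      define l where "l = \<lfloor>y * m\<rfloor>"
      have qt: "real_of_int q \<le> t * Suc n" "t * Suc n < real_of_int q + 1" unfolding q_def by linarith+
      have ly: "real_of_int l \<le> y * m" "y * m < real_of_int l + 1" unfolding l_def by linarith+
      have floor_mem: "\<lfloor>x * real c\<rfloor> \<in> {- int m * int c..int m * int c}" if "\<bar>x\<bar> \<le> m" for x :: real and c :: nat
      proof -
        have "\<bar>x * real c\<bar> \<le> real m * real c" using that by (simp add: abs_mult mult_right_mono)
        then show ?thesis by (simp add: le_floor_iff floor_le_iff abs_le_iff)
      qed
      have "q \<in> Q n" "l \<in> L" using floor_mem[OF t, of "Suc n"] floor_mem[OF y, of m] by (simp_all add: q_def l_def Q_def L_def)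
      then have nA: "\<omega> \<notin> A n q l" using n by (auto simp: Bad_def)
      define k where "k = \<kappa> n q l"
      have k1: "T k < real_of_int (q - 1) / Suc n" unfolding k_def by (rule \<kappa>(1))
      have k2: "\<bar>fst (z k) - real_of_int l / m\<bar> < 1 / m" unfolding k_def by (rule \<kappa>(2))
      have k3: "\<forall>t\<in>{T k..real_of_int (q + 2) / Suc n}. \<bar>W k t \<omega> - W k (T k) \<omega>\<bar> \<le> 1 / m"
        unfolding k_def by (rule tube[OF elim(4) _ nA]) (use elim(2) in blast)
      note k = k1 k2 k3
      have qn: "real_of_int (q - 1) / Suc n \<le> t - ?d" "t + ?d \<le> real_of_int (q + 2) / Suc n"
        using qt by (simp_all add: divide_le_eq le_divide_eq left_diff_distrib distrib_right del: of_nat_Suc)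
      have "l / m - y = (l - y * m) / m" using m by (simp add: diff_divide_distrib)
      moreover have "\<bar>l - y * m\<bar> \<le> 1" using ly by (simp add: abs_le_iff)
      ultimately have ym: "\<bar>l / m - y\<bar> \<le> 1 / m" by (simp add: divide_right_mono)
      show ?thesis
      proof (intro exI[of _ k] conjI ballI)
        show "T k \<le> t - ?d" using k(1) qn(1) by linarith
        fix s assume "s \<in> {t - ?d..t + ?d}"
        then have "s \<in> {T k..real_of_int (q + 2) / Suc n}" using k(1) qn by auto
        then have "\<bar>W k s \<omega> - fst (z k)\<bar> \<le> 1 / m" using k(3) elim(3) by auto
        then have "\<bar>W k s \<omega> - y\<bar> \<le> 1 / m + 1 / m + 1 / m" using k(2) ym by linarith
        then show "\<bar>W k s \<omega> - y\<bar> \<le> 3 / m" by simp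
      qed
    qed
    then show ?case unfolding m_def[symmetric] by (intro exI[of _ ?d] conjI allI impI) simp_all
  qed
qed

section \<open>Forward against backward paths\<close>

definition flip :: "(nat \<Rightarrow> real \<times> real) \<Rightarrow> nat \<Rightarrow> real \<times> real" where
  "flip z j = (fst (z j), - snd (z j))"

locale double_web = prob_space M for M :: "'w measure" +
  fixes z :: "nat \<Rightarrow> real \<times> real" and W Wb :: "nat \<Rightarrow> real \<Rightarrow> 'w \<Rightarrow> real"
  assumes dense: "closure (range z) = UNIV" and skeleton: "double_web_skeleton M z W Wb"
begin

sublocale coalescing M z W
  using skeleton by unfold_locales (simp add: double_web_skeleton_def)

lemma bwd: "coalescing M (flip z) (\<lambda>j t. Wb j (- t))"
  using skeleton unfolding coalescing_def coalescing_axioms_def flip_def[abs_def]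
  by (simp add: double_web_skeleton_def backward_coalescing_BMs_def prob_space_axioms)

lemma Wb_meas: "t \<le> T k \<Longrightarrow> Wb k t \<in> borel_measurable M"
  using coalescing.W_meas[OF bwd, of k "- t"] by (simp add: flip_def)

lemma Wb_start: "AE \<omega> in M. \<forall>k. Wb k (T k) \<omega> = fst (z k)"
  using coalescing.W_start[OF bwd] by (simp add: flip_def)

lemma Wb_cont: "AE \<omega> in M. \<forall>k. continuous_on {..T k} (\<lambda>t. Wb k t \<omega>)"
  using coalescing.W_cont[OF bwd]
proof eventually_elim
  case (elim \<omega>)
  show ?case
  proof
    fix k
    have "continuous_on {..T k} ((\<lambda>t. Wb k (- t) \<omega>) \<circ> uminus)"
      by (intro continuous_on_compose continuous_intros continuous_on_subset[OF elim[rule_format, of k]]) (auto simp: flip_def)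
    then show "continuous_on {..T k} (\<lambda>t. Wb k t \<omega>)" by (simp add: comp_def)
  qed
qed

lemma no_cross:
  "AE \<omega> in M. \<forall>i j s t. s \<in> {T i..T j} \<longrightarrow> t \<in> {T i..T j} \<longrightarrow> W i s \<omega> < Wb j s \<omega> \<longrightarrow> W i t \<omega> \<le> Wb j t \<omega>"
proof -
  have "AE \<omega> in M. \<forall>i j. \<not> crosses {T i..T j} (\<lambda>t. W i t \<omega>) (\<lambda>t. Wb j t \<omega>)"
    using skeleton by (simp add: double_web_skeleton_def)
  then show ?thesis
    by (rule eventually_mono) (unfold crosses_def, meson not_le)
qed

lemma no_cross':
  "AE \<omega> in M. \<forall>i j s t. s \<in> {T i..T j} \<longrightarrow> t \<in> {T i..T j} \<longrightarrow> Wb j s \<omega> < W i s \<omega> \<longrightarrow> Wb j t \<omega> \<le> W i t \<omega>"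
  using no_cross by (rule eventually_mono) (meson not_le)

lemma past_sub: "sets (past M z W u) \<subseteq> events"
  using past_subalgebra[OF W_meas] by (auto simp: subalgebra_def)

lemma sets_past_rel:
  assumes "T i \<le> t" "t \<le> u" "S \<in> sets borel"
  shows "{\<omega> \<in> space M. W i t \<omega> \<in> S} \<in> sets (past M z W u)"
proof -
  have "W i t -` S \<inter> space (past M z W u) \<in> sets (past M z W u)"
    using measurable_past[where z = z and j = i and V = W and N = M, OF assms(1,2)] assms(3) by (rule measurable_sets)
  also have "W i t -` S \<inter> space (past M z W u) = {\<omega> \<in> space M. W i t \<omega> \<in> S}" by auto
  finally show ?thesis .
qed

text \<open>Two forward paths started on both sides of \<open>(y, u)\<close> are kept apart up to time \<open>T k\<close> by any
  backward path that passes between them.\<close>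

lemma prob_past_near_bwd:
  assumes u: "u < T k" and E: "E \<in> sets (past M z W u)" and \<delta>: "0 < \<delta>"
  shows "prob (E \<inter> {\<omega> \<in> space M. \<bar>Wb k u \<omega> - y\<bar> < 2 * \<delta>}) \<le> 40 * \<delta> / sqrt (T k - u) * prob E"
proof (rule field_le_epsilon)
  fix \<epsilon> :: real assume \<epsilon>: "0 < \<epsilon>"
  \<comment> \<open>Chosen so that a forward path that starts within time \<open>\<eta>\<close>
    before \<open>u\<close> and within \<open>\<delta> / 2\<close> of a target misses the target at
    time \<open>u\<close> by more than \<open>\<delta>\<close> with probability at most
    \<open>\<epsilon> / 2\<close>.\<close>
  define \<eta> where "\<eta> = sqrt (\<epsilon> / 2 * (\<delta> / 2) ^ 4 / 9)"
  have \<eta>: "0 < \<eta>" "9 * \<eta>\<^sup>2 / (\<delta> / 2) ^ 4 = \<epsilon> / 2" using \<epsilon> \<delta> by (simp_all add: \<eta>_def)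
  have near: "\<exists>l. T l \<le> u \<and> prob {\<omega> \<in> space M. \<delta> < \<bar>W l u \<omega> - x\<bar>} \<le> \<epsilon> / 2" for x
  proof -
    obtain l where l: "u - \<eta> < T l" "T l < u" "\<bar>fst (z l) - x\<bar> < \<delta> / 2"
      using dense_point[OF dense, of "u - \<eta>" u "\<delta> / 2" x] \<eta> \<delta> by auto
    note [measurable] = W_meas[OF less_imp_le[OF l(2)]] W_meas[OF order_refl, of l]
    have "prob {\<omega> \<in> space M. \<delta> < \<bar>W l u \<omega> - x\<bar>} \<le> prob {\<omega> \<in> space M. \<delta> / 2 < \<bar>W l u \<omega> - W l (T l) \<omega>\<bar>}"
    proof (rule finite_measure_mono_AE)
      show "AE \<omega> in M. \<omega> \<in> {\<omega> \<in> space M. \<delta> < \<bar>W l u \<omega> - x\<bar>} \<longrightarrow> \<omega> \<in> {\<omega> \<in> space M. \<delta> / 2 < \<bar>W l u \<omega> - W l (T l) \<omega>\<bar>}"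
        using W_start
      proof eventually_elim
        case (elim \<omega>)
        then have "W l (T l) \<omega> = fst (z l)" by simp
        then have "\<delta> < \<bar>W l u \<omega> - x\<bar> \<Longrightarrow> \<delta> / 2 < \<bar>W l u \<omega> - W l (T l) \<omega>\<bar>" using l(3) by linarith
        then show ?case by simp
      qed
    qed measurable
    also have "\<dots> \<le> 9 * (u - T l)\<^sup>2 / (\<delta> / 2) ^ 4" using l \<delta> by (intro W_fourth_moment) auto
    also have "\<dots> \<le> 9 * \<eta>\<^sup>2 / (\<delta> / 2) ^ 4" using l \<delta> by (intro divide_right_mono mult_left_mono power_mono) auto
    finally show ?thesis using \<eta> l by (intro exI[of _ l]) auto
  qed
  obtain l where l: "T l \<le> u" "prob {\<omega> \<in> space M. \<delta> < \<bar>W l u \<omega> - (y - 3 * \<delta>)\<bar>} \<le> \<epsilon> / 2" using near by blast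
  obtain r where r: "T r \<le> u" "prob {\<omega> \<in> space M. \<delta> < \<bar>W r u \<omega> - (y + 3 * \<delta>)\<bar>} \<le> \<epsilon> / 2" using near by blast
  note [measurable] = W_meas[OF l(1)] W_meas[OF r(1)] Wb_meas[OF less_imp_le[OF u]]
  have [measurable]: "W l (T k) \<in> borel_measurable M" "W r (T k) \<in> borel_measurable M" using l r u by (auto intro!: W_meas)
  \<comment> \<open>On \<open>El\<close> and \<open>Er\<close> the two forward paths enclose all
    points at distance less than \<open>2 * \<delta>\<close> from \<open>y\<close>, and they are at
    most \<open>8 * \<delta>\<close> apart, which gives the constant
    \<open>40 = 5 * 8\<close>.\<close>
  define El where "El = {\<omega> \<in> space M. W l u \<omega> \<in> {y - 4 * \<delta>..y - 2 * \<delta>}}"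
  define Er where "Er = {\<omega> \<in> space M. W r u \<omega> \<in> {y + 2 * \<delta>..y + 4 * \<delta>}}"
  define E' where "E' = E \<inter> El \<inter> Er"
  have E': "E' \<in> sets (past M z W u)"
    unfolding E'_def El_def Er_def using E l r by (intro sets.Int sets_past_rel) auto
  have EM: "E \<in> events" "E' \<in> events" using E E' past_sub by auto
  have D: "{\<omega> \<in> space M. W l (T k) \<omega> \<noteq> W r (T k) \<omega>} \<in> events" by measurable
  have dl: "{\<omega> \<in> space M. \<delta> < \<bar>W l u \<omega> - (y - 3 * \<delta>)\<bar>} \<in> events" "{\<omega> \<in> space M. \<delta> < \<bar>W r u \<omega> - (y + 3 * \<delta>)\<bar>} \<in> events" by measurable
  have "prob (E \<inter> {\<omega> \<in> space M. \<bar>Wb k u \<omega> - y\<bar> < 2 * \<delta>}) \<le> prob ({\<omega> \<in> space M. \<delta> < \<bar>W l u \<omega> - (y - 3 * \<delta>)\<bar>} \<union>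
      {\<omega> \<in> space M. \<delta> < \<bar>W r u \<omega> - (y + 3 * \<delta>)\<bar>} \<union> (E' \<inter> {\<omega> \<in> space M. W l (T k) \<omega> \<noteq> W r (T k) \<omega>}))"
  proof (rule finite_measure_mono_AE)
    have Tl: "T l < T k" "T r < T k" using l r u by auto
    show "AE \<omega> in M. \<omega> \<in> E \<inter> {\<omega> \<in> space M. \<bar>Wb k u \<omega> - y\<bar> < 2 * \<delta>} \<longrightarrow> \<omega> \<in> {\<omega> \<in> space M. \<delta> < \<bar>W l u \<omega> - (y - 3 * \<delta>)\<bar>} \<union>
      {\<omega> \<in> space M. \<delta> < \<bar>W r u \<omega> - (y + 3 * \<delta>)\<bar>} \<union> (E' \<inter> {\<omega> \<in> space M. W l (T k) \<omega> \<noteq> W r (T k) \<omega>})"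
      using no_cross no_cross' Wb_start W_ne_const[OF Tl(1), of "fst (z k)"] W_ne_const[OF Tl(2), of "fst (z k)"]
    proof eventually_elim
      case (elim \<omega>)
      show ?case
      proof (intro impI)
        assume \<omega>: "\<omega> \<in> E \<inter> {\<omega> \<in> space M. \<bar>Wb k u \<omega> - y\<bar> < 2 * \<delta>}"
        show "\<omega> \<in> {\<omega> \<in> space M. \<delta> < \<bar>W l u \<omega> - (y - 3 * \<delta>)\<bar>} \<union>
          {\<omega> \<in> space M. \<delta> < \<bar>W r u \<omega> - (y + 3 * \<delta>)\<bar>} \<union> (E' \<inter> {\<omega> \<in> space M. W l (T k) \<omega> \<noteq> W r (T k) \<omega>})"
        proof (rule ccontr)
          assume n: "\<not> ?thesis"
          then have dev: "\<bar>W l u \<omega> - (y - 3 * \<delta>)\<bar> \<le> \<delta>" "\<bar>W r u \<omega> - (y + 3 * \<delta>)\<bar> \<le> \<delta>" using \<omega> by auto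
          then have "\<omega> \<in> E'" using \<omega> by (auto simp: E'_def El_def Er_def abs_le_iff)
          then have eq: "W l (T k) \<omega> = W r (T k) \<omega>" using n \<omega> by auto
          have "W l u \<omega> < Wb k u \<omega>" "Wb k u \<omega> < W r u \<omega>" using dev \<omega> by (auto simp: abs_le_iff abs_less_iff)
          then have "W l (T k) \<omega> \<le> Wb k (T k) \<omega>" "Wb k (T k) \<omega> \<le> W r (T k) \<omega>"
            using elim(1)[rule_format, of u l k "T k"] elim(2)[rule_format, of u r k "T k"] l r u by auto
          \<comment> \<open>If the enclosing paths had met by time \<open>T k\<close>, both would
            sit at the deterministic starting position of the backward path, an event of probability
            zero by \<open>W_ne_const\<close>.\<close>
          then show False using elim(3-5) eq by auto
        qed
      qed
    qed
    show "{\<omega> \<in> space M. \<delta> < \<bar>W l u \<omega> - (y - 3 * \<delta>)\<bar>} \<union>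
      {\<omega> \<in> space M. \<delta> < \<bar>W r u \<omega> - (y + 3 * \<delta>)\<bar>} \<union> (E' \<inter> {\<omega> \<in> space M. W l (T k) \<omega> \<noteq> W r (T k) \<omega>}) \<in> events"
      using dl D EM by (intro sets.Un sets.Int)
  qed
  also have "\<dots> \<le> prob {\<omega> \<in> space M. \<delta> < \<bar>W l u \<omega> - (y - 3 * \<delta>)\<bar>} + prob {\<omega> \<in> space M. \<delta> < \<bar>W r u \<omega> - (y + 3 * \<delta>)\<bar>} +
      prob (E' \<inter> {\<omega> \<in> space M. W l (T k) \<omega> \<noteq> W r (T k) \<omega>})"
    using dl D EM by (intro order_trans[OF measure_Un_le] add_mono order_refl measure_Un_le sets.Un sets.Int) auto
  also have "\<dots> \<le> \<epsilon> / 2 + \<epsilon> / 2 + 5 * (8 * \<delta>) / sqrt (T k - u) * prob E'"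
    using l r \<delta> by (intro add_mono W_noncoalescence[OF l(1) r(1) u E']) (auto simp: E'_def El_def Er_def abs_le_iff)
  also have "prob E' \<le> prob E" using EM by (intro finite_measure_mono) (auto simp: E'_def)
  then have "\<epsilon> / 2 + \<epsilon> / 2 + 5 * (8 * \<delta>) / sqrt (T k - u) * prob E' \<le> 40 * \<delta> / sqrt (T k - u) * prob E + \<epsilon>"
    using \<delta> u mult_left_mono[of "prob E'" "prob E" "5 * (8 * \<delta>) / sqrt (T k - u)"] by simp
  finally show "prob (E \<inter> {\<omega> \<in> space M. \<bar>Wb k u \<omega> - y\<bar> < 2 * \<delta>}) \<le> 40 * \<delta> / sqrt (T k - u) * prob E + \<epsilon>" .
qed

text \<open>The events \<open>E a\<close> are almost surely disjoint, so their probabilities sum to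
  at most one and the bound does not depend on the number of cells. Time and position may vary with
  the cell, which permits random times that take finitely many values.\<close>

lemma prob_cells_near_bwd:
  assumes S: "finite S" and \<eta>: "0 < \<eta>" and \<delta>: "0 < \<delta>"
    and u: "\<And>a. a \<in> S \<Longrightarrow> u a \<le> T k - \<eta>" and E: "\<And>a. a \<in> S \<Longrightarrow> E a \<in> sets (past M z W (u a))"
    and disj: "AE \<omega> in M. \<forall>a\<in>S. \<forall>b\<in>S. \<omega> \<in> E a \<longrightarrow> \<omega> \<in> E b \<longrightarrow> a = b"
  shows "(\<Union>a\<in>S. E a \<inter> {\<omega> \<in> space M. \<bar>Wb k (u a) \<omega> - y a\<bar> < 2 * \<delta>}) \<in> events" (is "(\<Union>a\<in>S. ?A a) \<in> _")
    and "prob (\<Union>a\<in>S. E a \<inter> {\<omega> \<in> space M. \<bar>Wb k (u a) \<omega> - y a\<bar> < 2 * \<delta>}) \<le> 40 * \<delta> / sqrt \<eta>"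
proof -
  have EM: "a \<in> S \<Longrightarrow> E a \<in> events" for a using E past_sub by auto
  have A: "?A a \<in> events" if "a \<in> S" for a
  proof -
    have "u a \<le> T k" using u[OF that] \<eta> by simp
    note [measurable] = Wb_meas[OF this]
    have "{\<omega> \<in> space M. \<bar>Wb k (u a) \<omega> - y a\<bar> < 2 * \<delta>} \<in> events" by measurable
    then show ?thesis using EM[OF that] by auto
  qed
  then show "(\<Union>a\<in>S. ?A a) \<in> events" using S by auto
  have "(\<Sum>a\<in>S. prob (E a)) = expectation (\<lambda>\<omega>. \<Sum>a\<in>S. indicator (E a) \<omega>)"
    using EM by (subst Bochner_Integration.integral_sum) (auto simp: emeasure_eq_measure)
  also have "\<dots> \<le> expectation (\<lambda>_. 1)"
  proof (rule integral_mono_AE)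
    show "AE \<omega> in M. (\<Sum>a\<in>S. indicator (E a) \<omega>) \<le> (1 :: real)"
      using disj
    proof eventually_elim
      case (elim \<omega>)
      show ?case
      proof (cases "\<exists>a\<in>S. \<omega> \<in> E a")
        case True
        then obtain a where a: "a \<in> S" "\<omega> \<in> E a" by auto
        then have "(\<Sum>b\<in>S. indicator (E b) \<omega> :: real) = (\<Sum>b\<in>S. if b = a then 1 else 0)"
          using elim by (intro sum.cong) (auto simp: indicator_def)
        also have "\<dots> \<le> 1" using S by simp
        finally show ?thesis .
      next
        case False
        then have "(\<Sum>a\<in>S. indicator (E a) \<omega>) = (0 :: real)" by (intro sum.neutral) auto
        then show ?thesis by simp
      qed
    qed
  qed (use EM S in \<open>auto simp: emeasure_eq_measure intro!: Bochner_Integration.integrable_sum\<close>)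
  finally have le1: "(\<Sum>a\<in>S. prob (E a)) \<le> 1" by (simp add: prob_space)
  have "prob (\<Union>a\<in>S. ?A a) \<le> (\<Sum>a\<in>S. prob (?A a))"
    using S A by (intro finite_measure_subadditive_finite) auto
  also have "\<dots> \<le> (\<Sum>a\<in>S. 40 * \<delta> / sqrt \<eta> * prob (E a))"
  proof (rule sum_mono)
    fix a assume a: "a \<in> S"
    have "u a < T k" using u[OF a] \<eta> by simp
    then have "prob (?A a) \<le> 40 * \<delta> / sqrt (T k - u a) * prob (E a)"
      by (rule prob_past_near_bwd[OF _ E[OF a] \<delta>])
    also have "\<dots> \<le> 40 * \<delta> / sqrt \<eta> * prob (E a)"
      using u[OF a] \<eta> \<delta> by (intro mult_right_mono divide_left_mono mult_pos_pos) auto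
    finally show "prob (?A a) \<le> 40 * \<delta> / sqrt \<eta> * prob (E a)" .
  qed
  also have "\<dots> = 40 * \<delta> / sqrt \<eta> * (\<Sum>a\<in>S. prob (E a))" by (simp add: sum_distrib_left)
  also have "\<dots> \<le> 40 * \<delta> / sqrt \<eta> * 1" using le1 \<delta> \<eta> by (intro mult_left_mono) auto
  finally show "prob (\<Union>a\<in>S. ?A a) \<le> 40 * \<delta> / sqrt \<eta>" by simp
qed

end

lemma abs_floor_le: "\<bar>x\<bar> \<le> real_of_int c \<Longrightarrow> \<bar>\<lfloor>x :: real\<rfloor>\<bar> \<le> c"
  by linarith

context double_web begin

text \<open>The cell of width \<open>1 / Suc d\<close> that contains the forward position is a past
  event; being equal to it forces the backward path to within \<open>2 / Suc d\<close> of the cell,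
  which has probability of order \<open>1 / d\<close>. The argument works for one fixed time, hence
  for countably many.\<close>

lemma fwd_ne_bwd_rational:
  "AE \<omega> in M. \<forall>i k. \<forall>r\<in>\<rat>. T i < r \<longrightarrow> r < T k \<longrightarrow> W i r \<omega> \<noteq> Wb k r \<omega>"
proof -
  have "AE \<omega> in M. \<forall>K::nat. \<bar>W i r \<omega>\<bar> \<le> K \<longrightarrow> W i r \<omega> \<noteq> Wb k r \<omega>" if r: "T i < r" "r < T k" for i k r
    unfolding AE_all_countable
  proof
    fix K :: nat
    define S where "S d = {- int K * int (Suc d)..int K * int (Suc d)}" for d
    define E where "E d m = {\<omega> \<in> space M. W i r \<omega> \<in> {real_of_int m / Suc d..<(real_of_int m + 1) / Suc d}}" for d and m :: int
    define A where "A d = (\<Union>m\<in>S d. E d m \<inter> {\<omega> \<in> space M. \<bar>Wb k r \<omega> - real_of_int m / Suc d\<bar> < 2 * (1 / Suc d)})" for d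
    have m_eq: "m = \<lfloor>x * Suc d\<rfloor>" if "x \<in> {real_of_int m / Suc d..<(real_of_int m + 1) / Suc d}" for x m and d :: nat
      using that by (intro floor_unique[symmetric]) (auto simp: pos_divide_le_eq pos_less_divide_eq simp del: of_nat_Suc)
    have A: "A d \<in> events \<and> prob (A d) \<le> 40 * (1 / Suc d) / sqrt (T k - r)" for d
    proof -
      have "E d m \<in> sets (past M z W r)" for m unfolding E_def using r by (intro sets_past_rel) auto
      moreover have "AE \<omega> in M. \<forall>a\<in>S d. \<forall>b\<in>S d. \<omega> \<in> E d a \<longrightarrow> \<omega> \<in> E d b \<longrightarrow> a = b"
      proof (intro AE_I2 ballI impI)
        fix \<omega> a b assume "\<omega> \<in> E d a" "\<omega> \<in> E d b"
        then show "a = b" using m_eq[of "W i r \<omega>" a d] m_eq[of "W i r \<omega>" b d] by (simp add: E_def)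
      qed
      ultimately show ?thesis
        unfolding A_def using r by (intro conjI prob_cells_near_bwd[where \<eta> = "T k - r"]) (auto simp: S_def)
    qed
    have "AE \<omega> in M. \<exists>d. \<omega> \<notin> A d"
    proof (rule AE_ex_notin)
      show "A d \<in> events" for d using A by blast
      show "prob (A d) \<le> 40 / sqrt (T k - r) / Suc d" for d using A[of d] by (simp add: mult.commute)
      show "(\<lambda>d. 40 / sqrt (T k - r) / Suc d) \<longlonglongrightarrow> 0" by (rule LIMSEQ_Suc[OF lim_const_over_n])
    qed
    then show "AE \<omega> in M. \<bar>W i r \<omega>\<bar> \<le> K \<longrightarrow> W i r \<omega> \<noteq> Wb k r \<omega>"
      using AE_space
    proof eventually_elim
      case (elim \<omega>)
      show ?case
      proof (intro impI notI)
        assume K: "\<bar>W i r \<omega>\<bar> \<le> K" and eq: "W i r \<omega> = Wb k r \<omega>"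
        obtain d where d: "\<omega> \<notin> A d" using elim by auto
        define m where "m = \<lfloor>W i r \<omega> * Suc d\<rfloor>"
        have m: "real_of_int m \<le> W i r \<omega> * Suc d" "W i r \<omega> * Suc d < real_of_int m + 1" unfolding m_def by linarith+
        have E: "\<omega> \<in> E d m" using elim m by (auto simp: E_def pos_divide_le_eq pos_less_divide_eq simp del: of_nat_Suc)
        then have "W i r \<omega> - real_of_int m / Suc d \<in> {0..<1 / Suc d}" by (simp add: E_def add_divide_distrib algebra_simps)
        then have "\<bar>Wb k r \<omega> - real_of_int m / Suc d\<bar> < 2 * (1 / Suc d)" using eq by auto
        moreover have "m \<in> S d"
        proof -
          have "\<bar>W i r \<omega> * Suc d\<bar> \<le> real K * Suc d" using K by (simp add: abs_mult mult_right_mono)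
          then have "\<bar>W i r \<omega> * Suc d\<bar> \<le> real_of_int (int K * int (Suc d))" by (simp only: of_int_mult of_int_of_nat_eq)
          then have "\<bar>m\<bar> \<le> int K * int (Suc d)" unfolding m_def by (rule abs_floor_le)
          then show ?thesis unfolding S_def by (auto simp only: abs_le_iff atLeastAtMost_iff mult_minus_left minus_le_iff)
        qed
        ultimately show False using d E elim by (auto simp: A_def)
      qed
    qed
  qed
  then have "AE \<omega> in M. \<forall>i k. \<forall>r\<in>\<rat>. T i < r \<longrightarrow> r < T k \<longrightarrow> (\<forall>K::nat. \<bar>W i r \<omega>\<bar> \<le> K \<longrightarrow> W i r \<omega> \<noteq> Wb k r \<omega>)"
    by (auto simp: AE_all_countable AE_ball_countable countable_rat intro: AE_impI)
  then show ?thesis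
    by eventually_elim (meson real_arch_simple)
qed

text \<open>Right after their meeting time, two forward paths form a fresh start for the estimate on
  backward paths. The meeting time is discretised from above.\<close>

lemma no_triple_meeting:
  "AE \<omega> in M. \<forall>i j k t. T i < t \<longrightarrow> T j < t \<longrightarrow> t < T k \<longrightarrow> W i t \<omega> = Wb k t \<omega> \<longrightarrow> W j t \<omega> = Wb k t \<omega> \<longrightarrow>
    (\<exists>s<t. T i \<le> s \<and> T j \<le> s \<and> W i s \<omega> = W j s \<omega>)"
proof -
  have "AE \<omega> in M. \<forall>t::real. \<bar>t\<bar> < K \<and> \<bar>W i t \<omega>\<bar> < K \<and> t + 2 / Suc e \<le> T k \<longrightarrow> T i < t \<longrightarrow> T j < t \<longrightarrow> W i t \<omega> = Wb k t \<omega> \<longrightarrow> W j t \<omega> = Wb k t \<omega> \<longrightarrow>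
    (\<exists>s<t. T i \<le> s \<and> T j \<le> s \<and> W i s \<omega> = W j s \<omega>)" for i j k and K e :: nat
  proof -
    define S where "S d n = {q. \<bar>q\<bar> \<le> int (Suc K) * int (Suc n) \<and> max (T i) (T j) \<le> (real_of_int q - 1) / Suc n \<and> real_of_int q / Suc n \<le> T k - 1 / Suc e} \<times>
      {m. \<bar>m\<bar> \<le> int K * int (Suc d)}" for d n :: nat
    define u where "u n a = real_of_int (fst a) / Suc n" for n and a :: "int \<times> int"
    define v where "v n a = (real_of_int (fst a) - 1) / Suc n" for n and a :: "int \<times> int"
    define y where "y d a = real_of_int (snd a) / Suc d" for d and a :: "int \<times> int"
    \<comment> \<open>The grid time \<open>u n a\<close> is the first one at which the two paths
      agree, and the second component of \<open>a\<close> is the cell of their common position.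
      Since agreement persists, at most one \<open>a\<close> occurs.\<close>
    define E where "E d n a = {\<omega> \<in> space M. W i (v n a) \<omega> \<noteq> W j (v n a) \<omega>} \<inter> {\<omega> \<in> space M. W i (u n a) \<omega> = W j (u n a) \<omega>} \<inter>
        {\<omega> \<in> space M. W i (u n a) \<omega> \<in> {y d a..<y d a + 1 / Suc d}}" for d n a
    define X where "X d n = (\<Union>a\<in>S d n. E d n a \<inter> {\<omega> \<in> space M. \<bar>Wb k (u n a) \<omega> - y d a\<bar> < 2 * (1 / Suc d)})" for d n
    have vu: "v n a < u n a" for n a unfolding v_def u_def by (intro divide_strict_right_mono) auto
    have X: "X d n \<in> events \<and> prob (X d n) \<le> 40 * (1 / Suc d) / sqrt (1 / Suc e)" for d n
    proof -
      have "E d n a \<in> sets (past M z W (u n a))" if "a \<in> S d n" for a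
      proof -
        have t: "T i \<le> v n a" "T j \<le> v n a" "T i \<le> u n a" "T j \<le> u n a" using that vu[of n a] by (auto simp: S_def v_def)
        have [measurable]: "W i (v n a) \<in> borel_measurable (past M z W (u n a))" "W j (v n a) \<in> borel_measurable (past M z W (u n a))"
          "W i (u n a) \<in> borel_measurable (past M z W (u n a))" "W j (u n a) \<in> borel_measurable (past M z W (u n a))"
          using t vu[of n a] by (auto intro!: measurable_past)
        have "{\<omega> \<in> space (past M z W (u n a)). W i (v n a) \<omega> \<noteq> W j (v n a) \<omega>} \<in> sets (past M z W (u n a))"
          "{\<omega> \<in> space (past M z W (u n a)). W i (u n a) \<omega> = W j (u n a) \<omega>} \<in> sets (past M z W (u n a))"
          by measurable
        then show ?thesis unfolding E_def using t by (intro sets.Int sets_past_rel) auto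
      qed
      moreover have "AE \<omega> in M. \<forall>a\<in>S d n. \<forall>b\<in>S d n. \<omega> \<in> E d n a \<longrightarrow> \<omega> \<in> E d n b \<longrightarrow> a = b"
        using W_coalesce
      proof eventually_elim
        case (elim \<omega>)
        have le: "fst b \<le> fst a" if ab: "a \<in> S d n" "b \<in> S d n" "\<omega> \<in> E d n a" "\<omega> \<in> E d n b" for a b
        proof (rule ccontr)
          assume "\<not> fst b \<le> fst a"
          then have "real_of_int (fst a) \<le> real_of_int (fst b) - 1" by linarith
          then have "u n a \<le> v n b" unfolding u_def v_def by (intro divide_right_mono) auto
          moreover have "T i \<le> u n a" "T j \<le> u n a" using ab(1) vu[of n a] by (auto simp: S_def v_def)
          ultimately have "W i (v n b) \<omega> = W j (v n b) \<omega>" using elim[rule_format, of i "u n a" j "v n b"] ab(3) by (simp add: E_def)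
          then show False using ab(4) by (simp add: E_def)
        qed
        show ?case
        proof (intro ballI impI)
          fix a b assume ab: "a \<in> S d n" "b \<in> S d n" "\<omega> \<in> E d n a" "\<omega> \<in> E d n b"
          have fst: "fst a = fst b" using le[OF ab] le[OF ab(2,1,4,3)] by simp
          then have u: "u n a = u n b" by (simp add: u_def)
          have "snd a = \<lfloor>W i (u n a) \<omega> * Suc d\<rfloor>" if "\<omega> \<in> E d n a" for a
            using that by (intro floor_unique[symmetric])
              (auto simp: E_def y_def add_divide_distrib[symmetric] pos_divide_le_eq pos_less_divide_eq simp del: of_nat_Suc)
          from this[OF ab(3)] this[OF ab(4)] show "a = b" using fst u by (simp add: prod_eq_iff)
        qed
      qed
      moreover have "finite (S d n)"
      proof -
        have "finite {q::int. \<bar>q\<bar> \<le> c}" for c by (rule finite_subset[of _ "{- c..c}"]) auto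
        then show ?thesis unfolding S_def by (intro finite_cartesian_product) (auto intro: finite_subset[rotated])
      qed
      ultimately show ?thesis
        unfolding X_def by (intro conjI prob_cells_near_bwd[where \<eta> = "1 / Suc e"]) (auto simp: S_def u_def)
    qed
    \<comment> \<open>For a fixed space mesh the time mesh is refined first: continuity brings both
      paths close at the discretised meeting time only for large \<open>n\<close>, depending on the
      sample.\<close>
    define Y where "Y d = (\<Union>N. \<Inter>n\<in>{N..}. X d n)" for d
    have "AE \<omega> in M. \<exists>d. \<omega> \<notin> Y d"
    proof (rule AE_ex_notin)
      show "Y d \<in> events" for d unfolding Y_def by (rule prob_eventually_le) (use X in blast)+
      have "prob (Y d) \<le> 40 * (1 / Suc d) / sqrt (1 / Suc e)" for d
        unfolding Y_def by (rule prob_eventually_le) (use X in blast)+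
      then show "prob (Y d) \<le> 40 / sqrt (1 / Suc e) / Suc d" for d by (simp add: divide_divide_eq_left mult.commute)
      show "(\<lambda>d. 40 / sqrt (1 / Suc e) / Suc d) \<longlonglongrightarrow> 0" by (rule LIMSEQ_Suc[OF lim_const_over_n])
    qed
    then show ?thesis
      using W_cont Wb_cont W_coalesce AE_space
    proof eventually_elim
      case (elim \<omega>)
      show ?case
      proof (intro allI impI, elim conjE, rule ccontr)
        fix t :: real assume K: "\<bar>t\<bar> < K" "\<bar>W i t \<omega>\<bar> < K" and e: "t + 2 / Suc e \<le> T k"
          and t: "T i < t" "T j < t" and eq: "W i t \<omega> = Wb k t \<omega>" "W j t \<omega> = Wb k t \<omega>"
          and no: "\<not> (\<exists>s<t. T i \<le> s \<and> T j \<le> s \<and> W i s \<omega> = W j s \<omega>)"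
        have tk: "t < T k" using e by (smt (verit) divide_pos_pos of_nat_0_less_iff zero_less_Suc)
        obtain d where d: "\<omega> \<notin> Y d" using elim(1) by auto
        \<comment> \<open>Rounding up puts the grid time at or after the meeting time
          \<open>t\<close>, while the preceding grid time lies strictly before \<open>t\<close>,
          when the two forward paths have by assumption not yet met.\<close>
        define q where "q n = \<lceil>t * Suc n\<rceil>" for n
        have q: "real_of_int (q n) - 1 < t * Suc n" "t * Suc n \<le> real_of_int (q n)" for n unfolding q_def by linarith+
        define U where "U n = real_of_int (q n) / Suc n" for n
        have U: "t \<le> U n" "U n < t + 1 / Suc n" "(real_of_int (q n) - 1) / Suc n = U n - 1 / Suc n" for n
        proof -
          show "t \<le> U n" using q(2)[of n] by (simp add: U_def pos_le_divide_eq del: of_nat_Suc)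
          have "real_of_int (q n) / Suc n < (t * Suc n + 1) / Suc n" using q(1)[of n] by (intro divide_strict_right_mono) auto
          then show "U n < t + 1 / Suc n" by (simp add: U_def add_divide_distrib del: of_nat_Suc)
          show "(real_of_int (q n) - 1) / Suc n = U n - 1 / Suc n" by (simp add: U_def diff_divide_distrib)
        qed
        have lim0: "(\<lambda>n. 1 / real (Suc n)) \<longlonglongrightarrow> 0" by (rule LIMSEQ_Suc[OF lim_const_over_n])
        have "(\<lambda>n. t + 1 / real (Suc n)) \<longlonglongrightarrow> t + 0" by (intro tendsto_intros lim0)
        then have Ulim: "U \<longlonglongrightarrow> t"
          by (intro tendsto_sandwich[OF _ _ tendsto_const, of _ U _ "\<lambda>n. t + 1 / real (Suc n)"]) (use U in \<open>auto intro: less_imp_le always_eventually\<close>)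
        have "eventually (\<lambda>n. U n < T k) sequentially" using Ulim tk by (rule order_tendstoD)
        then have "(\<lambda>n. Wb k (U n) \<omega>) \<longlonglongrightarrow> Wb k t \<omega>"
          using elim(3) Ulim tk by (intro continuous_on_tendsto_compose[of "{..T k}" "\<lambda>t. Wb k t \<omega>"]) (auto elim: eventually_mono)
        moreover have Wlim: "(\<lambda>n. W i (U n) \<omega>) \<longlonglongrightarrow> W i t \<omega>"
          using elim(2) Ulim t U(1) by (intro continuous_on_tendsto_compose[of "{T i..}" "\<lambda>t. W i t \<omega>"]) (auto intro!: always_eventually intro: order_trans less_imp_le)
        ultimately have "(\<lambda>n. \<bar>W i (U n) \<omega> - Wb k (U n) \<omega>\<bar>) \<longlonglongrightarrow> \<bar>W i t \<omega> - Wb k t \<omega>\<bar>" by (intro tendsto_intros)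
        then have e1: "eventually (\<lambda>n. \<bar>W i (U n) \<omega> - Wb k (U n) \<omega>\<bar> < 1 / Suc d) sequentially"
          using eq by (intro order_tendstoD) auto
        have "(\<lambda>n. \<bar>W i (U n) \<omega>\<bar>) \<longlonglongrightarrow> \<bar>W i t \<omega>\<bar>" by (intro tendsto_intros Wlim)
        then have e2: "eventually (\<lambda>n. \<bar>W i (U n) \<omega>\<bar> < K) sequentially" using K(2) by (rule order_tendstoD(2))
        have e3: "eventually (\<lambda>n. 1 / real (Suc n) < t - max (T i) (T j)) sequentially" using t by (intro order_tendstoD[OF lim0]) auto
        have e4: "eventually (\<lambda>n. 1 / real (Suc n) < 1 / Suc e) sequentially" by (intro order_tendstoD[OF lim0]) auto
        have "eventually (\<lambda>n. \<omega> \<in> X d n) sequentially"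
          using e1 e2 e3 e4
        proof eventually_elim
          case (elim n)
          note el = elim
          define m where "m = \<lfloor>W i (U n) \<omega> * Suc d\<rfloor>"
          have m: "real_of_int m \<le> W i (U n) \<omega> * Suc d" "W i (U n) \<omega> * Suc d < real_of_int m + 1" unfolding m_def by linarith+
          let ?a = "(q n, m)"
          have uv: "u n ?a = U n" "v n ?a = U n - 1 / Suc n" using U(3)[of n] by (simp_all add: u_def v_def U_def)
          have "W i (v n ?a) \<omega> \<noteq> W j (v n ?a) \<omega>"
            using no[unfolded not_ex, rule_format, of "v n ?a"] U(1,2)[of n] el(3) unfolding uv by auto
          moreover have "W i (U n) \<omega> = W j (U n) \<omega>"
            using \<open>\<forall>i j s t. _\<close>[rule_format, of i t j "U n"] t U(1)[of n] eq by auto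
          moreover have yU: "W i (U n) \<omega> \<in> {y d ?a..<y d ?a + 1 / Suc d}"
            using m by (simp add: y_def add_divide_distrib[symmetric] pos_divide_le_eq pos_less_divide_eq del: of_nat_Suc)
          ultimately have E: "\<omega> \<in> E d n ?a" using \<open>\<omega> \<in> space M\<close> unfolding E_def uv by auto
          moreover have "\<bar>Wb k (u n ?a) \<omega> - y d ?a\<bar> < 2 * (1 / Suc d)"
            using yU el(1) unfolding uv by auto
          moreover have "?a \<in> S d n"
          proof -
            have "\<bar>W i (U n) \<omega> * Suc d\<bar> \<le> real K * Suc d" using el(2) by (simp add: abs_mult mult_right_mono)
            then have "\<bar>m\<bar> \<le> int K * int (Suc d)"
              unfolding m_def by (intro abs_floor_le) (simp only: of_int_mult of_int_of_nat_eq)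
            moreover have "\<bar>q n\<bar> \<le> int (Suc K) * int (Suc n)"
            proof -
              have "\<bar>t * Suc n\<bar> \<le> real K * Suc n" using K(1) by (simp add: abs_mult mult_right_mono)
              then have "\<bar>real_of_int (q n)\<bar> \<le> real K * Suc n + 1" using q[of n] by linarith
              also have "\<dots> \<le> real (Suc K) * Suc n" by (simp add: algebra_simps)
              finally have "real_of_int \<bar>q n\<bar> \<le> real_of_int (int (Suc K) * int (Suc n))" by simp
              then show ?thesis by (simp only: of_int_le_iff)
            qed
            moreover have "max (T i) (T j) \<le> (real_of_int (q n) - 1) / Suc n"
              using el(3) U(1)[of n] unfolding U(3) by linarith
            moreover have "real_of_int (q n) / Suc n \<le> T k - 1 / Suc e"
              using U(2)[of n] el(4) e unfolding U_def by (simp add: add_divide_distrib[symmetric])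
            ultimately show ?thesis by (simp add: S_def)
          qed
          ultimately show "\<omega> \<in> X d n" using \<open>\<omega> \<in> space M\<close> unfolding X_def by blast
        qed
        then show False using d by (auto simp: Y_def eventually_sequentially)
      qed
    qed
  qed
  then have "AE \<omega> in M. \<forall>i j k (K::nat) (e::nat). \<forall>t::real. \<bar>t\<bar> < K \<and> \<bar>W i t \<omega>\<bar> < K \<and> t + 2 / Suc e \<le> T k \<longrightarrow> T i < t \<longrightarrow> T j < t \<longrightarrow> W i t \<omega> = Wb k t \<omega> \<longrightarrow> W j t \<omega> = Wb k t \<omega> \<longrightarrow>
    (\<exists>s<t. T i \<le> s \<and> T j \<le> s \<and> W i s \<omega> = W j s \<omega>)"
    unfolding AE_all_countable by blast
  then show ?thesis
  proof eventually_elim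
    case (elim \<omega>)
    show ?case
    proof (intro allI impI)
      fix i j k t assume t: "T i < t" "T j < t" "t < T k" and eq: "W i t \<omega> = Wb k t \<omega>" "W j t \<omega> = Wb k t \<omega>"
      obtain K :: nat where K: "max \<bar>t\<bar> \<bar>W i t \<omega>\<bar> < K" using reals_Archimedean2 by blast
      obtain e :: nat where "inverse (real (Suc e)) < (T k - t) / 2" using reals_Archimedean[of "(T k - t) / 2"] t by auto
      then have "t + 2 / Suc e \<le> T k" by (simp add: inverse_eq_divide field_simps)
      then show "\<exists>s<t. T i \<le> s \<and> T j \<le> s \<and> W i s \<omega> = W j s \<omega>"
        using elim[rule_format, of t K i e k j] K t eq by auto
    qed
  qed
qed

text \<open>Forward paths are placed at time \<open>r\<close> near all multiples of
  \<open>1 / Suc n\<close>. A backward path from after \<open>u\<close> passes at \<open>r\<close>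
  between two of them, three indices apart, and keeps them from merging until \<open>u\<close>.
  About \<open>2 * K * n\<close> such pairs exist, each unmerged with probability of order
  \<open>1 / n\<close>, so the expected number of unmerged pairs is bounded uniformly in
  \<open>n\<close>, and with it the number of distinct backward values.\<close>

lemma bwd_finite:
  "AE \<omega> in M. \<forall>r\<in>\<rat>. \<forall>u\<in>\<rat>. r < u \<longrightarrow> (\<forall>K::nat. finite {x::real. \<exists>k. u \<le> T k \<and> x = Wb k r \<omega> \<and> \<bar>x\<bar> \<le> K})"
proof -
  have "AE \<omega> in M. finite {x::real. \<exists>k. u \<le> T k \<and> x = Wb k r \<omega> \<and> \<bar>x\<bar> \<le> K}" if ru: "r < u" for r u and K :: nat
  proof -
    define N where "N n = int (Suc n)" for n
    define L where "L n = {- (int K * N n + 2)..int K * N n + 2}" for n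
    define L' where "L' n = {- (int K * N n + 2)..int K * N n + 5}" for n
    \<comment> \<open>Summed over all grid points in \<open>L' n\<close>, the probability that some
      forward path misses its grid point is then at most \<open>1 / Suc R\<close>.\<close>
    define p where "p R n = 1 / (real (Suc R) * real (card (L' n)))" for R n
    have "finite (L' n)" "0 \<in> L' n" for n
    proof -
      have "0 \<le> int K * N n" by (simp add: N_def)
      then show "0 \<in> L' n" unfolding L'_def atLeastAtMost_iff by linarith
    qed (simp add: L'_def)
    then have c0: "0 < card (L' n)" for n unfolding card_gt_0_iff by blast
    have p: "0 < p R n" for R n using c0[of n] by (simp add: p_def)
    have "\<exists>k. T k < r \<and> prob {\<omega> \<in> space M. 1 / (4 * Suc n) < \<bar>W k r \<omega> - real_of_int l / Suc n\<bar>} \<le> p R n" for R n :: nat and l :: int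
    proof -
      define e where "e = 1 / (8 * real (Suc n))"
      have e: "0 < e" "1 / (4 * real (Suc n)) = 2 * e" by (simp_all add: e_def del: of_nat_Suc)
      define \<eta> where "\<eta> = sqrt (p R n * e ^ 4 / 9)"
      have \<eta>: "0 < \<eta>" "9 * \<eta>\<^sup>2 / e ^ 4 = p R n" using e p[of R n] by (simp_all add: \<eta>_def)
      obtain k where k: "r - \<eta> < T k" "T k < r" "\<bar>fst (z k) - real_of_int l / Suc n\<bar> < e"
        using dense_point[OF dense, of "r - \<eta>" r e "real_of_int l / Suc n"] \<eta> e by auto
      note [measurable] = W_meas[OF less_imp_le[OF k(2)]] W_meas[OF order_refl, of k]
      have "prob {\<omega> \<in> space M. 2 * e < \<bar>W k r \<omega> - real_of_int l / Suc n\<bar>} \<le> prob {\<omega> \<in> space M. e < \<bar>W k r \<omega> - W k (T k) \<omega>\<bar>}"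
      proof (rule finite_measure_mono_AE)
        show "AE \<omega> in M. \<omega> \<in> {\<omega> \<in> space M. 2 * e < \<bar>W k r \<omega> - real_of_int l / Suc n\<bar>} \<longrightarrow> \<omega> \<in> {\<omega> \<in> space M. e < \<bar>W k r \<omega> - W k (T k) \<omega>\<bar>}"
          using W_start
        proof eventually_elim
          case (elim \<omega>)
          then have "W k (T k) \<omega> = fst (z k)" by simp
          then have "2 * e < \<bar>W k r \<omega> - real_of_int l / Suc n\<bar> \<Longrightarrow> e < \<bar>W k r \<omega> - W k (T k) \<omega>\<bar>" using k(3) by linarith
          then show ?case by simp
        qed
      qed measurable
      also have "\<dots> \<le> 9 * (r - T k)\<^sup>2 / e ^ 4" using k e by (intro W_fourth_moment) auto
      also have "\<dots> \<le> 9 * \<eta>\<^sup>2 / e ^ 4" using k by (intro divide_right_mono mult_left_mono power_mono) auto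
      finally show ?thesis unfolding \<eta>(2) using k e by (intro exI[of _ k]) simp
    qed
    then have "\<forall>x. \<exists>k. T k < r \<and> prob {\<omega> \<in> space M. 1 / (4 * Suc (fst (snd x))) < \<bar>W k r \<omega> - real_of_int (snd (snd x)) / Suc (fst (snd x))\<bar>} \<le> p (fst x) (fst (snd x))"
      by blast
    from choice[OF this] obtain f where f: "\<And>x. T (f x) < r \<and> prob {\<omega> \<in> space M. 1 / (4 * Suc (fst (snd x))) < \<bar>W (f x) r \<omega> - real_of_int (snd (snd x)) / Suc (fst (snd x))\<bar>} \<le> p (fst x) (fst (snd x))"
      by blast
    define \<kappa> where "\<kappa> R n l = f (R, n, l)" for R n l
    define dev where "dev R n l = {\<omega> \<in> space M. 1 / (4 * Suc n) < \<bar>W (\<kappa> R n l) r \<omega> - real_of_int l / Suc n\<bar>}" for R n l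
    have \<kappa>: "T (\<kappa> R n l) < r" and dev: "prob (dev R n l) \<le> p R n" for R n l
      using f[of "(R, n, l)"] by (simp_all add: \<kappa>_def dev_def)
    have Wr[measurable]: "W (\<kappa> R n l) r \<in> borel_measurable M" and Wu[measurable]: "W (\<kappa> R n l) u \<in> borel_measurable M" for R n l
      using \<kappa>[of R n l] ru by (auto intro!: W_meas)
    \<comment> \<open>Three grid steps plus two deviations of a quarter step are less than four
      steps.\<close>
    define F where "F R n l = {\<omega> \<in> space M. \<bar>W (\<kappa> R n l) r \<omega> - W (\<kappa> R n (l + 3)) r \<omega>\<bar> \<le> 4 / Suc n}" for R n l
    define C where "C R n l = F R n l \<inter> {\<omega> \<in> space M. W (\<kappa> R n l) u \<omega> \<noteq> W (\<kappa> R n (l + 3)) u \<omega>}" for R n l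
    have dev_ev: "dev R n l \<in> events" for R n l unfolding dev_def by measurable
    have C_ev: "C R n l \<in> events" for R n l unfolding C_def F_def by measurable
    have C: "prob (C R n l) \<le> 20 / sqrt (u - r) / Suc n" for R n l
    proof -
      have "F R n l \<in> sets (past M z W r)"
      proof -
        have [measurable]: "W (\<kappa> R n l) r \<in> borel_measurable (past M z W r)" for l
          using \<kappa>[of R n l] by (intro measurable_past) auto
        have "{\<omega> \<in> space (past M z W r). \<bar>W (\<kappa> R n l) r \<omega> - W (\<kappa> R n (l + 3)) r \<omega>\<bar> \<le> 4 / Suc n} \<in> sets (past M z W r)" by measurable
        then show ?thesis by (simp add: F_def)
      qed
      then have "prob (C R n l) \<le> 5 * (4 / Suc n) / sqrt (u - r) * prob (F R n l)"
        unfolding C_def using \<kappa>[of R n l] \<kappa>[of R n "l + 3"] ru by (intro W_noncoalescence) (auto simp: F_def)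
      also have "\<dots> \<le> 5 * (4 / Suc n) / sqrt (u - r) * 1" using ru by (intro mult_left_mono) auto
      finally show ?thesis by (simp add: mult.commute)
    qed
    define cnt where "cnt R n \<omega> = (\<Sum>l\<in>L n. indicator (C R n l) \<omega> :: real)" for R n \<omega>
    define A where "A R n = (\<Union>l\<in>L' n. dev R n l) \<union> {\<omega> \<in> space M. real (Suc R) \<le> cnt R n \<omega>}" for R n
    have cnt_meas[measurable]: "cnt R n \<in> borel_measurable M" for R n
      unfolding cnt_def[abs_def] using C_ev by measurable
    define c where "c = (2 * real K + 5) * (20 / sqrt (u - r))"
    have A: "A R n \<in> events" "prob (A R n) \<le> (1 + c) / Suc R" for R n
    proof -
      have D: "(\<Union>l\<in>L' n. dev R n l) \<in> events" using dev_ev by (auto simp: L'_def)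
      have G: "{\<omega> \<in> space M. real (Suc R) \<le> cnt R n \<omega>} \<in> events" by measurable
      show "A R n \<in> events" using D G by (simp add: A_def)
      have "prob (\<Union>l\<in>L' n. dev R n l) \<le> (\<Sum>l\<in>L' n. prob (dev R n l))"
        using dev_ev by (intro finite_measure_subadditive_finite) (auto simp: L'_def)
      also have "\<dots> \<le> (\<Sum>l\<in>L' n. p R n)" by (intro sum_mono dev)
      also have "\<dots> = 1 / Suc R" using c0[of n] by (simp add: p_def del: of_nat_Suc)
      finally have 1: "prob (\<Union>l\<in>L' n. dev R n l) \<le> 1 / Suc R" .
      have int: "integrable M (cnt R n)"
        unfolding cnt_def[abs_def] using C_ev by (auto simp: emeasure_eq_measure intro!: Bochner_Integration.integrable_sum)
      have "expectation (cnt R n) = (\<Sum>l\<in>L n. prob (C R n l))"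
        unfolding cnt_def[abs_def] using C_ev by (subst Bochner_Integration.integral_sum) (auto simp: emeasure_eq_measure)
      also have "\<dots> \<le> (\<Sum>l\<in>L n. 20 / sqrt (u - r) / Suc n)" by (intro sum_mono C)
      also have "\<dots> = (2 * real K * Suc n + 5) * (20 / sqrt (u - r) / Suc n)" by (simp add: L_def N_def algebra_simps)
      also have "\<dots> \<le> ((2 * real K + 5) * Suc n) * (20 / sqrt (u - r) / Suc n)"
        using ru by (intro mult_right_mono) (simp_all add: algebra_simps)
      also have "\<dots> = c" by (simp add: c_def)
      finally have E: "expectation (cnt R n) \<le> c" .
      have "prob {\<omega> \<in> space M. real (Suc R) \<le> cnt R n \<omega>} \<le> expectation (cnt R n) / Suc R"
        by (rule integral_Markov_inequality_measure[OF int, of "{}"]) (auto simp: cnt_def intro!: AE_I2 sum_nonneg)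
      also have "\<dots> \<le> c / Suc R" using E by (intro divide_right_mono) auto
      finally have "prob (A R n) \<le> 1 / Suc R + c / Suc R"
        unfolding A_def using 1 measure_Un_le[OF D G] by linarith
      then show "prob (A R n) \<le> (1 + c) / Suc R" by (simp add: add_divide_distrib)
    qed
    \<comment> \<open>How fine the mesh must be to separate \<open>Suc R\<close> distinct values
      depends on the sample, hence the events for all large \<open>n\<close>.\<close>
    define Y where "Y R = (\<Union>N. \<Inter>n\<in>{N..}. A R n)" for R
    have "AE \<omega> in M. \<exists>R. \<omega> \<notin> Y R"
    proof (rule AE_ex_notin)
      show "Y R \<in> events" for R unfolding Y_def by (rule prob_eventually_le[OF A])
      show "prob (Y R) \<le> (1 + c) / Suc R" for R unfolding Y_def by (rule prob_eventually_le[OF A])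
      show "(\<lambda>R. (1 + c) / Suc R) \<longlonglongrightarrow> 0" by (rule LIMSEQ_Suc[OF lim_const_over_n])
    qed
    moreover have "AE \<omega> in M. \<forall>i k. T i < T k \<longrightarrow> W i (T k) \<omega> \<noteq> fst (z k)"
      using W_ne_const by (auto simp: AE_all_countable)
    ultimately show ?thesis
      using no_cross no_cross' W_coalesce Wb_start AE_space
    proof eventually_elim
      case (elim \<omega>)
      let ?X = "{x::real. \<exists>k. u \<le> T k \<and> x = Wb k r \<omega> \<and> \<bar>x\<bar> \<le> K}"
      obtain R where R: "\<omega> \<notin> Y R" using elim by auto
      show ?case
      proof (rule ccontr)
        assume "infinite ?X"
        from infinite_arbitrarily_large[OF this, of "Suc R"]
        obtain Q where Q: "finite Q" "card Q = Suc R" "Q \<subseteq> ?X" by (elim exE conjE)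
        \<comment> \<open>The least distance between two of the selected values; a mesh below
          \<open>g\<close> puts them into different cells, so that they count different unmerged
          pairs.\<close>
        define g where "g = Min (insert 1 ((\<lambda>(x, y). \<bar>x - y\<bar>) ` {(x, y). x \<in> Q \<and> y \<in> Q \<and> x \<noteq> y}))"
        have fin: "finite {(x, y). x \<in> Q \<and> y \<in> Q \<and> x \<noteq> y}"
          by (rule finite_subset[of _ "Q \<times> Q"]) (use Q in auto)
        have g: "0 < g" unfolding g_def using fin by (subst Min_gr_iff) auto
        have g_le: "g \<le> \<bar>x - y\<bar>" if "x \<in> Q" "y \<in> Q" "x \<noteq> y" for x y
          unfolding g_def using fin that by (intro Min_le) auto
        have "eventually (\<lambda>n. 1 / real (Suc n) < g) sequentially"
          by (rule order_tendstoD(2)[OF LIMSEQ_Suc[OF lim_const_over_n] g])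
        then have "eventually (\<lambda>n. \<omega> \<in> A R n) sequentially"
        proof (rule eventually_mono)
          fix n assume n: "1 / real (Suc n) < g"
          show "\<omega> \<in> A R n"
          proof (rule ccontr)
            assume nA: "\<omega> \<notin> A R n"
            define S where "S = real (Suc n)"
            have S: "0 < S" by (simp add: S_def)
            have ndev: "\<bar>W (\<kappa> R n l) r \<omega> - l / S\<bar> \<le> 1 / (4 * S)" if "l \<in> L' n" for l
              using nA that elim by (auto simp: A_def dev_def S_def not_less)
            \<comment> \<open>Shifting the cell index by one leaves at least a full grid step
              between \<open>x\<close> and the grid points \<open>\<phi> x\<close> and
              \<open>\<phi> x + 3\<close>, up to strictness on the right, so a deviation of a
              quarter step cannot destroy the enclosure.\<close>
            define \<phi> where "\<phi> x = \<lfloor>x * S\<rfloor> - 1" for x :: real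
            have \<phi>: "\<phi> x \<in> L n" "\<phi> x \<in> L' n" "\<phi> x + 3 \<in> L' n" if "\<bar>x\<bar> \<le> K" for x :: real
            proof -
              have "\<bar>x * S\<bar> \<le> real K * S" using that S by (simp add: abs_mult mult_right_mono)
              then have "\<bar>\<lfloor>x * S\<rfloor>\<bar> \<le> int K * N n"
                by (intro abs_floor_le) (simp only: S_def N_def of_int_mult of_int_of_nat_eq)
              then show "\<phi> x \<in> L n" "\<phi> x \<in> L' n" "\<phi> x + 3 \<in> L' n"
                unfolding \<phi>_def L_def L'_def atLeastAtMost_iff by linarith+
            qed
            have inC: "\<omega> \<in> C R n (\<phi> x)" if x: "x \<in> Q" for x
            proof -
              obtain k where k: "u \<le> T k" "x = Wb k r \<omega>" "\<bar>x\<bar> \<le> K" using Q(3) x by auto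
              let ?a = "\<kappa> R n (\<phi> x)" and ?b = "\<kappa> R n (\<phi> x + 3)"
              have fl: "\<phi> x + 1 \<le> x * S" "x * S < \<phi> x + 2" unfolding \<phi>_def by linarith+
              have da: "\<bar>W ?a r \<omega> - \<phi> x / S\<bar> \<le> 1 / (4 * S)" and db: "\<bar>W ?b r \<omega> - (\<phi> x + 3) / S\<bar> \<le> 1 / (4 * S)"
                using ndev[OF \<phi>(2)[OF k(3)]] ndev[OF \<phi>(3)[OF k(3)]] by simp_all
              have q: "1 / (4 * S) = (1 / 4) / S" "4 / S = (4 :: real) / S" by simp_all
              have "(\<phi> x + 1 / 4) / S < x" "x < (\<phi> x + 3 - 1 / 4) / S"
                using fl S by (simp_all add: pos_divide_less_eq pos_less_divide_eq)
              then have "\<phi> x / S + (1 / 4) / S < x" "x < (\<phi> x + 3) / S - (1 / 4) / S"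
                by (simp_all only: add_divide_distrib diff_divide_distrib)
              then have lt: "W ?a r \<omega> < x" "x < W ?b r \<omega>" using da db unfolding q by linarith+
              have dd: "\<bar>(\<phi> x + 3) / S - \<phi> x / S\<bar> = 3 / S" using S by (simp add: diff_divide_distrib[symmetric])
              have "\<bar>W ?a r \<omega> - W ?b r \<omega>\<bar> \<le> (1 / 4) / S + 3 / S + (1 / 4) / S" using da db dd unfolding q by linarith
              also have "\<dots> \<le> 4 / S"
                unfolding add_divide_distrib[symmetric] using S by (intro divide_right_mono) auto
              finally have F: "\<omega> \<in> F R n (\<phi> x)" using elim by (simp add: F_def S_def)
              have Tk: "T ?a < r" "T ?b < r" "r < T k" using \<kappa> k(1) ru by auto
              have "W ?a u \<omega> \<noteq> W ?b u \<omega>"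
              proof
                assume eq: "W ?a u \<omega> = W ?b u \<omega>"
                have "W ?a (T k) \<omega> = W ?b (T k) \<omega>"
                  using \<open>\<forall>i j s t. T i \<le> s \<longrightarrow> _ i j s t\<close>[rule_format, of ?a u ?b "T k"] Tk ru k(1) eq by auto
                moreover have "W ?a (T k) \<omega> \<le> fst (z k)" "fst (z k) \<le> W ?b (T k) \<omega>"
                  using elim(3)[rule_format, of r ?a k "T k"] elim(4)[rule_format, of r ?b k "T k"] Tk lt k(2) elim(6) by auto
                ultimately have "W ?a (T k) \<omega> = fst (z k)" by simp
                then show False using elim(2) Tk by auto
              qed
              then show ?thesis using F elim by (simp add: C_def)
            qed
            have inj: "inj_on \<phi> Q"
            proof (rule inj_onI, rule ccontr)
              fix x y assume xy: "x \<in> Q" "y \<in> Q" "\<phi> x = \<phi> y" "x \<noteq> y"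
              have "\<phi> x + 1 \<le> x * S" "x * S < \<phi> x + 2" "\<phi> y + 1 \<le> y * S" "y * S < \<phi> y + 2" unfolding \<phi>_def by linarith+
              then have "\<bar>x * S - y * S\<bar> < 1" using xy(3) by linarith
              then have "\<bar>x - y\<bar> * S < 1" using S by (simp add: abs_mult left_diff_distrib[symmetric])
              then have "\<bar>x - y\<bar> < 1 / S" using S by (simp add: pos_less_divide_eq)
              then show False using g_le[OF xy(1,2,4)] n by (simp add: S_def)
            qed
            have sub: "\<phi> ` Q \<subseteq> L n" using Q(3) \<phi>(1) by auto
            have "real (Suc R) = (\<Sum>l\<in>\<phi> ` Q. 1)" using card_image[OF inj] Q(2) by simp
            also have "\<dots> = (\<Sum>l\<in>\<phi> ` Q. indicator (C R n l) \<omega>)" using inC by (intro sum.cong) auto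
            also have "\<dots> \<le> cnt R n \<omega>" unfolding cnt_def using sub by (intro sum_mono2) (auto simp: L_def)
            finally show False using nA elim by (auto simp: A_def)
          qed
        qed
        then show False using R by (auto simp: Y_def eventually_sequentially)
      qed
    qed
  qed
  then show ?thesis
    by (auto simp: AE_all_countable AE_ball_countable countable_rat intro: AE_impI)
qed

end

text \<open>Everything that the pathwise part takes from probability. Only the forward point of view
  is listed; the same predicate for the time-reversed pair, with the two families exchanged,
  supplies the backward one.\<close>

definition half_good :: "(nat \<Rightarrow> real \<times> real) \<Rightarrow> (nat \<Rightarrow> real \<Rightarrow> real) \<Rightarrow> (nat \<Rightarrow> real \<Rightarrow> real) \<Rightarrow> bool" where
  "half_good z w v \<longleftrightarrow>
     (\<forall>j. continuous_on {snd (z j)..} (w j)) \<and>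
     (\<forall>j. w j (snd (z j)) = fst (z j)) \<and>
     (\<forall>i j s t. snd (z i) \<le> s \<longrightarrow> snd (z j) \<le> s \<longrightarrow> s \<le> t \<longrightarrow> w i s = w j s \<longrightarrow> w i t = w j t) \<and>
     (\<forall>m::nat. \<exists>d>0. \<forall>(t::real) (y::real). \<bar>t\<bar> \<le> Suc m \<longrightarrow> \<bar>y\<bar> \<le> Suc m \<longrightarrow>
        (\<exists>k. snd (z k) \<le> t - d \<and> (\<forall>s\<in>{t - d..t + d}. \<bar>w k s - y\<bar> \<le> 3 / Suc m))) \<and>
     (\<forall>i j. \<exists>s\<ge>max (snd (z i)) (snd (z j)). w i s = w j s) \<and>
     (\<forall>i k. \<forall>r\<in>\<rat>. snd (z i) < r \<longrightarrow> r < snd (z k) \<longrightarrow> w i r \<noteq> v k r) \<and>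
     (\<forall>i j k t. snd (z i) < t \<longrightarrow> snd (z j) < t \<longrightarrow> t < snd (z k) \<longrightarrow> w i t = v k t \<longrightarrow> w j t = v k t \<longrightarrow>
        (\<exists>s<t. snd (z i) \<le> s \<and> snd (z j) \<le> s \<and> w i s = w j s)) \<and>
     (\<forall>r\<in>\<rat>. \<forall>u\<in>\<rat>. r < u \<longrightarrow> (\<forall>K::nat. finite {x::real. \<exists>k. u \<le> snd (z k) \<and> x = v k r \<and> \<bar>x\<bar> \<le> K})) \<and>
     (\<forall>i j s t. s \<in> {snd (z i)..snd (z j)} \<longrightarrow> t \<in> {snd (z i)..snd (z j)} \<longrightarrow> w i s < v j s \<longrightarrow> w i t \<le> v j t)"

lemma (in double_web) AE_half_good: "AE \<omega> in M. half_good z (\<lambda>j t. W j t \<omega>) (\<lambda>j t. Wb j t \<omega>)"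
  using W_cont W_start W_coalesce W_tubes[OF dense] W_meet fwd_ne_bwd_rational no_triple_meeting bwd_finite no_cross
  unfolding half_good_def by eventually_elim (intro conjI)

text \<open>Reversing time exchanges the two families and preserves the skeleton property, so every
  almost sure statement also holds with forward and backward interchanged.\<close>

lemma (in double_web) double_web_flip: "double_web M (flip z) (\<lambda>j t. Wb j (- t)) (\<lambda>j t. W j (- t))"
proof (intro double_web.intro double_web_axioms.intro)
  show "prob_space M" by (rule prob_space_axioms)
  have "closure ((\<lambda>p. (fst p, - snd p)) ` range z) = UNIV"
  proof -
    have "(\<lambda>p. (fst p, - snd p)) ` closure (range z) \<subseteq> closure ((\<lambda>p. (fst p, - snd p)) ` range z)"
      by (intro closure_subset image_closure_subset) (auto intro!: continuous_intros closure_subset)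
    moreover have "(\<lambda>p. (fst p, - snd p)) ` closure (range z) = (UNIV :: (real \<times> real) set)"
      unfolding dense by (rule surjI[of _ "\<lambda>p. (fst p, - snd p)"]) simp
    ultimately show ?thesis by auto
  qed
  then show "closure (range (flip z)) = UNIV" by (simp add: flip_def[abs_def] image_image)
  have flip2: "(\<lambda>j. (fst (flip z j), - snd (flip z j))) = z" by (simp add: flip_def fun_eq_iff)
  show "double_web_skeleton M (flip z) (\<lambda>j t. Wb j (- t)) (\<lambda>j t. W j (- t))"
    unfolding double_web_skeleton_def
  proof (intro conjI)
    show "coalescing_BMs M (flip z) (\<lambda>j t. Wb j (- t))" using coalescing.W[OF bwd] .
    show "backward_coalescing_BMs M (flip z) (\<lambda>j t. W j (- t))"
      unfolding backward_coalescing_BMs_def flip2 using W by simp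
    show "AE \<omega> in M. \<forall>i j. \<not> crosses {snd (flip z i)..snd (flip z j)} (\<lambda>t. Wb i (- t) \<omega>) (\<lambda>t. W j (- t) \<omega>)"
      using no_cross
    proof eventually_elim
      case (elim \<omega>)
      show ?case
      proof (intro allI notI)
        fix i j assume "crosses {snd (flip z i)..snd (flip z j)} (\<lambda>t. Wb i (- t) \<omega>) (\<lambda>t. W j (- t) \<omega>)"
        then obtain s t where "- T i \<le> s" "s \<le> - T j" "- T i \<le> t" "t \<le> - T j"
          "Wb i (- s) \<omega> > W j (- s) \<omega>" "Wb i (- t) \<omega> < W j (- t) \<omega>" by (auto simp: crosses_def flip_def)
        then show False using elim[rule_format, of "- s" j i "- t"] by auto
      qed
    qed
  qed
qed

lemma (in double_web) AE_half_good_flip: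
  "AE \<omega> in M. half_good (flip z) (\<lambda>j t. Wb j (- t) \<omega>) (\<lambda>j t. W j (- t) \<omega>)"
  using double_web.AE_half_good[OF double_web_flip] .

section \<open>Limit paths of the web\<close>

text \<open>Continuous convergence: \<open>f n (s n)\<close> tends to \<open>g l\<close> whenever \<open>s n\<close> tends to \<open>l\<close>.\<close>

definition cconv :: "(nat \<Rightarrow> real \<Rightarrow> real) \<Rightarrow> (real \<Rightarrow> ereal) \<Rightarrow> bool" where
  "cconv f g \<longleftrightarrow> (\<forall>l a.
     (ereal a < g l \<longrightarrow> (\<exists>N. \<exists>d>0. \<forall>n\<ge>N. \<forall>s. \<bar>s - l\<bar> < d \<longrightarrow> a < f n s)) \<and>
     (g l < ereal a \<longrightarrow> (\<exists>N. \<exists>d>0. \<forall>n\<ge>N. \<forall>s. \<bar>s - l\<bar> < d \<longrightarrow> f n s < a)))"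

lemma cconv_lower: "cconv f g \<Longrightarrow> ereal a < g l \<Longrightarrow> \<exists>N. \<exists>d>0. \<forall>n\<ge>N. \<forall>s. \<bar>s - l\<bar> < d \<longrightarrow> a < f n s"
  and cconv_upper: "cconv f g \<Longrightarrow> g l < ereal a \<Longrightarrow> \<exists>N. \<exists>d>0. \<forall>n\<ge>N. \<forall>s. \<bar>s - l\<bar> < d \<longrightarrow> f n s < a"
  by (auto simp: cconv_def)

lemma cconv_subseq: "cconv f g \<Longrightarrow> strict_mono r \<Longrightarrow> cconv (\<lambda>n. f (r n)) g"
  unfolding cconv_def by (meson order_trans seq_suble)

lemma cconv_flip: "cconv f g \<Longrightarrow> cconv (\<lambda>n s. f n (- s)) (\<lambda>s. g (- s))"
proof -
  assume c: "cconv f g"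
  have *: "(\<exists>N. \<exists>d>0. \<forall>n\<ge>N. \<forall>s. \<bar>s - l\<bar> < d \<longrightarrow> P n (- s)) \<longleftrightarrow> (\<exists>N. \<exists>d>0. \<forall>n\<ge>N. \<forall>s. \<bar>s - - l\<bar> < d \<longrightarrow> P n s)"
    for P :: "nat \<Rightarrow> real \<Rightarrow> bool" and l
  proof -
    have "(\<forall>s. \<bar>s - l\<bar> < d \<longrightarrow> P n (- s)) \<longleftrightarrow> (\<forall>s. \<bar>s - - l\<bar> < d \<longrightarrow> P n s)" for n d
    proof safe
      fix s assume a: "\<forall>s. \<bar>s - l\<bar> < d \<longrightarrow> P n (- s)" "\<bar>s - - l\<bar> < d"
      have "\<bar>- s - l\<bar> < d" using a(2) by linarith
      then show "P n s" using a(1)[rule_format, of "- s"] by simp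
    next
      fix s assume a: "\<forall>s. \<bar>s - - l\<bar> < d \<longrightarrow> P n s" "\<bar>s - l\<bar> < d"
      have "\<bar>- s - - l\<bar> < d" using a(2) by linarith
      then show "P n (- s)" using a(1) by blast
    qed
    then show ?thesis by simp
  qed
  show ?thesis
    unfolding cconv_def
  proof (intro allI conjI impI)
    fix l a
    show "ereal a < g (- l) \<Longrightarrow> \<exists>N. \<exists>d>0. \<forall>n\<ge>N. \<forall>s. \<bar>s - l\<bar> < d \<longrightarrow> a < f n (- s)"
      using cconv_lower[OF c, of a "- l"] *[of l "\<lambda>n s. a < f n s"] by blast
    show "g (- l) < ereal a \<Longrightarrow> \<exists>N. \<exists>d>0. \<forall>n\<ge>N. \<forall>s. \<bar>s - l\<bar> < d \<longrightarrow> f n (- s) < a"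
      using cconv_upper[OF c, of "- l" a] *[of l "\<lambda>n s. f n s < a"] by blast
  qed
qed

lemma cconv_uminus: "cconv f g \<Longrightarrow> cconv (\<lambda>n s. - f n s) (\<lambda>s. - g s)"
proof -
  assume c: "cconv f g"
  show ?thesis
    unfolding cconv_def
  proof (intro allI conjI impI)
    fix l a
    assume "ereal a < - g l"
    then have "g l < ereal (- a)" by (metis ereal_less_uminus_reorder uminus_ereal.simps(1))
    from cconv_upper[OF c this] show "\<exists>N. \<exists>d>0. \<forall>n\<ge>N. \<forall>s. \<bar>s - l\<bar> < d \<longrightarrow> a < - f n s"
      by (simp add: less_minus_iff)
  next
    fix l a
    assume "- g l < ereal a"
    then have "ereal (- a) < g l" by (metis ereal_uminus_less_reorder uminus_ereal.simps(1))
    from cconv_lower[OF c this] show "\<exists>N. \<exists>d>0. \<forall>n\<ge>N. \<forall>s. \<bar>s - l\<bar> < d \<longrightarrow> - f n s < a"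
      by (simp add: minus_less_iff)
  qed
qed

lemma cconv_tendsto:
  assumes c: "cconv f g" and s: "s \<longlonglongrightarrow> l"
  shows "(\<lambda>n. ereal (f n (s n))) \<longlonglongrightarrow> g l"
proof (rule order_tendstoI)
  fix b assume "b < g l"
  then obtain a where a: "b < ereal a" "ereal a < g l" using ereal_dense2 by blast
  obtain N d where "d > 0" and N: "\<And>n s. n \<ge> N \<Longrightarrow> \<bar>s - l\<bar> < d \<Longrightarrow> a < f n s"
    using cconv_lower[OF c a(2)] by blast
  have "eventually (\<lambda>n. dist (s n) l < d) sequentially" using s \<open>d > 0\<close> by (rule tendstoD)
  then show "eventually (\<lambda>n. b < ereal (f n (s n))) sequentially"
    using eventually_ge_at_top[of N]
    by eventually_elim (use a N in \<open>auto simp: dist_real_def intro: less_trans\<close>)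
next
  fix b assume "g l < b"
  then obtain a where a: "g l < ereal a" "ereal a < b" using ereal_dense2 by blast
  obtain N d where "d > 0" and N: "\<And>n s. n \<ge> N \<Longrightarrow> \<bar>s - l\<bar> < d \<Longrightarrow> f n s < a"
    using cconv_upper[OF c a(1)] by blast
  have "eventually (\<lambda>n. dist (s n) l < d) sequentially" using s \<open>d > 0\<close> by (rule tendstoD)
  then show "eventually (\<lambda>n. ereal (f n (s n)) < b) sequentially"
    using eventually_ge_at_top[of N]
    by eventually_elim (use a N in \<open>auto simp: dist_real_def intro: less_trans[of _ "ereal a"]\<close>)
qed

definition mirror :: "(nat \<Rightarrow> real \<times> real) \<Rightarrow> nat \<Rightarrow> real \<times> real" where
  "mirror z j = (- fst (z j), snd (z j))"

lemma flip_flip [simp]: "flip (flip z) = z"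
  by (simp add: flip_def fun_eq_iff)

lemma snd_flip [simp]: "snd (flip z j) = - snd (z j)" and fst_flip [simp]: "fst (flip z j) = fst (z j)"
  and snd_mirror [simp]: "snd (mirror z j) = snd (z j)" and fst_mirror [simp]: "fst (mirror z j) = - fst (z j)"
  and mirror_mirror [simp]: "mirror (mirror z) j = z j" and flip_mirror: "flip (mirror z) = mirror (flip z)"
  by (auto simp: flip_def mirror_def fun_eq_iff)

text \<open>Both halves converge along the same index sequence; this separates a limit path from an
  arbitrary pair of halves at a point. Constant sequences are allowed, so the skeleton paths are
  included.\<close>

definition limit_path :: "(nat \<Rightarrow> real \<times> real) \<Rightarrow> (nat \<Rightarrow> real \<Rightarrow> real) \<Rightarrow> real \<Rightarrow> real \<Rightarrow> (real \<Rightarrow> real) \<Rightarrow> bool" where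
  "limit_path z h x t g \<longleftrightarrow> (\<exists>k. (\<lambda>n. z (k n)) \<longlonglongrightarrow> (x, t) \<and> cconv (\<lambda>n. h (k n)) (\<lambda>s. ereal (g s)))"

lemma limit_path_flip:
  "limit_path z h x t g \<Longrightarrow> limit_path (flip z) (\<lambda>j s. h j (- s)) x (- t) (\<lambda>s. g (- s))"
proof -
  assume "limit_path z h x t g"
  then obtain k where k: "(\<lambda>n. z (k n)) \<longlonglongrightarrow> (x, t)" "cconv (\<lambda>n. h (k n)) (\<lambda>s. ereal (g s))"
    by (auto simp: limit_path_def)
  have "(\<lambda>n. flip z (k n)) \<longlonglongrightarrow> (x, - t)"
    unfolding flip_def using tendsto_fst[OF k(1)] tendsto_snd[OF k(1)] by (intro tendsto_Pair tendsto_minus) auto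
  then show ?thesis using cconv_flip[OF k(2)] by (auto simp: limit_path_def)
qed

lemma limit_path_flip_iff:
  "limit_path (flip z) (\<lambda>j s. h j (- s)) x (- t) (\<lambda>s. g (- s)) \<longleftrightarrow> limit_path z h x t g"
  using limit_path_flip[of z h x t g] limit_path_flip[of "flip z" "\<lambda>j s. h j (- s)" x "- t" "\<lambda>s. g (- s)"] by auto

lemma limit_path_mirror:
  "limit_path z h x t g \<Longrightarrow> limit_path (mirror z) (\<lambda>j s. - h j s) (- x) t (\<lambda>s. - g s)"
proof -
  assume "limit_path z h x t g"
  then obtain k where k: "(\<lambda>n. z (k n)) \<longlonglongrightarrow> (x, t)" "cconv (\<lambda>n. h (k n)) (\<lambda>s. ereal (g s))"
    by (auto simp: limit_path_def)
  have "(\<lambda>n. mirror z (k n)) \<longlonglongrightarrow> (- x, t)"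
    unfolding mirror_def using tendsto_fst[OF k(1)] tendsto_snd[OF k(1)] by (intro tendsto_Pair tendsto_minus) auto
  then show ?thesis using cconv_uminus[OF k(2)] by (auto simp: limit_path_def)
qed

lemma limit_path_mirror_iff:
  "limit_path (mirror z) (\<lambda>j s. - h j s) (- x) t (\<lambda>s. - g s) \<longleftrightarrow> limit_path z h x t g"
  using limit_path_mirror[of z h x t g] limit_path_mirror[of "mirror z" "\<lambda>j s. - h j s" "- x" t "\<lambda>s. - g s"]
  by (auto simp: fun_eq_iff[of "mirror (mirror z)" z, simplified])

text \<open>Path number \<open>j\<close> of the web is forward after the time of \<open>z j\<close> and backward before it.\<close>

locale half_web =
  fixes z :: "nat \<Rightarrow> real \<times> real" and h :: "nat \<Rightarrow> real \<Rightarrow> real"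
  assumes dense: "closure (range z) = UNIV"
    and cont: "continuous_on UNIV (h j)"
    and start: "h j (snd (z j)) = fst (z j)"
    and order: "(\<forall>s. h i s \<le> h j s) \<or> (\<forall>s. h j s \<le> h i s)"
    and coal: "snd (z i) \<le> s \<Longrightarrow> snd (z j) \<le> s \<Longrightarrow> s \<le> t \<Longrightarrow> h i s = h j s \<Longrightarrow> h i t = h j t"
    and tube: "0 < e \<Longrightarrow> \<exists>d>0. \<forall>t y. \<bar>t\<bar> \<le> K \<longrightarrow> \<bar>y\<bar> \<le> K \<longrightarrow>
        (\<exists>k. snd (z k) \<le> t - d \<and> (\<forall>s\<in>{t - d..t + d}. \<bar>h k s - y\<bar> \<le> e))"
    and meet: "\<exists>s\<ge>max (snd (z i)) (snd (z j)). h i s = h j s"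
    and apart: "r \<in> \<rat> \<Longrightarrow> snd (z i) < r \<Longrightarrow> r < snd (z k) \<Longrightarrow> h i r \<noteq> h k r"
    and triple: "snd (z i) < t \<Longrightarrow> snd (z j) < t \<Longrightarrow> t < snd (z k) \<Longrightarrow> h i t = h k t \<Longrightarrow> h j t = h k t \<Longrightarrow>
        \<exists>s<t. snd (z i) \<le> s \<and> snd (z j) \<le> s \<and> h i s = h j s"
    and fin: "r \<in> \<rat> \<Longrightarrow> u \<in> \<rat> \<Longrightarrow> r < u \<Longrightarrow> finite {x::real. \<exists>k. u \<le> snd (z k) \<and> x = h k r \<and> \<bar>x\<bar> \<le> K}"

locale web = half_web z h + reverse: half_web "flip z" "\<lambda>j s. h j (- s)"
  for z :: "nat \<Rightarrow> real \<times> real" and h :: "nat \<Rightarrow> real \<Rightarrow> real"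

lemma half_web_mirror:
  assumes "half_web z h" shows "half_web (mirror z) (\<lambda>j s. - h j s)"
proof -
  interpret half_web z h by fact
  show ?thesis
  proof
    have "(\<lambda>p. (- fst p, snd p)) ` closure (range z) \<subseteq> closure ((\<lambda>p. (- fst p, snd p)) ` range z)"
      by (intro closure_subset image_closure_subset) (auto intro!: continuous_intros closure_subset)
    moreover have "(\<lambda>p. (- fst p, snd p)) ` closure (range z) = (UNIV :: (real \<times> real) set)"
      unfolding dense by (rule surjI[of _ "\<lambda>p. (- fst p, snd p)"]) simp
    ultimately show "closure (range (mirror z)) = UNIV" by (auto simp: mirror_def[abs_def] image_image)
  next
    fix e K :: real assume e: "0 < e"
    obtain d where d: "d > 0" "\<forall>t y. \<bar>t\<bar> \<le> K \<longrightarrow> \<bar>y\<bar> \<le> K \<longrightarrow> (\<exists>k. snd (z k) \<le> t - d \<and> (\<forall>s\<in>{t - d..t + d}. \<bar>h k s - y\<bar> \<le> e))"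
      using tube[OF e, of K] by blast
    show "\<exists>d>0. \<forall>t y. \<bar>t\<bar> \<le> K \<longrightarrow> \<bar>y\<bar> \<le> K \<longrightarrow> (\<exists>k. snd (mirror z k) \<le> t - d \<and> (\<forall>s\<in>{t - d..t + d}. \<bar>- h k s - y\<bar> \<le> e))"
    proof (intro exI[of _ d] conjI allI impI d(1))
      fix t y :: real assume ty: "\<bar>t\<bar> \<le> K" "\<bar>y\<bar> \<le> K"
      then obtain k where k: "snd (z k) \<le> t - d" "\<forall>s\<in>{t - d..t + d}. \<bar>h k s - - y\<bar> \<le> e" using d(2)[rule_format, of t "- y"] by auto
      have "\<bar>- h k s - y\<bar> = \<bar>h k s - - y\<bar>" for s by linarith
      then show "\<exists>k. snd (mirror z k) \<le> t - d \<and> (\<forall>s\<in>{t - d..t + d}. \<bar>- h k s - y\<bar> \<le> e)"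
        using k by (intro exI[of _ k]) simp
    qed
  next
    fix r u K :: real assume "r \<in> \<rat>" "u \<in> \<rat>" "r < u"
    from finite_imageI[OF fin[OF this, of K], of uminus]
    show "finite {x::real. \<exists>k. u \<le> snd (mirror z k) \<and> x = - h k r \<and> \<bar>x\<bar> \<le> K}"
      by (rule finite_subset[rotated]) (auto simp: image_iff)
  next
    show "continuous_on UNIV (\<lambda>s. - h j s)" for j by (intro continuous_intros cont)
    show "- h j (snd (mirror z j)) = fst (mirror z j)" for j by (simp add: start)
    show "(\<forall>s. - h i s \<le> - h j s) \<or> (\<forall>s. - h j s \<le> - h i s)" for i j
      unfolding neg_le_iff_le by (rule disj_comms(1)[THEN iffD1, OF order])
    show "\<exists>s\<ge>max (snd (mirror z i)) (snd (mirror z j)). - h i s = - h j s" for i j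
      unfolding neg_equal_iff_equal snd_mirror by (rule meet)
  next
    fix i j and s t :: real
    assume "snd (mirror z i) \<le> s" "snd (mirror z j) \<le> s" "s \<le> t" "- h i s = - h j s"
    then show "- h i t = - h j t" unfolding neg_equal_iff_equal snd_mirror by (rule coal)
  next
    fix r :: real and i k
    assume "r \<in> \<rat>" "snd (mirror z i) < r" "r < snd (mirror z k)"
    then show "- h i r \<noteq> - h k r" unfolding neg_equal_iff_equal snd_mirror by (rule apart)
  next
    fix i j k and t :: real
    assume "snd (mirror z i) < t" "snd (mirror z j) < t" "t < snd (mirror z k)" "- h i t = - h k t" "- h j t = - h k t"
    then show "\<exists>s<t. snd (mirror z i) \<le> s \<and> snd (mirror z j) \<le> s \<and> - h i s = - h j s"
      unfolding neg_equal_iff_equal snd_mirror by (rule triple)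
  qed
qed

context web begin

abbreviation "T j \<equiv> snd (z j)"

lemma web_flip: "web (flip z) (\<lambda>j s. h j (- s))"
  unfolding web_def using half_web_axioms reverse.half_web_axioms by simp

lemma web_mirror: "web (mirror z) (\<lambda>j s. - h j s)"
  unfolding web_def using half_web_mirror[OF half_web_axioms] half_web_mirror[OF reverse.half_web_axioms]
  by (simp add: flip_mirror)

lemma coal_bwd: "s \<le> T i \<Longrightarrow> s \<le> T j \<Longrightarrow> t \<le> s \<Longrightarrow> h i s = h j s \<Longrightarrow> h i t = h j t"
  using reverse.coal[of i "- s" j "- t"] by simp

lemma near: "0 < e \<Longrightarrow> \<exists>k. \<exists>d>0. T k < l \<and> (\<forall>s. \<bar>s - l\<bar> < d \<longrightarrow> \<bar>h k s - y\<bar> \<le> e)"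
proof -
  assume e: "0 < e"
  obtain d k where "d > 0" "T k \<le> l - d" "\<forall>s\<in>{l - d..l + d}. \<bar>h k s - y\<bar> \<le> e"
    using tube[OF e, of "max \<bar>l\<bar> \<bar>y\<bar>"] by (metis max.cobounded1 max.cobounded2)
  then show ?thesis by (intro exI[of _ k] exI[of _ d]) (auto simp: abs_less_iff)
qed

lemma order_strict: "h i s < h j s \<Longrightarrow> h i u \<le> h j u"
  using order[of i j] by (metis not_le)

lemma near_between: "(a :: real) < b \<Longrightarrow> \<exists>k. \<exists>d>0. T k < l \<and> (\<forall>s. \<bar>s - l\<bar> < d \<longrightarrow> a < h k s \<and> h k s < b)"
proof -
  assume ab: "a < b"
  then obtain k d where "d > 0" "T k < l" "\<forall>s. \<bar>s - l\<bar> < d \<longrightarrow> \<bar>h k s - (a + b) / 2\<bar> \<le> (b - a) / 4"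
    using near[of "(b - a) / 4" l "(a + b) / 2"] by auto
  moreover have "\<bar>x - (a + b) / 2\<bar> \<le> (b - a) / 4 \<Longrightarrow> a < x \<and> x < b" for x :: real
    using ab unfolding abs_le_iff by (auto simp: field_simps)
  ultimately show ?thesis by blast
qed

text \<open>Compactness: convergence at rational times propagates to all times because nearby web paths
  act as barriers.\<close>

lemma compactness:
  fixes k :: "nat \<Rightarrow> nat"
  obtains r g where "strict_mono r" "cconv (\<lambda>n. h (k (r n))) g"
proof -
  define q where "q = from_nat_into (\<rat> :: real set)"
  have q: "range q = \<rat>" unfolding q_def by (rule range_from_nat_into) (auto simp: countable_rat)
  interpret D: subseqs "\<lambda>n s. \<exists>l. (\<lambda>m. ereal (h (k (s m)) (q n))) \<longlonglongrightarrow> l"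
  proof
    fix n :: nat and s :: "nat \<Rightarrow> nat" assume "strict_mono s"
    obtain l r where "strict_mono r" "((\<lambda>m. ereal (h (k (s m)) (q n))) \<circ> r) \<longlonglongrightarrow> l"
      using compact_complete_linorder by blast
    then show "\<exists>r'. strict_mono r' \<and> (\<exists>l. (\<lambda>m. ereal (h (k ((s \<circ> r') m)) (q n))) \<longlonglongrightarrow> l)"
      by (auto simp: comp_def)
  qed
  define r where "r = D.diagseq"
  have r: "strict_mono r" unfolding r_def by (rule D.subseq_diagseq)
  define f where "f n = h (k (r n))" for n
  have rat: "\<exists>l. (\<lambda>m. ereal (f m p)) \<longlonglongrightarrow> l" if "p \<in> \<rat>" for p
  proof -
    obtain n where n: "p = q n" using \<open>p \<in> \<rat>\<close> q by (metis imageE)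
    have "\<exists>l. (\<lambda>m. ereal (h (k ((D.diagseq \<circ> (+) (Suc n)) m)) (q n))) \<longlonglongrightarrow> l"
    proof (rule D.diagseq_holds)
      fix n r s assume "strict_mono (r :: nat \<Rightarrow> nat)" "\<exists>l. (\<lambda>m. ereal (h (k (s m)) (q n))) \<longlonglongrightarrow> l"
      then show "\<exists>l. (\<lambda>m. ereal (h (k ((s \<circ> r) m)) (q n))) \<longlonglongrightarrow> l"
        using LIMSEQ_subseq_LIMSEQ[of "\<lambda>m. ereal (h (k (s m)) (q n))" _ r] by (auto simp: comp_def)
    qed
    then obtain l where "(\<lambda>m. ereal (f (m + Suc n) p)) \<longlonglongrightarrow> l" by (auto simp: comp_def f_def r_def n add.commute)
    then have "(\<lambda>m. ereal (f m p)) \<longlonglongrightarrow> l" by (rule LIMSEQ_offset[where f = "\<lambda>m. ereal (f m p)"])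
    then show ?thesis by blast
  qed
  \<comment> \<open>The greatest level above which the sequence stays eventually near
    \<open>l\<close>. With this choice the lower half of \<open>cconv\<close> holds by definition
    and only the upper half needs barriers.\<close>
  define g where "g l = Sup (ereal ` {a. \<exists>N. \<exists>d>0. \<forall>n\<ge>N. \<forall>s. \<bar>s - l\<bar> < d \<longrightarrow> a < f n s})" for l
  have "cconv f g"
    unfolding cconv_def
  proof (intro allI conjI impI)
    fix l a assume "ereal a < g l"
    then obtain b where b: "a < b" "\<exists>N. \<exists>d>0. \<forall>n\<ge>N. \<forall>s. \<bar>s - l\<bar> < d \<longrightarrow> b < f n s"
      unfolding g_def less_Sup_iff by auto
    then show "\<exists>N. \<exists>d>0. \<forall>n\<ge>N. \<forall>s. \<bar>s - l\<bar> < d \<longrightarrow> a < f n s" by (meson less_trans)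
  next
    fix l a assume ga: "g l < ereal a"
    then obtain a' where a': "g l < ereal a'" "a' < a" using ereal_dense2 by (metis ereal_less_eq(3) less_ereal.simps(1))
    have na': "\<exists>n\<ge>N. \<exists>s. \<bar>s - l\<bar> < d \<and> f n s \<le> a'" if "d > 0" for N d
    proof (rule ccontr)
      assume "\<not> ?thesis"
      then have "\<forall>n\<ge>N. \<forall>s. \<bar>s - l\<bar> < d \<longrightarrow> a' < f n s" by (meson not_le)
      then have "ereal a' \<le> g l" unfolding g_def using that by (intro Sup_upper imageI CollectI) blast
      then show False using a' by simp
    qed
    define c where "c = (a' + a) / 2"
    have c: "a' < c" "c < a" using a' by (auto simp: c_def)
    obtain i d1 where i: "d1 > 0" "\<And>s. \<bar>s - l\<bar> < d1 \<Longrightarrow> a' < h i s \<and> h i s < c" using near_between[OF c(1), of l] by blast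
    obtain j d2 where j: "d2 > 0" "\<And>s. \<bar>s - l\<bar> < d2 \<Longrightarrow> c < h j s \<and> h j s < a" using near_between[OF c(2), of l] by blast
    define d where "d = min d1 d2"
    have d: "d > 0" using i j by (simp add: d_def)
    obtain p where p: "p \<in> \<rat>" "l < p" "p < l + d" using Rats_dense_in_real[of l "l + d"] d by auto
    have pl: "\<bar>p - l\<bar> < d1" "\<bar>p - l\<bar> < d2" using p by (auto simp: d_def)
    obtain L where L: "(\<lambda>m. ereal (f m p)) \<longlonglongrightarrow> L" using rat[OF p(1)] by blast
    \<comment> \<open>If the sequence were above barrier \<open>i\<close> at the rational time
      \<open>p\<close> for all large \<open>n\<close>, it would by ordering stay above it at all
      times, against the dips below \<open>a'\<close> near \<open>l\<close>. The second barrier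
      \<open>j\<close> then carries the bound at \<open>p\<close> back to a neighbourhood of
      \<open>l\<close>.\<close>
    have "L \<le> ereal (h i p)"
    proof (rule ccontr)
      assume "\<not> ?thesis"
      then have "eventually (\<lambda>n. ereal (h i p) < ereal (f n p)) sequentially" using L by (intro order_tendstoD) auto
      then obtain N where N: "\<And>n. n \<ge> N \<Longrightarrow> h i p < f n p" by (auto simp: eventually_sequentially)
      obtain n s where ns: "n \<ge> N" "\<bar>s - l\<bar> < d" "f n s \<le> a'" using na'[OF d, of N] by blast
      have "f n s < h i s" using ns i(2)[of s] by (auto simp: d_def)
      then have "f n p \<le> h i p" unfolding f_def by (rule order_strict)
      then show False using N[OF ns(1)] by simp
    qed
    then have "L < ereal c" using i(2)[OF pl(1)] by (metis ereal_less_eq(3) le_less_trans less_ereal.simps(1))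
    then have "L < ereal (h j p)" using j(2)[OF pl(2)] by (metis less_ereal.simps(1) less_trans)
    then have "eventually (\<lambda>n. ereal (f n p) < ereal (h j p)) sequentially" using L by (intro order_tendstoD)
    then obtain N where N: "\<And>n. n \<ge> N \<Longrightarrow> f n p < h j p" by (auto simp: eventually_sequentially)
    have "f n s < a" if "n \<ge> N" "\<bar>s - l\<bar> < d2" for n s
    proof -
      have "f n s \<le> h j s" using N[OF that(1)] unfolding f_def by (rule order_strict)
      then show ?thesis using j(2)[OF that(2)] by simp
    qed
    then show "\<exists>N. \<exists>d>0. \<forall>n\<ge>N. \<forall>s. \<bar>s - l\<bar> < d \<longrightarrow> f n s < a" using j(1) by blast
  qed
  then show thesis using r that unfolding f_def by blast
qed

text \<open>A skeleton path that exceeds \<open>K\<close> at \<open>s\<close> is eventually below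
  the sequence at \<open>l\<close>, hence at every time; so no value of the limit is below
  \<open>K\<close>.\<close>

lemma limit_infinite:
  assumes c: "cconv (\<lambda>n. h (k n)) g" and l: "g l = \<infinity>"
  shows "g s = \<infinity>"
proof (rule ccontr)
  assume "g s \<noteq> \<infinity>"
  then obtain K where K: "g s < ereal K" using less_PInf_Ex_of_nat by auto
  obtain m where m: "K < h m s" using near_between[of K "K + 1" s] by force
  obtain N where N: "\<And>n. n \<ge> N \<Longrightarrow> h m l < h (k n) l"
    using cconv_lower[OF c, of "h m l" l] l by force
  obtain N' where N': "\<And>n. n \<ge> N' \<Longrightarrow> h (k n) s < K"
    using cconv_upper[OF c K] by force
  have "h m s \<le> h (k (max N N')) s" by (rule order_strict[OF N]) simp
  then show False using N'[of "max N N'"] m by simp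
qed

lemma limit_minus_infinite:
  assumes c: "cconv (\<lambda>n. h (k n)) g" and l: "g l = -\<infinity>"
  shows "g s = -\<infinity>"
proof -
  interpret m: web "mirror z" "\<lambda>j s. - h j s" by (rule web_mirror)
  have "- g s = \<infinity>" by (rule m.limit_infinite[OF cconv_uminus[OF c], of l]) (simp add: l)
  then show ?thesis by (simp add: ereal_uminus_eq_reorder)
qed

text \<open>A finite limit is squeezed between two forward paths, and these meet at some time
  \<open>s\<close>. A path of the sequence that started well after \<open>s\<close> would, on its
  backward part, be equal to both of them at a rational time, which \<open>apart\<close>
  forbids.\<close>

lemma limit_starts_bounded_above:
  assumes c: "cconv (\<lambda>n. h (k n)) g" and fin: "\<bar>g l\<bar> \<noteq> \<infinity>"
  shows "\<exists>B. \<exists>N. \<forall>n\<ge>N. T (k n) \<le> B"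
proof -
  obtain x where x: "g l = ereal x" using fin by auto
  obtain i where i: "T i < l" "h i l < x" using near_between[of "x - 1" x l] by force
  obtain j where j: "T j < l" "x < h j l" using near_between[of x "x + 1" l] by force
  obtain s where s: "T i \<le> s" "T j \<le> s" "h i s = h j s" using meet[of i j] by auto
  obtain N1 where N1: "\<And>n. n \<ge> N1 \<Longrightarrow> h i l < h (k n) l" using cconv_lower[OF c, of "h i l" l] i x by force
  obtain N2 where N2: "\<And>n. n \<ge> N2 \<Longrightarrow> h (k n) l < h j l" using cconv_upper[OF c, of l "h j l"] j x by force
  have "T (k n) \<le> s + 1" if n: "n \<ge> max N1 N2" for n
  proof (rule ccontr)
    assume "\<not> ?thesis"
    then obtain r where r: "r \<in> \<rat>" "s < r" "r < T (k n)" using Rats_dense_in_real[of s "T (k n)"] by auto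
    have "h i r \<le> h (k n) r" "h (k n) r \<le> h j r" using order_strict N1[of n] N2[of n] n by auto
    moreover have "h i r = h j r" using coal[OF s(1,2) _ s(3)] r by simp
    ultimately show False using apart[OF r(1), of i "k n"] r s by simp
  qed
  then show ?thesis by blast
qed

lemma limit_starts_bounded_below:
  assumes c: "cconv (\<lambda>n. h (k n)) g" and fin: "\<bar>g l\<bar> \<noteq> \<infinity>"
  shows "\<exists>B. \<exists>N. \<forall>n\<ge>N. B \<le> T (k n)"
proof -
  interpret f: web "flip z" "\<lambda>j s. h j (- s)" by (rule web_flip)
  obtain B N where "\<forall>n\<ge>N. - T (k n) \<le> B"
    using f.limit_starts_bounded_above[OF cconv_flip[OF c], of "- l"] fin by auto
  then show ?thesis by (intro exI[of _ "- B"] exI[of _ N]) (auto simp: minus_le_iff)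
qed

lemma limit_path_skeleton: "limit_path z h (fst (z j)) (T j) (h j)"
  unfolding limit_path_def
proof (intro exI[of _ "\<lambda>_. j"] conjI)
  show "cconv (\<lambda>n. h j) (\<lambda>s. ereal (h j s))"
    unfolding cconv_def
  proof (intro allI conjI impI)
    fix l a
    have op: "\<exists>d>0. \<forall>s. \<bar>s - l\<bar> < d \<longrightarrow> h j s \<in> S" if "open S" "h j l \<in> S" for S
    proof -
      have "(h j \<longlongrightarrow> h j l) (nhds l)"
        using cont[of j] by (simp add: continuous_on_def tendsto_at_iff_tendsto_nhds)
      from topological_tendstoD[OF this that] show ?thesis
        unfolding eventually_nhds_metric dist_real_def by blast
    qed
    show "ereal a < ereal (h j l) \<Longrightarrow> \<exists>N. \<exists>d>0. \<forall>n\<ge>N. \<forall>s. \<bar>s - l\<bar> < d \<longrightarrow> a < h j s"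
      using op[of "{a<..}"] by auto
    show "ereal (h j l) < ereal a \<Longrightarrow> \<exists>N. \<exists>d>0. \<forall>n\<ge>N. \<forall>s. \<bar>s - l\<bar> < d \<longrightarrow> h j s < a"
      using op[of "{..<a}"] by auto
  qed
qed simp

lemma limit_path_tendsto:
  "cconv f (\<lambda>s. ereal (g s)) \<Longrightarrow> s \<longlonglongrightarrow> l \<Longrightarrow> (\<lambda>n. f n (s n)) \<longlonglongrightarrow> g l"
  using cconv_tendsto[of f "\<lambda>s. ereal (g s)" s l] by simp

lemma limit_path_start: "limit_path z h x t g \<Longrightarrow> g t = x"
proof -
  assume "limit_path z h x t g"
  then obtain k where k: "(\<lambda>n. z (k n)) \<longlonglongrightarrow> (x, t)" "cconv (\<lambda>n. h (k n)) (\<lambda>s. ereal (g s))"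
    by (auto simp: limit_path_def)
  have "(\<lambda>n. h (k n) (T (k n))) \<longlonglongrightarrow> g t" using limit_path_tendsto[OF k(2) tendsto_snd[OF k(1)]] by simp
  moreover have "(\<lambda>n. h (k n) (T (k n))) \<longlonglongrightarrow> x" using tendsto_fst[OF k(1)] by (simp add: start)
  ultimately show "g t = x" by (rule LIMSEQ_unique)
qed

lemma limit_path_order:
  assumes "limit_path z h x t g" "limit_path z h x' t' g'"
  shows "(\<forall>s. g s \<le> g' s) \<or> (\<forall>s. g' s \<le> g s)"
proof (rule ccontr)
  assume "\<not> ?thesis"
  then obtain a b where ab: "g' a < g a" "g b < g' b" by (auto simp: not_le)
  obtain k k' where k: "cconv (\<lambda>n. h (k n)) (\<lambda>s. ereal (g s))" and k': "cconv (\<lambda>n. h (k' n)) (\<lambda>s. ereal (g' s))"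
    using assms by (auto simp: limit_path_def)
  note t = limit_path_tendsto[OF k tendsto_const] limit_path_tendsto[OF k' tendsto_const]
  have "eventually (\<lambda>n. 0 < h (k n) a - h (k' n) a) sequentially"
    using ab by (intro order_tendstoD(1)[OF tendsto_diff[OF t(1) t(2)]]) simp
  moreover have "eventually (\<lambda>n. 0 < h (k' n) b - h (k n) b) sequentially"
    using ab by (intro order_tendstoD(1)[OF tendsto_diff[OF t(2) t(1)]]) simp
  ultimately have "eventually (\<lambda>n. False) sequentially"
  proof eventually_elim
    case (elim n)
    then have "h (k' n) b \<le> h (k n) b" by (intro order_strict[of _ a]) simp
    with elim show ?case by simp
  qed
  then show False by simp
qed

lemma limit_path_order_strict:
  "limit_path z h x t g \<Longrightarrow> limit_path z h x' t' g' \<Longrightarrow> g a < g' a \<Longrightarrow> g b \<le> g' b"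
  using limit_path_order[of x t g x' t' g'] by (metis not_le)

text \<open>Skeleton paths just above and just below the value at \<open>l\<close> bound
  \<open>g\<close> at all times by ordering, and they stay close to that value near
  \<open>l\<close>.\<close>

lemma limit_path_cont:
  assumes g: "limit_path z h x t g" shows "continuous_on UNIV g"
proof -
  have "\<exists>d>0. \<forall>s. \<bar>s - l\<bar> < d \<longrightarrow> \<bar>g s - g l\<bar> < e" if e: "0 < e" for l e
  proof -
    obtain i d1 where i: "d1 > 0" "\<forall>s. \<bar>s - l\<bar> < d1 \<longrightarrow> g l < h i s \<and> h i s < g l + e"
      using near_between[of "g l" "g l + e" l] e by auto
    obtain j d2 where j: "d2 > 0" "\<forall>s. \<bar>s - l\<bar> < d2 \<longrightarrow> g l - e < h j s \<and> h j s < g l"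
      using near_between[of "g l - e" "g l" l] e by auto
    have il: "g l < h i l" and jl: "h j l < g l" using i j by auto
    have up: "g s \<le> h i s" and lo: "h j s \<le> g s" for s
      by (rule limit_path_order_strict[OF g limit_path_skeleton il], rule limit_path_order_strict[OF limit_path_skeleton g jl])
    have "\<bar>g s - g l\<bar> < e" if "\<bar>s - l\<bar> < min d1 d2" for s
    proof -
      have "h i s < g l + e" "g l - e < h j s" using i(2) j(2) that by auto
      then show ?thesis using up[of s] lo[of s] by linarith
    qed
    then show ?thesis
      using i(1) j(1) by (intro exI[of _ "min d1 d2"]) simp
  qed
  then show ?thesis
    unfolding continuous_on_iff dist_real_def by blast
qed

lemma limit_pathI:
  "(\<lambda>n. z (k n)) \<longlonglongrightarrow> (x, t) \<Longrightarrow> cconv (\<lambda>n. h (k n)) (\<lambda>s. ereal (g s)) \<Longrightarrow> limit_path z h x t g"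
  unfolding limit_path_def by (intro exI conjI)

text \<open>Finiteness at one time spreads to all times and bounds the starting times, so a
  subsequence of starting points converges. A limit is therefore either identically infinite or a
  genuine limit path.\<close>

lemma cconv_cases:
  assumes c: "cconv (\<lambda>n. h (k n)) g" and fin: "\<bar>g l\<bar> \<noteq> \<infinity>"
  obtains x t g' r where "g = (\<lambda>s. ereal (g' s))" "strict_mono r"
    "(\<lambda>n. z (k (r n))) \<longlonglongrightarrow> (x, t)" "limit_path z h x t g'"
proof -
  define g' where "g' s = real_of_ereal (g s)" for s
  have g: "g = (\<lambda>s. ereal (g' s))"
  proof
    fix s
    have "g s \<noteq> \<infinity>" using limit_infinite[OF c, of s l] fin by auto
    moreover have "g s \<noteq> -\<infinity>" using limit_minus_infinite[OF c, of s l] fin by auto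
    ultimately show "g s = ereal (g' s)" by (cases "g s") (auto simp: g'_def)
  qed
  obtain A N1 where A: "\<And>n. n \<ge> N1 \<Longrightarrow> A \<le> T (k n)" using limit_starts_bounded_below[OF c fin] by blast
  obtain B N2 where B: "\<And>n. n \<ge> N2 \<Longrightarrow> T (k n) \<le> B" using limit_starts_bounded_above[OF c fin] by blast
  define N where "N = max N1 N2"
  have "range (\<lambda>n. T (k (n + N))) \<subseteq> {A..B}" using A B by (auto simp: N_def)
  then have "bounded (range (\<lambda>n. T (k (n + N))))" using bounded_subset bounded_closed_interval by blast
  then obtain t q where q: "strict_mono q" "((\<lambda>n. T (k (n + N))) \<circ> q) \<longlonglongrightarrow> t"
    using bounded_imp_convergent_subsequence by blast
  define r where "r n = q n + N" for n
  have r: "strict_mono r" using q(1) by (simp add: r_def strict_mono_def)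
  have t: "(\<lambda>n. T (k (r n))) \<longlonglongrightarrow> t" using q(2) by (simp add: r_def comp_def)
  have cr: "cconv (\<lambda>n. h (k (r n))) (\<lambda>s. ereal (g' s))" using cconv_subseq[OF c r] by (simp add: g)
  have "(\<lambda>n. h (k (r n)) (T (k (r n)))) \<longlonglongrightarrow> g' t" by (rule limit_path_tendsto[OF cr t])
  then have z: "(\<lambda>n. z (k (r n))) \<longlonglongrightarrow> (g' t, t)" using tendsto_Pair[OF _ t, of "\<lambda>n. fst (z (k (r n)))"] by (simp add: start)
  then have "limit_path z h (g' t) t g'" using cr by (rule limit_pathI)
  then show thesis using that[OF g r z] by simp
qed

lemma limit_exists:
  assumes z: "(\<lambda>n. z (k n)) \<longlonglongrightarrow> (x, t)"
  obtains r g where "strict_mono r" "cconv (\<lambda>n. h (k (r n))) (\<lambda>s. ereal (g s))" "limit_path z h x t g"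
proof -
  obtain r g where r: "strict_mono r" "cconv (\<lambda>n. h (k (r n))) g" using compactness[of k] by blast
  have zr: "(\<lambda>n. z (k (r n))) \<longlonglongrightarrow> (x, t)" using LIMSEQ_subseq_LIMSEQ[OF z r(1)] by (simp add: comp_def)
  have "(\<lambda>n. ereal (h (k (r n)) (T (k (r n))))) \<longlonglongrightarrow> g t"
    using cconv_tendsto[OF r(2) tendsto_snd[OF zr]] by simp
  moreover have "(\<lambda>n. ereal (h (k (r n)) (T (k (r n))))) \<longlonglongrightarrow> ereal x"
    using tendsto_fst[OF zr] by (simp add: start)
  ultimately have "g t = ereal x" by (rule LIMSEQ_unique)
  then have "\<bar>g t\<bar> \<noteq> \<infinity>" by simp
  from cconv_cases[OF r(2) this] obtain g' where g': "g = (\<lambda>s. ereal (g' s))" by metis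
  have "limit_path z h x t g'" by (rule limit_pathI[OF zr]) (use r(2) g' in \<open>simp\<close>)
  then show thesis using that r g' by blast
qed

text \<open>Paths started before \<open>u1\<close> take only finitely many values near
  \<open>g r1\<close> at the later time \<open>r1\<close>, so the converging values are eventually
  constant there. From \<open>r1\<close> on these paths coincide with each other, hence with the
  limit.\<close>

lemma limit_path_eventually_skeleton:
  assumes g: "limit_path z h x t g" and r: "t < r"
  shows "\<exists>k. T k < r \<and> (\<forall>u\<ge>r. g u = h k u)"
proof -
  obtain k where k: "(\<lambda>n. z (k n)) \<longlonglongrightarrow> (x, t)" "cconv (\<lambda>n. h (k n)) (\<lambda>s. ereal (g s))"
    using g by (auto simp: limit_path_def)
  obtain u1 where u1: "u1 \<in> \<rat>" "t < u1" "u1 < r" using Rats_dense_in_real[OF r] by auto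
  obtain r1 where r1: "r1 \<in> \<rat>" "u1 < r1" "r1 < r" using Rats_dense_in_real[OF u1(3)] by auto
  define X where "X = {x::real. \<exists>k. T k \<le> u1 \<and> x = h k r1 \<and> \<bar>x\<bar> \<le> \<bar>g r1\<bar> + 1}"
  have "finite X"
    using reverse.fin[of "- r1" "- u1" "\<bar>g r1\<bar> + 1"] r1 u1 by (simp add: X_def)
  then have "open (- (X - {g r1}))" by (intro open_Compl finite_imp_closed) auto
  have lim: "(\<lambda>n. h (k n) r1) \<longlonglongrightarrow> g r1" by (rule limit_path_tendsto[OF k(2) tendsto_const])
  have 1: "eventually (\<lambda>n. h (k n) r1 \<in> - (X - {g r1})) sequentially"
    by (rule topological_tendstoD[OF lim \<open>open (- (X - {g r1}))\<close>]) simp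
  have 2: "eventually (\<lambda>n. dist (h (k n) r1) (g r1) < 1) sequentially" by (rule tendstoD[OF lim]) simp
  have 3: "eventually (\<lambda>n. T (k n) < u1) sequentially"
    using tendsto_snd[OF k(1)] u1 by (intro order_tendstoD(2)[of _ t]) auto
  have "eventually (\<lambda>n. T (k n) < u1 \<and> h (k n) r1 = g r1) sequentially"
    using 1 2 3
  proof eventually_elim
    case (elim n)
    then have "h (k n) r1 \<in> X" unfolding X_def dist_real_def by (intro CollectI exI[of _ "k n"]) auto
    then show ?case using elim by auto
  qed
  then obtain N where N: "\<And>n. n \<ge> N \<Longrightarrow> T (k n) < u1 \<and> h (k n) r1 = g r1" by (auto simp: eventually_sequentially)
  have "g u = h (k N) u" if u: "r \<le> u" for u
  proof -
    have "h (k n) u = h (k N) u" if "n \<ge> N" for n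
      by (rule coal[of _ r1]) (use N[OF that] N[of N] r1 u in auto)
    then have "(\<lambda>n. h (k n) u) \<longlonglongrightarrow> h (k N) u"
      by (intro tendsto_eventually eventually_sequentiallyI[of N])
    then show ?thesis by (rule LIMSEQ_unique[OF limit_path_tendsto[OF k(2) tendsto_const]])
  qed
  moreover have "T (k N) < r" using N[of N] r1 by simp
  ultimately show ?thesis by blast
qed

text \<open>A skeleton point is taken in the gap between the two paths just after \<open>u\<close>.
  With a quarter of the gap as unit, neither path moves by a unit while the point stays within one
  unit of the middle; ordering does the rest.\<close>

lemma dense_between:
  assumes g: "limit_path z h x t g" and g': "limit_path z h x' t' g'" and u: "g u < g' u" and e: "0 < e"
  shows "\<exists>k. u < T k \<and> T k < u + e \<and> (\<forall>s. g s \<le> h k s \<and> h k s \<le> g' s)"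
proof -
  define m where "m = (g' u - g u) / 4"
  have m: "0 < m" and m4: "4 * m = g' u - g u" using u by (simp_all add: m_def)
  have at: "\<exists>d>0. \<forall>s. \<bar>s - u\<bar> < d \<longrightarrow> \<bar>f s - f u\<bar> < m" if "limit_path z h x t f" for x t f
    using limit_path_cont[OF that] m unfolding continuous_on_iff dist_real_def by blast
  obtain d1 where d1: "d1 > 0" "\<And>s. \<bar>s - u\<bar> < d1 \<Longrightarrow> \<bar>g s - g u\<bar> < m" using at[OF g] by blast
  obtain d2 where d2: "d2 > 0" "\<And>s. \<bar>s - u\<bar> < d2 \<Longrightarrow> \<bar>g' s - g' u\<bar> < m" using at[OF g'] by blast
  define d where "d = min e (min d1 d2)"
  have d: "0 < d" using e d1 d2 by (simp add: d_def)
  obtain k where k: "u < T k" "T k < u + d" "\<bar>fst (z k) - (g u + 2 * m)\<bar> < m"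
    using dense_point[OF dense, of u "u + d" m "g u + 2 * m"] d m by auto
  have b: "\<bar>g (T k) - g u\<bar> < m" "\<bar>g' (T k) - g' u\<bar> < m"
    using k by (auto simp: d_def intro!: d1(2) d2(2))
  have "g (T k) < h k (T k)" using b(1) k(3) unfolding start by linarith
  moreover have "h k (T k) < g' (T k)" using b(2) k(3) m4 unfolding start by linarith
  ultimately have "g s \<le> h k s \<and> h k s \<le> g' s" for s
    using limit_path_order_strict[OF g limit_path_skeleton] limit_path_order_strict[OF limit_path_skeleton g'] by blast
  then show ?thesis using k by (auto simp: d_def)
qed

text \<open>If the two paths differed at \<open>u\<close>, a skeleton path \<open>m\<close> started
  later would lie between them and run backward into the point, as \<open>h k\<close> does. By the
  reversed \<open>triple\<close>, \<open>h m\<close> and \<open>h k\<close> have merged already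
  after \<open>t\<close>, before reaching the forward path \<open>h i\<close>. At a rational time in
  between, the one of the two paths enclosed between \<open>h m\<close> and \<open>h k\<close>
  equals \<open>h k\<close>, contradicting \<open>apart\<close>.\<close>

lemma one_side_unique:
  assumes i: "T i < t" "h i t = x" and k: "t < T k" "h k t = x"
    and g: "limit_path z h x1 t1 g" "t1 \<le> t" "g t = x"
    and g': "limit_path z h x2 t2 g'" "t2 \<le> t" "g' t = x"
    and side: "(\<forall>s. g s \<le> h k s \<and> g' s \<le> h k s) \<or> (\<forall>s. h k s \<le> g s \<and> h k s \<le> g' s)"
    and u: "t \<le> u"
  shows "g u = g' u"
proof -
  have *: "\<not> f u < f' u"
    if f: "limit_path z h x1 t1 f" "t1 \<le> t" "f t = x"
      and f': "limit_path z h x2 t2 f'" "t2 \<le> t" "f' t = x"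
      and side: "(\<forall>s. f' s \<le> h k s) \<or> (\<forall>s. h k s \<le> f s)" for x1 t1 f x2 t2 f'
  proof
    assume "f u < f' u"
    from dense_between[OF f(1) f'(1) this, of 1]
    obtain m where m: "u < T m" "\<And>s. f s \<le> h m s \<and> h m s \<le> f' s" by auto
    have "h m t = x" using m(2)[of t] f(3) f'(3) by simp
    then obtain s' where "s' < - t" "- T m \<le> s'" "- T k \<le> s'" "h m (- s') = h k (- s')"
      using reverse.triple[of m "- t" k i] i k m(1) u by auto
    then obtain s where s: "t < s" "s \<le> T m" "s \<le> T k" "h m s = h k s"
      by (metis less_minus_iff minus_le_iff)
    obtain r where r: "r \<in> \<rat>" "t < r" "r < s" using Rats_dense_in_real[OF s(1)] by auto
    have mk: "h m r = h k r" using coal_bwd[OF s(2,3) _ s(4)] r by simp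
    have "f r = h k r \<or> f' r = h k r" using side m(2)[of r] mk by (metis order_antisym)
    moreover have "f r \<noteq> h k r" "f' r \<noteq> h k r"
      using limit_path_eventually_skeleton[OF f(1), of r] limit_path_eventually_skeleton[OF f'(1), of r]
        apart[OF r(1), of _ k] r s f f' by fastforce+
    ultimately show False by simp
  qed
  show ?thesis
    using *[OF g g'] *[OF g' g] side by (metis linorder_neqE)
qed

text \<open>Skeleton points just after \<open>t\<close>, strictly below \<open>f\<close> and
  converging to the point, carry paths that stay below \<open>f\<close>; any limit of these starts
  at the point itself, which \<open>f\<close> need not do.\<close>

lemma exists_below:
  assumes f: "limit_path z h x' t' f" and x: "f t = x"
  shows "\<exists>g. limit_path z h x t g \<and> (\<forall>s. g s \<le> f s)"
proof -
  have "\<exists>k. t < T k \<and> T k < t + e \<and> \<bar>fst (z k) - x\<bar> < e \<and> (\<forall>s. h k s \<le> f s)" if e: "0 < e" for e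
  proof -
    \<comment> \<open>The start is within \<open>c\<close> of \<open>x - 3 * c\<close>, while
      \<open>f\<close> stays within \<open>c\<close> of \<open>x\<close>, so the start lies below
      \<open>f\<close> and still within \<open>e\<close> of \<open>x\<close>.\<close>
    define c where "c = e / 4"
    have c: "0 < c" and e4: "e = 4 * c" using e by (simp_all add: c_def)
    obtain d where d: "d > 0" "\<And>s. \<bar>s - t\<bar> < d \<Longrightarrow> \<bar>f s - f t\<bar> < c"
      using limit_path_cont[OF f] c unfolding continuous_on_iff dist_real_def by blast
    obtain k where k: "t < T k" "T k < t + min d e" "\<bar>fst (z k) - (x - 3 * c)\<bar> < c"
      using dense_point[OF dense, of t "t + min d e" c "x - 3 * c"] d e c by auto
    have "\<bar>f (T k) - x\<bar> < c" using d(2)[of "T k"] k x by auto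
    then have "h k (T k) < f (T k)" using k(3) unfolding start by linarith
    then have "h k s \<le> f s" for s by (rule limit_path_order_strict[OF limit_path_skeleton f])
    moreover have "\<bar>fst (z k) - x\<bar> < e" using k(3) c unfolding e4 by linarith
    ultimately show ?thesis using k by (intro exI[of _ k]) auto
  qed
  then have "\<forall>n. \<exists>k. t < T k \<and> T k < t + 1 / Suc n \<and> \<bar>fst (z k) - x\<bar> < 1 / Suc n \<and> (\<forall>s. h k s \<le> f s)"
    by (metis of_nat_0_less_iff zero_less_Suc zero_less_divide_1_iff)
  then obtain k where k: "\<And>n. t < T (k n) \<and> T (k n) < t + 1 / Suc n \<and> \<bar>fst (z (k n)) - x\<bar> < 1 / Suc n \<and> (\<forall>s. h (k n) s \<le> f s)"
    by metis
  have "(\<lambda>n. T (k n) - t) \<longlonglongrightarrow> 0" "(\<lambda>n. fst (z (k n)) - x) \<longlonglongrightarrow> 0"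
    using k by (auto intro!: Lim_null_comparison[OF _ LIMSEQ_Suc[OF lim_const_over_n[of "1::real"]]] always_eventually
        simp: less_imp_le abs_less_iff algebra_simps simp del: of_nat_Suc)
  then have "(\<lambda>n. z (k n)) \<longlonglongrightarrow> (x, t)"
    using tendsto_Pair[of "\<lambda>n. fst (z (k n))" x sequentially "\<lambda>n. T (k n)" t] by (simp add: LIM_zero_iff)
  then obtain r g where r: "strict_mono r" and c: "cconv (\<lambda>n. h (k (r n))) (\<lambda>s. ereal (g s))" and g: "limit_path z h x t g"
    by (rule limit_exists)
  have "g s \<le> f s" for s
    using k by (intro LIMSEQ_le_const2[OF limit_path_tendsto[OF c tendsto_const]]) auto
  then show ?thesis using g by blast
qed

lemma exists_above:
  assumes f: "limit_path z h x' t' f" and x: "f t = x"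
  shows "\<exists>g. limit_path z h x t g \<and> (\<forall>s. f s \<le> g s)"
proof -
  interpret m: web "mirror z" "\<lambda>j s. - h j s" by (rule web_mirror)
  obtain g where g: "limit_path (mirror z) (\<lambda>j s. - h j s) (- x) t g" "\<And>s. g s \<le> - f s"
    using m.exists_below[OF limit_path_mirror[OF f], of t "- x"] x by auto
  have "limit_path z h x t (\<lambda>s. - g s)"
    using g(1) limit_path_mirror_iff[of z h x t "\<lambda>s. - g s"] by simp
  then show ?thesis using g(2) by (intro exI[of _ "\<lambda>s. - g s"]) (simp add: le_minus_iff)
qed

text \<open>A strict gap arbitrarily soon after \<open>t\<close> provides skeleton paths inside it.
  Both bounding paths pass through the point, so the starting points are squeezed to it.\<close>

lemma exists_between:
  assumes f: "limit_path z h x1 t1 f" "f t = x" and f': "limit_path z h x2 t2 f'" "f' t = x"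
    and lt: "\<And>e. 0 < e \<Longrightarrow> \<exists>r. t < r \<and> r < t + e \<and> f r < f' r"
  shows "\<exists>g. limit_path z h x t g \<and> (\<forall>s. f s \<le> g s \<and> g s \<le> f' s)"
proof -
  have "\<exists>k. t < T k \<and> T k < t + e \<and> (\<forall>s. f s \<le> h k s \<and> h k s \<le> f' s)" if e: "0 < e" for e
  proof -
    obtain r where r: "t < r" "r < t + e / 2" "f r < f' r" using lt[of "e / 2"] e by auto
    have "0 < e / 2" using e by simp
    from dense_between[OF f(1) f'(1) r(3) this] obtain k where
      "r < T k" "T k < r + e / 2" "\<forall>s. f s \<le> h k s \<and> h k s \<le> f' s" by blast
    then show ?thesis using r by (intro exI[of _ k]) (auto simp: field_simps)
  qed
  then have "\<forall>n. \<exists>k. t < T k \<and> T k < t + 1 / Suc n \<and> (\<forall>s. f s \<le> h k s \<and> h k s \<le> f' s)"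
    by (metis of_nat_0_less_iff zero_less_Suc zero_less_divide_1_iff)
  then obtain k where k: "\<And>n. t < T (k n) \<and> T (k n) < t + 1 / Suc n \<and> (\<forall>s. f s \<le> h (k n) s \<and> h (k n) s \<le> f' s)"
    by metis
  have "(\<lambda>n. T (k n) - t) \<longlonglongrightarrow> 0"
    using k by (auto intro!: Lim_null_comparison[OF _ LIMSEQ_Suc[OF lim_const_over_n[of "1::real"]]] always_eventually
        simp: less_imp_le abs_less_iff algebra_simps simp del: of_nat_Suc)
  then have T: "(\<lambda>n. T (k n)) \<longlonglongrightarrow> t" by (simp add: LIM_zero_iff)
  have ct: "(\<lambda>n. p (T (k n))) \<longlonglongrightarrow> p t" if "limit_path z h x' t' p" for x' t' p
    using limit_path_cont[OF that] T by (auto simp: continuous_on_eq_continuous_at intro: isCont_tendsto_compose)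
  have "(\<lambda>n. fst (z (k n))) \<longlonglongrightarrow> x"
  proof (rule tendsto_sandwich[OF _ _ ct[OF f(1), unfolded f(2)] ct[OF f'(1), unfolded f'(2)]])
    show "eventually (\<lambda>n. f (T (k n)) \<le> fst (z (k n))) sequentially"
      "eventually (\<lambda>n. fst (z (k n)) \<le> f' (T (k n))) sequentially"
      using k start by (metis (no_types, lifting) always_eventually)+
  qed
  from tendsto_Pair[OF this T] have "(\<lambda>n. z (k n)) \<longlonglongrightarrow> (x, t)" by simp
  then obtain r g where r: "strict_mono r" and c: "cconv (\<lambda>n. h (k (r n))) (\<lambda>s. ereal (g s))" and g: "limit_path z h x t g"
    by (rule limit_exists)
  note lim = limit_path_tendsto[OF c tendsto_const]
  have "f s \<le> g s \<and> g s \<le> f' s" for s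
    using k by (intro conjI LIMSEQ_le_const2[OF lim] LIMSEQ_le_const[OF lim]) auto
  then show ?thesis using g by blast
qed

lemma agree_after:
  assumes "\<not> (\<exists>k. t < T k \<and> h k t = x)" "limit_path z h x t g" "limit_path z h x t g'" "t \<le> u"
  shows "g u = g' u"
proof -
  have *: "\<not> f u < f' u" if f: "limit_path z h x t f" and f': "limit_path z h x t f'" for f f'
  proof
    assume "f u < f' u"
    from dense_between[OF f f' this, of 1] obtain k where k: "u < T k" "\<And>s. f s \<le> h k s \<and> h k s \<le> f' s" by auto
    have "h k t = x" using k(2)[of t] limit_path_start[OF f] limit_path_start[OF f'] by simp
    moreover have "t < T k" using k(1) assms(4) by simp
    ultimately show False using assms(1) by blast
  qed
  show ?thesis using *[OF assms(2,3)] *[OF assms(3,2)] by (metis linorder_neqE)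
qed

lemma agree_before:
  assumes "\<not> (\<exists>i. T i < t \<and> h i t = x)" "limit_path z h x t g" "limit_path z h x t g'" "u \<le> t"
  shows "g u = g' u"
proof -
  interpret f: web "flip z" "\<lambda>j s. h j (- s)" by (rule web_flip)
  show ?thesis
    using f.agree_after[OF _ limit_path_flip[OF assms(2)] limit_path_flip[OF assms(3)], of "- u"] assms(1,4) by simp
qed

lemma incoming_skeleton:
  assumes g: "limit_path z h x0 t0 g" "t0 < t" "g t = x"
  shows "\<exists>i. T i < t \<and> h i t = x"
  using limit_path_eventually_skeleton[OF g(1,2)] g(3) by auto

text \<open>Shortly before \<open>t\<close> both paths run along skeleton paths, and
  \<open>triple\<close> says that these have merged before they touch the backward path. Hence a
  single class of incoming paths.\<close>

lemma incoming_coalesce: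
  assumes k: "t < T k" "h k t = x"
    and p: "limit_path z h x1 t1 p" "t1 < t" "p t = x" and q: "limit_path z h x2 t2 q" "t2 < t" "q t = x"
  shows "\<exists>s<t. t1 \<le> s \<and> t2 \<le> s \<and> (\<forall>u\<ge>s. p u = q u)"
proof -
  obtain r where r: "max t1 t2 < r" "r < t" using dense_order_class.dense[of "max t1 t2" t] p(2) q(2) by auto
  obtain a where a: "T a < r" "\<And>u. r \<le> u \<Longrightarrow> p u = h a u"
    using limit_path_eventually_skeleton[OF p(1), of r] r by auto
  obtain b where b: "T b < r" "\<And>u. r \<le> u \<Longrightarrow> q u = h b u"
    using limit_path_eventually_skeleton[OF q(1), of r] r by auto
  obtain s where s: "s < t" "T a \<le> s" "T b \<le> s" "h a s = h b s"
    using triple[of a t b k] a b r k p q by auto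
  have "p u = q u" if "max r s \<le> u" for u
    using coal[OF s(2,3) _ s(4), of u] a b that by simp
  then show ?thesis using s r by (intro exI[of _ "max r s"]) auto
qed

lemma backward_one_side_unique:
  assumes "T i < t" "h i t = x" "t < T k" "h k t = x"
    and g: "limit_path z h x t g" and g': "limit_path z h x t g'"
    and side: "(\<forall>s. g s \<le> h i s \<and> g' s \<le> h i s) \<or> (\<forall>s. h i s \<le> g s \<and> h i s \<le> g' s)"
    and u: "u \<le> t"
  shows "g u = g' u"
proof -
  interpret f: web "flip z" "\<lambda>j s. h j (- s)" by (rule web_flip)
  show ?thesis
    using f.one_side_unique[of k "- t" x i, OF _ _ _ _ limit_path_flip[OF g] _ _ limit_path_flip[OF g'], of "- u"]
      assms limit_path_start[OF g] limit_path_start[OF g'] by auto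
qed

lemma skeleton_ne:
  assumes "T i < t" "t < T k" "0 < e"
  shows "\<exists>r>t. r < T k \<and> r < t + e \<and> h i r \<noteq> h k r"
proof -
  obtain r where "r \<in> \<rat>" "t < r" "r < min (T k) (t + e)" using Rats_dense_in_real[of t "min (T k) (t + e)"] assms by auto
  then show ?thesis using apart[of r i k] assms by auto
qed

text \<open>At a point hit by a forward path \<open>h i\<close> and a backward path \<open>h k\<close>, a limit path is determined after
  \<open>t\<close> by its side of \<open>h k\<close> and before \<open>t\<close> by its side of \<open>h i\<close>. Of the four combinations, \<open>h i\<close> and
  \<open>h k\<close> being ordered excludes exactly one, which is the crossing one.\<close>

lemma branch_point_ordered:
  assumes i: "T i < t" "h i t = x" and k: "t < T k" "h k t = x" and ik: "\<And>s. h i s \<le> h k s"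
  obtains g1 g2 g3 where "limit_path z h x t g1" "limit_path z h x t g2" "limit_path z h x t g3"
    "\<forall>g. limit_path z h x t g \<longrightarrow> (\<forall>u\<ge>t. g u = g1 u) \<or> (\<forall>u\<ge>t. g u = g3 u)"
    "\<forall>g. limit_path z h x t g \<longrightarrow> (\<forall>u\<le>t. g u = g1 u) \<or> (\<forall>u\<le>t. g u = g3 u)"
    "\<forall>u\<ge>t. g2 u = g1 u" "\<forall>u\<le>t. g2 u = g3 u" "\<exists>u>t. h i u < g3 u" "\<exists>u<t. T i < u \<and> g1 u < h i u"
    "\<exists>u>t. g1 u \<noteq> g3 u"
proof -
  \<comment> \<open>\<open>g1\<close> lies below both \<open>h i\<close> and \<open>h k\<close>,
    \<open>g3\<close> above both, and \<open>g2\<close> between them. So \<open>g2\<close> shares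
    its right half with \<open>g1\<close> and its left half with \<open>g3\<close>; the remaining
    combination, right half of \<open>g3\<close> and left half of \<open>g1\<close>, changes sides
    of \<open>h i\<close>.\<close>
  obtain g1 where g1: "limit_path z h x t g1" "\<And>s. g1 s \<le> h i s"
    using exists_below[OF limit_path_skeleton i(2)] by blast
  obtain g3 where g3: "limit_path z h x t g3" "\<And>s. h k s \<le> g3 s"
    using exists_above[OF limit_path_skeleton k(2)] by blast
  have "\<exists>r. t < r \<and> r < t + e \<and> h i r < h k r" if "0 < e" for e
    using skeleton_ne[OF i(1) k(1) that] ik by (metis less_le not_le)
  from exists_between[OF limit_path_skeleton i(2) limit_path_skeleton k(2) this]
  obtain g2 where g2: "limit_path z h x t g2" "\<And>s. h i s \<le> g2 s" "\<And>s. g2 s \<le> h k s" by blast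
  have g1k: "g1 s \<le> h k s" and g3i: "h i s \<le> g3 s" for s
    using g1(2)[of s] g3(2)[of s] ik[of s] by auto
  have right: "g u = g' u"
    if "limit_path z h x t g" "limit_path z h x t g'" "(\<forall>s. g s \<le> h k s \<and> g' s \<le> h k s) \<or> (\<forall>s. h k s \<le> g s \<and> h k s \<le> g' s)" "t \<le> u"
    for g g' u
    using one_side_unique[OF i k that(1) order_refl _ that(2) order_refl _ that(3,4)] that(1,2)[THEN limit_path_start] by blast
  have left: "g u = g' u"
    if "limit_path z h x t g" "limit_path z h x t g'" "(\<forall>s. g s \<le> h i s \<and> g' s \<le> h i s) \<or> (\<forall>s. h i s \<le> g s \<and> h i s \<le> g' s)" "u \<le> t"
    for g g' u
    by (rule backward_one_side_unique[OF i k that])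
  obtain u where u: "t < u" "u < T k" "h i u \<noteq> h k u" using skeleton_ne[OF i(1) k(1), of 1] by auto
  have u': "h i u < h k u" using u(3) ik[of u] by simp
  obtain v where v: "v \<in> \<rat>" "T i < v" "v < t" using Rats_dense_in_real[OF i(1)] by auto
  \<comment> \<open>Read backward in time, the left half of \<open>g1\<close> is at \<open>v\<close>
    part of a skeleton path started after \<open>v\<close>, so \<open>apart\<close> at the rational
    time \<open>v\<close> makes the inequality with \<open>h i\<close> strict.\<close>
  obtain b where "- T b < - v" and b2: "\<forall>u\<ge>- v. g1 (- u) = h b (- u)"
    using web.limit_path_eventually_skeleton[OF web_flip limit_path_flip[OF g1(1)], of "- v"] v by auto
  then have b: "v < T b" "g1 v = h b v" using b2[rule_format, of "- v"] by simp_all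
  have v': "g1 v < h i v" using apart[OF v(1,2) b(1)] b(2) g1(2)[of v] by simp
  show thesis
  proof (rule that[OF g1(1) g2(1) g3(1)])
    show "\<forall>g. limit_path z h x t g \<longrightarrow> (\<forall>u\<ge>t. g u = g1 u) \<or> (\<forall>u\<ge>t. g u = g3 u)"
    proof (intro allI impI)
      fix g assume g: "limit_path z h x t g"
      show "(\<forall>u\<ge>t. g u = g1 u) \<or> (\<forall>u\<ge>t. g u = g3 u)"
        using limit_path_order[OF g limit_path_skeleton[of k]] right[OF g g1(1)] right[OF g g3(1)] g1k g3(2) by blast
    qed
    show "\<forall>g. limit_path z h x t g \<longrightarrow> (\<forall>u\<le>t. g u = g1 u) \<or> (\<forall>u\<le>t. g u = g3 u)"
    proof (intro allI impI)
      fix g assume g: "limit_path z h x t g"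
      show "(\<forall>u\<le>t. g u = g1 u) \<or> (\<forall>u\<le>t. g u = g3 u)"
        using limit_path_order[OF g limit_path_skeleton[of i]] left[OF g g1(1)] left[OF g g3(1)] g1(2) g3i by blast
    qed
  next
    show "\<forall>u\<ge>t. g2 u = g1 u" using right[OF g2(1) g1(1)] g2(3) g1k by blast
    show "\<forall>u\<le>t. g2 u = g3 u" using left[OF g2(1) g3(1)] g2(2) g3i by blast
    show "\<exists>u>t. h i u < g3 u" using u(1) u' g3(2)[of u] by (intro exI[of _ u]) auto
    show "\<exists>u<t. T i < u \<and> g1 u < h i u" using v v' by blast
    show "\<exists>u>t. g1 u \<noteq> g3 u" using u(1) u' g1(2)[of u] g3(2)[of u] by (intro exI[of _ u]) auto
  qed
qed

text \<open>Reflection of space reduces the opposite order of \<open>h i\<close> and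
  \<open>h k\<close> to the previous lemma; the disjunction in the conclusion records in which
  direction the excluded combination crosses.\<close>

lemma branch_point:
  assumes i: "T i < t" "h i t = x" and k: "t < T k" "h k t = x"
  obtains g1 g2 g3 where "limit_path z h x t g1" "limit_path z h x t g2" "limit_path z h x t g3"
    "\<forall>g. limit_path z h x t g \<longrightarrow> (\<forall>u\<ge>t. g u = g1 u) \<or> (\<forall>u\<ge>t. g u = g3 u)"
    "\<forall>g. limit_path z h x t g \<longrightarrow> (\<forall>u\<le>t. g u = g1 u) \<or> (\<forall>u\<le>t. g u = g3 u)"
    "\<forall>u\<ge>t. g2 u = g1 u" "\<forall>u\<le>t. g2 u = g3 u"
    "(\<exists>u>t. h i u < g3 u) \<and> (\<exists>u<t. T i < u \<and> g1 u < h i u) \<or>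
     (\<exists>u>t. g3 u < h i u) \<and> (\<exists>u<t. T i < u \<and> h i u < g1 u)"
    "\<exists>u>t. g1 u \<noteq> g3 u"
proof (cases "\<forall>s. h i s \<le> h k s")
  case True
  then have ik: "h i s \<le> h k s" for s by simp
  obtain g1 g2 g3 where g: "limit_path z h x t g1" "limit_path z h x t g2" "limit_path z h x t g3"
    and right: "\<forall>g. limit_path z h x t g \<longrightarrow> (\<forall>u\<ge>t. g u = g1 u) \<or> (\<forall>u\<ge>t. g u = g3 u)"
    and left: "\<forall>g. limit_path z h x t g \<longrightarrow> (\<forall>u\<le>t. g u = g1 u) \<or> (\<forall>u\<le>t. g u = g3 u)"
    and g2: "\<forall>u\<ge>t. g2 u = g1 u" "\<forall>u\<le>t. g2 u = g3 u"
    and sep: "\<exists>u>t. h i u < g3 u" "\<exists>u<t. T i < u \<and> g1 u < h i u" "\<exists>u>t. g1 u \<noteq> g3 u"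
    by (rule branch_point_ordered[OF i k ik])
  show thesis
    using sep(1,2) by (intro that[OF g right left g2 _ sep(3)] disjI1 conjI)
next
  case False
  then have ik: "- h i s \<le> - h k s" for s using order[of i k] by auto
  interpret m: web "mirror z" "\<lambda>j s. - h j s" by (rule web_mirror)
  have i': "snd (mirror z i) < t" "- h i t = - x" and k': "t < snd (mirror z k)" "- h k t = - x" using i k by simp_all
  obtain g1 g2 g3 where g: "limit_path (mirror z) (\<lambda>j s. - h j s) (- x) t g1" "limit_path (mirror z) (\<lambda>j s. - h j s) (- x) t g2"
      "limit_path (mirror z) (\<lambda>j s. - h j s) (- x) t g3"
    and right: "\<forall>g. limit_path (mirror z) (\<lambda>j s. - h j s) (- x) t g \<longrightarrow> (\<forall>u\<ge>t. g u = g1 u) \<or> (\<forall>u\<ge>t. g u = g3 u)"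
    and left: "\<forall>g. limit_path (mirror z) (\<lambda>j s. - h j s) (- x) t g \<longrightarrow> (\<forall>u\<le>t. g u = g1 u) \<or> (\<forall>u\<le>t. g u = g3 u)"
    and g2: "\<forall>u\<ge>t. g2 u = g1 u" "\<forall>u\<le>t. g2 u = g3 u"
    and sep: "\<exists>u>t. - h i u < g3 u" "\<exists>u<t. snd (mirror z i) < u \<and> g1 u < - h i u" "\<exists>u>t. g1 u \<noteq> g3 u"
    by (rule m.branch_point_ordered[OF i' k' ik])
  have lp: "limit_path z h x t (\<lambda>s. - g s)" if "limit_path (mirror z) (\<lambda>j s. - h j s) (- x) t g" for g
    using that limit_path_mirror_iff[of z h x t "\<lambda>s. - g s"] by simp
  show thesis
  proof (rule that[OF lp[OF g(1)] lp[OF g(2)] lp[OF g(3)]])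
    have neg: "(\<forall>u. P u \<longrightarrow> - g u = f u) \<longleftrightarrow> (\<forall>u. P u \<longrightarrow> g u = - f u)" for P and g f :: "real \<Rightarrow> real"
      by (metis minus_equation_iff)
    show "\<forall>g. limit_path z h x t g \<longrightarrow> (\<forall>u\<ge>t. g u = - g1 u) \<or> (\<forall>u\<ge>t. g u = - g3 u)"
      using right limit_path_mirror unfolding neg[symmetric] by blast
    show "\<forall>g. limit_path z h x t g \<longrightarrow> (\<forall>u\<le>t. g u = - g1 u) \<or> (\<forall>u\<le>t. g u = - g3 u)"
      using left limit_path_mirror unfolding neg[symmetric] by blast
  next
    show "\<forall>u\<ge>t. - g2 u = - g1 u" "\<forall>u\<le>t. - g2 u = - g3 u" using g2 by simp_all
    show "(\<exists>u>t. h i u < - g3 u) \<and> (\<exists>u<t. T i < u \<and> - g1 u < h i u) \<or>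
       (\<exists>u>t. - g3 u < h i u) \<and> (\<exists>u<t. T i < u \<and> h i u < - g1 u)"
    proof (rule disjI2, intro conjI)
      show "\<exists>u>t. - g3 u < h i u" using sep(1) by (metis minus_less_iff)
      show "\<exists>u<t. T i < u \<and> h i u < - g1 u" using sep(2) by (metis less_minus_iff snd_mirror)
    qed
    show "\<exists>u>t. - g1 u \<noteq> - g3 u" using sep(3) by simp
  qed
qed

end

section \<open>From the almost sure properties to the pathwise setting\<close>

definition joined :: "(nat \<Rightarrow> real \<times> real) \<Rightarrow> (nat \<Rightarrow> real \<Rightarrow> real) \<Rightarrow> (nat \<Rightarrow> real \<Rightarrow> real) \<Rightarrow> nat \<Rightarrow> real \<Rightarrow> real" where
  "joined z w v j t = (if snd (z j) \<le> t then w j t else v j t)"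

lemma half_goodD:
  assumes "half_good z w v"
  shows "continuous_on {snd (z j)..} (w j)"
    and "w j (snd (z j)) = fst (z j)"
    and "snd (z i) \<le> s \<Longrightarrow> snd (z j) \<le> s \<Longrightarrow> s \<le> t \<Longrightarrow> w i s = w j s \<Longrightarrow> w i t = w j t"
    and "\<exists>d>0. \<forall>(t::real) (y::real). \<bar>t\<bar> \<le> Suc m \<longrightarrow> \<bar>y\<bar> \<le> Suc m \<longrightarrow>
        (\<exists>k. snd (z k) \<le> t - d \<and> (\<forall>s\<in>{t - d..t + d}. \<bar>w k s - y\<bar> \<le> 3 / Suc m))"
    and "\<exists>s\<ge>max (snd (z i)) (snd (z j)). w i s = w j s"
    and "r \<in> \<rat> \<Longrightarrow> snd (z i) < r \<Longrightarrow> r < snd (z k) \<Longrightarrow> w i r \<noteq> v k r"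
    and "snd (z i) < t \<Longrightarrow> snd (z j) < t \<Longrightarrow> t < snd (z k) \<Longrightarrow> w i t = v k t \<Longrightarrow> w j t = v k t \<Longrightarrow>
      \<exists>s<t. snd (z i) \<le> s \<and> snd (z j) \<le> s \<and> w i s = w j s"
    and "r \<in> \<rat> \<Longrightarrow> u \<in> \<rat> \<Longrightarrow> r < u \<Longrightarrow> finite {x::real. \<exists>k. u \<le> snd (z k) \<and> x = v k r \<and> \<bar>x\<bar> \<le> real K}"
    and "s \<in> {snd (z i)..snd (z j)} \<Longrightarrow> t \<in> {snd (z i)..snd (z j)} \<Longrightarrow> w i s < v j s \<Longrightarrow> w i t \<le> v j t"
proof -
  note D = assms[unfolded half_good_def]
  note D2 = D[THEN conjunct2] note D3 = D2[THEN conjunct2] note D4 = D3[THEN conjunct2]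
  note D5 = D4[THEN conjunct2] note D6 = D5[THEN conjunct2] note D7 = D6[THEN conjunct2]
  note D8 = D7[THEN conjunct2] note D9 = D8[THEN conjunct2]
  note E = D[THEN conjunct1] D2[THEN conjunct1] D3[THEN conjunct1] D4[THEN conjunct1] D5[THEN conjunct1]
    D6[THEN conjunct1] D7[THEN conjunct1] D8[THEN conjunct1] D9
  show "continuous_on {snd (z j)..} (w j)" by (rule E(1)[THEN spec])
  show "w j (snd (z j)) = fst (z j)" by (rule E(2)[THEN spec])
  show "snd (z i) \<le> s \<Longrightarrow> snd (z j) \<le> s \<Longrightarrow> s \<le> t \<Longrightarrow> w i s = w j s \<Longrightarrow> w i t = w j t"
    by (rule E(3)[rule_format])
  show "\<exists>d>0. \<forall>(t::real) (y::real). \<bar>t\<bar> \<le> Suc m \<longrightarrow> \<bar>y\<bar> \<le> Suc m \<longrightarrow>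
        (\<exists>k. snd (z k) \<le> t - d \<and> (\<forall>s\<in>{t - d..t + d}. \<bar>w k s - y\<bar> \<le> 3 / Suc m))"
    by (rule E(4)[THEN spec])
  show "\<exists>s\<ge>max (snd (z i)) (snd (z j)). w i s = w j s" by (rule E(5)[THEN spec, THEN spec])
  show "r \<in> \<rat> \<Longrightarrow> snd (z i) < r \<Longrightarrow> r < snd (z k) \<Longrightarrow> w i r \<noteq> v k r" by (rule E(6)[rule_format])
  show "snd (z i) < t \<Longrightarrow> snd (z j) < t \<Longrightarrow> t < snd (z k) \<Longrightarrow> w i t = v k t \<Longrightarrow> w j t = v k t \<Longrightarrow>
      \<exists>s<t. snd (z i) \<le> s \<and> snd (z j) \<le> s \<and> w i s = w j s" by (rule E(7)[rule_format])
  show "r \<in> \<rat> \<Longrightarrow> u \<in> \<rat> \<Longrightarrow> r < u \<Longrightarrow> finite {x::real. \<exists>k. u \<le> snd (z k) \<and> x = v k r \<and> \<bar>x\<bar> \<le> real K}"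
    by (rule E(8)[rule_format])
  show "s \<in> {snd (z i)..snd (z j)} \<Longrightarrow> t \<in> {snd (z i)..snd (z j)} \<Longrightarrow> w i s < v j s \<Longrightarrow> w i t \<le> v j t"
    by (rule E(9)[rule_format])
qed

lemma half_good_mono:
  assumes "half_good z w v" and s: "snd (z i) \<le> s" "snd (z j) \<le> s" "s \<le> t" and le: "w i s \<le> w j s"
  shows "w i t \<le> w j t"
proof (rule ccontr)
  assume n: "\<not> ?thesis"
  note cont = half_goodD(1)[OF assms(1)] and coal = half_goodD(3)[OF assms(1)]
  have "continuous_on {s..t} (\<lambda>u. w i u - w j u)"
    using s by (intro continuous_on_diff continuous_on_subset[OF cont]) auto
  then obtain u where u: "s \<le> u" "u \<le> t" "w i u - w j u = 0"
    using IVT'[of "\<lambda>u. w i u - w j u" s 0 t] le n s by auto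
  then have "w i t = w j t" using s by (intro coal[of i u j t]) auto
  then show False using n by simp
qed

text \<open>The total order comes from noncrossing on the interval between the two starting times,
  where one path is forward and the other backward. Outside it both are forward or both backward,
  and coalescence preserves the order reached at the end of the interval.\<close>

lemma half_good_half_web:
  assumes A: "half_good z w v" and B: "half_good (flip z) (\<lambda>j t. v j (- t)) (\<lambda>j t. w j (- t))"
    and dense: "closure (range z) = UNIV"
  shows "half_web z (joined z w v)"
proof -
  note cont = half_goodD(1)[OF A] and start = half_goodD(2)[OF A] and coal = half_goodD(3)[OF A]
    and tube = half_goodD(4)[OF A] and meet = half_goodD(5)[OF A] and apart = half_goodD(6)[OF A]
    and triple = half_goodD(7)[OF A] and fin = half_goodD(8)[OF A] and no_cross = half_goodD(9)[OF A]
  have cont': "continuous_on {- snd (z j)..} (\<lambda>t. v j (- t))" and start': "v j (snd (z j)) = fst (z j)" for j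
    using half_goodD(1,2)[OF B, of j] by simp_all
  have v_cont: "continuous_on {..snd (z j)} (v j)" for j
  proof -
    have "continuous_on {..snd (z j)} ((\<lambda>t. v j (- t)) \<circ> uminus)"
      by (intro continuous_on_compose continuous_on_subset[OF cont'[of j]] continuous_intros) auto
    then show ?thesis by (simp add: comp_def)
  qed
  have w_mono: "snd (z i) \<le> s \<Longrightarrow> snd (z j) \<le> s \<Longrightarrow> s \<le> t \<Longrightarrow> w i s \<le> w j s \<Longrightarrow> w i t \<le> w j t" for i j s t
    by (rule half_good_mono[OF A])
  have v_mono: "s \<le> snd (z i) \<Longrightarrow> s \<le> snd (z j) \<Longrightarrow> t \<le> s \<Longrightarrow> v i s \<le> v j s \<Longrightarrow> v i t \<le> v j t" for i j s t
    using half_good_mono[OF B, of i "- s" j "- t"] by simp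
  let ?h = "joined z w v"
  have after: "snd (z j) \<le> t \<Longrightarrow> ?h j t = w j t" and before: "t \<le> snd (z j) \<Longrightarrow> ?h j t = v j t" for j t
    using start start' by (auto simp: joined_def)
  have ord: "(\<forall>s. ?h i s \<le> ?h j s) \<or> (\<forall>s. ?h j s \<le> ?h i s)" if ij: "snd (z i) \<le> snd (z j)" for i j
  proof (cases "\<forall>s\<in>{snd (z i)..snd (z j)}. w i s \<le> v j s")
    case True
    have "?h i s \<le> ?h j s" for s
    proof -
      consider "s \<le> snd (z i)" | "snd (z j) \<le> s" | "s \<in> {snd (z i)..snd (z j)}" by fastforce
      then show ?thesis
      proof cases
        case 1
        have "v i (snd (z i)) \<le> v j (snd (z i))" using True ij start start' by (metis atLeastAtMost_iff order_refl)
        then show ?thesis using v_mono[of "snd (z i)" i j s] 1 ij by (simp add: before)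
      next
        case 2
        have "w i (snd (z j)) \<le> w j (snd (z j))" using True ij start start' by (metis atLeastAtMost_iff order_refl)
        then show ?thesis using w_mono[of i "snd (z j)" j s] 2 ij by (simp add: after)
      next
        case 3
        then show ?thesis using True by (simp add: after before)
      qed
    qed
    then show ?thesis by blast
  next
    case False
    then have ge: "v j s \<le> w i s" if "s \<in> {snd (z i)..snd (z j)}" for s
      using no_cross[OF that] that by (meson not_le)
    have "?h j s \<le> ?h i s" for s
    proof -
      consider "s \<le> snd (z i)" | "snd (z j) \<le> s" | "s \<in> {snd (z i)..snd (z j)}" by fastforce
      then show ?thesis
      proof cases
        case 1
        have "v j (snd (z i)) \<le> v i (snd (z i))" using ge[of "snd (z i)"] ij start start' by simp
        then show ?thesis using v_mono[of "snd (z i)" j i s] 1 ij by (simp add: before)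
      next
        case 2
        have "w j (snd (z j)) \<le> w i (snd (z j))" using ge[of "snd (z j)"] ij start start' by simp
        then show ?thesis using w_mono[of j "snd (z j)" i s] 2 ij by (simp add: after)
      next
        case 3
        then show ?thesis using ge by (simp add: after before)
      qed
    qed
    then show ?thesis by blast
  qed
  show ?thesis
  proof
    show "closure (range z) = UNIV" by fact
    show "?h j (snd (z j)) = fst (z j)" for j by (simp add: after start)
    show "(\<forall>s. ?h i s \<le> ?h j s) \<or> (\<forall>s. ?h j s \<le> ?h i s)" for i j
      using ord[of i j] disj_comms(1)[THEN iffD1, OF ord[of j i]] by (cases "snd (z i) \<le> snd (z j)") simp_all
    show "continuous_on UNIV (?h j)" for j
    proof -
      have "continuous_on ({snd (z j)..} \<union> {..snd (z j)}) (\<lambda>t. if snd (z j) \<le> t then w j t else v j t)"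
        by (rule continuous_on_cases) (use cont v_cont start start' in \<open>auto simp: not_le dest: order_antisym\<close>)
      moreover have "{snd (z j)..} \<union> {..snd (z j)} = UNIV" by auto
      ultimately show ?thesis by (simp add: joined_def[abs_def])
    qed
  next
    fix i j s t assume "snd (z i) \<le> s" "snd (z j) \<le> s" "s \<le> t" "?h i s = ?h j s"
    then show "?h i t = ?h j t" using coal[of i s j t] by (simp add: after)
  next
    fix e K :: real assume e: "0 < e"
    \<comment> \<open>One index serves both as the size of the box and, through
      \<open>3 / Suc m\<close>, as the precision of the tubes.\<close>
    define m where "m = nat \<lceil>max K (3 / e)\<rceil>"
    have "max K (3 / e) \<le> Suc m" unfolding m_def by linarith
    then have m: "K \<le> Suc m" "3 / Suc m \<le> e" using e by (auto simp: field_simps simp del: of_nat_Suc)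
    obtain d where d: "d > 0" "\<And>(t::real) (y::real). \<bar>t\<bar> \<le> Suc m \<Longrightarrow> \<bar>y\<bar> \<le> Suc m \<Longrightarrow>
        \<exists>k. snd (z k) \<le> t - d \<and> (\<forall>s\<in>{t - d..t + d}. \<bar>w k s - y\<bar> \<le> 3 / Suc m)"
      using tube[of m] by blast
    show "\<exists>d>0. \<forall>t y. \<bar>t\<bar> \<le> K \<longrightarrow> \<bar>y\<bar> \<le> K \<longrightarrow>
        (\<exists>k. snd (z k) \<le> t - d \<and> (\<forall>s\<in>{t - d..t + d}. \<bar>?h k s - y\<bar> \<le> e))"
    proof (intro exI[of _ d] conjI allI impI d(1))
      fix t y :: real assume "\<bar>t\<bar> \<le> K" "\<bar>y\<bar> \<le> K"
      then have "\<bar>t\<bar> \<le> Suc m" "\<bar>y\<bar> \<le> Suc m" using m(1) by linarith+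
      then obtain k where k: "snd (z k) \<le> t - d" "\<And>s. s \<in> {t - d..t + d} \<Longrightarrow> \<bar>w k s - y\<bar> \<le> 3 / Suc m"
        using d(2)[of t y] by blast
      have "\<bar>?h k s - y\<bar> \<le> e" if "s \<in> {t - d..t + d}" for s
        using k(2)[OF that] m(2) k(1) that by (simp add: after del: of_nat_Suc)
      then show "\<exists>k. snd (z k) \<le> t - d \<and> (\<forall>s\<in>{t - d..t + d}. \<bar>?h k s - y\<bar> \<le> e)" using k(1) by blast
    qed
  next
    fix i j
    obtain s where "s \<ge> max (snd (z i)) (snd (z j))" "w i s = w j s" using meet by blast
    then show "\<exists>s\<ge>max (snd (z i)) (snd (z j)). ?h i s = ?h j s" by (intro exI[of _ s]) (simp add: after)
  next
    fix r :: real and i k assume "r \<in> \<rat>" "snd (z i) < r" "r < snd (z k)"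
    then show "?h i r \<noteq> ?h k r" using apart[of r i k] by (simp add: after before)
  next
    fix i j k t assume a: "snd (z i) < t" "snd (z j) < t" "t < snd (z k)" "?h i t = ?h k t" "?h j t = ?h k t"
    then obtain s where "s < t" "snd (z i) \<le> s" "snd (z j) \<le> s" "w i s = w j s"
      using triple[of i t j k] by (auto simp: after before)
    then show "\<exists>s<t. snd (z i) \<le> s \<and> snd (z j) \<le> s \<and> ?h i s = ?h j s" by (intro exI[of _ s]) (simp add: after)
  next
    fix r u K :: real assume ru: "r \<in> \<rat>" "u \<in> \<rat>" "r < u"
    obtain n :: nat where n: "K \<le> real n" using real_arch_simple by blast
    show "finite {x::real. \<exists>k. u \<le> snd (z k) \<and> x = ?h k r \<and> \<bar>x\<bar> \<le> K}"
    proof (rule finite_subset[OF _ fin[OF ru, of n]])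
      show "{x::real. \<exists>k. u \<le> snd (z k) \<and> x = ?h k r \<and> \<bar>x\<bar> \<le> K} \<subseteq> {x. \<exists>k. u \<le> snd (z k) \<and> x = v k r \<and> \<bar>x\<bar> \<le> real n}"
      proof
        fix x assume "x \<in> {x::real. \<exists>k. u \<le> snd (z k) \<and> x = ?h k r \<and> \<bar>x\<bar> \<le> K}"
        then obtain k where "u \<le> snd (z k)" "x = ?h k r" "\<bar>x\<bar> \<le> K" by blast
        then have "u \<le> snd (z k) \<and> x = v k r \<and> \<bar>x\<bar> \<le> real n" using ru n before[of r k] by simp
        then show "x \<in> {x. \<exists>k. u \<le> snd (z k) \<and> x = v k r \<and> \<bar>x\<bar> \<le> real n}" by blast
      qed
    qed
  qed
qed

lemma half_good_web:
  assumes A: "half_good z w v" and B: "half_good (flip z) (\<lambda>j t. v j (- t)) (\<lambda>j t. w j (- t))"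
    and dense: "closure (range z) = UNIV" "closure (range (flip z)) = UNIV"
  shows "web z (joined z w v)"
proof -
  have A': "half_good (flip (flip z)) (\<lambda>j t. w j (- (- t))) (\<lambda>j t. v j (- (- t)))" using A by simp
  have "w j (snd (z j)) = fst (z j)" "v j (snd (z j)) = fst (z j)" for j
    using half_goodD(2)[OF A, of j] half_goodD(2)[OF B, of j] by simp_all
  then have eq: "joined (flip z) (\<lambda>j t. v j (- t)) (\<lambda>j t. w j (- t)) = (\<lambda>j s. joined z w v j (- s))"
    by (auto simp: joined_def fun_eq_iff minus_le_iff le_minus_iff dest: order_antisym)
  show ?thesis
    unfolding web_def using half_good_half_web[OF A B dense(1)] half_good_half_web[OF B A' dense(2)] by (simp add: eq)
qed

section \<open>The metric path spaces\<close>

lemma ereal_tanh_ereal [simp]: "ereal_tanh (ereal r) = tanh r"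
  and ereal_tanh_infty [simp]: "ereal_tanh \<infinity> = 1" "ereal_tanh (-\<infinity>) = -1"
  by (simp_all add: ereal_tanh_def)

lemma ereal_tanh_less_iff: "ereal_tanh x < ereal_tanh y \<longleftrightarrow> x < y"
proof -
  have lt: "x < y \<Longrightarrow> ereal_tanh x < ereal_tanh y" for x y
    by (cases x; cases y) (simp_all add: tanh_real_lt_1 tanh_real_gt_neg1)
  show ?thesis using lt[of x y] lt[of y x] ereal_tanh_inject[of x y] by (metis linorder_neqE less_asym')
qed

lemma ereal_tanh_tendsto_cancel: "((\<lambda>n. ereal_tanh (f n)) \<longlongrightarrow> ereal_tanh y) F \<Longrightarrow> (f \<longlongrightarrow> y) F"
  by (rule order_tendstoI) (drule (1) order_tendstoD[OF _ ereal_tanh_less_iff[THEN iffD2]], simp add: ereal_tanh_less_iff)+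

lemma Phi_dist_tendsto_D:
  assumes "(\<lambda>n. Phi_dist (F n) G) \<longlonglongrightarrow> 0"
  shows "(\<lambda>n. F n (ereal s)) \<longlonglongrightarrow> G (ereal s)"
proof (rule ereal_tanh_tendsto_cancel, rule LIM_zero_cancel, rule Lim_null_comparison)
  show "(\<lambda>n. (1 + \<bar>s\<bar>) * Phi_dist (F n) G) \<longlonglongrightarrow> 0"
    using tendsto_mult_right_zero[OF assms] by simp
  show "\<forall>\<^sub>F n in sequentially. norm (ereal_tanh (F n (ereal s)) - ereal_tanh (G (ereal s))) \<le> (1 + \<bar>s\<bar>) * Phi_dist (F n) G"
  proof (intro always_eventually allI)
    fix n
    have "\<bar>Phi (F n (ereal s)) (ereal s) - Phi (G (ereal s)) (ereal s)\<bar> \<le> Phi_dist (F n) G" by (rule Phi_dist_upper)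
    moreover have "Phi (F n (ereal s)) (ereal s) - Phi (G (ereal s)) (ereal s) = (ereal_tanh (F n (ereal s)) - ereal_tanh (G (ereal s))) / (1 + \<bar>s\<bar>)"
      by (simp add: Phi_def diff_divide_distrib)
    ultimately show "norm (ereal_tanh (F n (ereal s)) - ereal_tanh (G (ereal s))) \<le> (1 + \<bar>s\<bar>) * Phi_dist (F n) G"
      by (simp add: abs_divide divide_le_eq mult.commute add_pos_nonneg)
  qed
qed

text \<open>Continuous convergence is stated with real levels. A level of \<open>tanh\<close> is
  either below its range or comes from some real \<open>a\<close>, with \<open>artanh\<close> as
  inverse; the value \<open>-1\<close> needs separate care because no real argument attains
  it.\<close>

lemma less_ereal_tanh_approx:
  assumes "c < ereal_tanh y" shows "c < -1 \<or> (\<exists>a. ereal a < y \<and> c \<le> tanh a)"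
proof -
  consider "c < -1" | "c = -1" | "-1 < c" by linarith
  then show ?thesis
  proof cases
    case 2
    then have "y \<noteq> -\<infinity>" using assms by auto
    then obtain a where "ereal a < y" by (cases y) (auto intro: that[of 0] that[of "real_of_ereal y - 1"])
    then show ?thesis using 2 tanh_real_gt_neg1[of a] by (auto intro!: exI[of _ a])
  next
    case 3
    have "c < 1" using assms abs_ereal_tanh_le[of y] by linarith
    then have c: "0 < (1 + c) / (1 - c)" "1 + c \<noteq> 0" "1 - c \<noteq> 0" using 3 by simp_all
    have E: "exp (- 2 * artanh c) = (1 - c) / (1 + c)"
      using c by (simp add: artanh_def exp_minus exp_ln)
    have "1 - (1 - c) / (1 + c) = 2 * c / (1 + c)" "1 + (1 - c) / (1 + c) = 2 / (1 + c)"
      using c by (simp_all add: field_simps)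
    then have "tanh (artanh c) = c" unfolding tanh_real_altdef E using c by simp
    then obtain a where "tanh a = c" by blast
    then show ?thesis using assms ereal_tanh_less_iff[of "ereal a" y] by (intro disjI2 exI[of _ a]) simp
  qed simp
qed

lemma cconv_tanh:
  assumes c: "cconv f g" and e: "0 < e"
  shows "\<exists>N. \<exists>d>0. \<forall>n\<ge>N. \<forall>s. \<bar>s - l\<bar> < d \<longrightarrow> \<bar>tanh (f n s) - ereal_tanh (g l)\<bar> < e"
proof -
  have lower: "\<exists>N. \<exists>d>0. \<forall>n\<ge>N. \<forall>s. \<bar>s - l\<bar> < d \<longrightarrow> ereal_tanh (g l) - e < tanh (f n s)"
    if c: "cconv f g" for f g
  proof -
    have "ereal_tanh (g l) - e < ereal_tanh (g l)" using e by simp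
    from less_ereal_tanh_approx[OF this] show ?thesis
    proof
      assume "ereal_tanh (g l) - e < - 1"
      then show ?thesis using less_trans[OF _ tanh_real_gt_neg1] by (intro exI[of _ 0] exI[of _ 1]) simp
    next
      assume "\<exists>a. ereal a < g l \<and> ereal_tanh (g l) - e \<le> tanh a"
      then obtain a where a: "ereal a < g l" "ereal_tanh (g l) - e \<le> tanh a" by blast
      obtain N d where "d > 0" "\<And>n s. n \<ge> N \<Longrightarrow> \<bar>s - l\<bar> < d \<Longrightarrow> a < f n s"
        using cconv_lower[OF c a(1)] by blast
      then show ?thesis
        using a(2) by (intro exI[of _ N] exI[of _ d]) (auto intro: le_less_trans simp: tanh_real_less_iff)
    qed
  qed
  have neg: "ereal_tanh (- y) = - ereal_tanh y" for y by (cases y) simp_all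
  obtain N1 d1 where 1: "d1 > 0" "\<And>n s. n \<ge> N1 \<Longrightarrow> \<bar>s - l\<bar> < d1 \<Longrightarrow> ereal_tanh (g l) - e < tanh (f n s)"
    using lower[OF c] by blast
  obtain N2 d2 where 2: "d2 > 0" "\<And>n s. n \<ge> N2 \<Longrightarrow> \<bar>s - l\<bar> < d2 \<Longrightarrow> - ereal_tanh (g l) - e < - tanh (f n s)"
    using lower[OF cconv_uminus[OF c]] unfolding neg by auto
  have "\<bar>tanh (f n s) - ereal_tanh (g l)\<bar> < e" if "n \<ge> max N1 N2" "\<bar>s - l\<bar> < min d1 d2" for n s
    using 1(2)[of n s] 2(2)[of n s] that by (simp add: abs_less_iff)
  then show ?thesis using 1(1) 2(1) by (intro exI[of _ "max N1 N2"] exI[of _ "min d1 d2"]) simp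
qed

text \<open>On a compact interval the local estimates are combined by a finite cover. Outside it the
  weight \<open>1 / (1 + \<bar>s\<bar>)\<close> alone makes the difference at most
  \<open>2 / (1 + M)\<close>, and \<open>M = 6 / e\<close> is large enough for
  \<open>e / 2\<close>.\<close>

lemma cconv_Phi_dist:
  assumes c: "cconv \<phi> \<gamma>" and F: "\<And>n s. F n (ereal s) = ereal (\<phi> n s)" and G: "\<And>s. G (ereal s) = \<gamma> s"
  shows "(\<lambda>n. Phi_dist (F n) G) \<longlonglongrightarrow> 0"
proof (rule LIMSEQ_I)
  fix e :: real assume e: "0 < e"
  define M where "M = 6 / e"
  have M: "0 < M" "2 / (1 + M) \<le> e / 2" using e by (auto simp: M_def field_simps)
  have loc: "\<exists>N. \<exists>d>0. \<forall>n\<ge>N. \<forall>s. \<bar>s - l\<bar> < d \<longrightarrow> \<bar>tanh (\<phi> n s) - ereal_tanh (\<gamma> s)\<bar> \<le> e / 2" for l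
  proof -
    define b where "b = e / 4"
    have b: "0 < b" "e / 2 = 2 * b" using e by (simp_all add: b_def)
    obtain N d where d: "d > 0" "\<And>n s. n \<ge> N \<Longrightarrow> \<bar>s - l\<bar> < d \<Longrightarrow> \<bar>tanh (\<phi> n s) - ereal_tanh (\<gamma> l)\<bar> < b"
      using cconv_tanh[OF c b(1)] by blast
    \<comment> \<open>Continuity of the limit is a consequence of continuous convergence: the
      estimate near \<open>l\<close> passes to the limit at the fixed time \<open>s\<close>.\<close>
    have \<gamma>: "\<bar>ereal_tanh (\<gamma> s) - ereal_tanh (\<gamma> l)\<bar> \<le> b" if s: "\<bar>s - l\<bar> < d" for s
    proof (rule field_le_epsilon)
      fix e' :: real assume "0 < e'"
      then obtain N' where N': "\<And>n. n \<ge> N' \<Longrightarrow> \<bar>tanh (\<phi> n s) - ereal_tanh (\<gamma> s)\<bar> < e'"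
        using cconv_tanh[OF c, of e' s] by (metis abs_zero diff_self)
      show "\<bar>ereal_tanh (\<gamma> s) - ereal_tanh (\<gamma> l)\<bar> \<le> b + e'"
        using N'[OF max.cobounded2[of N' N]] d(2)[OF max.cobounded1[of N N'] s] by linarith
    qed
    have "\<bar>tanh (\<phi> n s) - ereal_tanh (\<gamma> s)\<bar> \<le> e / 2" if "n \<ge> N" "\<bar>s - l\<bar> < d" for n s
      using d(2)[OF that] \<gamma>[OF that(2)] unfolding b(2) by linarith
    then show ?thesis using d(1) by blast
  qed
  then obtain N d where Nd: "\<And>l. d l > 0" "\<And>l n s. n \<ge> N l \<Longrightarrow> \<bar>s - l\<bar> < d l \<Longrightarrow> \<bar>tanh (\<phi> n s) - ereal_tanh (\<gamma> s)\<bar> \<le> e / 2"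
    by metis
  obtain C where C: "finite C" "{-M..M} \<subseteq> (\<Union>l\<in>C. ball l (d l))"
  proof (rule compactE_image[of "{-M..M}" UNIV "\<lambda>l. ball l (d l)"])
    show "{-M..M} \<subseteq> (\<Union>l\<in>UNIV. ball l (d l))"
    proof
      show "s \<in> (\<Union>l\<in>UNIV. ball l (d l))" for s by (rule UN_I[of s]) (simp_all add: Nd(1))
    qed
  qed (rule compact_Icc open_ball that; assumption)+
  define N0 where "N0 = Max (insert 0 (N ` C))"
  have N0: "N l \<le> N0" if "l \<in> C" for l unfolding N0_def using C(1) that by (intro Max_ge) auto
  have "Phi_dist (F n) G \<le> e / 2" if n: "n \<ge> N0" for n
    unfolding Phi_dist_def
  proof (rule cSUP_least)
    fix t :: ereal
    show "\<bar>Phi (F n t) t - Phi (G t) t\<bar> \<le> e / 2"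
    proof (cases t)
      case (real s)
      have *: "\<bar>Phi (F n t) t - Phi (G t) t\<bar> = \<bar>tanh (\<phi> n s) - ereal_tanh (\<gamma> s)\<bar> / (1 + \<bar>s\<bar>)"
        by (simp add: real Phi_def F G diff_divide_distrib[symmetric])
      show ?thesis
      proof (cases "\<bar>s\<bar> \<le> M")
        case True
        then have "s \<in> (\<Union>l\<in>C. ball l (d l))" by (intro subsetD[OF C(2)]) (auto simp: abs_le_iff)
        then obtain l where l: "l \<in> C" "\<bar>s - l\<bar> < d l" by (auto simp: dist_real_def abs_minus_commute)
        have "\<bar>tanh (\<phi> n s) - ereal_tanh (\<gamma> s)\<bar> \<le> e / 2" using Nd(2)[OF _ l(2)] N0[OF l(1)] n by simp
        moreover have "\<bar>tanh (\<phi> n s) - ereal_tanh (\<gamma> s)\<bar> / (1 + \<bar>s\<bar>) \<le> \<bar>tanh (\<phi> n s) - ereal_tanh (\<gamma> s)\<bar>"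
          by (simp add: divide_le_eq mult_le_cancel_left1 algebra_simps add_pos_nonneg)
        ultimately show ?thesis unfolding * by linarith
      next
        case False
        have "\<bar>tanh (\<phi> n s) - ereal_tanh (\<gamma> s)\<bar> \<le> 2"
          using abs_ereal_tanh_le[of "ereal (\<phi> n s)"] abs_ereal_tanh_le[of "\<gamma> s"] by simp
        then have "\<bar>tanh (\<phi> n s) - ereal_tanh (\<gamma> s)\<bar> / (1 + \<bar>s\<bar>) \<le> 2 / (1 + M)"
          using False M(1) by (intro frac_le) auto
        then show ?thesis unfolding * using M(2) by linarith
      qed
    qed (use e in \<open>simp_all add: Phi_def\<close>)
  qed simp
  then have "norm (Phi_dist (F n) G - 0) < e" if "n \<ge> N0" for n
    using that e Phi_dist_nonneg[of "F n" G] by fastforce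
  then show "\<exists>no. \<forall>n\<ge>no. norm (Phi_dist (F n) G - 0) < e" by blast
qed

text \<open>At finite times this is continuity of a quotient. At the infinite times the weight
  forces the values to zero whatever the path does.\<close>

lemma continuous_Phi:
  assumes "continuous_on UNIV (\<lambda>s. ereal_tanh (f (ereal s)))"
  shows "continuous_on UNIV (\<lambda>t. Phi (f t) t)"
proof -
  have bound: "\<bar>Phi x t\<bar> < e" if "0 < e" "ereal (1 / e) < \<bar>t\<bar>" for x t and e :: real
  proof (cases t)
    case (real s)
    then have "1 / e < \<bar>s\<bar>" using that by simp
    then have "1 < e * (1 + \<bar>s\<bar>)" using that(1) by (simp add: field_simps)
    then have "\<bar>ereal_tanh x\<bar> < e * (1 + \<bar>s\<bar>)" using abs_ereal_tanh_le[of x] by linarith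
    then show ?thesis by (simp add: real Phi_def abs_divide divide_less_eq add_pos_nonneg)
  qed (use that in \<open>simp_all add: Phi_def\<close>)
  have inf: "isCont (\<lambda>t. Phi (f t) t) t" if S: "open S" "t \<in> S" "\<bar>t\<bar> = \<infinity>" "\<And>e. 0 < e \<Longrightarrow> open (S' e) \<and> t \<in> S' e \<and> (\<forall>u\<in>S' e. ereal (1 / e) < \<bar>u\<bar>)" for t S S'
    unfolding continuous_at tendsto_iff
  proof (intro allI impI)
    fix e :: real assume "0 < e"
    then have "\<forall>\<^sub>F u in at t. u \<in> S' e" using S(4)[of e] by (auto intro: eventually_at_topological[THEN iffD2])
    then show "\<forall>\<^sub>F u in at t. dist (Phi (f u) u) (Phi (f t) t) < e"
    proof eventually_elim
      case (elim u)
      have "Phi (f t) t = 0" using S(3) by (cases t) (simp_all add: Phi_def)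
      then show ?case using bound[OF \<open>0 < e\<close>, of u "f u"] S(4)[OF \<open>0 < e\<close>] elim by (simp add: dist_real_def)
    qed
  qed
  have "isCont (\<lambda>t. Phi (f t) t) t" for t
  proof (cases t)
    case PInf
    have "ereal (1 / e) < \<bar>u\<bar>" if "ereal (1 / e) < u" for u e using that by (cases u) auto
    then show ?thesis by (intro inf[of UNIV _ "\<lambda>e. {ereal (1 / e)<..}"]) (auto simp: PInf)
  next
    case MInf
    have "ereal (1 / e) < \<bar>u\<bar>" if "u < ereal (- (1 / e))" for u e using that by (cases u) auto
    then show ?thesis by (intro inf[of UNIV _ "\<lambda>e. {..<ereal (- (1 / e))}"]) (auto simp: MInf)
  next
    case (real s)
    have fin: "UNIV - {\<infinity>, -\<infinity>} = range ereal"
      by (auto simp: image_iff intro: ereal_cases)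
    have op: "open (range ereal)" unfolding fin[symmetric] by (intro open_Diff) auto
    have c1: "continuous_on UNIV (\<lambda>s::real. ereal_tanh (f (ereal s)) / (1 + \<bar>s\<bar>))"
      by (intro continuous_intros assms) (auto simp: add_nonneg_eq_0_iff)
    have c2: "continuous_on (range ereal) real_of_ereal" unfolding fin[symmetric] by (rule continuous_on_real)
    have "continuous_on (range ereal) (\<lambda>t. ereal_tanh (f (ereal (real_of_ereal t))) / (1 + \<bar>real_of_ereal t\<bar>))"
      by (rule continuous_on_compose2[OF c1 c2]) simp
    then have "continuous_on (range ereal) (\<lambda>t. Phi (f t) t)"
      by (rule continuous_on_eq) (erule imageE, simp add: Phi_def)
    then show ?thesis using op real by (simp add: continuous_on_eq_continuous_at)
  qed
  then show ?thesis by (simp add: continuous_on_eq_continuous_at)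
qed

section \<open>Real paths as members of the metric path spaces\<close>

definition lift :: "(real \<Rightarrow> real) \<Rightarrow> ereal \<Rightarrow> ereal" where
  "lift g = canonical (\<lambda>t. ereal (g (real_of_ereal t)))"

lemma lift_simps [simp]: "lift g (ereal s) = ereal (g s)" "lift g \<infinity> = 0" "lift g (-\<infinity>) = 0"
  by (simp_all add: lift_def canonical_def)

lemma lift_eqI: "(\<And>s. F (ereal s) = ereal (g s)) \<Longrightarrow> F \<infinity> = 0 \<Longrightarrow> F (-\<infinity>) = 0 \<Longrightarrow> F = lift g"
proof
  fix t assume "\<And>s. F (ereal s) = ereal (g s)" "F \<infinity> = 0" "F (-\<infinity>) = 0"
  then show "F t = lift g t" by (cases t) auto
qed

lemma continuous_Phi_lift: "continuous_on UNIV g \<Longrightarrow> continuous_on UNIV (\<lambda>t. Phi (lift g t) t)"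
  by (rule continuous_Phi) (auto intro!: continuous_on_tanh simp: cosh_real_nonzero)

lemma lift_PiF: "continuous_on UNIV g \<Longrightarrow> lift g \<in> PiF"
  by (simp add: PiF_def continuous_Phi_lift)

lemma canonical_const_PiF: "canonical (\<lambda>_. c) \<in> PiF"
  unfolding PiF_def mem_Collect_eq
proof (intro conjI)
  show "continuous_on UNIV (\<lambda>t. Phi (canonical (\<lambda>_. c) t) t)"
    by (rule continuous_Phi) (simp add: canonical_def)
qed (simp_all add: canonical_def)

lemma fwd_semipath_eq: "fwd_semipath t g = (restrict (lift g) {ereal t..}, ereal t)"
  and bwd_semipath_eq: "bwd_semipath t g = (restrict (lift g) {..ereal t}, ereal t)"
  by (simp_all add: fwd_semipath_def bwd_semipath_def lift_def)

lemma fwd_semipath_Pi_fwd: "continuous_on UNIV g \<Longrightarrow> fwd_semipath t g \<in> Pi_fwd"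
proof -
  assume "continuous_on UNIV g"
  then have "continuous_on {ereal t..} (\<lambda>s. Phi (restrict (lift g) {ereal t..} s) s)"
    by (intro continuous_on_eq[OF continuous_on_subset[OF continuous_Phi_lift]]) auto
  then show ?thesis by (auto simp: fwd_semipath_eq Pi_fwd_def lift_def canonical_def)
qed

lemma glue_halves:
  "glue (ereal t) (fst (fwd_semipath t g)) (fst (bwd_semipath t g')) = lift (\<lambda>s. if t \<le> s then g s else g' s)"
  by (rule lift_eqI) (auto simp: glue_def canonical_def fwd_semipath_eq bwd_semipath_eq)

lemma fwd_semipath_inject: "fst (fwd_semipath t g) = fst (fwd_semipath t g') \<longleftrightarrow> (\<forall>u\<ge>t. g u = g' u)"
proof
  assume a: "fst (fwd_semipath t g) = fst (fwd_semipath t g')"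
  show "\<forall>u\<ge>t. g u = g' u"
  proof (intro allI impI)
    fix u assume "t \<le> u"
    then show "g u = g' u" using fun_cong[OF a, of "ereal u"] by (simp add: fwd_semipath_eq)
  qed
next
  assume a: "\<forall>u\<ge>t. g u = g' u"
  have "lift g s = lift g' s" if "ereal t \<le> s" for s using a that by (cases s) auto
  then show "fst (fwd_semipath t g) = fst (fwd_semipath t g')" by (auto simp: fwd_semipath_eq restrict_def)
qed

lemma bwd_semipath_inject: "fst (bwd_semipath t g) = fst (bwd_semipath t g') \<longleftrightarrow> (\<forall>u\<le>t. g u = g' u)"
proof
  assume a: "fst (bwd_semipath t g) = fst (bwd_semipath t g')"
  show "\<forall>u\<le>t. g u = g' u"
  proof (intro allI impI)
    fix u assume "u \<le> t"
    then show "g u = g' u" using fun_cong[OF a, of "ereal u"] by (simp add: bwd_semipath_eq)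
  qed
next
  assume a: "\<forall>u\<le>t. g u = g' u"
  have "lift g s = lift g' s" if "s \<le> ereal t" for s using a that by (cases s) auto
  then show "fst (bwd_semipath t g) = fst (bwd_semipath t g')" by (auto simp: bwd_semipath_eq restrict_def)
qed

lemma (in Metric_space) closure_of_range_iff:
  assumes "range S \<subseteq> M"
  shows "p \<in> mtopology closure_of range S \<longleftrightarrow> p \<in> M \<and> (\<exists>k :: nat \<Rightarrow> nat. (\<lambda>n. d (S (k n)) p) \<longlonglongrightarrow> 0)"
proof
  assume "p \<in> mtopology closure_of range S"
  then have p: "p \<in> M" "\<And>r. 0 < r \<Longrightarrow> \<exists>j. d (S j) p < r"
    by (auto simp: metric_closure_of commute)
  have "\<forall>n. \<exists>j. d (S j) p < 1 / real (Suc n)" by (intro allI p(2)) simp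
  then obtain k where k: "\<And>n. d (S (k n)) p < 1 / real (Suc n)" by metis
  have "(\<lambda>n. d (S (k n)) p) \<longlonglongrightarrow> 0"
    by (rule Lim_null_comparison[OF _ LIMSEQ_Suc[OF lim_const_over_n[of "1::real"]]])
      (use k less_imp_le in \<open>auto intro!: always_eventually simp del: of_nat_Suc\<close>)
  then show "p \<in> M \<and> (\<exists>k :: nat \<Rightarrow> nat. (\<lambda>n. d (S (k n)) p) \<longlonglongrightarrow> 0)" using p by blast
next
  assume "p \<in> M \<and> (\<exists>k :: nat \<Rightarrow> nat. (\<lambda>n. d (S (k n)) p) \<longlonglongrightarrow> 0)"
  then obtain k :: "nat \<Rightarrow> nat" where p: "p \<in> M" and k: "(\<lambda>n. d (S (k n)) p) \<longlonglongrightarrow> 0" by blast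
  show "p \<in> mtopology closure_of range S"
    unfolding metric_closure_of
  proof (intro CollectI conjI p allI impI)
    fix r :: real assume "0 < r"
    from order_tendstoD(2)[OF k this] obtain n where "d (S (k n)) p < r" by (auto simp: eventually_sequentially)
    then show "\<exists>y\<in>range S. y \<in> mball p r" using p assms by (intro bexI[of _ "S (k n)"]) (auto simp: commute)
  qed
qed

text \<open>The constant extension of a semipath before its start is composition with the maximum of
  the starting time and the current time, so convergent starts preserve continuous
  convergence.\<close>

lemma cconv_max:
  assumes c: "cconv f g" and \<tau>: "\<tau> \<longlonglongrightarrow> t"
  shows "cconv (\<lambda>n s. f n (max (\<tau> n) s)) (\<lambda>s. g (max t s))"
proof -
  have *: "\<exists>N. \<exists>d>0. \<forall>n\<ge>N. \<forall>s. \<bar>s - l\<bar> < d \<longrightarrow> P n (max (\<tau> n) s)"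
    if P: "\<exists>N. \<exists>d>0. \<forall>n\<ge>N. \<forall>s. \<bar>s - max t l\<bar> < d \<longrightarrow> P n s" for P and l :: real
  proof -
    obtain N d where d: "d > 0" "\<And>n s. n \<ge> N \<Longrightarrow> \<bar>s - max t l\<bar> < d \<Longrightarrow> P n s" using P by blast
    obtain N' where N': "\<And>n. n \<ge> N' \<Longrightarrow> \<bar>\<tau> n - t\<bar> < d"
      using tendstoD[OF \<tau> d(1)] by (auto simp: eventually_sequentially dist_real_def)
    have "P n (max (\<tau> n) s)" if "n \<ge> max N N'" "\<bar>s - l\<bar> < d" for n s
    proof (rule d(2))
      have "\<bar>\<tau> n - t\<bar> < d" using N' that(1) by simp
      then show "\<bar>max (\<tau> n) s - max t l\<bar> < d" using that(2) by linarith
    qed (use that in \<open>simp\<close>)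
    then show ?thesis using d(1) by blast
  qed
  show ?thesis
    unfolding cconv_def
  proof (intro allI conjI impI)
    fix l a
    show "ereal a < g (max t l) \<Longrightarrow> \<exists>N. \<exists>d>0. \<forall>n\<ge>N. \<forall>s. \<bar>s - l\<bar> < d \<longrightarrow> a < f n (max (\<tau> n) s)"
      using *[OF cconv_lower[OF c]] .
    show "g (max t l) < ereal a \<Longrightarrow> \<exists>N. \<exists>d>0. \<forall>n\<ge>N. \<forall>s. \<bar>s - l\<bar> < d \<longrightarrow> f n (max (\<tau> n) s) < a"
      using *[OF cconv_upper[OF c]] .
  qed
qed

lemma hat_fwd_semipath: "hat_fwd (fwd_semipath \<tau> g) (ereal s) = ereal (g (max \<tau> s))"
  by (simp add: hat_fwd_def fwd_semipath_eq flip: ereal_max)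

section \<open>The closures described by limit paths\<close>

context web begin

definition fwd_paths :: "semipath set" where
  "fwd_paths = Pi_fwd_topology closure_of range (\<lambda>j. fwd_semipath (T j) (h j))"

definition bwd_paths :: "semipath set" where
  "bwd_paths = Pi_bwd_topology closure_of range (\<lambda>j. bwd_semipath (T j) (h j))"

definition full_paths :: "(ereal \<Rightarrow> ereal) set" where
  "full_paths = PiF_topology closure_of range (\<lambda>j. lift (h j))"

lemma fwd_paths_iff:
  "p \<in> fwd_paths \<longleftrightarrow> p \<in> Pi_fwd \<and> (\<exists>k :: nat \<Rightarrow> nat. (\<lambda>n. dist_fwd (fwd_semipath (T (k n)) (h (k n))) p) \<longlonglongrightarrow> 0)"
  unfolding fwd_paths_def
  by (rule Metric_space.closure_of_range_iff[OF Metric_space_Pi_fwd]) (use fwd_semipath_Pi_fwd[OF cont] in blast)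

lemma full_paths_iff_tendsto:
  "p \<in> full_paths \<longleftrightarrow> p \<in> PiF \<and> (\<exists>k :: nat \<Rightarrow> nat. (\<lambda>n. Phi_dist (lift (h (k n))) p) \<longlonglongrightarrow> 0)"
  unfolding full_paths_def
  by (rule Metric_space.closure_of_range_iff[OF Metric_space_PiF]) (use lift_PiF[OF cont] in blast)

lemma limit_path_fwd_paths:
  assumes g: "limit_path z h x t g" shows "fwd_semipath t g \<in> fwd_paths"
proof -
  obtain k where k: "(\<lambda>n. z (k n)) \<longlonglongrightarrow> (x, t)" "cconv (\<lambda>n. h (k n)) (\<lambda>s. ereal (g s))"
    using g by (auto simp: limit_path_def)
  have T: "(\<lambda>n. T (k n)) \<longlonglongrightarrow> t" using tendsto_snd[OF k(1)] by simp
  have 1: "(\<lambda>n. Phi_dist (hat_fwd (fwd_semipath (T (k n)) (h (k n)))) (hat_fwd (fwd_semipath t g))) \<longlonglongrightarrow> 0"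
    by (rule cconv_Phi_dist[OF cconv_max[OF k(2) T]]) (simp_all add: hat_fwd_semipath)
  have 2: "(\<lambda>n. \<bar>Psi (ereal (T (k n))) - Psi (ereal t)\<bar>) \<longlonglongrightarrow> 0"
    using T unfolding Psi_def by (intro tendsto_rabs_zero LIM_zero) (simp add: tendsto_tanh cosh_real_nonzero)
  have "(\<lambda>n. dist_fwd (fwd_semipath (T (k n)) (h (k n))) (fwd_semipath t g)) \<longlonglongrightarrow> 0"
    using tendsto_max[OF 1 2] by (simp add: dist_fwd_def fwd_semipath_eq)
  then show ?thesis unfolding fwd_paths_iff using fwd_semipath_Pi_fwd[OF limit_path_cont[OF g]] by blast
qed

text \<open>The metric of semipaths sees only forward halves, but compactness makes the whole paths
  \<open>h k\<close> converge along a subsequence. Passing through a real point makes this limit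
  finite, so \<open>cconv_cases\<close> excludes infinite starting times and provides a backward
  half as well.\<close>

lemma fwd_paths_cases:
  assumes p: "p \<in> fwd_paths" "snd p \<le> ereal t" "fst p (ereal t) = ereal x"
  shows "\<exists>x0 t0 g. t0 \<le> t \<and> p = fwd_semipath t0 g \<and> limit_path z h x0 t0 g \<and> g t = x"
proof -
  obtain k0 :: "nat \<Rightarrow> nat" where Pp: "p \<in> Pi_fwd"
    and k0: "(\<lambda>n. dist_fwd (fwd_semipath (T (k0 n)) (h (k0 n))) p) \<longlonglongrightarrow> 0"
    using p(1) unfolding fwd_paths_iff by blast
  obtain r g where r: "strict_mono r" and c: "cconv (\<lambda>n. h (k0 (r n))) g" using compactness[of k0] by blast
  define k where "k n = k0 (r n)" for n
  have ck: "cconv (\<lambda>n. h (k n)) g" using c by (simp add: k_def)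
  have d: "(\<lambda>n. dist_fwd (fwd_semipath (T (k n)) (h (k n))) p) \<longlonglongrightarrow> 0"
    using LIMSEQ_subseq_LIMSEQ[OF k0 r] by (simp add: comp_def k_def)
  have hat: "(\<lambda>n. ereal (h (k n) (max (T (k n)) s))) \<longlonglongrightarrow> hat_fwd p (ereal s)" for s
  proof -
    have "(\<lambda>n. Phi_dist (hat_fwd (fwd_semipath (T (k n)) (h (k n)))) (hat_fwd p)) \<longlonglongrightarrow> 0"
      by (rule Lim_null_comparison[OF always_eventually d]) (simp add: dist_fwd_def Phi_dist_nonneg)
    from Phi_dist_tendsto_D[OF this, of s] show ?thesis by (simp add: hat_fwd_semipath)
  qed
  have "(\<lambda>n. Psi (ereal (T (k n))) - Psi (snd p)) \<longlonglongrightarrow> 0"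
    by (rule Lim_null_comparison[OF always_eventually d]) (simp add: dist_fwd_def fwd_semipath_eq)
  then have Tp: "(\<lambda>n. ereal (T (k n))) \<longlonglongrightarrow> snd p"
    unfolding Psi_def by (rule ereal_tanh_tendsto_cancel[OF LIM_zero_cancel])
  have "(\<lambda>n. max (ereal (T (k n))) (ereal t)) \<longlonglongrightarrow> max (snd p) (ereal t)"
    by (rule tendsto_max[OF Tp tendsto_const])
  then have "(\<lambda>n. ereal (max (T (k n)) t)) \<longlonglongrightarrow> ereal t" using p(2) by (simp add: max_absorb2)
  then have "(\<lambda>n. max (T (k n)) t) \<longlonglongrightarrow> t" by (rule lim_ereal[THEN iffD1])
  from cconv_tendsto[OF ck this] hat[of t] have "g t = hat_fwd p (ereal t)" by (rule LIMSEQ_unique)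
  also have "\<dots> = ereal x" using p(2,3) by (simp add: hat_fwd_def max_absorb2)
  finally have gt: "g t = ereal x" .
  obtain x0 t0 g' q where g': "g = (\<lambda>s. ereal (g' s))" and q: "strict_mono q"
    and z: "(\<lambda>n. z (k (q n))) \<longlonglongrightarrow> (x0, t0)" and l: "limit_path z h x0 t0 g'"
    by (rule cconv_cases[OF ck, of t]) (use gt in \<open>simp\<close>)
  have T0: "(\<lambda>n. T (k (q n))) \<longlonglongrightarrow> t0" using tendsto_snd[OF z] by simp
  then have "(\<lambda>n. ereal (T (k (q n)))) \<longlonglongrightarrow> ereal t0" by simp
  moreover have "(\<lambda>n. ereal (T (k (q n)))) \<longlonglongrightarrow> snd p" using LIMSEQ_subseq_LIMSEQ[OF Tp q] by (simp add: comp_def)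
  ultimately have sp: "snd p = ereal t0" by (rule LIMSEQ_unique[symmetric])
  have hatp: "hat_fwd p (ereal s) = ereal (g' (max t0 s))" for s
  proof -
    have "cconv (\<lambda>n. h (k (q n))) g" by (rule cconv_subseq[OF ck q])
    from cconv_tendsto[OF this tendsto_max[OF T0 tendsto_const, of s]]
    have "(\<lambda>n. ereal (h (k (q n)) (max (T (k (q n))) s))) \<longlonglongrightarrow> g (max t0 s)" .
    moreover have "(\<lambda>n. ereal (h (k (q n)) (max (T (k (q n))) s))) \<longlonglongrightarrow> hat_fwd p (ereal s)"
      using LIMSEQ_subseq_LIMSEQ[OF hat[of s] q] by (simp add: comp_def)
    ultimately show ?thesis using LIMSEQ_unique g' by metis
  qed
  have "fst p u = restrict (lift g') {ereal t0..} u" for u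
  proof (cases "ereal t0 \<le> u")
    case False
    then show ?thesis using Pp sp by (auto simp: Pi_fwd_def extensional_def)
  next
    case True
    then show ?thesis
    proof (cases u)
      case (real s)
      then show ?thesis using hatp[of s] True sp by (simp add: hat_fwd_def max_absorb2)
    next
      case PInf
      then show ?thesis using Pp sp by (auto simp: Pi_fwd_def)
    qed simp
  qed
  then have "p = fwd_semipath t0 g'" using sp by (simp add: fwd_semipath_eq prod_eq_iff fun_eq_iff)
  moreover have "t0 \<le> t" using p(2) sp by simp
  moreover have "g' t = x" using gt g' by simp
  ultimately show ?thesis using l by blast
qed

lemma paths_from_fwd: "paths_from fwd_paths x t = {fst (fwd_semipath t g) | g. limit_path z h x t g}"
proof (intro set_eqI iffI)
  fix f assume "f \<in> paths_from fwd_paths x t"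
  then have "(f, ereal t) \<in> fwd_paths" "f (ereal t) = ereal x" by (auto simp: paths_from_def)
  then obtain x0 t0 g where g: "(f, ereal t) = fwd_semipath t0 g" "limit_path z h x0 t0 g" "g t = x"
    using fwd_paths_cases[of "(f, ereal t)" t x] by auto
  then have "t0 = t" "f = fst (fwd_semipath t g)" by (auto simp: fwd_semipath_eq)
  moreover have "x0 = x" using limit_path_start[OF g(2)] g(3) \<open>t0 = t\<close> by simp
  ultimately show "f \<in> {fst (fwd_semipath t g) | g. limit_path z h x t g}" using g(2) by blast
next
  fix f assume "f \<in> {fst (fwd_semipath t g) | g. limit_path z h x t g}"
  then obtain g where g: "limit_path z h x t g" "f = fst (fwd_semipath t g)" by blast
  have "(f, ereal t) = fwd_semipath t g" using g(2) by (simp add: fwd_semipath_eq)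
  then show "f \<in> paths_from fwd_paths x t"
    using limit_path_fwd_paths[OF g(1)] limit_path_start[OF g(1)] g(2) by (simp add: paths_from_def fwd_semipath_eq)
qed

lemma paths_into_fwd:
  "paths_into fwd_paths x t = {fwd_semipath t0 g | x0 t0 g. t0 < t \<and> limit_path z h x0 t0 g \<and> g t = x}"
proof (intro set_eqI iffI)
  fix p assume "p \<in> paths_into fwd_paths x t"
  then have p: "p \<in> fwd_paths" "snd p < ereal t" "fst p (ereal t) = ereal x" by (auto simp: paths_into_def)
  then obtain x0 t0 g where g: "p = fwd_semipath t0 g" "limit_path z h x0 t0 g" "g t = x"
    using fwd_paths_cases[OF p(1) less_imp_le[OF p(2)] p(3)] by blast
  moreover have "t0 < t" using p(2) g(1) by (simp add: fwd_semipath_eq)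
  ultimately show "p \<in> {fwd_semipath t0 g | x0 t0 g. t0 < t \<and> limit_path z h x0 t0 g \<and> g t = x}" by blast
next
  fix p assume "p \<in> {fwd_semipath t0 g | x0 t0 g. t0 < t \<and> limit_path z h x0 t0 g \<and> g t = x}"
  then obtain x0 t0 g where g: "p = fwd_semipath t0 g" "t0 < t" "limit_path z h x0 t0 g" "g t = x" by blast
  then show "p \<in> paths_into fwd_paths x t"
    using limit_path_fwd_paths[OF g(3)] by (simp add: paths_into_def) (simp add: fwd_semipath_eq)
qed

text \<open>Starting points near \<open>(n + 1, 0)\<close> escape to infinity at time zero, and a
  limit that is infinite at one time is infinite at all times. This yields the trivial path.\<close>

lemma exists_infinite_limit: "\<exists>k :: nat \<Rightarrow> nat. cconv (\<lambda>n. h (k n)) (\<lambda>s. \<infinity>)"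
proof -
  have "\<exists>k. 0 < T k \<and> T k < 1 / Suc n \<and> \<bar>fst (z k) - (real n + 1)\<bar> < 1" for n
    using dense_point[OF dense, of 0 "1 / Suc n" 1 "real n + 1"] by auto
  then obtain k where k: "\<And>n. 0 < T (k n) \<and> T (k n) < 1 / Suc n \<and> \<bar>fst (z (k n)) - (real n + 1)\<bar> < 1" by metis
  obtain r g where r: "strict_mono r" and c: "cconv (\<lambda>n. h (k (r n))) g" using compactness[of k] by blast
  have "(\<lambda>n. T (k n)) \<longlonglongrightarrow> 0"
    using k by (intro Lim_null_comparison[OF _ LIMSEQ_Suc[OF lim_const_over_n[of "1::real"]]] always_eventually)
      (auto simp: less_imp_le simp del: of_nat_Suc)
  from LIMSEQ_subseq_LIMSEQ[OF this r] have "(\<lambda>n. T (k (r n))) \<longlonglongrightarrow> 0" by (simp add: comp_def)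
  from cconv_tendsto[OF c this] have 1: "(\<lambda>n. ereal (fst (z (k (r n))))) \<longlonglongrightarrow> g 0" by (simp add: start)
  have "(\<lambda>n. ereal (fst (z (k n)))) \<longlonglongrightarrow> \<infinity>"
    unfolding tendsto_PInfty
  proof
    fix K :: real
    obtain N :: nat where N: "K < real N" using reals_Archimedean2 by blast
    have "K < fst (z (k n))" if "n \<ge> N" for n
    proof -
      have "real N \<le> real n" using that by simp
      then show ?thesis using k[of n] N by linarith
    qed
    then show "\<forall>\<^sub>F n in sequentially. ereal K < ereal (fst (z (k n)))" by (auto simp: eventually_sequentially)
  qed
  from LIMSEQ_subseq_LIMSEQ[OF this r] have "g 0 = \<infinity>" using 1 by (auto simp: comp_def dest: LIMSEQ_unique)
  then have "g = (\<lambda>s. \<infinity>)" using limit_infinite[OF c] by auto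
  then show ?thesis using c by (intro exI[of _ "\<lambda>n. k (r n)"]) simp
qed

lemma full_paths_eq:
  "full_paths = {canonical (\<lambda>_. \<infinity>), canonical (\<lambda>_. -\<infinity>)} \<union> {lift g | x t g. limit_path z h x t g}"
proof (intro set_eqI iffI)
  fix F assume "F \<in> full_paths"
  then obtain k :: "nat \<Rightarrow> nat" where F: "F \<in> PiF" and k: "(\<lambda>n. Phi_dist (lift (h (k n))) F) \<longlonglongrightarrow> 0"
    unfolding full_paths_iff_tendsto by blast
  obtain r g where r: "strict_mono r" and c: "cconv (\<lambda>n. h (k (r n))) g" using compactness[of k] by blast
  have g: "F (ereal s) = g s" for s
  proof -
    have "(\<lambda>n. ereal (h (k (r n)) s)) \<longlonglongrightarrow> F (ereal s)"
      using LIMSEQ_subseq_LIMSEQ[OF Phi_dist_tendsto_D[OF k, of s] r] by (simp add: comp_def)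
    then show ?thesis using cconv_tendsto[OF c tendsto_const] by (rule LIMSEQ_unique)
  qed
  have inf: "F \<infinity> = 0" "F (-\<infinity>) = 0" using F by (simp_all add: PiF_def)
  have const: "F = canonical (\<lambda>_. y)" if "\<And>s. g s = y" for y
  proof
    show "F u = canonical (\<lambda>_. y) u" for u by (cases u) (simp_all add: canonical_def inf g that)
  qed
  consider "g 0 = \<infinity>" | "g 0 = -\<infinity>" | "\<bar>g 0\<bar> \<noteq> \<infinity>" by auto
  then show "F \<in> {canonical (\<lambda>_. \<infinity>), canonical (\<lambda>_. -\<infinity>)} \<union> {lift g | x t g. limit_path z h x t g}"
  proof cases
    case 1
    then show ?thesis using const limit_infinite[OF c] by blast
  next
    case 2
    then show ?thesis using const limit_minus_infinite[OF c] by blast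
  next
    case 3
    obtain x t g' where g': "g = (\<lambda>s. ereal (g' s))" "limit_path z h x t g'"
      using cconv_cases[OF c 3] by metis
    then have "F = lift g'" by (intro lift_eqI) (simp_all add: g inf)
    then show ?thesis using g' by blast
  qed
next
  have in_full: "F \<in> full_paths"
    if "cconv (\<lambda>n. h (k n)) \<gamma>" "\<And>s. F (ereal s) = \<gamma> s" "F \<in> PiF" for F \<gamma> and k :: "nat \<Rightarrow> nat"
    unfolding full_paths_iff_tendsto using cconv_Phi_dist[OF that(1), of "\<lambda>n. lift (h (k n))" F] that by auto
  obtain k1 :: "nat \<Rightarrow> nat" where k1: "cconv (\<lambda>n. h (k1 n)) (\<lambda>s. \<infinity>)" using exists_infinite_limit by blast
  interpret m: web "mirror z" "\<lambda>j s. - h j s" by (rule web_mirror)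
  obtain k2 :: "nat \<Rightarrow> nat" where "cconv (\<lambda>n s. - h (k2 n) s) (\<lambda>s. \<infinity>)" using m.exists_infinite_limit by blast
  from cconv_uminus[OF this] have k2: "cconv (\<lambda>n. h (k2 n)) (\<lambda>s. -\<infinity>)" by simp
  fix F assume "F \<in> {canonical (\<lambda>_. \<infinity>), canonical (\<lambda>_. -\<infinity>)} \<union> {lift g | x t g. limit_path z h x t g}"
  then consider "F = canonical (\<lambda>_. \<infinity>)" | "F = canonical (\<lambda>_. -\<infinity>)" | x t g where "limit_path z h x t g" "F = lift g" by blast
  then show "F \<in> full_paths"
  proof cases
    case 1
    then show ?thesis using in_full[OF k1] canonical_const_PiF by (simp add: canonical_def)
  next
    case 2
    then show ?thesis using in_full[OF k2] canonical_const_PiF by (simp add: canonical_def)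
  next
    case 3
    obtain k where "cconv (\<lambda>n. h (k n)) (\<lambda>s. ereal (g s))" using 3(1) by (auto simp: limit_path_def)
    then show ?thesis using in_full[of k "\<lambda>s. ereal (g s)" F] lift_PiF[OF limit_path_cont[OF 3(1)]] 3(2) by simp
  qed
qed

end

section \<open>Time reversal of semipaths\<close>

definition time_reverse :: "semipath \<Rightarrow> semipath" where
  "time_reverse p = (\<lambda>t. fst p (- t), - snd p)"

lemma Phi_uminus [simp]: "Phi x (- t) = Phi x t"
  by (cases t) (simp_all add: Phi_def)

lemma Psi_uminus [simp]: "Psi (- t) = - Psi t"
  by (cases t) (simp_all add: Psi_def)

lemma Phi_dist_reverse: "Phi_dist (\<lambda>t. f (- t)) (\<lambda>t. g (- t)) = Phi_dist f g"
proof -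
  define H where "H t = \<bar>Phi (f t) t - Phi (g t) t\<bar>" for t
  have "\<bar>Phi (f (- t)) t - Phi (g (- t)) t\<bar> = H (- t)" for t by (simp add: H_def)
  moreover have "range (\<lambda>t. H (- t)) = H ` range uminus" by (simp only: image_image)
  moreover have "range (uminus :: ereal \<Rightarrow> ereal) = UNIV" by (rule surjI[of _ uminus]) simp
  ultimately show ?thesis by (simp add: Phi_dist_def H_def[symmetric])
qed

lemma hat_fwd_reverse: "hat_fwd (time_reverse p) = (\<lambda>t. hat_bwd p (- t))"
proof
  fix t
  have "- max (- snd p) t = min (snd p) (- t)"
  proof (cases "- snd p \<le> t")
    case True
    then have "- t \<le> snd p" by (simp add: ereal_uminus_le_reorder)
    with True show ?thesis by (simp add: max_absorb2 min_absorb2)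
  next
    case False
    then have "\<not> - t \<le> snd p" by (simp add: ereal_uminus_le_reorder)
    with False show ?thesis by (simp add: max_absorb1 min_absorb1 not_le less_imp_le)
  qed
  then show "hat_fwd (time_reverse p) t = hat_bwd p (- t)"
    by (simp add: hat_fwd_def hat_bwd_def time_reverse_def)
qed

lemma dist_fwd_reverse: "dist_fwd (time_reverse p) (time_reverse q) = dist_bwd p q"
  unfolding dist_fwd_def dist_bwd_def hat_fwd_reverse Phi_dist_reverse by (simp add: time_reverse_def abs_minus_commute)

lemma continuous_on_reverse:
  fixes H :: "ereal \<Rightarrow> real"
  shows "continuous_on {- a..} (\<lambda>t. H (- t)) \<longleftrightarrow> continuous_on {..a} H"
proof
  note c = continuous_uminus_ereal
  show "continuous_on {..a} H" if "continuous_on {- a..} (\<lambda>t. H (- t))"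
  proof -
    have "continuous_on {..a} (\<lambda>t. H (- (- t)))" by (rule continuous_on_compose2[OF that c]) auto
    then show ?thesis by simp
  qed
  show "continuous_on {- a..} (\<lambda>t. H (- t))" if "continuous_on {..a} H"
    by (rule continuous_on_compose2[OF that c]) (auto simp: ereal_uminus_le_reorder)
qed

lemma time_reverse_Pi_fwd: "time_reverse p \<in> Pi_fwd \<longleftrightarrow> p \<in> Pi_bwd"
proof -
  obtain g a where p: "p = (g, a)" by (cases p)
  have all: "(\<forall>t. P (- t)) \<longleftrightarrow> (\<forall>t. P t)" for P :: "ereal \<Rightarrow> bool" by (metis ereal_uminus_uminus)
  have "(\<lambda>t. g (- t)) \<in> extensional {- a..} \<longleftrightarrow> g \<in> extensional {..a}"
    using all[of "\<lambda>t. t \<notin> {..a} \<longrightarrow> g t = undefined"]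
    by (simp add: extensional_def ereal_uminus_le_reorder)
  moreover have "continuous_on {- a..} (\<lambda>t. Phi (g (- t)) t) \<longleftrightarrow> continuous_on {..a} (\<lambda>t. Phi (g t) t)"
    using continuous_on_reverse[of a "\<lambda>t. Phi (g t) t"] by simp
  moreover have "(\<forall>t\<in>{- a..}. \<bar>t\<bar> = \<infinity> \<longrightarrow> g (- t) = 0) \<longleftrightarrow> (\<forall>t\<in>{..a}. \<bar>t\<bar> = \<infinity> \<longrightarrow> g t = 0)"
    using all[of "\<lambda>t. t \<le> a \<longrightarrow> \<bar>t\<bar> = \<infinity> \<longrightarrow> g t = 0"] by (simp add: Ball_def ereal_uminus_le_reorder)
  moreover have "- a = \<infinity> \<longleftrightarrow> a = -\<infinity>" by (cases a) simp_all
  ultimately show ?thesis by (simp add: p time_reverse_def Pi_fwd_def Pi_bwd_def)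
qed

lemma time_reverse_semipath: "time_reverse (bwd_semipath t g) = fwd_semipath (- t) (\<lambda>s. g (- s))"
proof -
  have "restrict (lift g) {..ereal t} (- u) = restrict (lift (\<lambda>s. g (- s))) {ereal (- t)..} u" for u
    by (cases u) auto
  then show ?thesis
    unfolding time_reverse_def bwd_semipath_eq fwd_semipath_eq by (simp only: fst_conv snd_conv uminus_ereal.simps)
qed

lemma time_reverse_inject: "time_reverse p = time_reverse q \<longleftrightarrow> p = q"
proof
  assume e: "time_reverse p = time_reverse q"
  then have "fst p (- t) = fst q (- t)" for t unfolding time_reverse_def by (metis fst_conv)
  then have "fst p t = fst q t" for t by (metis ereal_uminus_uminus)
  moreover have "snd p = snd q" using e by (simp add: time_reverse_def)
  ultimately show "p = q" by (simp add: prod_eq_iff fun_eq_iff)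
qed simp

context web begin

text \<open>Time reversal is an isometry between backward and forward semipaths and carries the
  skeleton to that of the flipped web, so the forward description applies there.\<close>

lemma paths_from_bwd: "paths_from bwd_paths x t = {fst (bwd_semipath t g) | g. limit_path z h x t g}"
proof -
  interpret f: web "flip z" "\<lambda>j s. h j (- s)" by (rule web_flip)
  have rev: "time_reverse (bwd_semipath (T j) (h j)) = fwd_semipath (snd (flip z j)) (\<lambda>s. h j (- s))" for j
    by (simp add: time_reverse_semipath)
  have "bwd_semipath (T j) (h j) \<in> Pi_bwd" for j
    unfolding time_reverse_Pi_fwd[symmetric] rev by (rule fwd_semipath_Pi_fwd[OF reverse.cont])
  then have "p \<in> bwd_paths \<longleftrightarrow> p \<in> Pi_bwd \<and> (\<exists>k :: nat \<Rightarrow> nat. (\<lambda>n. dist_bwd (bwd_semipath (T (k n)) (h (k n))) p) \<longlonglongrightarrow> 0)" for p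
    unfolding bwd_paths_def by (intro Metric_space.closure_of_range_iff[OF Metric_space_Pi_bwd]) blast
  then have bwd: "p \<in> bwd_paths \<longleftrightarrow> time_reverse p \<in> f.fwd_paths" for p
    unfolding f.fwd_paths_iff time_reverse_Pi_fwd dist_fwd_reverse[symmetric] rev by simp
  have "f \<in> paths_from bwd_paths x t \<longleftrightarrow> (\<exists>g. f = fst (bwd_semipath t g) \<and> limit_path z h x t g)" for f
  proof -
    have eq: "(\<lambda>s. f (- s)) = fst (fwd_semipath (- t) (\<lambda>s. g (- s))) \<longleftrightarrow> f = fst (bwd_semipath t g)" for g
      using time_reverse_inject[of "(f, ereal t)" "bwd_semipath t g"] unfolding time_reverse_semipath
      by (simp add: time_reverse_def fwd_semipath_eq bwd_semipath_eq)
    have "f \<in> paths_from bwd_paths x t \<longleftrightarrow> (\<lambda>s. f (- s)) \<in> paths_from f.fwd_paths x (- t)"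
      by (simp add: paths_from_def bwd time_reverse_def)
    also have "(\<lambda>s. f (- s)) \<in> paths_from f.fwd_paths x (- t) \<longleftrightarrow>
        (\<exists>g. (\<lambda>s. f (- s)) = fst (fwd_semipath (- t) g) \<and> limit_path (flip z) (\<lambda>j s. h j (- s)) x (- t) g)"
      unfolding f.paths_from_fwd by blast
    also have "\<dots> \<longleftrightarrow> (\<exists>g. (\<lambda>s. f (- s)) = fst (fwd_semipath (- t) (\<lambda>s. g (- s))) \<and> limit_path (flip z) (\<lambda>j s. h j (- s)) x (- t) (\<lambda>s. g (- s)))"
    proof
      assume "\<exists>g. (\<lambda>s. f (- s)) = fst (fwd_semipath (- t) g) \<and> limit_path (flip z) (\<lambda>j s. h j (- s)) x (- t) g"
      then obtain g where "(\<lambda>s. f (- s)) = fst (fwd_semipath (- t) g)" "limit_path (flip z) (\<lambda>j s. h j (- s)) x (- t) g" by blast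
      then show "\<exists>g. (\<lambda>s. f (- s)) = fst (fwd_semipath (- t) (\<lambda>s. g (- s))) \<and> limit_path (flip z) (\<lambda>j s. h j (- s)) x (- t) (\<lambda>s. g (- s))"
        by (intro exI[of _ "\<lambda>s. g (- s)"]) simp
    qed blast
    finally show ?thesis unfolding eq limit_path_flip_iff .
  qed
  then show ?thesis by blast
qed

text \<open>An incoming forward path is the right half of a limit path, and limit paths are totally
  ordered.\<close>

lemma not_crosses_incoming:
  assumes G: "limit_path z h x' t' G"
  shows "\<not> crosses_incoming fwd_paths x t (lift G)"
proof
  assume "crosses_incoming fwd_paths x t (lift G)"
  then obtain p s u where p: "p \<in> paths_into fwd_paths x t" and su: "snd p \<le> s" "snd p \<le> u"
    "fst p s < lift G s" "lift G u < fst p u"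
    unfolding crosses_incoming_def crosses_def by auto
  obtain x0 t0 g where g: "p = fwd_semipath t0 g" "limit_path z h x0 t0 g"
    using p unfolding paths_into_fwd by blast
  obtain s' where "s = ereal s'" using su(1,3) by (cases s) (simp_all add: g fwd_semipath_eq)
  moreover obtain u' where "u = ereal u'" using su(2,4) by (cases u) (simp_all add: g fwd_semipath_eq)
  ultimately have "g s' < G s'" "G u' < g u'" using su by (simp_all add: g fwd_semipath_eq)
  then show False using limit_path_order[OF G g(2)] by (metis not_le)
qed

lemma crosses_incomingI:
  assumes i: "T i < t" "h i t = x" and su: "T i \<le> s" "T i \<le> u" "h i s < G s" "G u < h i u"
  shows "crosses_incoming fwd_paths x t (lift G)"
proof -
  have p: "fwd_semipath (T i) (h i) \<in> paths_into fwd_paths x t"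
    unfolding paths_into_fwd using i limit_path_skeleton by blast
  show ?thesis
    unfolding crosses_incoming_def crosses_def
    by (rule bexI[OF _ p], rule bexI[of _ "ereal s"], rule bexI[of _ "ereal u"]) (use su in \<open>auto simp: fwd_semipath_eq\<close>)
qed

text \<open>Two distinct outgoing paths force a backward path into the point by
  \<open>agree_after\<close>. Conversely, a backward path through the point merges all incoming
  paths into one class, and together with an incoming path it leaves exactly two right
  halves.\<close>

lemma point_type_branch:
  "point_type fwd_paths x t = (1, 2) \<longleftrightarrow> (\<exists>i k. T i < t \<and> h i t = x \<and> t < T k \<and> h k t = x)"
proof
  assume "point_type fwd_paths x t = (1, 2)"
  then have m: "m_in fwd_paths x t = 1" "m_out fwd_paths x t = 2" by (simp_all add: point_type_def)
  have "paths_into fwd_paths x t \<noteq> {}"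
  proof
    assume "paths_into fwd_paths x t = {}"
    then show False using m(1) by (simp add: m_in_def ecard_def one_enat_def)
  qed
  then obtain i where i: "T i < t" "h i t = x" unfolding paths_into_fwd using incoming_skeleton by blast
  have "card (paths_from fwd_paths x t) = 2"
    using m(2) by (simp add: m_out_def ecard_def numeral_eq_enat split: if_splits)
  then obtain a b where ab: "paths_from fwd_paths x t = {a, b}" "a \<noteq> b" unfolding card_2_iff by blast
  have "a \<in> paths_from fwd_paths x t" "b \<in> paths_from fwd_paths x t" by (simp_all add: ab)
  then obtain g g' where "limit_path z h x t g" "a = fst (fwd_semipath t g)" "limit_path z h x t g'" "b = fst (fwd_semipath t g')"
    unfolding paths_from_fwd by auto
  with ab(2) have "limit_path z h x t g" "limit_path z h x t g'" "fst (fwd_semipath t g) \<noteq> fst (fwd_semipath t g')"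
    by simp_all
  then have "\<exists>k. t < T k \<and> h k t = x" unfolding fwd_semipath_inject using agree_after[of t x g g'] by blast
  then show "\<exists>i k. T i < t \<and> h i t = x \<and> t < T k \<and> h k t = x" using i by blast
next
  assume "\<exists>i k. T i < t \<and> h i t = x \<and> t < T k \<and> h k t = x"
  then obtain i k where i: "T i < t" "h i t = x" and k: "t < T k" "h k t = x" by blast
  let ?P = "paths_into fwd_paths x t" and ?R = "coalesced_before fwd_paths x t"
  have "(p, q) \<in> ?R" if pq: "p \<in> ?P" "q \<in> ?P" for p q
  proof -
    obtain x1 t1 f where f: "p = fwd_semipath t1 f" "limit_path z h x1 t1 f" "t1 < t" "f t = x"
      using pq(1) unfolding paths_into_fwd by blast
    obtain x2 t2 g where g: "q = fwd_semipath t2 g" "limit_path z h x2 t2 g" "t2 < t" "g t = x"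
      using pq(2) unfolding paths_into_fwd by blast
    obtain s where s: "s < t" "t1 \<le> s" "t2 \<le> s" "\<And>u. s \<le> u \<Longrightarrow> f u = g u"
      using incoming_coalesce[OF k f(2-) g(2-)] by blast
    have "fst p u = fst q u" if "u \<in> {ereal s..ereal t}" for u
      using that s by (cases u) (auto simp: f g fwd_semipath_eq)
    moreover have "snd p \<le> ereal s" "snd q \<le> ereal s" "ereal s < ereal t" using s by (auto simp: f g fwd_semipath_eq)
    ultimately show ?thesis unfolding coalesced_before_def using pq by blast
  qed
  then have R: "?R = ?P \<times> ?P" using equiv_coalesced_before[of fwd_paths x t] by (auto simp: equiv_def refl_on_def coalesced_before_def)
  have "fwd_semipath (T i) (h i) \<in> ?P" unfolding paths_into_fwd using i limit_path_skeleton by blast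
  then have "?P // ?R = {?P}" unfolding R by (auto simp: quotient_def)
  then have 1: "m_in fwd_paths x t = 1" by (simp add: m_in_def ecard_def one_enat_def)
  obtain g1 g2 g3 where g: "limit_path z h x t g1" "limit_path z h x t g3"
    "\<forall>g. limit_path z h x t g \<longrightarrow> (\<forall>u\<ge>t. g u = g1 u) \<or> (\<forall>u\<ge>t. g u = g3 u)" "\<exists>u>t. g1 u \<noteq> g3 u"
    by (rule branch_point[OF i k])
  have "paths_from fwd_paths x t = {fst (fwd_semipath t g1), fst (fwd_semipath t g3)}"
  proof (intro set_eqI iffI)
    fix f assume "f \<in> paths_from fwd_paths x t"
    then obtain g where "limit_path z h x t g" "f = fst (fwd_semipath t g)" unfolding paths_from_fwd by auto
    with g(3) show "f \<in> {fst (fwd_semipath t g1), fst (fwd_semipath t g3)}"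
      by (simp add: fwd_semipath_inject)
  next
    fix f assume "f \<in> {fst (fwd_semipath t g1), fst (fwd_semipath t g3)}"
    then show "f \<in> paths_from fwd_paths x t" unfolding paths_from_fwd using g(1,2) by auto
  qed
  moreover have "fst (fwd_semipath t g1) \<noteq> fst (fwd_semipath t g3)"
    unfolding fwd_semipath_inject using g(4) less_imp_le by blast
  ultimately have "m_out fwd_paths x t = 2" by (simp add: m_out_def ecard_def numeral_eq_enat)
  then show "point_type fwd_paths x t = (1, 2)" using 1 by (simp add: point_type_def)
qed

text \<open>Of the four pairs of a right and a left half, three are realised by \<open>g1\<close>,
  \<open>g2\<close>, \<open>g3\<close>; the fourth crosses the incoming path \<open>h i\<close>.
  Limit paths never cross incoming ones, so this form gives both the exclusion and its
  uniqueness.\<close>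

lemma branch_point_halves:
  assumes i: "T i < t" "h i t = x" and k: "t < T k" "h k t = x"
  obtains g1 g3 where "limit_path z h x t g1" "limit_path z h x t g3"
    "crosses_incoming fwd_paths x t (lift (\<lambda>s. if t \<le> s then g3 s else g1 s))"
    "\<forall>g g'. limit_path z h x t g \<longrightarrow> limit_path z h x t g' \<longrightarrow>
      limit_path z h x t (\<lambda>s. if t \<le> s then g s else g' s) \<or> (\<forall>u\<ge>t. g u = g3 u) \<and> (\<forall>u\<le>t. g' u = g1 u)"
proof -
  obtain g1 g2 g3 where g: "limit_path z h x t g1" "limit_path z h x t g2" "limit_path z h x t g3"
    and right: "\<forall>g. limit_path z h x t g \<longrightarrow> (\<forall>u\<ge>t. g u = g1 u) \<or> (\<forall>u\<ge>t. g u = g3 u)"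
    and left: "\<forall>g. limit_path z h x t g \<longrightarrow> (\<forall>u\<le>t. g u = g1 u) \<or> (\<forall>u\<le>t. g u = g3 u)"
    and g2: "\<forall>u\<ge>t. g2 u = g1 u" "\<forall>u\<le>t. g2 u = g3 u"
    and cross: "(\<exists>u>t. h i u < g3 u) \<and> (\<exists>u<t. T i < u \<and> g1 u < h i u) \<or>
     (\<exists>u>t. g3 u < h i u) \<and> (\<exists>u<t. T i < u \<and> h i u < g1 u)"
    by (rule branch_point[OF i k])
  show thesis
  proof (rule that[OF g(1,3)])
    let ?G = "\<lambda>s. if t \<le> s then g3 s else g1 s"
    from cross show "crosses_incoming fwd_paths x t (lift ?G)"
    proof
      assume "(\<exists>u>t. h i u < g3 u) \<and> (\<exists>u<t. T i < u \<and> g1 u < h i u)"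
      then obtain s u where "t < s" "h i s < g3 s" "u < t" "T i < u" "g1 u < h i u" by blast
      then show ?thesis using crosses_incomingI[OF i, of s u ?G] i by simp
    next
      assume "(\<exists>u>t. g3 u < h i u) \<and> (\<exists>u<t. T i < u \<and> h i u < g1 u)"
      then obtain s u where "t < s" "g3 s < h i s" "u < t" "T i < u" "h i u < g1 u" by blast
      then show ?thesis using crosses_incomingI[OF i, of u s ?G] i by simp
    qed
    show "\<forall>g g'. limit_path z h x t g \<longrightarrow> limit_path z h x t g' \<longrightarrow>
      limit_path z h x t (\<lambda>s. if t \<le> s then g s else g' s) \<or> (\<forall>u\<ge>t. g u = g3 u) \<and> (\<forall>u\<le>t. g' u = g1 u)"
    proof (intro allI impI)
      fix f f' assume f: "limit_path z h x t f" "limit_path z h x t f'"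
      let ?F = "\<lambda>s. if t \<le> s then f s else f' s"
      consider "\<forall>u\<ge>t. f u = g1 u" "\<forall>u\<le>t. f' u = g1 u" | "\<forall>u\<ge>t. f u = g1 u" "\<forall>u\<le>t. f' u = g3 u"
        | "\<forall>u\<ge>t. f u = g3 u" "\<forall>u\<le>t. f' u = g3 u" | "\<forall>u\<ge>t. f u = g3 u" "\<forall>u\<le>t. f' u = g1 u"
        using right f(1) left f(2) by blast
      then show "limit_path z h x t ?F \<or> (\<forall>u\<ge>t. f u = g3 u) \<and> (\<forall>u\<le>t. f' u = g1 u)"
      proof cases
        case 1
        then have "?F = g1" by auto
        then show ?thesis using g by simp
      next
        case 2
        then have "?F = g2" using g2 by auto
        then show ?thesis using g by simp
      next
        case 3
        then have "?F = g3" by auto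
        then show ?thesis using g by simp
      qed simp
    qed
  qed
qed

lemma glue_limit_paths:
  assumes g: "limit_path z h x t g" "limit_path z h x t g'"
    and n: "\<not> (point_type fwd_paths x t = (1, 2) \<and> crosses_incoming fwd_paths x t (lift (\<lambda>s. if t \<le> s then g s else g' s)))"
  shows "limit_path z h x t (\<lambda>s. if t \<le> s then g s else g' s)"
proof (cases "\<exists>k. t < T k \<and> h k t = x")
  case False
  from agree_after[OF this g] have "(\<lambda>s. if t \<le> s then g s else g' s) = g'" by auto
  then show ?thesis using g by simp
next
  case True
  then obtain k where k: "t < T k" "h k t = x" by blast
  show ?thesis
  proof (cases "\<exists>i. T i < t \<and> h i t = x")
    case False
    from agree_before[OF this g] have "(\<lambda>s. if t \<le> s then g s else g' s) = g" by auto
    then show ?thesis using g by simp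
  next
    case True
    then obtain i where i: "T i < t" "h i t = x" by blast
    obtain g1 g3 where c: "crosses_incoming fwd_paths x t (lift (\<lambda>s. if t \<le> s then g3 s else g1 s))"
      and d: "\<forall>g g'. limit_path z h x t g \<longrightarrow> limit_path z h x t g' \<longrightarrow>
        limit_path z h x t (\<lambda>s. if t \<le> s then g s else g' s) \<or> (\<forall>u\<ge>t. g u = g3 u) \<and> (\<forall>u\<le>t. g' u = g1 u)"
      by (rule branch_point_halves[OF i k])
    show ?thesis
    proof (rule ccontr)
      assume "\<not> ?thesis"
      then have "(\<forall>u\<ge>t. g u = g3 u) \<and> (\<forall>u\<le>t. g' u = g1 u)" using d g by blast
      then have "(\<lambda>s. if t \<le> s then g s else g' s) = (\<lambda>s. if t \<le> s then g3 s else g1 s)" by auto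
      then show False using n c i k point_type_branch by auto
    qed
  qed
qed

lemma full_paths_glue:
  "full_paths = {canonical (\<lambda>_. \<infinity>), canonical (\<lambda>_. -\<infinity>)} \<union>
    {glue (ereal t) f g | x t f g. f \<in> paths_from fwd_paths x t \<and> g \<in> paths_from bwd_paths x t \<and>
      \<not> (point_type fwd_paths x t = (1, 2) \<and> crosses_incoming fwd_paths x t (glue (ereal t) f g))}"
proof -
  have "{lift g | x t g. limit_path z h x t g} =
    {glue (ereal t) f g | x t f g. f \<in> paths_from fwd_paths x t \<and> g \<in> paths_from bwd_paths x t \<and>
      \<not> (point_type fwd_paths x t = (1, 2) \<and> crosses_incoming fwd_paths x t (glue (ereal t) f g))}"
    (is "?L = ?R")
  proof (intro set_eqI iffI)
    fix F assume "F \<in> ?L"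
    then obtain x t g where g: "limit_path z h x t g" "F = lift g" by blast
    have "F = glue (ereal t) (fst (fwd_semipath t g)) (fst (bwd_semipath t g))" unfolding glue_halves g by simp
    moreover have "fst (fwd_semipath t g) \<in> paths_from fwd_paths x t" "fst (bwd_semipath t g) \<in> paths_from bwd_paths x t"
      unfolding paths_from_fwd paths_from_bwd using g by blast+
    moreover have "\<not> crosses_incoming fwd_paths x t F" unfolding g using not_crosses_incoming[OF g(1)] .
    ultimately show "F \<in> ?R" by blast
  next
    fix F assume "F \<in> ?R"
    then obtain x t g g' where g: "limit_path z h x t g" "limit_path z h x t g'"
      and F: "F = glue (ereal t) (fst (fwd_semipath t g)) (fst (bwd_semipath t g'))"
      and n: "\<not> (point_type fwd_paths x t = (1, 2) \<and> crosses_incoming fwd_paths x t F)"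
      unfolding paths_from_fwd paths_from_bwd by blast
    show "F \<in> ?L" using glue_limit_paths[OF g n[unfolded F glue_halves]] unfolding F glue_halves by blast
  qed
  then show ?thesis unfolding full_paths_eq by simp
qed

lemma unique_crossing:
  assumes "point_type fwd_paths x t = (1, 2)"
  shows "\<exists>!(f, g). f \<in> paths_from fwd_paths x t \<and> g \<in> paths_from bwd_paths x t \<and>
    crosses_incoming fwd_paths x t (glue (ereal t) f g)"
proof -
  obtain i k where i: "T i < t" "h i t = x" and k: "t < T k" "h k t = x"
    using assms unfolding point_type_branch by blast
  obtain g1 g3 where g: "limit_path z h x t g1" "limit_path z h x t g3"
    and c: "crosses_incoming fwd_paths x t (lift (\<lambda>s. if t \<le> s then g3 s else g1 s))"
    and d: "\<forall>g g'. limit_path z h x t g \<longrightarrow> limit_path z h x t g' \<longrightarrow>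
      limit_path z h x t (\<lambda>s. if t \<le> s then g s else g' s) \<or> (\<forall>u\<ge>t. g u = g3 u) \<and> (\<forall>u\<le>t. g' u = g1 u)"
    by (rule branch_point_halves[OF i k])
  show ?thesis
  proof (rule ex1I[of _ "(fst (fwd_semipath t g3), fst (bwd_semipath t g1))"])
    show "case (fst (fwd_semipath t g3), fst (bwd_semipath t g1)) of (f, g) \<Rightarrow>
      f \<in> paths_from fwd_paths x t \<and> g \<in> paths_from bwd_paths x t \<and> crosses_incoming fwd_paths x t (glue (ereal t) f g)"
      unfolding paths_from_fwd paths_from_bwd prod.case glue_halves using g c by blast
  next
    fix p assume "case p of (f, g) \<Rightarrow>
      f \<in> paths_from fwd_paths x t \<and> g \<in> paths_from bwd_paths x t \<and> crosses_incoming fwd_paths x t (glue (ereal t) f g)"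
    then obtain g g' where p: "p = (fst (fwd_semipath t g), fst (bwd_semipath t g'))"
      and g: "limit_path z h x t g" "limit_path z h x t g'"
      and c: "crosses_incoming fwd_paths x t (glue (ereal t) (fst (fwd_semipath t g)) (fst (bwd_semipath t g')))"
      unfolding paths_from_fwd paths_from_bwd by (cases p) auto
    have "\<not> limit_path z h x t (\<lambda>s. if t \<le> s then g s else g' s)"
      using c not_crosses_incoming unfolding glue_halves by blast
    then have "(\<forall>u\<ge>t. g u = g3 u) \<and> (\<forall>u\<le>t. g' u = g1 u)" using d g by blast
    then show "p = (fst (fwd_semipath t g3), fst (bwd_semipath t g1))"
      unfolding p using fwd_semipath_inject bwd_semipath_inject by blast
  qed
qed

end

theorem proposition2p5:
  fixes M :: "'w measure"
    and z :: "nat \<Rightarrow> real \<times> real"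
    and W Wb :: "nat \<Rightarrow> real \<Rightarrow> 'w \<Rightarrow> real"
  assumes "prob_space M"
    and "closure (range z) = UNIV"
    and "double_web_skeleton M z W Wb"
  shows "AE \<omega> in M.
    (let F = fwd_web z W \<omega>; G = bwd_web z Wb \<omega> in
      full_web z W Wb \<omega> =
        {canonical (\<lambda>_. \<infinity>), canonical (\<lambda>_. -\<infinity>)} \<union>
        {glue (ereal t) f g | x t f g.
           f \<in> paths_from F x t \<and> g \<in> paths_from G x t \<and>
           \<not> (point_type F x t = (1, 2) \<and> crosses_incoming F x t (glue (ereal t) f g))} \<and>
      (\<forall>x t. point_type F x t = (1, 2) \<longrightarrow>
        (\<exists>!(f, g). f \<in> paths_from F x t \<and> g \<in> paths_from G x t \<and>
           crosses_incoming F x t (glue (ereal t) f g))))"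
proof -
  have web: "double_web M z W Wb"
    using assms by (simp add: double_web_def double_web_axioms_def)
  have dense_flip: "closure (range (flip z)) = UNIV"
    using double_web.double_web_flip[OF web] by (simp add: double_web_def double_web_axioms_def)
  from double_web.AE_half_good[OF web] double_web.AE_half_good_flip[OF web] show ?thesis
  proof eventually_elim
    case (elim \<omega>)
    define h where "h = joined z (\<lambda>j t. W j t \<omega>) (\<lambda>j t. Wb j t \<omega>)"
    interpret web z h
      unfolding h_def by (rule half_good_web[OF elim assms(2) dense_flip])
    have eq: "W j (snd (z j)) \<omega> = Wb j (snd (z j)) \<omega>" for j
      using half_goodD(2)[OF elim(1), of j] half_goodD(2)[OF elim(2), of j] by simp
    have f: "fst (fwd_semipath (snd (z j)) (\<lambda>t. W j t \<omega>)) = fst (fwd_semipath (snd (z j)) (h j))"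
      and b: "fst (bwd_semipath (snd (z j)) (\<lambda>t. Wb j t \<omega>)) = fst (bwd_semipath (snd (z j)) (h j))" for j
      unfolding fwd_semipath_inject bwd_semipath_inject using eq[of j] by (auto simp: h_def joined_def dest: order_antisym)
    have "fwd_semipath (snd (z j)) (\<lambda>t. W j t \<omega>) = fwd_semipath (snd (z j)) (h j)"
      "bwd_semipath (snd (z j)) (\<lambda>t. Wb j t \<omega>) = bwd_semipath (snd (z j)) (h j)" for j
      using f[of j] b[of j] by (simp_all add: prod_eq_iff fwd_semipath_eq bwd_semipath_eq)
    then have F: "fwd_web z W \<omega> = fwd_paths" and G: "bwd_web z Wb \<omega> = bwd_paths"
      by (simp_all add: fwd_web_def bwd_web_def fwd_paths_def bwd_paths_def)
    have "full_web z W Wb \<omega> = full_paths"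
      unfolding full_web_def full_paths_def f b glue_halves by simp
    then show ?case
      unfolding Let_def F G using full_paths_glue unique_crossing by blast
  qed
qed

end
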